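(* Let $g\ge 0$ be an integer. An object of $\mathrm{Rep}_{\mathbb C}(\mathcal G_{\mathbb C}^g)$ (a finite dimensional $\mathbb C$-linear representation of the $g$-fold product $\mathcal G_{\mathbb C}^g$) corresponds to a triple $U=(U_{\mathbb C},\{U^{\boldsymbol p,\boldsymbol q}\},\{t_\mu\})$, where $U_{\mathbb C}$ is a finite dimensional $\mathbb C$-vector space, $\{U^{\boldsymbol p,\boldsymbol q}\}$ is a $2g$-grading of $U_{\mathbb C}$ by $\mathbb C$-linear subspaces $$U_{\mathbb C}=\bigoplus_{\boldsymbol p,\boldsymbol q\in\mathbb Z^g}U^{\boldsymbol p,\boldsymbol q},$$ and $t_\mu$ for $\mu=1,\dots,g$ are $\mathbb C$-linear automorphisms of $U_{\mathbb C}$ commuting with each other and satisfying $$(t_\mu-1)(U^{\boldsymbol p,\boldsymbol q})\subset\bigoplus_{\boldsymbol r,\boldsymbol s}U^{\boldsymbol r,\boldsymbol s}$$ for all $\boldsymbol p=(p_1,\dots,p_g),\boldsymbol q=(q_1,\dots,q_g)\in\mathbb Z^g$, where the direct sum is over $\boldsymbol r=(r_1,\dots,r_g),\boldsymbol s=(s_1,\dots,s_g)\in\mathbb Z^g$ with $r_\nu=p_\nu$, $s_\nu=q_\nu$ for $\nu\ne\mu$ and $r_\mu<p_\mu$, $s_\mu<q_\mu$. That is, for each finite dimensional $\mathbb C$-vector space $U_{\mathbb C}$, the correspondence described in the context is a bijection between the representations of $\mathcal G_{\mathbb C}^g$ on $U_{\mathbb C}$ and the pairs $(\{U^{\boldsymbol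 p,\boldsymbol q}\},\{t_\mu\})$ consisting of a $2g$-grading $U_{\mathbb C}=\bigoplus_{\boldsymbol p,\boldsymbol q\in\mathbb Z^g}U^{\boldsymbol p,\boldsymbol q}$ by $\mathbb C$-linear subspaces and a family of mutually commuting $\mathbb C$-linear automorphisms $t_\mu$ ($\mu=1,\dots,g$) of $U_{\mathbb C}$ such that, for all $\mu$ and all $\boldsymbol p,\boldsymbol q\in\mathbb Z^g$, $(t_\mu-1)(U^{\boldsymbol p,\boldsymbol q})$ is contained in the direct sum of the $U^{\boldsymbol r,\boldsymbol s}$ over $\boldsymbol r,\boldsymbol s\in\mathbb Z^g$ with $r_\nu=p_\nu$, $s_\nu=q_\nu$ for $\nu\ne\mu$ and $r_\mu<p_\mu$, $s_\mu<q_\mu$.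
   Context: The pro-algebraic group $\mathcal G_{\mathbb C}$ (the tannakian fundamental group of the category of mixed $\mathbb C$-Hodge structures) is constructed as follows. For $n\geq 1$ let $\mathfrak L_n$ be the free Lie algebra over $\mathbb C$ generated by symbols $T^{i,j}$ for positive integers $i,j$ with $i+j\le n$, graded by $\deg T^{i,j}=i+j$; let $I_n$ be the ideal generated by elements of degree larger than $n$, and $\mathfrak u_n=\mathfrak L_n/I_n$, a nilpotent Lie algebra. Let $\mathcal U_n$ be the simply connected unipotent algebraic group over $\mathbb C$ with $\mathrm{Rep}_{\mathbb C}(\mathcal U_n)=\mathrm{Rep}^{\mathrm{nil}}_{\mathbb C}(\mathfrak u_n)$ (nilpotent finite dimensional representations). Let $\mathbb S_{\mathbb C}=\mathbb G_m\times\mathbb G_m$ over $\mathbb C$, acting on $\mathfrak u_n$ by $(x,y)\cdot T^{i,j}=x^{-i}y^{-j}T^{i,j}$, hence on $\mathcal U_n$ and on $\mathcal U:=\varprojlim_n\mathcal U_n$. Then $\mathcal G_{\mathbb C}:=\mathbb S_{\mathbb C}\ltimes\mathcal U$, and $\mathcal G_{\mathbb C}^g$ is the $g$-fold product. $\mathrm{Rep}_{\mathbb C}(H)$ denotes the category of $\mathbb C$-linear representations of $H$ on finite dimensional $\mathbb C$-vector spaces. The correspondence: given a representation of $\mathcal G_{\mathbb C}^g$ on $U_{\mathbb C}$, for each $\mu$ the $\mu$-th factor $\mathbb S_{\mathbb C}$ gives the bigrading $U_\mu^{p,q}=\{u\mid (x,y)\cdot u=x^py^qu \text{ for all }(x,y)\in\mathbb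 C^\times\times\mathbb C^\times\}$, and one puts $U^{\boldsymbol p,\boldsymbol q}:=U_1^{p_1,q_1}\cap\cdots\cap U_g^{p_g,q_g}$; the $\mu$-th factor $\mathcal U$ acts through $\mathcal U_n$ for some large $n$, hence gives nilpotent endomorphisms $T^{i,j}_\mu$ of $U_{\mathbb C}$, and $t_\mu:=\exp\bigl(\sum_{i,j>0}T_\mu^{i,j}\bigr)$. *)

theory Defs
  imports Complex_Main "HOL-Library.FuncSet" "HOL-Algebra.Product_Groups"
begin

section \<open>Free Lie algebras over the complex numbers\<close>

text \<open>
  The free Lie algebra on a type of generators: formal Lie expressions modulo the congruence
  generated by the axioms of a complex Lie algebra.
\<close>

datatype 'a lie_term =
    TGen 'a
  | TZero
  | TAdd "'a lie_term" "'a lie_term"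
  | TScale complex "'a lie_term"
  | TBr "'a lie_term" "'a lie_term"

inductive lie_eq :: "'a lie_term \<Rightarrow> 'a lie_term \<Rightarrow> bool" where
  refl: "lie_eq s s"
| sym: "lie_eq s t \<Longrightarrow> lie_eq t s"
| trans: "lie_eq s t \<Longrightarrow> lie_eq t u \<Longrightarrow> lie_eq s u"
| cong_add: "lie_eq s s' \<Longrightarrow> lie_eq t t' \<Longrightarrow> lie_eq (TAdd s t) (TAdd s' t')"
| cong_scale: "lie_eq s s' \<Longrightarrow> lie_eq (TScale a s) (TScale a s')"
| cong_br: "lie_eq s s' \<Longrightarrow> lie_eq t t' \<Longrightarrow> lie_eq (TBr s t) (TBr s' t')"
| add_assoc: "lie_eq (TAdd (TAdd s t) u) (TAdd s (TAdd t u))"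
| add_comm: "lie_eq (TAdd s t) (TAdd t s)"
| add_zero: "lie_eq (TAdd TZero s) s"
| add_neg: "lie_eq (TAdd (TScale (-1) s) s) TZero"
| scale_right: "lie_eq (TScale a (TAdd s t)) (TAdd (TScale a s) (TScale a t))"
| scale_left: "lie_eq (TScale (a + b) s) (TAdd (TScale a s) (TScale b s))"
| scale_scale: "lie_eq (TScale a (TScale b s)) (TScale (a * b) s)"
| scale_one: "lie_eq (TScale 1 s) s"
| br_add_left: "lie_eq (TBr (TAdd s t) u) (TAdd (TBr s u) (TBr t u))"
| br_add_right: "lie_eq (TBr s (TAdd t u)) (TAdd (TBr s t) (TBr s u))"
| br_scale_left: "lie_eq (TBr (TScale a s) t) (TScale a (TBr s t))"
| br_scale_right: "lie_eq (TBr s (TScale a t)) (TScale a (TBr s t))"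
| br_alt: "lie_eq (TBr s s) TZero"
| jacobi: "lie_eq (TAdd (TBr s (TBr t u)) (TAdd (TBr t (TBr u s)) (TBr u (TBr s t)))) TZero"

quotient_type 'a free_lie = "'a lie_term" / lie_eq
  by (rule equivpI) (auto simp: reflp_def symp_def transp_def
        intro: lie_eq.refl lie_eq.sym lie_eq.trans)

instantiation free_lie :: (type) ab_group_add
begin

lift_definition zero_free_lie :: "'a free_lie" is TZero .

lift_definition plus_free_lie :: "'a free_lie \<Rightarrow> 'a free_lie \<Rightarrow> 'a free_lie" is TAdd
  by (rule lie_eq.cong_add)

lift_definition uminus_free_lie :: "'a free_lie \<Rightarrow> 'a free_lie" is "TScale (-1)"
  by (rule lie_eq.cong_scale)

lift_definition minus_free_lie :: "'a free_lie \<Rightarrow> 'a free_lie \<Rightarrow> 'a free_lie"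
  is "\<lambda>s t. TAdd s (TScale (-1) t)"
  by (intro lie_eq.cong_add lie_eq.cong_scale)

instance
  by (standard; transfer)
    (fact lie_eq.add_assoc lie_eq.add_comm lie_eq.add_zero lie_eq.add_neg lie_eq.refl)+

end

lift_definition gen :: "'a \<Rightarrow> 'a free_lie" is TGen .

lift_definition lscale :: "complex \<Rightarrow> 'a free_lie \<Rightarrow> 'a free_lie" is TScale
  by (rule lie_eq.cong_scale)

lift_definition lbr :: "'a free_lie \<Rightarrow> 'a free_lie \<Rightarrow> 'a free_lie" is TBr
  by (rule lie_eq.cong_br)

interpretation free_lie: vector_space lscale
  by (standard; transfer)
    (fact lie_eq.scale_right lie_eq.scale_left lie_eq.scale_scale lie_eq.scale_one)+

lemma lbr_add_left: "lbr (x + y) z = lbr x z + lbr y z"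
  by transfer (fact lie_eq.br_add_left)

lemma lbr_add_right: "lbr x (y + z) = lbr x y + lbr x z"
  by transfer (fact lie_eq.br_add_right)

lemma lbr_scale_left: "lbr (lscale a x) y = lscale a (lbr x y)"
  by transfer (fact lie_eq.br_scale_left)

lemma lbr_scale_right: "lbr x (lscale a y) = lscale a (lbr x y)"
  by transfer (fact lie_eq.br_scale_right)

lemma lbr_self: "lbr x x = 0"
  by transfer (fact lie_eq.br_alt)

lemma lbr_jacobi: "lbr x (lbr y z) + (lbr y (lbr z x) + lbr z (lbr x y)) = 0"
  by transfer (fact lie_eq.jacobi)

primrec term_hom :: "('a \<Rightarrow> 'b free_lie) \<Rightarrow> 'a lie_term \<Rightarrow> 'b free_lie" where
  "term_hom f (TGen a) = f a"
| "term_hom f TZero = 0"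
| "term_hom f (TAdd s t) = term_hom f s + term_hom f t"
| "term_hom f (TScale a s) = lscale a (term_hom f s)"
| "term_hom f (TBr s t) = lbr (term_hom f s) (term_hom f t)"

text \<open>The homomorphism of Lie algebras with prescribed values on the generators.\<close>

lift_definition lie_hom :: "('a \<Rightarrow> 'b free_lie) \<Rightarrow> 'a free_lie \<Rightarrow> 'b free_lie" is term_hom
proof -
  fix f :: "'a \<Rightarrow> 'b free_lie" and s t :: "'a lie_term"
  assume "lie_eq s t"
  then show "term_hom f s = term_hom f t"
  proof induction
    case (add_assoc s t u)
    then show ?case by (simp add: add.assoc)
  next
    case (add_comm s t)
    then show ?case by (simp add: add.commute)
  next
    case (scale_left a b s)
    then show ?case by (simp add: free_lie.scale_left_distrib)
  next
    case (scale_right a s t)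
    then show ?case by (simp add: free_lie.scale_right_distrib)
  qed (simp_all add: lbr_add_left lbr_add_right lbr_scale_left lbr_scale_right lbr_self lbr_jacobi)
qed

lemma lie_hom_gen [simp]: "lie_hom f (gen a) = f a"
  by transfer simp

lemma lie_hom_zero [simp]: "lie_hom f 0 = 0"
  by (simp add: lie_hom.abs_eq zero_free_lie_def)

lemma lie_hom_add [simp]: "lie_hom f (x + y) = lie_hom f x + lie_hom f y"
  by (induct x, induct y) (simp add: lie_hom.abs_eq plus_free_lie.abs_eq)

lemma lie_hom_scale [simp]: "lie_hom f (lscale c x) = lscale c (lie_hom f x)"
  by (induct x) (simp add: lie_hom.abs_eq lscale.abs_eq)

lemma lie_hom_br [simp]: "lie_hom f (lbr x y) = lbr (lie_hom f x) (lie_hom f y)"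
  by (induct x, induct y) (simp add: lie_hom.abs_eq lbr.abs_eq)

inductive_set lie_subalgebra :: "'a free_lie set \<Rightarrow> 'a free_lie set" for S where
  base: "x \<in> S \<Longrightarrow> x \<in> lie_subalgebra S"
| zero: "0 \<in> lie_subalgebra S"
| add: "x \<in> lie_subalgebra S \<Longrightarrow> y \<in> lie_subalgebra S \<Longrightarrow> x + y \<in> lie_subalgebra S"
| scale: "x \<in> lie_subalgebra S \<Longrightarrow> lscale c x \<in> lie_subalgebra S"
| br: "x \<in> lie_subalgebra S \<Longrightarrow> y \<in> lie_subalgebra S \<Longrightarrow> lbr x y \<in> lie_subalgebra S"

inductive_set lie_ideal :: "'a free_lie set \<Rightarrow> 'a free_lie set \<Rightarrow> 'a free_lie set" for L S where
  base: "x \<in> S \<Longrightarrow> x \<in> lie_ideal L S"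
| zero: "0 \<in> lie_ideal L S"
| add: "x \<in> lie_ideal L S \<Longrightarrow> y \<in> lie_ideal L S \<Longrightarrow> x + y \<in> lie_ideal L S"
| scale: "x \<in> lie_ideal L S \<Longrightarrow> lscale c x \<in> lie_ideal L S"
| br: "x \<in> L \<Longrightarrow> y \<in> lie_ideal L S \<Longrightarrow> lbr x y \<in> lie_ideal L S"

section \<open>The nilpotent Lie algebras \<open>u\<^sub>n\<close>\<close>

text \<open>The generator \<open>gen (i, j)\<close> is the symbol \<open>T\<^sup>i\<^sup>,\<^sup>j\<close>; only \<open>i, j > 0\<close> are used.\<close>

type_synonym hlie = "(nat \<times> nat) free_lie"

text \<open>
  A Lie subalgebra of a free Lie algebra generated by some of the free generators is free on
  these generators, so \<open>L\<^sub>n\<close> can be taken inside the free Lie algebra on all symbols.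
\<close>

definition Ln_gens :: "nat \<Rightarrow> (nat \<times> nat) set" where
  "Ln_gens n = {(i, j). 0 < i \<and> 0 < j \<and> i + j \<le> n}"

definition Ln :: "nat \<Rightarrow> hlie set" where
  "Ln n = lie_subalgebra (gen ` Ln_gens n)"

text \<open>\<open>Ln_deg n d\<close> is the component of degree \<open>d\<close> of \<open>L\<^sub>n\<close>.\<close>

inductive Ln_homog :: "nat \<Rightarrow> nat \<Rightarrow> hlie \<Rightarrow> bool" for n where
  gen: "(i, j) \<in> Ln_gens n \<Longrightarrow> Ln_homog n (i + j) (gen (i, j))"
| zero: "Ln_homog n d 0"
| add: "Ln_homog n d x \<Longrightarrow> Ln_homog n d y \<Longrightarrow> Ln_homog n d (x + y)"
| scale: "Ln_homog n d x \<Longrightarrow> Ln_homog n d (lscale c x)"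
| br: "Ln_homog n d x \<Longrightarrow> Ln_homog n e y \<Longrightarrow> Ln_homog n (d + e) (lbr x y)"

definition Ln_deg :: "nat \<Rightarrow> nat \<Rightarrow> hlie set" where
  "Ln_deg n d = {x. Ln_homog n d x}"

definition In_ideal :: "nat \<Rightarrow> hlie set" where
  "In_ideal n = lie_ideal (Ln n) (\<Union>d\<in>{n<..}. Ln_deg n d)"

definition un_rel :: "nat \<Rightarrow> (hlie \<times> hlie) set" where
  "un_rel n = {(x, y). x \<in> Ln n \<and> y \<in> Ln n \<and> x - y \<in> In_ideal n}"

text \<open>The elements of \<open>u\<^sub>n = L\<^sub>n / I\<^sub>n\<close> are cosets; \<open>un_class n x\<close> is the coset of \<open>x \<in> L\<^sub>n\<close>.\<close>

definition un :: "nat \<Rightarrow> hlie set set" where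
  "un n = Ln n // un_rel n"

definition un_class :: "nat \<Rightarrow> hlie \<Rightarrow> hlie set" where
  "un_class n x = un_rel n `` {x}"

text \<open>
  The homomorphism from the free Lie algebra on all symbols to \<open>L\<^sub>n\<close> that kills the symbols
  of degree \<open>> n\<close>. It induces the transition maps \<open>u\<^sub>m \<rightarrow> u\<^sub>n\<close> for \<open>m \<ge> n\<close>.
\<close>

definition Ln_proj :: "nat \<Rightarrow> hlie \<Rightarrow> hlie" where
  "Ln_proj n = lie_hom (\<lambda>ij. if ij \<in> Ln_gens n then gen ij else 0)"

definition un_proj :: "nat \<Rightarrow> hlie set \<Rightarrow> hlie set" where
  "un_proj n X = (\<Union>x\<in>X. un_class n (Ln_proj n x))"

text \<open>The image of \<open>T\<^sup>i\<^sup>,\<^sup>j\<close> in \<open>u\<^sub>n\<close>, which is zero for \<open>i + j > n\<close>.\<close>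

definition un_T :: "nat \<Rightarrow> nat \<Rightarrow> nat \<Rightarrow> hlie set" where
  "un_T n i j = un_class n (Ln_proj n (gen (i, j)))"

definition un_linear_form :: "nat \<Rightarrow> (hlie set \<Rightarrow> complex) \<Rightarrow> bool" where
  "un_linear_form n l \<longleftrightarrow>
     (\<forall>x\<in>Ln n. \<forall>y\<in>Ln n. l (un_class n (x + y)) = l (un_class n x) + l (un_class n y)) \<and>
     (\<forall>c. \<forall>x\<in>Ln n. l (un_class n (lscale c x)) = c * l (un_class n x))"

section \<open>The pro-algebraic group\<close>

primrec nested_br :: "'a free_lie list \<Rightarrow> 'a free_lie" where
  "nested_br [] = 0"
| "nested_br (x # xs) = (if xs = [] then x else lbr x (nested_br xs))"

text \<open>
  Dynkin's form of the Baker-Campbell-Hausdorff series \<open>log (exp x exp y)\<close>, truncated to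
  brackets of at most \<open>n\<close> letters.
\<close>

definition bch :: "nat \<Rightarrow> 'a free_lie \<Rightarrow> 'a free_lie \<Rightarrow> 'a free_lie" where
  "bch n x y =
     (\<Sum>m = 1..n. \<Sum>k = 1..m.
       \<Sum>rs \<in> {rs :: (nat \<times> nat) list. length rs = k \<and> (\<forall>(r, s)\<in>set rs. 0 < r + s) \<and>
                (\<Sum>(r, s)\<leftarrow>rs. r + s) = m}.
         lscale ((- 1) ^ (k - 1) / (of_nat k * of_nat m * (\<Prod>(r, s)\<leftarrow>rs. fact r * fact s)))
           (nested_br (concat (map (\<lambda>(r, s). replicate r x @ replicate s y) rs))))"

text \<open>
  The simply connected unipotent group with Lie algebra \<open>u\<^sub>n\<close>, in exponential coordinates:
  its group of complex points is \<open>u\<^sub>n\<close> with the Baker-Campbell-Hausdorff product, so that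
  \<open>X \<in> u\<^sub>n\<close> stands for \<open>exp X\<close>, and its regular functions are the polynomial functions
  on \<open>u\<^sub>n\<close>. Brackets of more than \<open>n\<close> elements vanish in \<open>u\<^sub>n\<close>.
\<close>

definition Ugp :: "nat \<Rightarrow> hlie set monoid" where
  "Ugp n = \<lparr>carrier = un n,
           monoid.mult = (\<lambda>X Y. \<Union>x\<in>X. \<Union>y\<in>Y. un_class n (bch n x y)),
           one = un_class n 0\<rparr>"

text \<open>
  The inverse limit of the \<open>U\<^sub>n\<close>, as compatible sequences. The additional term \<open>n = 0\<close>
  is trivial, because \<open>u\<^sub>0 = 0\<close>.
\<close>

definition Ulim :: "(nat \<Rightarrow> hlie set) monoid" where
  "Ulim = \<lparr>carrier = {u. \<forall>n. u n \<in> un n \<and> un_proj n (u (Suc n)) = u n},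
           monoid.mult = (\<lambda>u v n. u n \<otimes>\<^bsub>Ugp n\<^esub> v n),
           one = (\<lambda>n. \<one>\<^bsub>Ugp n\<^esub>)\<rparr>"

text \<open>The action of \<open>(x, y) \<in> G\<^sub>m \<times> G\<^sub>m\<close>; in exponential coordinates it is the same on
  \<open>U\<^sub>n\<close> as on \<open>u\<^sub>n\<close>.\<close>

definition lie_act :: "complex \<times> complex \<Rightarrow> hlie \<Rightarrow> hlie" where
  "lie_act = (\<lambda>(x, y). lie_hom (\<lambda>(i, j).
     lscale (x powi (- int i) * y powi (- int j)) (gen (i, j))))"

definition Ulim_act :: "complex \<times> complex \<Rightarrow> (nat \<Rightarrow> hlie set) \<Rightarrow> nat \<Rightarrow> hlie set" where
  "Ulim_act z u = (\<lambda>n. \<Union>x\<in>u n. un_class n (lie_act z x))"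

type_synonym hodge_point = "(complex \<times> complex) \<times> (nat \<Rightarrow> hlie set)"

text \<open>
  The complex points of \<open>\<S> \<ltimes> \<U>\<close>. The pair \<open>(z, u)\<close> is the product \<open>u z\<close>, so
  that \<open>z u z\<^sup>-\<^sup>1 = z \<cdot> u\<close>.
\<close>

definition GC :: "hodge_point monoid" where
  "GC = \<lparr>carrier = {(x, y). x \<noteq> 0 \<and> y \<noteq> 0} \<times> carrier Ulim,
         monoid.mult = (\<lambda>((x, y), u) ((x', y'), v).
            ((x * x', y * y'), u \<otimes>\<^bsub>Ulim\<^esub> Ulim_act (x, y) v)),
         one = ((1, 1), \<one>\<^bsub>Ulim\<^esub>)\<rparr>"

definition GCg :: "nat \<Rightarrow> (nat \<Rightarrow> hodge_point) monoid" where
  "GCg g = product_group {..<g} (\<lambda>_. GC)"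

definition factor :: "nat \<Rightarrow> nat \<Rightarrow> hodge_point \<Rightarrow> nat \<Rightarrow> hodge_point" where
  "factor g \<mu> a = (\<lambda>\<nu>\<in>{..<g}. if \<nu> = \<mu> then a else \<one>\<^bsub>GC\<^esub>)"

text \<open>
  The coordinate ring of the pro-algebraic group \<open>GCg g\<close>, as functions of its complex points:
  it is generated by the coordinates and inverse coordinates of the tori and by
  the linear forms on all \<open>u\<^sub>n\<close> (it is the union over \<open>n\<close> of the coordinate rings of the
  quotients in which \<open>U\<close> is replaced by \<open>U\<^sub>n\<close>).
\<close>

inductive_set regular_functions :: "nat \<Rightarrow> ((nat \<Rightarrow> hodge_point) \<Rightarrow> complex) set" for g where
  const: "(\<lambda>_. c) \<in> regular_functions g"
| torus1: "\<mu> < g \<Longrightarrow> (\<lambda>a. fst (fst (a \<mu>))) \<in> regular_functions g"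
| torus1_inv: "\<mu> < g \<Longrightarrow> (\<lambda>a. inverse (fst (fst (a \<mu>)))) \<in> regular_functions g"
| torus2: "\<mu> < g \<Longrightarrow> (\<lambda>a. snd (fst (a \<mu>))) \<in> regular_functions g"
| torus2_inv: "\<mu> < g \<Longrightarrow> (\<lambda>a. inverse (snd (fst (a \<mu>)))) \<in> regular_functions g"
| unip: "\<mu> < g \<Longrightarrow> un_linear_form n l \<Longrightarrow> (\<lambda>a. l (snd (a \<mu>) n)) \<in> regular_functions g"
| add: "f \<in> regular_functions g \<Longrightarrow> h \<in> regular_functions g \<Longrightarrow>
    (\<lambda>a. f a + h a) \<in> regular_functions g"
| mult: "f \<in> regular_functions g \<Longrightarrow> h \<in> regular_functions g \<Longrightarrow>
    (\<lambda>a. f a * h a) \<in> regular_functions g"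

section \<open>Representations\<close>

definition GLV :: "(complex \<Rightarrow> 'v \<Rightarrow> 'v) \<Rightarrow> ('v :: ab_group_add \<Rightarrow> 'v) monoid" where
  "GLV scale = \<lparr>carrier = {f. Vector_Spaces.linear scale scale f \<and> bij f},
                monoid.mult = (\<circ>), one = id\<rparr>"

text \<open>
  The representations of the pro-algebraic group \<open>GCg g\<close> on the vector space \<open>V\<close>: the
  homomorphisms to \<open>GL(V)\<close> all of whose matrix coefficients are regular functions.
  Homomorphisms are extensional, so that different elements of the set are different
  representations.
\<close>

definition reps ::
  "(complex \<Rightarrow> 'v \<Rightarrow> 'v) \<Rightarrow> nat \<Rightarrow> ((nat \<Rightarrow> hodge_point) \<Rightarrow> 'v :: ab_group_add \<Rightarrow> 'v) set" where
  "reps scale g = {\<rho> \<in> hom (GCg g) (GLV scale) \<inter> extensional (carrier (GCg g)).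
     \<forall>v \<xi>. Vector_Spaces.linear scale (*) \<xi> \<longrightarrow>
       (\<exists>f \<in> regular_functions g. \<forall>a \<in> carrier (GCg g). \<xi> (\<rho> a v) = f a)}"

definition nilpotent_map :: "('v :: zero \<Rightarrow> 'v) \<Rightarrow> bool" where
  "nilpotent_map N \<longleftrightarrow> (\<exists>k. N ^^ k = (\<lambda>_. 0))"

text \<open>For nilpotent linear \<open>N\<close> this finite sum is the whole exponential series.\<close>

definition nil_exp :: "(complex \<Rightarrow> 'v \<Rightarrow> 'v) \<Rightarrow> ('v \<Rightarrow> 'v) \<Rightarrow> 'v :: ab_group_add \<Rightarrow> 'v" where
  "nil_exp scale N v = (\<Sum>k | (N ^^ k) v \<noteq> 0. scale (1 / fact k) ((N ^^ k) v))"

definition nil_lie_rep ::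
  "(complex \<Rightarrow> 'v \<Rightarrow> 'v) \<Rightarrow> nat \<Rightarrow> (hlie set \<Rightarrow> 'v :: ab_group_add \<Rightarrow> 'v) \<Rightarrow> bool" where
  "nil_lie_rep scale n \<phi> \<longleftrightarrow>
     (\<forall>X\<in>un n. Vector_Spaces.linear scale scale (\<phi> X) \<and> nilpotent_map (\<phi> X)) \<and>
     (\<forall>x\<in>Ln n. \<forall>y\<in>Ln n. \<forall>v.
        \<phi> (un_class n (x + y)) v = \<phi> (un_class n x) v + \<phi> (un_class n y) v) \<and>
     (\<forall>c. \<forall>x\<in>Ln n. \<forall>v. \<phi> (un_class n (lscale c x)) v = scale c (\<phi> (un_class n x) v)) \<and>
     (\<forall>x\<in>Ln n. \<forall>y\<in>Ln n. \<forall>v. \<phi> (un_class n (lbr x y)) v =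
        \<phi> (un_class n x) (\<phi> (un_class n y) v) - \<phi> (un_class n y) (\<phi> (un_class n x) v))"

text \<open>
  The factor \<open>U\<close> with index \<open>\<mu>\<close> acts through \<open>U\<^sub>n\<close>, and \<open>\<phi>\<close> is the nilpotent
  representation of \<open>u\<^sub>n\<close> that corresponds to this representation of \<open>U\<^sub>n\<close>.
\<close>

definition acts_through ::
  "(complex \<Rightarrow> 'v \<Rightarrow> 'v) \<Rightarrow> nat \<Rightarrow> ((nat \<Rightarrow> hodge_point) \<Rightarrow> 'v :: ab_group_add \<Rightarrow> 'v) \<Rightarrow> nat \<Rightarrow>
     nat \<Rightarrow> (hlie set \<Rightarrow> 'v \<Rightarrow> 'v) \<Rightarrow> bool" where
  "acts_through scale g \<rho> \<mu> n \<phi> \<longleftrightarrow> nil_lie_rep scale n \<phi> \<and>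
     (\<forall>u \<in> carrier Ulim. \<rho> (factor g \<mu> ((1, 1), u)) = nil_exp scale (\<phi> (u n)))"

section \<open>The correspondence\<close>

definition rep_T ::
  "(complex \<Rightarrow> 'v \<Rightarrow> 'v) \<Rightarrow> nat \<Rightarrow> ((nat \<Rightarrow> hodge_point) \<Rightarrow> 'v :: ab_group_add \<Rightarrow> 'v) \<Rightarrow> nat \<Rightarrow>
     nat \<Rightarrow> nat \<Rightarrow> 'v \<Rightarrow> 'v" where
  "rep_T scale g \<rho> \<mu> i j = (THE N. \<exists>n \<phi>. acts_through scale g \<rho> \<mu> n \<phi> \<and> N = \<phi> (un_T n i j))"

text \<open>Only finitely many \<open>T\<^sup>i\<^sup>,\<^sup>j\<close> act non-trivially, so the sum in the exponent is finite.\<close>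

definition rep_t ::
  "(complex \<Rightarrow> 'v \<Rightarrow> 'v) \<Rightarrow> nat \<Rightarrow> ((nat \<Rightarrow> hodge_point) \<Rightarrow> 'v :: ab_group_add \<Rightarrow> 'v) \<Rightarrow> nat \<Rightarrow>
     'v \<Rightarrow> 'v" where
  "rep_t scale g \<rho> \<mu> = nil_exp scale (\<lambda>v.
     \<Sum>(i, j) | 0 < i \<and> 0 < j \<and> rep_T scale g \<rho> \<mu> i j \<noteq> (\<lambda>_. 0). rep_T scale g \<rho> \<mu> i j v)"

definition weight_space ::
  "(complex \<Rightarrow> 'v \<Rightarrow> 'v) \<Rightarrow> nat \<Rightarrow> ((nat \<Rightarrow> hodge_point) \<Rightarrow> 'v :: ab_group_add \<Rightarrow> 'v) \<Rightarrow> nat \<Rightarrow>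
     int \<Rightarrow> int \<Rightarrow> 'v set" where
  "weight_space scale g \<rho> \<mu> p q = {v. \<forall>x y. x \<noteq> 0 \<longrightarrow> y \<noteq> 0 \<longrightarrow>
     \<rho> (factor g \<mu> ((x, y), \<one>\<^bsub>Ulim\<^esub>)) v = scale (x powi p * y powi q) v}"

text \<open>Multi-indices, as extensional functions on \<open>{..<g}\<close>.\<close>

definition Zg :: "nat \<Rightarrow> (nat \<Rightarrow> int) set" where
  "Zg g = {..<g} \<rightarrow>\<^sub>E UNIV"

definition correspondence ::
  "(complex \<Rightarrow> 'v \<Rightarrow> 'v) \<Rightarrow> nat \<Rightarrow> ((nat \<Rightarrow> hodge_point) \<Rightarrow> 'v :: ab_group_add \<Rightarrow> 'v) \<Rightarrow>
     ((nat \<Rightarrow> int) \<times> (nat \<Rightarrow> int) \<Rightarrow> 'v set) \<times> (nat \<Rightarrow> 'v \<Rightarrow> 'v)" where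
  "correspondence scale g \<rho> =
     (\<lambda>(p, q)\<in>Zg g \<times> Zg g. \<Inter>\<mu><g. weight_space scale g \<rho> \<mu> (p \<mu>) (q \<mu>),
      \<lambda>\<mu>\<in>{..<g}. rep_t scale g \<rho> \<mu>)"

definition is_grading ::
  "(complex \<Rightarrow> 'v \<Rightarrow> 'v) \<Rightarrow> 'i set \<Rightarrow> ('i \<Rightarrow> 'v :: ab_group_add set) \<Rightarrow> bool" where
  "is_grading scale I U \<longleftrightarrow> (\<forall>i\<in>I. module.subspace scale (U i)) \<and>
     (\<forall>v. \<exists>!f. (\<forall>i\<in>I. f i \<in> U i) \<and> (\<forall>i. i \<notin> I \<longrightarrow> f i = 0) \<and>
        finite {i. f i \<noteq> 0} \<and> v = (\<Sum>i | f i \<noteq> 0. f i))"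

definition triples ::
  "(complex \<Rightarrow> 'v \<Rightarrow> 'v) \<Rightarrow> nat \<Rightarrow>
     (((nat \<Rightarrow> int) \<times> (nat \<Rightarrow> int) \<Rightarrow> 'v :: ab_group_add set) \<times> (nat \<Rightarrow> 'v \<Rightarrow> 'v)) set" where
  "triples scale g = {(U, t). U \<in> extensional (Zg g \<times> Zg g) \<and> t \<in> extensional {..<g} \<and>
     is_grading scale (Zg g \<times> Zg g) U \<and>
     (\<forall>\<mu><g. Vector_Spaces.linear scale scale (t \<mu>) \<and> bij (t \<mu>)) \<and>
     (\<forall>\<mu><g. \<forall>\<nu><g. t \<mu> \<circ> t \<nu> = t \<nu> \<circ> t \<mu>) \<and>
     (\<forall>\<mu><g. \<forall>p\<in>Zg g. \<forall>q\<in>Zg g. \<forall>u\<in>U (p, q).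
        t \<mu> u - u \<in> module.span scale (\<Union>{U (r, s) | r s. r \<in> Zg g \<and> s \<in> Zg g \<and>
          (\<forall>\<nu><g. \<nu> \<noteq> \<mu> \<longrightarrow> r \<nu> = p \<nu> \<and> s \<nu> = q \<nu>) \<and> r \<mu> < p \<mu> \<and> s \<mu> < q \<mu>}))}"

end

theory Submission
  imports Defs "HOL-Computational_Algebra.Formal_Power_Series" "HOL-Computational_Algebra.Polynomial"
begin

text \<open>A representation of the group is determined by its restrictions to the torus and to the \<open>g\<close>
  unipotent factors, because these subgroups generate the group (\<open>GCg_hom_eqI\<close>).

  The matrix coefficients of the torus are combinations of finitely many characters. Characters
  are linearly independent (\<open>independent_characters\<close>), so the operator coefficients of the
  characters form a complete system of orthogonal idempotents (\<open>torus_idem\<close>), which is the same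
  as a grading by bidegrees; its pieces are the common weight spaces (\<open>weight_spaces\<close>).

  On a unipotent factor the matrix coefficients are polynomial functions on some \<open>u\<^sub>n\<close>. Along a
  line \<open>t x\<close> the action is therefore a one-parameter group that is polynomial in \<open>t\<close>, and such a
  group is \<open>exp (t N)\<close> with \<open>N\<close> nilpotent (\<open>one_parameter_group\<close>). The terms of order at most
  two of the matrix coefficients show that \<open>N\<close> is linear in \<open>x\<close> and carries brackets to
  commutators (\<open>acts_through_level\<close>): the factor acts by the exponential of a nilpotent
  representation of \<open>u\<^sub>n\<close>.

  Conjugation by the torus shows that the operator of \<open>T\<^sup>i\<^sup>,\<^sup>j\<close> in the factor \<open>\<mu>\<close> shifts the bidegree
  at \<open>\<mu>\<close> by \<open>(-i, -j)\<close> and leaves the others alone (\<open>generator_shifts\<close>). Hence \<open>t\<^sub>\<mu>\<close> satisfies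
  the condition on a triple, and conversely each generator is recovered from \<open>log t\<^sub>\<mu>\<close> as the part
  that shifts by \<open>(-i, -j)\<close>. As the generators determine the representation of \<open>u\<^sub>n\<close>, the
  correspondence is injective (\<open>correspondence_inject\<close>).

  For surjectivity the parts of \<open>log t\<^sub>\<mu>\<close> are taken as the images of the generators. They define a
  representation of the free Lie algebra in which every element of degree larger than \<open>n\<close> acts as
  zero as soon as \<open>n\<close> is at least the spread of the grading (\<open>ev_In\<close>). The group law of \<open>U\<^sub>n\<close> is the
  truncated Campbell-Hausdorff series in Dynkin's form, so that the exponential of this
  representation is multiplicative by Dynkin's formula for endomorphisms that lower a
  filtration (\<open>ex_mult_ex\<close>). The compatibility with the torus is built into the bidegrees
  (\<open>D_ev\<close>), and different factors commute because the \<open>t\<^sub>\<mu>\<close> do (\<open>T_comm\<close>).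

  Dynkin's formula itself is first proved in a filtered ring with a derivation \<open>\<delta>\<close> that fixes
  \<open>x\<close> and \<open>y\<close> (\<open>ex_dynkin\<close>): the derivation plays the role of \<open>t d/dt\<close> applied to \<open>t x\<close> and
  \<open>t y\<close>, it turns \<open>log (exp x exp y)\<close> into a series of nested commutators, and it is injective on
  elements of positive order. Endomorphisms of \<open>V[t]\<close> supply such a ring, and the value at
  \<open>t = 1\<close> gives the formula for endomorphisms of \<open>V\<close>.\<close>

section \<open>Rings of endomorphisms and power series of nilpotent elements\<close>

unbundle fps_syntax

text \<open>Rings in which \<open>0 = 1\<close> is permitted, so that the endomorphisms of the zero space form
  an instance.\<close>

class unital_ring = ring + monoid_mult

text \<open>Additive endomorphisms rather than linear ones: linearity would make the type depend on
  a scalar multiplication, which is a term. Scalars are elements of the ring, and linearity is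
  commutation with them.\<close>

typedef (overloaded) 'v endo = "{f :: 'v::ab_group_add \<Rightarrow> 'v. \<forall>x y. f (x + y) = f x + f y}"
  morphisms app Endo
  by (rule exI[of _ "\<lambda>x. x"]) simp

setup_lifting type_definition_endo

instantiation endo :: (ab_group_add) unital_ring
begin
lift_definition zero_endo :: "'a endo" is "\<lambda>_. 0" by simp
lift_definition one_endo :: "'a endo" is "\<lambda>x. x" by simp
lift_definition plus_endo :: "'a endo \<Rightarrow> 'a endo \<Rightarrow> 'a endo" is "\<lambda>f g x. f x + g x"
  by (simp add: algebra_simps)
lift_definition minus_endo :: "'a endo \<Rightarrow> 'a endo \<Rightarrow> 'a endo" is "\<lambda>f g x. f x - g x"
  by (simp add: algebra_simps)
lift_definition uminus_endo :: "'a endo \<Rightarrow> 'a endo" is "\<lambda>f x. - f x"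
  by (simp add: algebra_simps)
lift_definition times_endo :: "'a endo \<Rightarrow> 'a endo \<Rightarrow> 'a endo" is "\<lambda>f g x. f (g x)"
  by simp
instance
  by (standard; transfer) (simp_all add: algebra_simps fun_eq_iff)
end

lemma app_zero [simp]: "app 0 v = 0" by transfer simp
lemma app_one [simp]: "app 1 v = v" by transfer simp
lemma app_plus [simp]: "app (a + b) v = app a v + app b v" by transfer simp
lemma app_minus [simp]: "app (a - b) v = app a v - app b v" by transfer simp
lemma app_uminus [simp]: "app (- a) v = - app a v" by transfer simp
lemma app_times [simp]: "app (a * b) v = app a (app b v)" by transfer simp
lemma app_add [simp]: "app a (v + w) = app a v + app a w" by transfer simp
lemma app_0 [simp]: "app a 0 = 0" using app_add[of a 0 0] by simp
lemma app_neg [simp]: "app a (- v) = - app a v"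
  using app_add[of a v "- v"] by (simp add: eq_neg_iff_add_eq_0 add.commute)
lemma app_diff [simp]: "app a (v - w) = app a v - app a w"
  using app_add[of a v "- w"] by simp
lemma app_sum: "app a (\<Sum>i\<in>I. f i) = (\<Sum>i\<in>I. app a (f i))"
  by (induct I rule: infinite_finite_induct) auto
lemma sum_app: "app (\<Sum>i\<in>I. f i) v = (\<Sum>i\<in>I. app (f i) v)"
  by (induct I rule: infinite_finite_induct) auto
lemma app_power: "app (a ^ k) v = (app a ^^ k) v"
  by (induct k arbitrary: v) auto
lemma endo_eqI: "(\<And>v. app a v = app b v) \<Longrightarrow> a = b"
  using app_inject by blast
lemma app_Endo: "(\<And>x y. f (x + y) = f x + f y) \<Longrightarrow> app (Endo f) = f"
  by (rule Endo_inverse) simp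

definition nil :: "'r::unital_ring \<Rightarrow> bool" where
  "nil a \<longleftrightarrow> (\<exists>k. a ^ k = 0)"

lemma power_eq_0_mono: "a ^ k = 0 \<Longrightarrow> k \<le> m \<Longrightarrow> a ^ m = (0::'r::unital_ring)"
  by (metis le_add_diff_inverse mult_zero_left power_add)

lemma nil_0 [simp]: "nil 0"
  unfolding nil_def by (rule exI[of _ 1]) simp

lemma power_commuting: "a * b = b * a \<Longrightarrow> a ^ k * b = b * (a::'r::unital_ring) ^ k"
  by (induct k) (simp_all add: mult.assoc, metis mult.assoc)

lemma power_mult_commuting: "a * b = b * a \<Longrightarrow> (a * b) ^ k = a ^ k * (b::'r::unital_ring) ^ k"
proof (induct k)
  case (Suc k)
  have "(a * b) ^ Suc k = a * b * (a * b) ^ k" by simp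
  also have "\<dots> = a * (b * a ^ k) * b ^ k" unfolding Suc(1)[OF Suc(2)] by (simp add: mult.assoc)
  also have "\<dots> = a * (a ^ k * b) * b ^ k" using power_commuting[OF Suc(2)] by simp
  finally show ?case by (simp add: mult.assoc)
qed simp

lemma nil_mult_commuting: "nil a \<Longrightarrow> a * b = b * a \<Longrightarrow> nil (a * b)"
  unfolding nil_def by (metis power_mult_commuting mult_zero_left)

lemma nil_uminus: "nil a \<Longrightarrow> nil (- a)"
proof -
  assume "nil a"
  then have "nil (a * - 1)" by (rule nil_mult_commuting) simp
  then show "nil (- a)" by simp
qed

text \<open>A ring that contains an image of the rational numbers; \<open>q\<close> need not be injective, since
  the ring may be zero.\<close>

locale rational_ring =
  fixes q :: "rat \<Rightarrow> 'r::unital_ring"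
  assumes q_1 [simp]: "q 1 = 1"
    and q_add: "q (a + b) = q a + q b"
    and q_mult: "q (a * b) = q a * q b"
begin

lemma q_0 [simp]: "q 0 = 0"
  using q_add[of 0 0] by simp

lemma q_minus: "q (- a) = - q a"
  using q_add[of a "- a"] by (simp add: eq_neg_iff_add_eq_0 add.commute)

lemma q_diff: "q (a - b) = q a - q b"
  using q_add[of a "- b"] by (simp add: q_minus)

lemma q_sum: "q (\<Sum>i\<in>I. f i) = (\<Sum>i\<in>I. q (f i))"
  by (induct I rule: infinite_finite_induct) (auto simp: q_add)

text \<open>Integers are central, and so are their inverses.\<close>

lemma q_central: "q a * x = x * q a"
proof -
  have nat: "q (of_nat n) * x = x * q (of_nat n)" for n
    by (induct n) (simp_all add: q_add algebra_simps)
  have int: "q (of_int z) * x = x * q (of_int z)" for z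
    by (cases z) (simp_all add: nat q_minus q_diff q_add algebra_simps del: of_nat_Suc)
  obtain m n where a: "a = of_int m / of_int n" "n > 0"
    by (metis quotient_of_div quotient_of_denom_pos prod.collapse)
  define c where "c = q (of_int n)"
  define c' where "c' = q (1 / of_int n)"
  have cc: "c' * c = 1" "c * c' = 1"
    using a(2) by (simp_all add: c_def c'_def flip: q_mult)
  have ca: "c * q a = q (of_int m)" "q a * c = q (of_int m)"
    using a by (simp_all add: c_def flip: q_mult)
  have "c * (q a * x) = q (of_int m) * x" by (simp add: ca flip: mult.assoc)
  also have "\<dots> = x * (c * q a)" by (simp add: int ca)
  also have "\<dots> = (c * x) * q a" by (simp add: c_def int mult.assoc)
  also have "\<dots> = c * (x * q a)" by (rule mult.assoc)
  finally have "c' * c * (q a * x) = c' * c * (x * q a)" by (simp add: mult.assoc)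
  then show ?thesis by (simp add: cc)
qed

lemma q_left: "x * (q a * y) = q a * (x * y)"
  by (simp add: q_central[of a x] flip: mult.assoc)

text \<open>The value of a formal power series at a nilpotent element, the common source of the
  exponential, the logarithm and the series that occur in the derivative of the exponential.\<close>

definition ser :: "rat fps \<Rightarrow> 'r \<Rightarrow> 'r" where
  "ser c a = (\<Sum>k | a ^ k \<noteq> 0. q (c $ k) * a ^ k)"

lemma ser_eq: assumes "a ^ K = 0" shows "ser c a = (\<Sum>k<K. q (c $ k) * a ^ k)"
  unfolding ser_def
proof (rule sum.mono_neutral_left)
  show "{k. a ^ k \<noteq> 0} \<subseteq> {..<K}"
    using power_eq_0_mono[OF assms] by (auto simp: not_le[symmetric])
qed auto

lemma ser_minus: "nil a \<Longrightarrow> ser (c - d) a = ser c a - ser d a"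
  unfolding nil_def by (auto simp: ser_eq q_diff left_diff_distrib sum_subtractf)

lemma ser_const: "nil a \<Longrightarrow> ser (fps_const r) a = q r"
proof -
  assume "nil a"
  then obtain k where "a ^ k = 0" by (auto simp: nil_def)
  then have *: "a ^ Suc k = 0" by simp
  show ?thesis by (subst ser_eq[OF *]) (simp add: sum.lessThan_Suc_shift del: sum.lessThan_Suc)
qed

lemma ser_1: "nil a \<Longrightarrow> ser 1 a = 1"
  using ser_const[of a 1] by simp

lemma ser_X: "nil a \<Longrightarrow> ser fps_X a = a"
proof -
  assume "nil a"
  then obtain k where "a ^ k = 0" by (auto simp: nil_def)
  then have *: "a ^ Suc (Suc k) = 0" by simp
  show ?thesis
    by (subst ser_eq[OF *]) (simp add: sum.lessThan_Suc_shift fps_X_def del: sum.lessThan_Suc)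
qed

lemma ser_commute: "a * b = b * a \<Longrightarrow> ser c a * b = b * ser c a"
  by (simp add: ser_def sum_distrib_left sum_distrib_right q_left mult.assoc power_commuting)

lemma ser_commute2: "a * b = b * a \<Longrightarrow> ser c a * ser d b = ser d b * ser c a"
  by (metis ser_commute)

text \<open>Together with compatibility with composition, this makes every identity of formal power
  series available for nilpotent elements of an arbitrary ring.\<close>

lemma ser_mult:
  assumes "nil a"
  shows "ser (c * d) a = ser c a * ser d a"
proof -
  obtain K where K: "a ^ K = 0" using assms by (auto simp: nil_def)
  let ?g = "\<lambda>i j. q (c $ i) * q (d $ j) * a ^ (i + j)"
  have "ser (c * d) a = (\<Sum>k<K. \<Sum>i\<le>k. ?g i (k - i))"
    by (simp add: ser_eq[OF K] fps_mult_nth q_sum q_mult sum_distrib_right atLeast0AtMost)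
  also have "\<dots> = (\<Sum>(i, j) | i + j < K. ?g i j)"
    by (rule sum.triangle_reindex[symmetric])
  also have "\<dots> = (\<Sum>(i, j) \<in> {..<K} \<times> {..<K}. ?g i j)"
  proof (rule sum.mono_neutral_left)
    show "\<forall>p\<in>{..<K} \<times> {..<K} - {(i, j). i + j < K}. (case p of (i, j) \<Rightarrow> ?g i j) = 0"
      using power_eq_0_mono[OF K] by (simp add: split_beta not_less)
  qed auto
  also have "\<dots> = (\<Sum>i<K. \<Sum>j<K. ?g i j)"
    by (rule sum.cartesian_product[symmetric])
  also have "\<dots> = (\<Sum>i<K. \<Sum>j<K. (q (c $ i) * a ^ i) * (q (d $ j) * a ^ j))"
    by (simp add: q_left[of "a ^ i" for i] mult.assoc power_add)
  also have "\<dots> = ser c a * ser d a"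
    by (simp add: ser_eq[OF K] sum_product)
  finally show ?thesis .
qed

lemma ser_power: "nil a \<Longrightarrow> ser (c ^ k) a = ser c a ^ k"
  by (induct k) (simp_all add: ser_1 ser_mult)

lemma ser_fps_X_mult: "nil a \<Longrightarrow> ser (fps_X * c) a = a * ser c a"
  by (simp add: ser_mult ser_X)

lemma fps_eq_X_mult: "d $ 0 = 0 \<Longrightarrow> d = fps_X * fps_shift 1 (d :: rat fps)"
  by (rule fps_ext) (auto simp: fps_X_mult_nth)

lemma ser_pow_eq_0:
  assumes "d $ 0 = 0" "a ^ K = 0"
  shows "ser d a ^ K = 0"
proof -
  have a: "nil a" using assms by (auto simp: nil_def)
  then have "ser d a = a * ser (fps_shift 1 d) a"
    by (subst fps_eq_X_mult[OF assms(1)]) (rule ser_fps_X_mult)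
  then show ?thesis
    using power_mult_commuting[of a "ser (fps_shift 1 d) a"] ser_commute[of a a] assms(2) by simp
qed

lemma nil_ser: "d $ 0 = 0 \<Longrightarrow> nil a \<Longrightarrow> nil (ser d a)"
  using ser_pow_eq_0 unfolding nil_def by blast

lemma ser_compose:
  assumes d: "d $ 0 = 0" and "nil a"
  shows "ser (c oo d) a = ser c (ser d a)"
proof -
  obtain K where K: "a ^ K = 0" using assms by (auto simp: nil_def)
  have "ser c (ser d a) = (\<Sum>k<K. q (c $ k) * ser (d ^ k) a)"
    by (simp add: ser_eq[OF ser_pow_eq_0[OF d K]] ser_power[OF assms(2)])
  also have "\<dots> = (\<Sum>k<K. \<Sum>m<K. q (c $ k * d ^ k $ m) * a ^ m)"
    by (simp add: ser_eq[OF K] sum_distrib_left q_mult mult.assoc)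
  also have "\<dots> = (\<Sum>m<K. \<Sum>k<K. q (c $ k * d ^ k $ m) * a ^ m)"
    by (rule sum.swap)
  also have "\<dots> = (\<Sum>m<K. \<Sum>k=0..m. q (c $ k * d ^ k $ m) * a ^ m)"
  proof (rule sum.cong[OF HOL.refl])
    fix m assume m: "m \<in> {..<K}"
    have "d ^ k $ m = 0" if "k > m" for k
      using startsby_zero_power_prefix[OF d] that by auto
    then show "(\<Sum>k<K. q (c $ k * d ^ k $ m) * a ^ m) = (\<Sum>k=0..m. q (c $ k * d ^ k $ m) * a ^ m)"
      using m by (intro sum.mono_neutral_right) auto
  qed
  also have "\<dots> = ser (c oo d) a"
    by (simp add: ser_eq[OF K] fps_compose_nth q_sum sum_distrib_right)
  finally show ?thesis by simp
qed

definition ex :: "'r \<Rightarrow> 'r" where "ex a = ser (fps_exp 1) a"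

definition lg :: "'r \<Rightarrow> 'r" where "lg b = ser (fps_ln 1) (b - 1)"

lemma ex_minus_1: "nil a \<Longrightarrow> ex a - 1 = ser (fps_exp 1 - 1) a"
  by (simp add: ex_def ser_minus ser_1)

lemma nil_lg: "nil (b - 1) \<Longrightarrow> nil (lg b)"
  by (simp add: lg_def nil_ser)

lemma lg_ex: "nil a \<Longrightarrow> lg (ex a) = a"
proof -
  assume a: "nil a"
  have "fps_ln 1 oo (fps_exp 1 - 1 :: rat fps) = fps_X"
    by (simp add: fps_ln_fps_exp_inv fps_inv)
  then show ?thesis
    using ser_compose[of "fps_exp 1 - 1" a "fps_ln 1"] a
    by (simp add: lg_def ex_minus_1 ser_X)
qed

lemma ex_lg: "nil (b - 1) \<Longrightarrow> ex (lg b) = b"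
proof -
  assume b: "nil (b - 1)"
  have "(fps_exp 1 - 1) oo fps_ln (1::rat) = fps_X"
    using fps_inv_right[of "fps_exp 1 - 1 :: rat fps"] by (simp add: fps_ln_fps_exp_inv)
  then have "ser (fps_exp 1 - 1) (lg b) = b - 1"
    using ser_compose[of "fps_ln 1" "b - 1" "fps_exp 1 - 1"] b by (simp add: lg_def ser_X)
  then show ?thesis using ex_minus_1[OF nil_lg[OF b]] by simp
qed

lemma ex_inject: "nil a \<Longrightarrow> nil b \<Longrightarrow> ex a = ex b \<Longrightarrow> a = b"
  by (metis lg_ex)

lemma ex_0 [simp]: "ex 0 = 1"
  using ex_minus_1[of 0] ser_eq[of 0 1 "fps_exp 1 - 1"] by simp

lemma ex_eq: "a ^ K = 0 \<Longrightarrow> ex a = (\<Sum>k<K. q (1 / fact k) * a ^ k)"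
  unfolding ex_def by (subst ser_eq) (auto simp: fps_exp_def)

text \<open>The binomial formula divided by \<open>n!\<close>, proved without binomial coefficients by the
  recursion for \<open>(a + b) (a + b)\<^sup>n / n!\<close>.\<close>

lemma divided_power_add:
  assumes "a * b = b * a"
  shows "q (1 / fact n) * (a + b) ^ n
    = (\<Sum>i\<le>n. (q (1 / fact i) * a ^ i) * (q (1 / fact (n - i)) * b ^ (n - i)))"
proof (induct n)
  case (Suc n)
  define S where "S = (\<lambda>x i. q (1 / fact i) * x ^ i)"
  have S_Suc: "x * S x i = q (of_nat (Suc i)) * S x (Suc i)" for x i
  proof -
    have "q (of_nat (Suc i)) * S x (Suc i) = q (of_nat (Suc i) * (1 / fact (Suc i))) * x ^ Suc i"
      by (simp only: S_def q_mult mult.assoc)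
    also have "of_nat (Suc i) * (1 / fact (Suc i)) = (1 / fact i :: rat)" by simp
    also have "q (1 / fact i) * x ^ Suc i = x * S x i"
      unfolding S_def power_Suc by (simp only: q_left)
    finally show ?thesis ..
  qed
  have bS: "b * S a i = S a i * b" for i
    unfolding S_def by (simp add: q_left mult.assoc power_commuting[OF assms])
  have "q (of_nat (Suc n)) * S (a + b) (Suc n) = (a + b) * (\<Sum>i\<le>n. S a i * S b (n - i))"
    using Suc unfolding S_Suc[symmetric] by (simp add: S_def)
  also have "\<dots> = (\<Sum>i\<le>n. (a * S a i) * S b (n - i)) + (\<Sum>i\<le>n. S a i * (b * S b (n - i)))"
    by (simp add: distrib_right sum_distrib_left sum.distrib)
      (simp add: bS flip: mult.assoc)
  also have "(\<Sum>i\<le>n. (a * S a i) * S b (n - i))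
    = (\<Sum>i\<le>n. q (of_nat (Suc i)) * (S a (Suc i) * S b (Suc n - Suc i)))"
    by (simp add: S_Suc mult.assoc)
  also have "\<dots> = (\<Sum>i\<le>Suc n. q (of_nat i) * (S a i * S b (Suc n - i)))"
    by (simp add: sum.atMost_Suc_shift del: sum.atMost_Suc)
  also have "(\<Sum>i\<le>n. S a i * (b * S b (n - i)))
    = (\<Sum>i\<le>n. q (of_nat (Suc n - i)) * (S a i * S b (Suc n - i)))"
    by (intro sum.cong HOL.refl) (simp add: S_Suc Suc_diff_le q_left del: of_nat_Suc)
  also have "\<dots> = (\<Sum>i\<le>Suc n. q (of_nat (Suc n - i)) * (S a i * S b (Suc n - i)))"
    by simp
  also have "(\<Sum>i\<le>Suc n. q (of_nat i) * (S a i * S b (Suc n - i))) + \<dots>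
    = (\<Sum>i\<le>Suc n. q (of_nat (Suc n)) * (S a i * S b (Suc n - i)))"
    by (subst sum.distrib[symmetric], intro sum.cong HOL.refl)
      (simp add: distrib_right[symmetric] q_add[symmetric] del: of_nat_Suc)
  finally have *: "q (of_nat (Suc n)) * S (a + b) (Suc n)
    = q (of_nat (Suc n)) * (\<Sum>i\<le>Suc n. S a i * S b (Suc n - i))"
    by (simp only: sum_distrib_left)
  have "q (1 / of_nat (Suc n)) * q (of_nat (Suc n)) = 1"
    by (simp flip: q_mult del: of_nat_Suc)
  then have "S (a + b) (Suc n) = (\<Sum>i\<le>Suc n. S a i * S b (Suc n - i))"
    using arg_cong[OF *, of "\<lambda>z. q (1 / of_nat (Suc n)) * z"] by (simp flip: mult.assoc)
  then show ?case by (simp add: S_def)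
qed simp

lemma
  assumes ab: "a * b = b * a" and "nil a" "nil b"
  shows nil_add_commuting: "nil (a + b)"
    and ex_add_commuting: "ex (a + b) = ex a * ex b"
proof -
  obtain K where K: "a ^ K = 0" "b ^ K = 0"
    using assms(2,3) power_eq_0_mono unfolding nil_def by (metis nle_le)
  define g where "g = (\<lambda>i j. (q (1 / fact i) * a ^ i) * (q (1 / fact j) * b ^ j))"
  have g0: "g i j = 0" if "i + j \<ge> 2 * K" for i j
  proof -
    have "i \<ge> K \<or> j \<ge> K" using that by linarith
    then show ?thesis
      using power_eq_0_mono[OF K(1), of i] power_eq_0_mono[OF K(2), of j] by (auto simp: g_def)
  qed
  have "q (1 / fact (2 * K)) * (a + b) ^ (2 * K) = (\<Sum>i\<le>2 * K. g i (2 * K - i))"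
    unfolding g_def by (rule divided_power_add[OF ab])
  also have "\<dots> = 0" by (rule sum.neutral) (simp add: g0)
  finally have "q (fact (2 * K)) * (q (1 / fact (2 * K)) * (a + b) ^ (2 * K)) = 0" by simp
  then have 0: "(a + b) ^ (2 * K) = 0"
    by (simp flip: mult.assoc q_mult)
  then show "nil (a + b)" by (auto simp: nil_def)
  have "ex (a + b) = (\<Sum>n<2*K. \<Sum>i\<le>n. g i (n - i))"
    by (simp add: ex_eq[OF 0] divided_power_add[OF ab] g_def)
  also have "\<dots> = (\<Sum>(i, j) | i + j < 2 * K. g i j)"
    by (rule sum.triangle_reindex[symmetric])
  also have "\<dots> = (\<Sum>(i, j) \<in> {..<2*K} \<times> {..<2*K}. g i j)"
    by (rule sum.mono_neutral_left) (auto intro: g0 simp flip: not_less)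
  also have "\<dots> = (\<Sum>i<2*K. q (1 / fact i) * a ^ i) * (\<Sum>j<2*K. q (1 / fact j) * b ^ j)"
    by (simp add: sum_product sum.cartesian_product g_def)
  also have "\<dots> = ex a * ex b"
    using K power_eq_0_mono[of a K "2 * K"] power_eq_0_mono[of b K "2 * K"]
    by (simp add: ex_eq[of _ "2 * K"])
  finally show "ex (a + b) = ex a * ex b" .
qed

lemma ex_minus: "nil a \<Longrightarrow> ex a * ex (- a) = 1" "nil a \<Longrightarrow> ex (- a) * ex a = 1"
  using ex_add_commuting[of a "- a"] ex_add_commuting[of "- a" a] nil_uminus[of a] by auto

end

text \<open>The map need not be multiplicative everywhere: it is enough that it respects the powers
  of the element in question. This covers conjugation and left and right multiplication.\<close>

lemma ser_hom:
  assumes "rational_ring q" "rational_ring q'" "nil a" "nil (h a)"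
    and add: "\<And>x y. h (x + y) = h x + h y"
    and hq: "\<And>r k. h (q r * a ^ k) = q' r * h a ^ k"
  shows "h (rational_ring.ser q c a) = rational_ring.ser q' c (h a)"
proof -
  obtain K where K: "a ^ K = 0" "h a ^ K = 0"
    using assms(3,4) power_eq_0_mono unfolding nil_def by (metis nle_le)
  have h0: "h 0 = 0" using add[of 0 0] by simp
  have "h (\<Sum>i\<in>I. f i) = (\<Sum>i\<in>I. h (f i))" for f :: "nat \<Rightarrow> 'a" and I
    by (induct I rule: infinite_finite_induct) (auto simp: add h0)
  then show ?thesis
    using assms(1,2) K by (simp add: rational_ring.ser_eq hq)
qed

section \<open>The derivative of the exponential series\<close>

definition Lm :: "'r::unital_ring \<Rightarrow> 'r endo" where "Lm a = Endo (\<lambda>v. a * v)"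
definition Rm :: "'r::unital_ring \<Rightarrow> 'r endo" where "Rm a = Endo (\<lambda>v. v * a)"
definition ad :: "'r::unital_ring \<Rightarrow> 'r endo" where "ad a = Lm a - Rm a"

lemma app_Lm [simp]: "app (Lm a) v = a * v"
  by (simp add: Lm_def app_Endo distrib_left)
lemma app_Rm [simp]: "app (Rm a) v = v * a"
  by (simp add: Rm_def app_Endo distrib_right)
lemma app_ad [simp]: "app (ad a) v = a * v - v * a"
  by (simp add: ad_def)

lemma Lm_power: "Lm a ^ k = Lm (a ^ k)"
  by (rule endo_eqI) (induct k, simp_all add: mult.assoc)
lemma Rm_power: "Rm a ^ k = Rm (a ^ k)"
  by (rule endo_eqI) (induct k, simp_all add: mult.assoc power_commutes)
lemma Lm_0: "Lm 0 = 0" by (rule endo_eqI) simp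
lemma Rm_0: "Rm 0 = 0" by (rule endo_eqI) simp
lemma nil_Lm: "nil a \<Longrightarrow> nil (Lm a)"
  unfolding nil_def Lm_power by (metis Lm_0)
lemma nil_Rm: "nil a \<Longrightarrow> nil (Rm a)"
  unfolding nil_def Rm_power by (metis Rm_0)

context rational_ring
begin

lemma rational_ring_Lm: "rational_ring (\<lambda>r. Lm (q r))"
  by standard (auto intro!: endo_eqI simp: q_add q_mult distrib_right mult.assoc)

interpretation op: rational_ring "\<lambda>r. Lm (q r)"
  by (rule rational_ring_Lm)

text \<open>Left and right multiplication commute, so the exponential of their difference is the
  product of their exponentials.\<close>

lemma
  assumes "nil a"
  shows nil_ad: "nil (ad a)"
    and app_ex_ad: "app (op.ex (ad a)) v = ex a * v * ex (- a)"
proof -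
  have com: "Lm a * Rm (- a) = Rm (- a) * Lm a"
    by (rule endo_eqI) (simp add: mult.assoc)
  have ad: "ad a = Lm a + Rm (- a)" by (rule endo_eqI) simp
  show "nil (ad a)"
    unfolding ad using com nil_Lm[OF assms] nil_Rm[OF nil_uminus[OF assms]]
    by (rule op.nil_add_commuting)
  have "op.ex (ad a) = op.ex (Lm a) * op.ex (Rm (- a))"
    unfolding ad using com nil_Lm[OF assms] nil_Rm[OF nil_uminus[OF assms]]
    by (rule op.ex_add_commuting)
  also have "op.ex (Lm a) = Lm (ex a)"
    unfolding op.ex_def ex_def
    by (rule ser_hom[symmetric], unfold_locales)
      (auto intro!: endo_eqI nil_Lm assms simp: distrib_right Lm_power mult.assoc)
  also have "op.ex (Rm (- a)) = Rm (ex (- a))"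
    unfolding op.ex_def ex_def
    by (rule ser_hom[symmetric], unfold_locales)
      (auto intro!: endo_eqI nil_Rm nil_uminus assms simp: distrib_left Rm_power q_left)
  finally show "app (op.ex (ad a)) v = ex a * v * ex (- a)" by (simp add: mult.assoc)
qed

text \<open>Only the constant term of a series acts on a vector that is annihilated.\<close>

lemma ser_app_kernel:
  assumes "nil A" "app A v = 0"
  shows "app (op.ser c A) v = q (c $ 0) * v"
proof -
  obtain k where "A ^ k = 0" using assms(1) by (auto simp: nil_def)
  then have k: "A ^ Suc k = 0" by simp
  have "app (A ^ Suc i) v = 0" for i
    by (induct i) (simp_all add: assms(2) power_Suc2 del: power_Suc)
  then show ?thesis
    unfolding op.ser_eq[OF k] sum.lessThan_Suc_shift by (simp add: sum_app del: power_Suc)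
qed

end

locale derivation_ring = rational_ring q for q :: "rat \<Rightarrow> 'r::unital_ring" +
  fixes \<delta> :: "'r \<Rightarrow> 'r"
  assumes \<delta>_add: "\<delta> (a + b) = \<delta> a + \<delta> b"
    and \<delta>_mult: "\<delta> (a * b) = \<delta> a * b + a * \<delta> b"
    and \<delta>_q [simp]: "\<delta> (q r) = 0"
begin

interpretation op: rational_ring "\<lambda>r. Lm (q r)"
  by (rule rational_ring_Lm)

lemma \<delta>_0 [simp]: "\<delta> 0 = 0" using \<delta>_q[of 0] by simp
lemma \<delta>_1 [simp]: "\<delta> 1 = 0" using \<delta>_q[of 1] by simp
lemma \<delta>_minus: "\<delta> (a - b) = \<delta> a - \<delta> b"
  using \<delta>_add[of "a - b" b] by (simp add: algebra_simps)
lemma \<delta>_sum: "\<delta> (\<Sum>i\<in>I. f i) = (\<Sum>i\<in>I. \<delta> (f i))"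
  by (induct I rule: infinite_finite_induct) (auto simp: \<delta>_add)
lemma \<delta>_scale: "\<delta> (q r * a) = q r * \<delta> a"
  by (simp add: \<delta>_mult)

text \<open>Moving all factors \<open>Z\<close> in \<open>\<Sum> Z\<^sup>a \<delta>(Z) Z\<^sup>b\<close> to the right produces the iterated
  commutators.\<close>

lemma \<delta>_power:
  "\<delta> (Z ^ k) = (\<Sum>j<k. q (of_nat (k choose Suc j)) * (app (ad Z ^ j) (\<delta> Z) * Z ^ (k - 1 - j)))"
proof (induct k)
  case (Suc k)
  define A where "A = (\<lambda>j. app (ad Z ^ j) (\<delta> Z))"
  have A0: "A 0 = \<delta> Z" by (simp add: A_def)
  have ZA: "Z * A j = A (Suc j) + A j * Z" for j by (simp add: A_def)
  have "\<delta> (Z ^ Suc k) = A 0 * Z ^ k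
      + (\<Sum>j<k. Z * (q (of_nat (k choose Suc j)) * (A j * Z ^ (k - 1 - j))))"
    by (simp add: \<delta>_mult Suc A0 sum_distrib_left) (simp add: A_def)
  also have "(\<Sum>j<k. Z * (q (of_nat (k choose Suc j)) * (A j * Z ^ (k - 1 - j))))
    = (\<Sum>j<k. q (of_nat (k choose Suc j)) * (A (Suc j) * Z ^ (k - 1 - j))
         + q (of_nat (k choose Suc j)) * (A j * Z ^ (k - j)))"
  proof (rule sum.cong[OF HOL.refl])
    fix j assume "j \<in> {..<k}"
    then have "Z ^ (k - j) = Z * Z ^ (k - 1 - j)" by (simp add: Suc_diff_Suc flip: power_Suc)
    then show "Z * (q (of_nat (k choose Suc j)) * (A j * Z ^ (k - 1 - j)))
      = q (of_nat (k choose Suc j)) * (A (Suc j) * Z ^ (k - 1 - j))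
         + q (of_nat (k choose Suc j)) * (A j * Z ^ (k - j))"
      by (simp add: q_left[of Z] distrib_left distrib_right ZA flip: mult.assoc)
        (simp add: mult.assoc q_left[of Z] ZA distrib_left distrib_right)
  qed
  also have "A 0 * Z ^ k + \<dots>
    = (A 0 * Z ^ k + (\<Sum>j<k. q (of_nat (k choose Suc j)) * (A (Suc j) * Z ^ (k - Suc j))))
      + (\<Sum>j<k. q (of_nat (k choose Suc j)) * (A j * Z ^ (k - j)))"
    by (simp add: sum.distrib add.assoc)
  also have "A 0 * Z ^ k + (\<Sum>j<k. q (of_nat (k choose Suc j)) * (A (Suc j) * Z ^ (k - Suc j)))
    = (\<Sum>j<Suc k. q (of_nat (k choose j)) * (A j * Z ^ (k - j)))"
    by (simp add: sum.lessThan_Suc_shift del: sum.lessThan_Suc)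
  also have "(\<Sum>j<k. q (of_nat (k choose Suc j)) * (A j * Z ^ (k - j)))
    = (\<Sum>j<Suc k. q (of_nat (k choose Suc j)) * (A j * Z ^ (k - j)))"
    by (simp add: binomial_eq_0)
  also have "(\<Sum>j<Suc k. q (of_nat (k choose j)) * (A j * Z ^ (k - j))) + \<dots>
    = (\<Sum>j<Suc k. q (of_nat (Suc k choose Suc j)) * (A j * Z ^ (k - j)))"
    by (simp add: sum.distrib[symmetric] distrib_right q_add del: sum.lessThan_Suc)
  finally show ?case by (simp add: A_def)
qed simp

text \<open>The series \<open>(exp X - 1) / X\<close>.\<close>

definition dexp :: "rat fps" where "dexp = Abs_fps (\<lambda>j. 1 / fact (Suc j))"

lemma X_dexp: "fps_X * dexp = fps_exp 1 - 1"
  proof (rule fps_ext)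
  fix n show "(fps_X * dexp) $ n = (fps_exp 1 - 1) $ n"
    by (cases n) (simp_all add: dexp_def fps_X_mult_nth fps_exp_def)
qed

text \<open>The derivative of the exponential map in a noncommutative ring, obtained by summing
  the derivatives of the divided powers.\<close>

lemma \<delta>_ex:
  assumes "nil Z"
  shows "\<delta> (ex Z) = app (op.ser dexp (ad Z)) (\<delta> Z) * ex Z"
proof -
  obtain K where K: "Z ^ K = 0" "ad Z ^ K = 0"
    using assms nil_ad[OF assms] power_eq_0_mono unfolding nil_def by (metis nle_le)
  define A where "A = (\<lambda>j. app (ad Z ^ j) (\<delta> Z))"
  define g where "g = (\<lambda>j m. (q (1 / fact (Suc j)) * A j) * (q (1 / fact m) * Z ^ m))"
  have g0: "g j m = 0" if "j + m \<ge> 2 * K" for j m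
  proof -
    have "j \<ge> K \<or> m \<ge> K" using that by linarith
    then show ?thesis
      using power_eq_0_mono[OF K(2), of j] power_eq_0_mono[OF K(1), of m] by (auto simp: g_def A_def)
  qed
  have Z: "Z ^ Suc (2 * K) = 0" using power_eq_0_mono[OF K(1)] by simp
  have "\<delta> (ex Z) = (\<Sum>k<Suc (2 * K). q (1 / fact k) * \<delta> (Z ^ k))"
    by (simp only: ex_eq[OF Z] \<delta>_sum \<delta>_scale)
  also have "\<dots> = (\<Sum>k<2 * K. q (1 / fact (Suc k)) * \<delta> (Z ^ Suc k))"
    by (subst sum.lessThan_Suc_shift) simp
  also have "\<dots> = (\<Sum>k<2 * K. \<Sum>j\<le>k. g j (k - j))"
  proof (rule sum.cong[OF HOL.refl])
    fix k
    have "q (1 / fact (Suc k)) * (q (of_nat (Suc k choose Suc j)) * (A j * Z ^ (k - j))) = g j (k - j)"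
      if "j \<le> k" for j
    proof -
      have "1 / fact (Suc k) * of_nat (Suc k choose Suc j) = (1 / (fact (Suc j) * fact (k - j)) :: rat)"
        using that binomial_fact[of "Suc j" "Suc k", where 'a = rat] by (simp del: fact_Suc)
      then have "q (1 / fact (Suc k)) * (q (of_nat (Suc k choose Suc j)) * (A j * Z ^ (k - j)))
        = q (1 / fact (Suc j) * (1 / fact (k - j))) * (A j * Z ^ (k - j))"
        by (simp add: q_mult[symmetric] mult.assoc[symmetric] del: fact_Suc binomial_Suc_Suc)
      then show ?thesis
        unfolding g_def by (simp only: q_mult mult.assoc q_left[of "A j"])
    qed
    then show "q (1 / fact (Suc k)) * \<delta> (Z ^ Suc k) = (\<Sum>j\<le>k. g j (k - j))"
      unfolding \<delta>_power sum_distrib_left lessThan_Suc_atMost A_def[symmetric]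
      by (intro sum.cong HOL.refl) (simp add: A_def del: fact_Suc binomial_Suc_Suc)
  qed
  also have "\<dots> = (\<Sum>(i, j) | i + j < 2 * K. g i j)"
    by (rule sum.triangle_reindex[symmetric])
  also have "\<dots> = (\<Sum>(i, j) \<in> {..<2*K} \<times> {..<2*K}. g i j)"
    by (rule sum.mono_neutral_left) (auto intro: g0 simp flip: not_less)
  also have "\<dots> = (\<Sum>i<2*K. q (1 / fact (Suc i)) * A i) * (\<Sum>j<2*K. q (1 / fact j) * Z ^ j)"
    by (simp add: sum_product sum.cartesian_product g_def)
  also have "\<dots> = app (op.ser dexp (ad Z)) (\<delta> Z) * ex Z"
    using power_eq_0_mono[OF K(1), of "2 * K"] power_eq_0_mono[OF K(2), of "2 * K"]
    by (simp add: ex_eq[of _ "2 * K"] op.ser_eq[of _ "2 * K"] sum_app A_def dexp_def)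
  finally show ?thesis .
qed

text \<open>The series \<open>log (1 + X) / X\<close>, which inverts \<open>(exp X - 1) / X\<close> after the substitution
  of \<open>exp X - 1\<close>.\<close>

definition dlog :: "rat fps" where "dlog = Abs_fps (\<lambda>k. (- 1) ^ k / of_nat (Suc k))"

lemma dlog_dexp: "(dlog oo (fps_exp 1 - 1)) * dexp = 1"
proof -
  have ln: "fps_ln 1 = fps_X * dlog"
    by (rule fps_ext) (auto simp: fps_ln_def dlog_def fps_X_mult_nth)
  have "fps_X = fps_ln 1 oo (fps_exp 1 - 1 :: rat fps)"
    by (simp add: fps_ln_fps_exp_inv fps_inv)
  also have "\<dots> = fps_X * dexp * (dlog oo (fps_exp 1 - 1))"
    by (simp add: ln fps_compose_mult_distrib X_dexp)
  finally have "fps_X * ((dlog oo (fps_exp 1 - 1)) * dexp) = fps_X * 1"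
    by (simp add: mult_ac)
  then show ?thesis by (metis fps_X_neq_zero mult_left_cancel)
qed

lemma \<delta>_eigen_ex:
  assumes "nil a" "\<delta> a = a"
  shows "\<delta> (ex a) = a * ex a"
  using ser_app_kernel[OF nil_ad[OF assms(1)], of a dexp]
  by (simp add: \<delta>_ex[OF assms(1)] assms(2) dexp_def)

text \<open>The logarithmic derivative of \<open>f = exp x exp y\<close> is \<open>x + f y f\<^sup>-\<^sup>1\<close>, and for
  \<open>f = exp Z\<close> it is also \<open>(exp (ad Z) - 1) / ad Z\<close> applied to \<open>\<delta> Z\<close>. Conjugation by \<open>f\<close> is
  \<open>E = exp (ad x) exp (ad y) = exp (ad Z)\<close>, so the second expression can be solved for \<open>\<delta> Z\<close> by
  the series \<open>log E / (E - 1)\<close>.\<close>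

lemma \<delta>_log_product:
  assumes x: "nil x" "\<delta> x = x" and y: "nil y" "\<delta> y = y"
    and Z: "nil Z" "ex Z = ex x * ex y"
  defines "E \<equiv> op.ex (ad x) * op.ex (ad y)"
  shows "\<delta> Z = app (op.ser dlog (E - 1)) (x + app E y)" and "nil (E - 1)"
proof -
  define f where "f = ex x * ex y"
  define f' where "f' = ex (- y) * ex (- x)"
  have ff': "f * f' = 1"
  proof -
    have "f * f' = ex x * (ex y * ex (- y)) * ex (- x)" by (simp add: f_def f'_def mult.assoc)
    then show ?thesis by (simp add: ex_minus x y)
  qed
  have f': "ex (- Z) = f'"
  proof -
    have "ex (- Z) = ex (- Z) * (f * f')" by (simp add: ff')
    also have "\<dots> = (ex (- Z) * ex Z) * f'" by (simp only: Z f_def mult.assoc)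
    finally show ?thesis using ex_minus(2)[OF Z(1)] by simp
  qed
  have E: "app E v = f * v * f'" for v
    by (simp add: E_def app_ex_ad x y f_def f'_def mult.assoc)
  have EZ: "E = op.ex (ad Z)"
    by (rule endo_eqI) (simp only: E app_ex_ad[OF Z(1)] f' Z(2) f_def)
  have E1: "E - 1 = op.ser (fps_exp 1 - 1) (ad Z)"
    unfolding EZ by (rule op.ex_minus_1[OF nil_ad[OF Z(1)]])
  show "nil (E - 1)" unfolding E1 by (rule op.nil_ser) (simp_all add: nil_ad Z)
  define W where "W = app (op.ser dexp (ad Z)) (\<delta> Z)"
  have "W * f = \<delta> f" using \<delta>_ex[OF Z(1)] by (simp add: W_def f_def Z)
  also have "\<dots> = x * f + f * y"
    using ser_commute[of y y "fps_exp 1", folded ex_def]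
    by (simp add: f_def \<delta>_mult \<delta>_eigen_ex x y mult.assoc)
  finally have "W * f * f' = x * (f * f') + f * y * f'" by (simp add: distrib_right mult.assoc)
  then have W: "W = x + app E y" by (simp add: ff' mult.assoc E)
  have "app (op.ser dlog (E - 1)) W
    = app (op.ser (dlog oo (fps_exp 1 - 1)) (ad Z) * op.ser dexp (ad Z)) (\<delta> Z)"
    by (simp add: E1 W_def op.ser_compose nil_ad Z)
  also have "\<dots> = \<delta> Z"
    by (simp add: op.ser_mult[symmetric] dlog_dexp op.ser_1 nil_ad Z)
  finally show "\<delta> Z = app (op.ser dlog (E - 1)) (x + app E y)" by (simp add: W)
qed

end

section \<open>Dynkin's formula in a ring with a derivation\<close>

primrec nested_commutator :: "'r::unital_ring list \<Rightarrow> 'r" where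
  "nested_commutator [] = 0"
| "nested_commutator (x # xs) = (if xs = [] then x else app (ad x) (nested_commutator xs))"

definition blocks :: "'b \<Rightarrow> 'b \<Rightarrow> (nat \<times> nat) list \<Rightarrow> 'b list" where
  "blocks x y rs = concat (map (\<lambda>(r, s). replicate r x @ replicate s y) rs)"

lemma blocks_Nil [simp]: "blocks x y [] = []"
  and blocks_Cons [simp]: "blocks x y ((r, s) # rs) = replicate r x @ replicate s y @ blocks x y rs"
  by (simp_all add: blocks_def)

lemma nested_commutator_append:
  "ws \<noteq> [] \<Longrightarrow> nested_commutator (replicate r x @ ws) = app (ad x ^ r) (nested_commutator ws)"
  by (induct r) auto

definition total :: "(nat \<times> nat) list \<Rightarrow> nat" where "total rs = (\<Sum>(r, s)\<leftarrow>rs. r + s)"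

lemma total_Nil [simp]: "total [] = 0" and total_Cons [simp]: "total ((r, s) # rs) = r + s + total rs"
  by (simp_all add: total_def)

lemma length_blocks: "length (blocks x y rs) = total rs"
  by (induct rs) auto

definition dynkin_index :: "nat \<Rightarrow> nat \<Rightarrow> (nat \<times> nat) list set" where
  "dynkin_index k m = {rs. length rs = k \<and> (\<forall>(r, s)\<in>set rs. 0 < r + s) \<and> (\<Sum>(r, s)\<leftarrow>rs. r + s) = m}"

definition block_fact :: "(nat \<times> nat) list \<Rightarrow> 'a::field_char_0" where
  "block_fact rs = (\<Prod>(r, s)\<leftarrow>rs. fact r * fact s)"

lemma block_fact_Cons: "block_fact ((r, s) # rs) = fact r * fact s * block_fact rs"
  by (simp add: block_fact_def)

lemma total_bounds: "(r, s) \<in> set rs \<Longrightarrow> r + s \<le> total rs"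
  by (induct rs) auto

lemma length_le_total: "(\<forall>(r, s)\<in>set rs. 0 < r + s) \<Longrightarrow> length rs \<le> total rs"
  by (induct rs) auto

text \<open>Exponents bounded by \<open>K\<close>: products of exponential series truncated at \<open>K\<close> are sums over
  these finite index sets, and terms outside the index sets of Dynkin's formula will vanish.\<close>

definition boxed :: "nat \<Rightarrow> nat \<Rightarrow> (nat \<times> nat) list set" where
  "boxed K k = {rs. set rs \<subseteq> {..K} \<times> {..K} - {(0, 0)} \<and> length rs = k}"

lemma finite_boxed: "finite (boxed K k)"
  unfolding boxed_def by (rule finite_lists_length_eq) simp

lemma boxed_Suc: "boxed K (Suc k) = (\<lambda>(rs, p). p # rs) ` (boxed K k \<times> ({..K} \<times> {..K} - {(0, 0)}))"
  unfolding boxed_def by (rule lists_length_Suc_eq)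

lemma dynkin_index_boxed: "m \<le> K \<Longrightarrow> dynkin_index k m \<subseteq> boxed K k"
proof
  fix rs assume m: "m \<le> K" and rs: "rs \<in> dynkin_index k m"
  then have "total rs = m" by (simp add: dynkin_index_def total_def)
  then have "r \<le> K" "s \<le> K" "(r, s) \<noteq> (0, 0)" if "(r, s) \<in> set rs" for r s
    using total_bounds[OF that] m rs that by (auto simp: dynkin_index_def)
  then show "rs \<in> boxed K k"
    using rs by (auto simp: boxed_def dynkin_index_def)
qed

lemma dynkin_index_empty: "m < k \<Longrightarrow> dynkin_index k m = {}"
  unfolding dynkin_index_def using length_le_total by (force simp: total_def[symmetric])

context rational_ring
begin

text \<open>The Campbell-Hausdorff series in Dynkin's form, up to degree \<open>n\<close>.\<close>

definition dynkin :: "nat \<Rightarrow> 'r \<Rightarrow> 'r \<Rightarrow> 'r" where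
  "dynkin n x y = (\<Sum>m = 1..n. \<Sum>k = 1..m. \<Sum>rs\<in>dynkin_index k m.
     q ((- 1) ^ (k - 1) / (of_nat k * of_nat m * block_fact rs)) * nested_commutator (blocks x y rs))"

end

text \<open>The derivation plays the role of \<open>t d/dt\<close> and the filtration that of the order in \<open>t\<close>,
  in a setting in which everything of order larger than \<open>n\<close> vanishes.\<close>

locale filtered_derivation_ring = derivation_ring q \<delta> for q :: "rat \<Rightarrow> 'r::unital_ring" and \<delta> +
  fixes fil :: "nat \<Rightarrow> 'r set" and n :: nat
  assumes fil_add: "a \<in> fil k \<Longrightarrow> b \<in> fil k \<Longrightarrow> a + b \<in> fil k"
    and fil_scale: "a \<in> fil k \<Longrightarrow> q r * a \<in> fil k"
    and fil_0: "0 \<in> fil k"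
    and fil_mult: "a \<in> fil i \<Longrightarrow> b \<in> fil j \<Longrightarrow> a * b \<in> fil (i + j)"
    and fil_anti: "i \<le> j \<Longrightarrow> fil j \<subseteq> fil i"
    and fil_zero: "a \<in> fil (Suc n) \<Longrightarrow> a = 0"
    and \<delta>_kernel: "a \<in> fil 1 \<Longrightarrow> \<delta> a = 0 \<Longrightarrow> a = 0"
begin

interpretation op: rational_ring "\<lambda>r. Lm (q r)"
  by (rule rational_ring_Lm)

lemma fil_diff: "a \<in> fil k \<Longrightarrow> b \<in> fil k \<Longrightarrow> a - b \<in> fil k"
  using fil_add[of a k "q (- 1) * b"] fil_scale[of b k "- 1"] by (simp add: q_minus)

lemma fil_sum: "(\<And>i. i \<in> I \<Longrightarrow> f i \<in> fil k) \<Longrightarrow> (\<Sum>i\<in>I. f i) \<in> fil k"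
  by (induct I rule: infinite_finite_induct) (auto simp: fil_0 fil_add)

lemma fil_power: "a \<in> fil 1 \<Longrightarrow> a ^ Suc k \<in> fil (Suc k)"
proof (induct k)
  case (Suc k)
  then show ?case using fil_mult[of a 1 "a ^ Suc k" "Suc k"] by simp
qed simp

lemma fil_nil: "a \<in> fil 1 \<Longrightarrow> nil a"
  unfolding nil_def using fil_zero[OF fil_power] by blast

lemma fil_ser: assumes "a \<in> fil 1" "c $ 0 = 0" shows "ser c a \<in> fil 1"
  unfolding ser_def
proof (rule fil_sum)
  fix k show "q (c $ k) * a ^ k \<in> fil 1"
    using fil_power[OF assms(1)] fil_anti[of 1 k] assms(2) by (cases k) (auto simp: fil_0 intro!: fil_scale)
qed

lemma fil_nested: "set ws \<subseteq> fil 1 \<Longrightarrow> ws \<noteq> [] \<Longrightarrow> nested_commutator ws \<in> fil (length ws)"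
proof (induct ws)
  case (Cons w ws)
  show ?case
  proof (cases "ws = []")
    case False
    then have "nested_commutator ws \<in> fil (length ws)" using Cons by auto
    then show ?thesis
      using False Cons(2) fil_mult[of w 1 _ "length ws"] fil_mult[of _ "length ws" w 1]
      by (auto intro!: fil_diff)
  qed (use Cons in auto)
qed simp

lemma \<delta>_nested:
  "(\<And>w. w \<in> set ws \<Longrightarrow> \<delta> w = w) \<Longrightarrow>
    \<delta> (nested_commutator ws) = q (of_nat (length ws)) * nested_commutator ws"
proof (induct ws)
  case (Cons w ws)
  show ?case
  proof (cases "ws = []")
    case False
    then have w: "\<delta> w = w" and ws: "\<delta> (nested_commutator ws) = q (of_nat (length ws)) * nested_commutator ws"
      using Cons by auto
    show ?thesis using False
      by (simp add: \<delta>_minus \<delta>_mult w ws q_add mult.assoc q_left[of w] algebra_simps)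
  qed (use Cons in auto)
qed simp

lemma blocks_set: "set (blocks x y rs) \<subseteq> {x, y}"
  by (induct rs) auto

text \<open>A nested commutator ends in a commutator of equal letters, and vanishes, unless its last
  block is \<open>x\<close> or \<open>x\<dots>x y\<close>. The blocks \<open>x\<dots>x y\<close> sum up to \<open>exp (ad x) y\<close>, and \<open>exp (ad y)\<close>
  fixes \<open>y\<close>.\<close>

lemma sum_last_block:
  assumes x: "nil x" and y: "nil y" and K: "ad x ^ Suc K = 0" "ad y ^ Suc K = 0" "K \<ge> 1"
  shows "(\<Sum>p\<in>{..K} \<times> {..K} - {(0, 0)}. q (1 / block_fact [p]) * nested_commutator (blocks x y [p]))
    = x + app (op.ex (ad x) * op.ex (ad y)) y"
proof -
  define t where "t = (\<lambda>p. q (1 / block_fact [p]) * nested_commutator (blocks x y [p]))"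
  have t1: "t (r, 1) = app (Lm (q (1 / fact r)) * ad x ^ r) y" for r
    by (simp add: t_def block_fact_def nested_commutator_append)
  have t0: "t (1, 0) = x" by (simp add: t_def block_fact_def)
  have nc0: "nested_commutator (replicate (Suc (Suc r)) w) = 0" for r and w :: 'r
    using nested_commutator_append[of "[w]" "Suc r" w]
    by (simp add: replicate_append_same power_Suc2 del: power_Suc)
  have t_zero: "t (r, s) = 0" if nz: "(r, s) \<noteq> (0, 0)" "(r, s) \<noteq> (1, 0)" "s \<noteq> 1" for r s
  proof (cases "s = 0")
    case True
    then obtain r' where "r = Suc (Suc r')" using nz by (cases r; cases "r - 1") auto
    then show ?thesis using nc0[of r' x] True by (simp add: t_def)
  next
    case False
    then obtain s' where "s = Suc (Suc s')" using nz by (cases s; cases "s - 1") auto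
    then show ?thesis
      using nc0[of s' y] nested_commutator_append[of "replicate s y" r x] by (simp add: t_def)
  qed
  have "(\<Sum>p\<in>{..K} \<times> {..K} - {(0, 0)}. t p) = (\<Sum>p\<in>insert (1, 0) ({..K} \<times> {1}). t p)"
  proof (rule sum.mono_neutral_right)
    show "\<forall>p\<in>{..K} \<times> {..K} - {(0, 0)} - insert (1, 0) ({..K} \<times> {1}). t p = 0"
    proof
      fix p assume "p \<in> {..K} \<times> {..K} - {(0, 0)} - insert (1, 0) ({..K} \<times> {1})"
      then show "t p = 0" by (cases p) (auto intro!: t_zero simp del: One_nat_def)
    qed
  qed (use K(3) in auto)
  also have "\<dots> = x + (\<Sum>r\<le>K. t (r, 1))"
  proof -
    have "sum t ({..K} \<times> {1}) = (\<Sum>r\<le>K. t (r, 1))"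
      by (rule sum.reindex_bij_witness[of _ "\<lambda>r. (r, 1)" fst]) auto
    then show ?thesis by (subst sum.insert) (auto simp: t0 simp del: One_nat_def)
  qed
  also have "(\<Sum>r\<le>K. t (r, 1)) = app (op.ex (ad x)) y"
    unfolding op.ex_eq[OF K(1)] lessThan_Suc_atMost sum_app t1 ..
  also have "app (op.ex (ad x)) y = app (op.ex (ad x) * op.ex (ad y)) y"
    using ser_app_kernel[OF nil_ad[OF y], of y "fps_exp 1"] by (simp add: op.ex_def)
  finally show ?thesis by (simp add: t_def)
qed

text \<open>Each factor \<open>E - 1\<close> prepends one nonempty block \<open>x\<^sup>r y\<^sup>s\<close> to the nested commutators.\<close>

lemma sum_blocks:
  assumes x: "nil x" and y: "nil y" and K: "ad x ^ Suc K = 0" "ad y ^ Suc K = 0" "K \<ge> 1"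
  defines "E \<equiv> op.ex (ad x) * op.ex (ad y)"
  shows "app ((E - 1) ^ k) (x + app E y)
    = (\<Sum>rs\<in>boxed K (Suc k). q (1 / block_fact rs) * nested_commutator (blocks x y rs))"
proof (induct k)
  let ?B = "{..K} \<times> {..K} - {(0::nat, 0::nat)}"
  let ?T = "\<lambda>rs. q (1 / block_fact rs) * nested_commutator (blocks x y rs)"
  have split: "(\<Sum>rs\<in>boxed K (Suc k). ?T rs) = (\<Sum>rs\<in>boxed K k. \<Sum>p\<in>?B. ?T (p # rs))" for k
    unfolding boxed_Suc
    by (subst sum.reindex) (auto simp: inj_on_def sum.cartesian_product intro!: sum.cong)
  {
    case 0
    have "boxed K 0 = {[]}" by (auto simp: boxed_def)
    then show ?case
      using sum_last_block[OF x y K] by (simp add: split E_def)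
  next
    case (Suc k)
    have E1: "E - 1 = (\<Sum>(r, s)\<in>?B. Lm (q (1 / (fact r * fact s))) * (ad x ^ r * ad y ^ s))"
    proof -
      have "E = (\<Sum>r\<le>K. \<Sum>s\<le>K. (Lm (q (1 / fact r)) * ad x ^ r) * (Lm (q (1 / fact s)) * ad y ^ s))"
        by (simp add: E_def op.ex_eq[OF K(1)] op.ex_eq[OF K(2)] lessThan_Suc_atMost sum_product
            del: sum.atMost_Suc sum.lessThan_Suc)
      also have "\<dots> = (\<Sum>(r, s)\<in>{..K} \<times> {..K}. Lm (q (1 / (fact r * fact s))) * (ad x ^ r * ad y ^ s))"
        unfolding sum.cartesian_product
      proof (rule sum.cong[OF HOL.refl], clarify)
        fix r s
        have "Lm (q (1 / (fact r * fact s))) = Lm (q (1 / fact r)) * Lm (q (1 / fact s))"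
          using op.q_mult[of "1 / fact r" "1 / fact s"] by simp
        then show "(Lm (q (1 / fact r)) * ad x ^ r) * (Lm (q (1 / fact s)) * ad y ^ s)
          = Lm (q (1 / (fact r * fact s))) * (ad x ^ r * ad y ^ s)"
          by (simp add: mult.assoc op.q_left[of "ad x ^ r"])
      qed
      also have "\<dots> = 1 + (\<Sum>(r, s)\<in>?B. Lm (q (1 / (fact r * fact s))) * (ad x ^ r * ad y ^ s))"
        by (subst sum.remove[of _ "(0, 0)"]) (auto intro!: endo_eqI)
      finally show ?thesis by simp
    qed
    have step: "app (Lm (q (1 / (fact r * fact s))) * (ad x ^ r * ad y ^ s)) (?T rs) = ?T ((r, s) # rs)"
      if rs: "rs \<in> boxed K (Suc k)" for r s rs
    proof -
      have "blocks x y rs \<noteq> []"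
        using rs by (cases rs) (auto simp: boxed_def)
      then have nc: "nested_commutator (blocks x y ((r, s) # rs))
          = app (ad x ^ r * ad y ^ s) (nested_commutator (blocks x y rs))"
        by (simp add: nested_commutator_append)
      have c: "app (ad x ^ r * ad y ^ s) (q c * v) = q c * app (ad x ^ r * ad y ^ s) v" for c v
        using arg_cong[OF op.q_central[of c "ad x ^ r * ad y ^ s"], of "\<lambda>A. app A v"] by simp
      show ?thesis
        unfolding nc block_fact_Cons app_times[of "Lm _"] c
        by (simp add: q_mult[symmetric] flip: mult.assoc)
    qed
    have "app (E - 1) (?T rs) = (\<Sum>p\<in>?B. ?T (p # rs))" if rs: "rs \<in> boxed K (Suc k)" for rs
      unfolding E1 sum_app
    proof (rule sum.cong[OF HOL.refl])
      fix p assume "p \<in> ?B"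
      show "app (case p of (r, s) \<Rightarrow> Lm (q (1 / (fact r * fact s))) * (ad x ^ r * ad y ^ s)) (?T rs)
        = ?T (p # rs)"
        by (cases p) (simp only: case_prod_conv step[OF rs])
    qed
    then show ?case
      unfolding power_Suc app_times Suc split[of "Suc k"] app_sum
      by (intro sum.cong HOL.refl)
  }
qed

lemma dynkin_fil:
  assumes "x \<in> fil 1" "y \<in> fil 1"
  shows "dynkin n' x y \<in> fil 1"
    unfolding dynkin_def
  proof (intro fil_sum fil_scale)
    fix m k rs assume "m \<in> {1..n'}" "rs \<in> dynkin_index k m"
    then have "length (blocks x y rs) \<ge> 1"
      by (simp add: length_blocks dynkin_index_def total_def)
    then show "nested_commutator (blocks x y rs) \<in> fil 1"
      using fil_nested[of "blocks x y rs"] blocks_set[of x y rs] assms fil_anti[of 1 "length (blocks x y rs)"]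
      by (cases "blocks x y rs = []") auto
  qed

text \<open>The two sides have logarithms with the same image under \<open>\<delta>\<close>: for the left side this is
  the series of nested commutators found above, and on the right side \<open>\<delta>\<close> multiplies a nested
  commutator of length \<open>m\<close> by \<open>m\<close>, which cancels the factor \<open>1/m\<close> in Dynkin's formula.\<close>

theorem ex_dynkin:
  assumes x: "x \<in> fil 1" "\<delta> x = x" and y: "y \<in> fil 1" "\<delta> y = y"
  shows "ex x * ex y = ex (dynkin n x y)"
proof -
  define T where "T = (\<lambda>rs. q (1 / block_fact rs) * nested_commutator (blocks x y rs))"
  define c where "c = (\<lambda>k. (- 1) ^ (k - 1) / of_nat k :: rat)"
  have nx: "nil x" and ny: "nil y" using x y by (auto intro: fil_nil)
  have "ex x - 1 \<in> fil 1" "ex y - 1 \<in> fil 1"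
    unfolding ex_minus_1[OF nx] ex_minus_1[OF ny] using x y by (simp_all add: fil_ser del: One_nat_def)
  moreover from this have "(ex x - 1) * (ex y - 1) \<in> fil 1"
    using fil_mult[of "ex x - 1" 1 "ex y - 1" 1] fil_anti[of 1 2] by (auto simp: numeral_2_eq_2)
  moreover have "ex x * ex y - 1 = (ex x - 1) * (ex y - 1) + ((ex x - 1) + (ex y - 1))"
    by (simp add: algebra_simps)
  ultimately have f: "ex x * ex y - 1 \<in> fil 1" by (metis fil_add)
  define Z where "Z = lg (ex x * ex y)"
  have Z: "Z \<in> fil 1" unfolding Z_def lg_def using f by (rule fil_ser) simp
  have eZ: "ex Z = ex x * ex y" unfolding Z_def using f by (intro ex_lg fil_nil)
  define E where "E = op.ex (ad x) * op.ex (ad y)"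
  have \<delta>Z: "\<delta> Z = app (op.ser dlog (E - 1)) (x + app E y)" and nE: "nil (E - 1)"
    unfolding E_def
    by (rule \<delta>_log_product[OF nx x(2) ny y(2) fil_nil[OF Z] eZ])+
  obtain K1 K2 K3 where "ad x ^ K1 = 0" "ad y ^ K2 = 0" "(E - 1) ^ K3 = 0"
    using nil_ad[OF nx] nil_ad[OF ny] nE unfolding nil_def by auto
  \<comment> \<open>one bound beyond which all series involved and all indices of total degree at most \<open>n\<close> are exhausted\<close>
  define K where "K = n + K1 + K2 + K3 + 1"
  have K: "ad x ^ Suc K = 0" "ad y ^ Suc K = 0" "K \<ge> 1" "K \<ge> n" and EK: "(E - 1) ^ K = 0"
    using power_eq_0_mono[OF \<open>ad x ^ K1 = 0\<close>, of "Suc K"] power_eq_0_mono[OF \<open>ad y ^ K2 = 0\<close>, of "Suc K"]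
      power_eq_0_mono[OF \<open>(E - 1) ^ K3 = 0\<close>, of K]
    by (auto simp: K_def simp del: power_Suc)
  have T0: "T rs = 0" if "total rs > n" for rs
  proof -
    have "nested_commutator (blocks x y rs) \<in> fil (total rs)"
      using fil_nested[of "blocks x y rs"] blocks_set[of x y rs] that x y length_blocks[of x y rs]
      by force
    then have "nested_commutator (blocks x y rs) = 0"
      using that fil_anti[of "Suc n" "total rs"] fil_zero by auto
    then show ?thesis by (simp add: T_def)
  qed
  have boxed_eq: "(\<Sum>rs\<in>boxed K k. T rs) = (\<Sum>m = 1..n. \<Sum>rs\<in>dynkin_index k m. T rs)"
    if k: "k \<ge> 1" for k
  proof -
    have "(\<Sum>m = 1..n. \<Sum>rs\<in>dynkin_index k m. T rs) = (\<Sum>rs\<in>(\<Union>m\<in>{1..n}. dynkin_index k m). T rs)"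
    proof (rule sum.UNION_disjoint[symmetric])
      show "\<forall>m\<in>{1..n}. finite (dynkin_index k m)"
        using K(4) by (meson atLeastAtMost_iff dynkin_index_boxed finite_boxed finite_subset le_trans)
    qed (auto simp: dynkin_index_def)
    also have "\<dots> = (\<Sum>rs\<in>boxed K k. T rs)"
    proof (rule sum.mono_neutral_left[OF finite_boxed])
      show "(\<Union>m\<in>{1..n}. dynkin_index k m) \<subseteq> boxed K k"
        using K(4) dynkin_index_boxed by (metis (no_types, lifting) UN_least atLeastAtMost_iff le_trans)
      show "\<forall>rs\<in>boxed K k - (\<Union>m\<in>{1..n}. dynkin_index k m). T rs = 0"
      proof
        fix rs assume rs: "rs \<in> boxed K k - (\<Union>m\<in>{1..n}. dynkin_index k m)"
        then have pos: "\<forall>(r, s)\<in>set rs. 0 < r + s" and len: "length rs = k"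
          by (auto simp: boxed_def)
        have "rs \<in> dynkin_index k (total rs)"
          using pos len by (auto simp: dynkin_index_def total_def)
        moreover have "total rs \<ge> 1" using length_le_total[OF pos] len k by simp
        ultimately have "total rs > n" using rs by (auto simp: not_le[symmetric])
        then show "T rs = 0" by (rule T0)
      qed
    qed
    finally show ?thesis by simp
  qed
  have "\<delta> Z = (\<Sum>k<K. q (c (Suc k)) * app ((E - 1) ^ k) (x + app E y))"
    unfolding \<delta>Z op.ser_eq[OF EK] sum_app by (simp add: dlog_def c_def del: app_add)
  also have "\<dots> = (\<Sum>k<K. q (c (Suc k)) * (\<Sum>rs\<in>boxed K (Suc k). T rs))"
    unfolding E_def T_def sum_blocks[OF nx ny K(1-3)] ..
  also have "\<dots> = (\<Sum>k = 1..K. q (c k) * (\<Sum>rs\<in>boxed K k. T rs))"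
    by (simp only: One_nat_def sum.atLeast1_atMost_eq)
  also have "\<dots> = (\<Sum>k = 1..K. \<Sum>m = 1..n. q (c k) * (\<Sum>rs\<in>dynkin_index k m. T rs))"
    by (intro sum.cong HOL.refl) (simp add: boxed_eq sum_distrib_left)
  also have "\<dots> = (\<Sum>m = 1..n. \<Sum>k = 1..K. q (c k) * (\<Sum>rs\<in>dynkin_index k m. T rs))"
    by (rule sum.swap)
  also have "\<dots> = (\<Sum>m = 1..n. \<Sum>k = 1..m. q (c k) * (\<Sum>rs\<in>dynkin_index k m. T rs))"
    using K(4) by (intro sum.cong[OF HOL.refl] sum.mono_neutral_right) (auto simp: dynkin_index_empty)
  also have "\<dots> = \<delta> (dynkin n x y)"
    unfolding dynkin_def \<delta>_sum \<delta>_scale sum_distrib_left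
  proof (intro sum.cong HOL.refl)
    fix m k rs assume m: "m \<in> {1..n}" and "rs \<in> dynkin_index k m"
    then have "length (blocks x y rs) = m"
      by (simp add: length_blocks dynkin_index_def total_def)
    then have "\<delta> (nested_commutator (blocks x y rs)) = q (of_nat m) * nested_commutator (blocks x y rs)"
      using \<delta>_nested[of "blocks x y rs"] blocks_set[of x y rs] x y by auto
    then show "q (c k) * T rs = q ((- 1) ^ (k - 1) / (of_nat k * of_nat m * block_fact rs))
        * \<delta> (nested_commutator (blocks x y rs))"
      using m by (simp add: T_def c_def q_mult[symmetric] flip: mult.assoc)
  qed
  finally have "\<delta> (Z - dynkin n x y) = 0" by (simp add: \<delta>_minus)
  moreover have "dynkin n x y \<in> fil 1" using x y by (intro dynkin_fil)
  ultimately have "Z = dynkin n x y"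
    using \<delta>_kernel[OF fil_diff[OF Z]] by simp
  then show ?thesis using eZ by simp
qed

end

section \<open>Dynkin's formula for endomorphisms that lower a filtration\<close>

definition coeffwise :: "'v::ab_group_add endo \<Rightarrow> 'v poly endo" where
  "coeffwise A = Endo (map_poly (app A))"

text \<open>Multiplication by \<open>t\<close> after the coefficientwise action, the operator \<open>t A\<close> on \<open>V[t]\<close>.\<close>

definition tmul :: "'v::ab_group_add endo \<Rightarrow> 'v poly endo" where
  "tmul A = Endo (\<lambda>p. pCons 0 (map_poly (app A) p))"

lemma coeff_coeffwise [simp]: "coeff (app (coeffwise A) p) i = app A (coeff p i)"
proof -
  have "app (coeffwise A) = map_poly (app A)"
    unfolding coeffwise_def by (rule app_Endo) (simp add: poly_eq_iff coeff_map_poly)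
  then show ?thesis by (simp add: coeff_map_poly)
qed

lemma app_tmul: "app (tmul A) p = pCons 0 (map_poly (app A) p)"
  unfolding tmul_def by (subst app_Endo) (simp_all add: poly_eq_iff coeff_map_poly coeff_pCons split: nat.split)

lemma coeff_tmul: "coeff (app (tmul A) p) i = (case i of 0 \<Rightarrow> 0 | Suc j \<Rightarrow> app A (coeff p j))"
  by (simp add: app_tmul coeff_pCons coeff_map_poly split: nat.split)

definition at_one :: "'v::ab_group_add poly \<Rightarrow> 'v" where
  "at_one p = (\<Sum>i\<le>degree p. coeff p i)"

lemma at_one_eq: "degree p \<le> N \<Longrightarrow> at_one p = (\<Sum>i\<le>N. coeff p i)"
  unfolding at_one_def by (rule sum.mono_neutral_left) (auto intro: coeff_eq_0)

lemma at_one_add: "at_one (p + p') = at_one p + at_one p'"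
proof -
  have "degree (p + p') \<le> max (degree p) (degree p')" by (rule degree_add_le_max)
  then show ?thesis
    by (simp add: at_one_eq[of _ "max (degree p) (degree p')"] sum.distrib)
qed

lemma at_one_diff: "at_one (p - p') = at_one p - at_one p'"
  using at_one_add[of "p - p'" p'] by simp

lemma at_one_0 [simp]: "at_one 0 = 0" by (simp add: at_one_def)

lemma at_one_const [simp]: "at_one [:v:] = v" by (simp add: at_one_def)

text \<open>The endomorphism \<open>D\<close> of \<open>V[t]\<close> induces \<open>A\<close> on \<open>V = V[t] / (t - 1)\<close>. This relation is
  compatible with sums, products and scalars and \<open>A\<close> is determined by \<open>D\<close>, so identities can be
  transported from \<open>V[t]\<close> to \<open>V\<close>.\<close>

definition specializes :: "'v::ab_group_add poly endo \<Rightarrow> 'v endo \<Rightarrow> bool" where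
  "specializes D A \<longleftrightarrow> (\<forall>p. at_one (app D p) = app A (at_one p))"

lemma specializes_unique: "specializes D A \<Longrightarrow> specializes D A' \<Longrightarrow> A = A'"
  unfolding specializes_def by (metis at_one_const endo_eqI)

lemma specializes_simps:
  "specializes 0 0" "specializes 1 1"
  "specializes D A \<Longrightarrow> specializes D' A' \<Longrightarrow> specializes (D + D') (A + A')"
  "specializes D A \<Longrightarrow> specializes D' A' \<Longrightarrow> specializes (D - D') (A - A')"
  "specializes D A \<Longrightarrow> specializes D' A' \<Longrightarrow> specializes (D * D') (A * A')"
  by (simp_all add: specializes_def at_one_add at_one_diff)

lemma specializes_power: "specializes D A \<Longrightarrow> specializes (D ^ k) (A ^ k)"
  by (induct k) (auto intro: specializes_simps)

lemma specializes_sum: "(\<And>i. i \<in> I \<Longrightarrow> specializes (f i) (g i)) \<Longrightarrow> specializes (sum f I) (sum g I)"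
  by (induct I rule: infinite_finite_induct) (auto intro: specializes_simps)

lemma specializes_coeffwise: "specializes (coeffwise A) A"
  unfolding specializes_def
proof
  fix p
  have "degree (app (coeffwise A) p) \<le> degree p"
    by (rule degree_le) (simp add: coeff_eq_0)
  then show "at_one (app (coeffwise A) p) = app A (at_one p)"
    by (simp add: at_one_eq[of _ "degree p"] app_sum)
qed

lemma specializes_tmul: "specializes (tmul A) A"
  unfolding specializes_def
proof
  fix p
  have "degree (app (tmul A) p) \<le> Suc (degree p)"
    by (rule degree_le) (auto simp: coeff_tmul coeff_eq_0 split: nat.split)
  then have "at_one (app (tmul A) p) = (\<Sum>i\<le>Suc (degree p). coeff (app (tmul A) p) i)"
    by (rule at_one_eq)
  also have "\<dots> = app A (at_one p)"
    by (subst sum.atMost_Suc_shift) (simp add: coeff_tmul at_one_def app_sum)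
  finally show "at_one (app (tmul A) p) = app A (at_one p)" .
qed

lemma specializes_nested:
  "list_all2 specializes Ds As \<Longrightarrow> specializes (nested_commutator Ds) (nested_commutator As)"
proof (induct rule: list_all2_induct)
  case (Cons D Ds A As)
  moreover have "Ds = [] \<longleftrightarrow> As = []" using Cons(2) by auto
  ultimately show ?case by (auto intro!: specializes_simps)
qed (simp add: specializes_simps)

lemma specializes_blocks:
  "specializes D A \<Longrightarrow> specializes D' A' \<Longrightarrow> list_all2 specializes (blocks D D' rs) (blocks A A' rs)"
proof (induct rs)
  case (Cons p rs)
  have "list_all2 specializes (replicate k B) (replicate k C)" if "specializes B C" for k B C
    using that by (simp add: list_all2_conv_all_nth)
  then show ?case using Cons by (cases p) (auto intro!: list_all2_appendI)
qed simp

locale filtered_module = rational_ring q for q :: "rat \<Rightarrow> 'v::ab_group_add endo" +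
  fixes F :: "nat \<Rightarrow> 'v set" and n :: nat
  assumes F_UNIV: "F 0 = UNIV"
    and F_add: "v \<in> F d \<Longrightarrow> w \<in> F d \<Longrightarrow> v + w \<in> F d"
    and F_zero: "0 \<in> F d"
    and F_scale: "v \<in> F d \<Longrightarrow> app (q r) v \<in> F d"
    and F_Suc: "F (Suc d) \<subseteq> F d"
    and F_last: "F (Suc n) \<subseteq> {0}"
begin

definition qt :: "rat \<Rightarrow> 'v poly endo" where "qt r = coeffwise (q r)"

text \<open>The operator \<open>t d/dt\<close>.\<close>

definition euler :: "'v poly endo" where
  "euler = Endo (\<lambda>p. Abs_poly (\<lambda>i. app (q (of_nat i)) (coeff p i)))"

lemma coeff_euler [simp]: "coeff (app euler p) i = app (q (of_nat i)) (coeff p i)"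
proof -
  have c: "coeff (Abs_poly (\<lambda>i. app (q (of_nat i)) (coeff p i))) = (\<lambda>i. app (q (of_nat i)) (coeff p i))" for p
    by (rule Abs_poly_inverse) (auto simp: MOST_nat coeff_eq_0 intro!: exI[of _ "degree p"])
  have "app euler = (\<lambda>p. Abs_poly (\<lambda>i. app (q (of_nat i)) (coeff p i)))"
    unfolding euler_def
  proof (rule app_Endo)
    fix x y
    show "Abs_poly (\<lambda>i. app (q (of_nat i)) (coeff (x + y) i))
      = Abs_poly (\<lambda>i. app (q (of_nat i)) (coeff x i)) + Abs_poly (\<lambda>i. app (q (of_nat i)) (coeff y i))"
      using c[of x] c[of y] c[of "x + y"] by (simp add: poly_eq_iff fun_eq_iff)
  qed
  then show ?thesis by (simp add: c)
qed

definition \<delta>t :: "'v poly endo \<Rightarrow> 'v poly endo" where "\<delta>t D = euler * D - D * euler"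

text \<open>Endomorphisms that raise both the order in \<open>t\<close> and the index of the filtration by
  \<open>k\<close>. The first condition makes the bracket with \<open>t d/dt\<close> injective on positive order, the second
  one makes the filtration finite.\<close>

definition filt :: "nat \<Rightarrow> 'v poly endo set" where
  "filt k = {D. \<forall>d i p. (\<forall>j<i. coeff p j = 0) \<and> (\<forall>j. coeff p j \<in> F d) \<longrightarrow>
     (\<forall>j<i + k. coeff (app D p) j = 0) \<and> (\<forall>j. coeff (app D p) j \<in> F (d + k))}"

lemma filtI:
  assumes "\<And>d i p. (\<forall>j<i. coeff p j = 0) \<and> (\<forall>j. coeff p j \<in> F d) \<Longrightarrow>
    (\<forall>j<i + k. coeff (app D p) j = 0) \<and> (\<forall>j. coeff (app D p) j \<in> F (d + k))"
  shows "D \<in> filt k"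
  using assms by (auto simp: filt_def)

lemma filtD:
  assumes "D \<in> filt k" "(\<forall>j<i. coeff p j = 0) \<and> (\<forall>j. coeff p j \<in> F d)"
  shows "(\<forall>j<i + k. coeff (app D p) j = 0) \<and> (\<forall>j. coeff (app D p) j \<in> F (d + k))"
  using assms unfolding filt_def by blast

lemma F_anti: "d \<le> e \<Longrightarrow> F e \<subseteq> F d"
  by (rule lift_Suc_antimono_le[of F]) (use F_Suc in auto)

lemma rational_ring_qt: "rational_ring qt"
  by standard (auto intro!: endo_eqI simp: qt_def poly_eq_iff q_add q_mult)

lemma qt_eq_0: assumes "app (q r) v = 0" "r \<noteq> 0" shows "v = 0"
proof -
  have "q (1 / r) * q r = 1" using assms(2) by (simp flip: q_mult)
  then show ?thesis using assms(1) by (metis app_0 app_one app_times)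
qed

text \<open>An endomorphism that commutes with \<open>t d/dt\<close> maps \<open>V t\<^sup>m\<close> to itself; if it also raises
  the order in \<open>t\<close>, it is zero.\<close>

lemma filtered_derivation_ring_filt: "filtered_derivation_ring qt \<delta>t filt n"
proof -
  interpret qt: rational_ring qt by (rule rational_ring_qt)
  show ?thesis
  proof
    fix a b :: "'v poly endo" and r :: rat
    show "\<delta>t (a + b) = \<delta>t a + \<delta>t b" by (simp add: \<delta>t_def algebra_simps)
    show "\<delta>t (a * b) = \<delta>t a * b + a * \<delta>t b" by (simp add: \<delta>t_def algebra_simps)
    show "\<delta>t (qt r) = 0" by (simp add: \<delta>t_def qt.q_central)
  next
    fix a b :: "'v poly endo" and k i j :: nat and r :: rat
    show "a + b \<in> filt k" if a: "a \<in> filt k" and b: "b \<in> filt k"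
    proof (rule filtI)
      fix d i p assume p: "(\<forall>j<i. coeff p j = 0) \<and> (\<forall>j. coeff p j \<in> F d)"
      show "(\<forall>j<i + k. coeff (app (a + b) p) j = 0) \<and> (\<forall>j. coeff (app (a + b) p) j \<in> F (d + k))"
        using filtD[OF a p] filtD[OF b p] by (simp add: F_add)
    qed
    show "qt r * a \<in> filt k" if a: "a \<in> filt k"
    proof (rule filtI)
      fix d i p assume p: "(\<forall>j<i. coeff p j = 0) \<and> (\<forall>j. coeff p j \<in> F d)"
      show "(\<forall>j<i + k. coeff (app (qt r * a) p) j = 0) \<and> (\<forall>j. coeff (app (qt r * a) p) j \<in> F (d + k))"
        using filtD[OF a p] by (simp add: F_scale qt_def)
    qed
    show "0 \<in> filt k" by (rule filtI) (simp add: F_zero)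
    show "filt j \<subseteq> filt i" if ij: "i \<le> j"
    proof (rule subsetI, rule filtI)
      fix D d l p assume D: "D \<in> filt j" and p: "(\<forall>j<l. coeff p j = 0) \<and> (\<forall>j. coeff p j \<in> F d)"
      show "(\<forall>j<l + i. coeff (app D p) j = 0) \<and> (\<forall>j. coeff (app D p) j \<in> F (d + i))"
        using filtD[OF D p] F_anti[of "d + i" "d + j"] ij by auto
    qed
    assume a: "a \<in> filt i" and b: "b \<in> filt j"
    show "a * b \<in> filt (i + j)"
    proof (rule filtI)
      fix d l p assume p: "(\<forall>j<l. coeff p j = 0) \<and> (\<forall>j. coeff p j \<in> F d)"
      note filtD[OF a filtD[OF b p]]
      then show "(\<forall>m<l + (i + j). coeff (app (a * b) p) m = 0) \<and>
          (\<forall>m. coeff (app (a * b) p) m \<in> F (d + (i + j)))"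
        by (simp add: ac_simps)
    qed
  next
    fix a assume a: "a \<in> filt (Suc n)"
    have "\<forall>m. coeff (app a p) m \<in> F (0 + Suc n)" for p
      using a F_UNIV unfolding filt_def by blast
    then have "coeff (app a p) m = 0" for p m
      using F_last by (metis add_0 singletonD subsetD)
    then show "a = 0" by (auto intro!: endo_eqI poly_eqI)
  next
    fix a assume a: "a \<in> filt 1" and \<delta>: "\<delta>t a = 0"
    have "app a (monom v m) = 0" for v m
    proof -
      have "app euler (monom v m) = app (qt (of_nat m)) (monom v m)"
        by (auto simp: poly_eq_iff qt_def)
      then have "app (a * euler) (monom v m) = app (a * qt (of_nat m)) (monom v m)" by simp
      then have "app (euler * a) (monom v m) = app (qt (of_nat m) * a) (monom v m)"
        using \<delta> by (simp add: \<delta>t_def qt.q_central)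
      then have "app (q (of_nat j)) (coeff (app a (monom v m)) j)
          = app (q (of_nat m)) (coeff (app a (monom v m)) j)" for j
        by (simp add: poly_eq_iff qt_def)
      then have "app (q (of_nat j - of_nat m)) (coeff (app a (monom v m)) j) = 0" for j
        by (simp add: q_diff)
      then have "coeff (app a (monom v m)) j = 0" if "j \<noteq> m" for j
        using qt_eq_0 that by (metis eq_iff_diff_eq_0 of_nat_eq_iff)
      moreover have "\<forall>j<m + 1. coeff (app a (monom v m)) j = 0"
      proof -
        have "(\<forall>j<m. coeff (monom v m) j = 0) \<and> (\<forall>j. coeff (monom v m) j \<in> F 0)"
          by (simp add: F_UNIV)
        then show ?thesis using a unfolding filt_def by blast
      qed
      ultimately show ?thesis by (metis coeff_0 less_add_one poly_eq_iff)
    qed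
    then have "app a p = 0" for p
      using app_sum[of a "\<lambda>i. monom (coeff p i) i" "{..degree p}"]
      by (simp add: poly_as_sum_of_monoms)
    then show "a = 0" by (auto intro!: endo_eqI)
  qed
qed

lemma tmul_filt:
  assumes "\<And>d v. v \<in> F d \<Longrightarrow> app X v \<in> F (Suc d)"
  shows "tmul X \<in> filt 1"
  using assms by (auto simp: filt_def coeff_tmul F_zero split: nat.split)

lemma \<delta>t_tmul: "\<delta>t (tmul X) = tmul X"
proof (rule endo_eqI, rule poly_eqI)
  fix p i
  have "app (q r) (app X v) = app X (app (q r) v)" for r v
    using arg_cong[OF q_central[of r X], of "\<lambda>A. app A v"] by simp
  then show "coeff (app (\<delta>t (tmul X)) p) i = coeff (app (tmul X) p) i"
    by (cases i) (simp_all add: \<delta>t_def coeff_tmul q_add)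
qed

text \<open>The formula holds for \<open>t X\<close> and \<open>t Y\<close>, which are fixed by the bracket with \<open>t d/dt\<close>.
  Setting \<open>t = 1\<close> gives the claim.\<close>

theorem ex_mult_ex:
  assumes X: "\<And>d v. v \<in> F d \<Longrightarrow> app X v \<in> F (Suc d)"
    and Y: "\<And>d v. v \<in> F d \<Longrightarrow> app Y v \<in> F (Suc d)"
  shows "ex X * ex Y = ex (dynkin n X Y)"
proof -
  interpret qt: filtered_derivation_ring qt \<delta>t filt n
    by (rule filtered_derivation_ring_filt)
  have ex: "specializes (qt.ex D) (ex A)" if "specializes D A" "nil D" for D A
  proof -
    obtain K where K: "D ^ K = 0" using \<open>nil D\<close> by (auto simp: nil_def)
    then have "A ^ K = 0"
      using specializes_power[OF that(1), of K] specializes_simps(1) specializes_unique by metis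
    then show ?thesis
      unfolding ex_eq[OF \<open>A ^ K = 0\<close>] qt.ex_eq[OF K] qt_def
      by (intro specializes_sum specializes_simps specializes_power that specializes_coeffwise)
  qed
  have *: "tmul X \<in> filt 1" "tmul Y \<in> filt 1" using X Y by (blast intro: tmul_filt)+
  have "qt.dynkin n (tmul X) (tmul Y) \<in> filt 1"
    using * by (rule qt.dynkin_fil)
  moreover have "specializes (qt.dynkin n (tmul X) (tmul Y)) (dynkin n X Y)"
    unfolding qt.dynkin_def dynkin_def unfolding qt_def
    by (intro specializes_sum specializes_simps(5) specializes_coeffwise specializes_nested
        specializes_blocks specializes_tmul)
  ultimately have "specializes (qt.ex (qt.dynkin n (tmul X) (tmul Y))) (ex (dynkin n X Y))"
    by (intro ex qt.fil_nil)
  moreover have "specializes (qt.ex (tmul X) * qt.ex (tmul Y)) (ex X * ex Y)"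
    using * by (intro specializes_simps ex specializes_tmul qt.fil_nil)
  ultimately show ?thesis
    using qt.ex_dynkin[OF *(1) \<delta>t_tmul *(2) \<delta>t_tmul] specializes_unique by metis
qed

end

section \<open>The Campbell-Hausdorff polynomials in a free Lie algebra\<close>

lemma free_lie_induct [case_names gen zero add scale br]:
  assumes "\<And>a. P (gen a)" "P 0" "\<And>x y. P x \<Longrightarrow> P y \<Longrightarrow> P (x + y)"
    "\<And>c x. P x \<Longrightarrow> P (lscale c x)" "\<And>x y. P x \<Longrightarrow> P y \<Longrightarrow> P (lbr x y)"
  shows "P (x :: 'a free_lie)"
proof (induct x)
  fix s :: "'a lie_term"
  show "P (abs_free_lie s)"
  proof (induct s)
    case (TGen a) then show ?case using assms(1)[of a] by (simp add: gen.abs_eq)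
  next
    case TZero then show ?case using assms(2) by (simp add: zero_free_lie_def)
  next
    case (TAdd s t) then show ?case using assms(3) by (metis plus_free_lie.abs_eq)
  next
    case (TScale c s) then show ?case using assms(4) by (metis lscale.abs_eq)
  next
    case (TBr s t) then show ?case using assms(5) by (metis lbr.abs_eq)
  qed
qed

lemma lscale_minus_one [simp]: "lscale (- 1) x = - x"
  using free_lie.scale_minus_left[of 1 x] by simp

lemma lbr_zero_left [simp]: "lbr 0 x = 0" using lbr_scale_left[of 0 0 x] by simp
lemma lbr_zero_right [simp]: "lbr x 0 = 0" using lbr_scale_right[of x 0 0] by simp

lemma lbr_swap: "lbr y x = - lbr x y"
proof -
  have "lbr (x + y) (x + y) = lbr x y + lbr y x"
    unfolding lbr_add_left lbr_add_right lbr_self[of x] lbr_self[of y] by (simp add: add.commute)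
  then show ?thesis by (simp add: lbr_self eq_neg_iff_add_eq_0 add.commute)
qed

lemma lbr_minus_left: "lbr (- x) y = - lbr x y"
  using lbr_scale_left[of "- 1" x y] by simp
lemma lbr_minus_right: "lbr x (- y) = - lbr x y"
  using lbr_scale_right[of x "- 1" y] by simp
lemma lbr_diff_left: "lbr (x - y) z = lbr x z - lbr y z"
  using lbr_add_left[of x "- y" z] by (simp add: lbr_minus_left)
lemma lbr_diff_right: "lbr z (x - y) = lbr z x - lbr z y"
  using lbr_add_right[of z x "- y"] by (simp add: lbr_minus_right)

lemma lie_hom_sum: "lie_hom f (\<Sum>i\<in>I. g i) = (\<Sum>i\<in>I. lie_hom f (g i))"
  by (induct I rule: infinite_finite_induct) auto

lemma lie_hom_diff: "lie_hom f (x - y) = lie_hom f x - lie_hom f y"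
  using lie_hom_add[of f "x - y" y] by (simp add: algebra_simps)

lemma lie_hom_comp: "lie_hom f (lie_hom h x) = lie_hom (\<lambda>a. lie_hom f (h a)) x"
  by (induct x rule: free_lie_induct) auto

lemma lie_hom_nested: "lie_hom f (nested_br ws) = nested_br (map (lie_hom f) ws)"
  by (induct ws) auto

lemma map_blocks: "map f (blocks x y rs) = blocks (f x) (f y) rs"
  by (induct rs) auto

lemma in_set_blocks: "set (blocks x y rs) \<subseteq> {x, y}"
  by (induct rs) auto

text \<open>The homogeneous part of degree \<open>m\<close> in \<open>x\<close> and \<open>y\<close>. Homogeneity makes
  \<open>bch (t x) (t y)\<close> a polynomial curve in \<open>t\<close>, whose first two coefficients enter the proof that an
  action of \<open>U\<^sub>n\<close> has a derivative.\<close>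

definition bch_term :: "nat \<Rightarrow> 'a free_lie \<Rightarrow> 'a free_lie \<Rightarrow> 'a free_lie" where
  "bch_term m x y = (\<Sum>k = 1..m. \<Sum>rs\<in>dynkin_index k m.
     lscale ((- 1) ^ (k - 1) / (of_nat k * of_nat m * block_fact rs)) (nested_br (blocks x y rs)))"

lemma bch_eq: "bch n x y = (\<Sum>m = 1..n. bch_term m x y)"
  by (simp add: bch_def bch_term_def dynkin_index_def block_fact_def blocks_def)

lemma lie_hom_bch: "lie_hom f (bch n x y) = bch n (lie_hom f x) (lie_hom f y)"
  by (simp add: bch_eq bch_term_def lie_hom_sum lie_hom_nested map_blocks)

lemma nested_br_scale: "nested_br (map (lscale t) ws) = lscale (t ^ length ws) (nested_br ws)"
  by (induct ws) (auto simp: lbr_scale_left lbr_scale_right mult_ac)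

lemma dynkin_index_length: "rs \<in> dynkin_index k m \<Longrightarrow> length (blocks x y rs) = m"
  by (simp add: length_blocks dynkin_index_def total_def)

lemma bch_term_scale: "bch_term m (lscale t x) (lscale t y) = lscale (t ^ m) (bch_term m x y)"
proof -
  have "nested_br (blocks (lscale t x) (lscale t y) rs) = lscale (t ^ m) (nested_br (blocks x y rs))"
    if "rs \<in> dynkin_index k m" for rs k
    using nested_br_scale[of t "blocks x y rs"] dynkin_index_length[OF that, of x y] by (simp add: map_blocks)
  then show ?thesis
    by (simp add: bch_term_def free_lie.scale_sum_right mult.commute)
qed

lemma dynkin_index_1_1: "dynkin_index 1 1 = {[(1, 0)], [(0, 1)]}"
proof -
  have "a = 1 \<and> b = 0 \<or> a = 0 \<and> b = 1" if "a + b = 1" for a b :: nat using that by arith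
  then show ?thesis by (fastforce simp: dynkin_index_def length_Suc_conv)
qed

lemma dynkin_index_1_2: "dynkin_index 1 2 = {[(2, 0)], [(1, 1)], [(0, 2)]}"
proof -
  have "a = 2 \<and> b = 0 \<or> a = 1 \<and> b = 1 \<or> a = 0 \<and> b = 2" if "a + b = 2" for a b :: nat
    using that by arith
  then show ?thesis by (fastforce simp: dynkin_index_def length_Suc_conv)
qed

lemma dynkin_index_2_2:
  "dynkin_index 2 2 = {[(1, 0), (1, 0)], [(1, 0), (0, 1)], [(0, 1), (1, 0)], [(0, 1), (0, 1)]}"
    (is "_ = ?R")
proof (rule Set.equalityI; rule subsetI)
  fix rs :: "(nat \<times> nat) list" assume rs: "rs \<in> dynkin_index 2 2"
  then obtain a b c d where *: "rs = [(a, b), (c, d)]"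
    by (auto simp: dynkin_index_def length_Suc_conv numeral_2_eq_2)
  have "0 < a + b" "0 < c + d" "a + b + (c + d) = 2"
    using rs by (auto simp: dynkin_index_def *)
  then have "(a = 1 \<and> b = 0 \<or> a = 0 \<and> b = 1) \<and> (c = 1 \<and> d = 0 \<or> c = 0 \<and> d = 1)" by arith
  then show "rs \<in> ?R" by (auto simp: *)
qed (auto simp: dynkin_index_def)

lemma bch_term_1: "bch_term 1 x y = x + y"
  unfolding bch_term_def by (simp add: dynkin_index_1_1[simplified] block_fact_def)

lemma bch_term_2: "bch_term 2 x y = lscale (1 / 2) (lbr x y)"
proof -
  have "{1..2} = {1, 2::nat}" by auto
  moreover have "nested_br (replicate 2 w) = 0" for w :: "'a free_lie"
    by (simp add: numeral_2_eq_2 lbr_self)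
  ultimately show ?thesis
    unfolding bch_term_def
    by (simp add: dynkin_index_1_2[simplified] dynkin_index_2_2[simplified] block_fact_def lbr_self
        numeral_2_eq_2[symmetric] lbr_swap[of y x])
qed

lemma nested_br_multiples:
  assumes "set ws \<subseteq> range (\<lambda>c. lscale c x)"
  shows "nested_br ws \<in> range (\<lambda>c. lscale c x)" and "length ws \<ge> 2 \<Longrightarrow> nested_br ws = 0"
proof -
  have "nested_br ws \<in> range (\<lambda>c. lscale c x) \<and> (length ws \<ge> 2 \<longrightarrow> nested_br ws = 0)"
    using assms
  proof (induct ws)
    case Nil
    show ?case by (auto intro!: range_eqI[of _ _ 0])
  next
    case (Cons w ws)
    then obtain a b where "w = lscale a x" "nested_br ws = lscale b x" by auto
    then have "lbr w (nested_br ws) = 0" by (simp add: lbr_scale_left lbr_scale_right lbr_self)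
    then show ?case using Cons by (cases ws) (auto intro!: range_eqI[of _ _ 0])
  qed
  then show "nested_br ws \<in> range (\<lambda>c. lscale c x)" "length ws \<ge> 2 \<Longrightarrow> nested_br ws = 0" by auto
qed

text \<open>All brackets of multiples of one element vanish, so \<open>t \<mapsto> t x\<close> is a one-parameter
  subgroup.\<close>

lemma bch_line:
  assumes "n \<ge> 1"
  shows "bch n (lscale a x) (lscale b x) = lscale (a + b) x"
proof -
  have "bch_term m (lscale a x) (lscale b x) = 0" if "m \<ge> 2" for m
    unfolding bch_term_def
  proof (intro sum.neutral ballI)
    fix k rs assume "rs \<in> dynkin_index k m"
    then have "length (blocks (lscale a x) (lscale b x) rs) \<ge> 2"
      using that by (simp add: dynkin_index_length)
    then have "nested_br (blocks (lscale a x) (lscale b x) rs) = 0"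
      using in_set_blocks[of "lscale a x" "lscale b x" rs] by (intro nested_br_multiples(2)[of _ x]) auto
    then show "lscale ((- 1) ^ (k - 1) / (of_nat k * of_nat m * block_fact rs))
        (nested_br (blocks (lscale a x) (lscale b x) rs)) = 0" by simp
  qed
  then have "bch n (lscale a x) (lscale b x) = (\<Sum>m\<in>{1}. bch_term m (lscale a x) (lscale b x))"
    unfolding bch_eq using assms by (intro sum.mono_neutral_right) auto
  then show ?thesis by (simp only: sum.insert bch_term_1 free_lie.scale_left_distrib) (simp add: bch_term_1[simplified] free_lie.scale_left_distrib)
qed

section \<open>The nilpotent Lie algebras and their pro-unipotent group\<close>

lemma Ln_0: "0 \<in> Ln n" by (simp add: Ln_def lie_subalgebra.zero)
lemma Ln_add: "x \<in> Ln n \<Longrightarrow> y \<in> Ln n \<Longrightarrow> x + y \<in> Ln n" by (simp add: Ln_def lie_subalgebra.add)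
lemma Ln_scale: "x \<in> Ln n \<Longrightarrow> lscale c x \<in> Ln n" by (simp add: Ln_def lie_subalgebra.scale)
lemma Ln_br: "x \<in> Ln n \<Longrightarrow> y \<in> Ln n \<Longrightarrow> lbr x y \<in> Ln n" by (simp add: Ln_def lie_subalgebra.br)
lemma Ln_gen: "ij \<in> Ln_gens n \<Longrightarrow> gen ij \<in> Ln n" by (simp add: Ln_def lie_subalgebra.base)
lemma Ln_sum: "(\<And>i. i \<in> I \<Longrightarrow> f i \<in> Ln n) \<Longrightarrow> sum f I \<in> Ln n"
  by (induct I rule: infinite_finite_induct) (auto simp: Ln_0 Ln_add)
lemma Ln_nested: "set ws \<subseteq> Ln n \<Longrightarrow> nested_br ws \<in> Ln n"
  by (induct ws) (auto simp: Ln_0 Ln_br)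

lemma Ln_bch_term: "x \<in> Ln n \<Longrightarrow> y \<in> Ln n \<Longrightarrow> bch_term m x y \<in> Ln n"
  unfolding bch_term_def
  by (intro Ln_sum Ln_scale Ln_nested) (use in_set_blocks[of x y] in auto)

lemma Ln_bch: "x \<in> Ln n \<Longrightarrow> y \<in> Ln n \<Longrightarrow> bch m x y \<in> Ln n"
  unfolding bch_eq by (intro Ln_sum Ln_bch_term)

lemma In_0: "0 \<in> In_ideal n" by (simp add: In_ideal_def lie_ideal.zero)
lemma In_add: "x \<in> In_ideal n \<Longrightarrow> y \<in> In_ideal n \<Longrightarrow> x + y \<in> In_ideal n"
  by (simp add: In_ideal_def lie_ideal.add)
lemma In_scale: "x \<in> In_ideal n \<Longrightarrow> lscale c x \<in> In_ideal n"
  by (simp add: In_ideal_def lie_ideal.scale)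
lemma In_minus: "x \<in> In_ideal n \<Longrightarrow> - x \<in> In_ideal n"
  using In_scale[of x n "- 1"] by simp
lemma In_sum: "(\<And>i. i \<in> I \<Longrightarrow> f i \<in> In_ideal n) \<Longrightarrow> sum f I \<in> In_ideal n"
  by (induct I rule: infinite_finite_induct) (auto simp: In_0 In_add)
lemma In_br: "x \<in> Ln n \<Longrightarrow> y \<in> In_ideal n \<Longrightarrow> lbr x y \<in> In_ideal n"
  by (simp add: In_ideal_def lie_ideal.br)
lemma In_br': "x \<in> Ln n \<Longrightarrow> y \<in> In_ideal n \<Longrightarrow> lbr y x \<in> In_ideal n"
  using In_minus[OF In_br, of x n y] by (simp add: lbr_swap[of y x])
lemma In_homog: "Ln_homog n d x \<Longrightarrow> n < d \<Longrightarrow> x \<in> In_ideal n"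
  unfolding In_ideal_def by (rule lie_ideal.base) (auto simp: Ln_deg_def)

lemma un_rel_iff: "(x, y) \<in> un_rel n \<longleftrightarrow> x \<in> Ln n \<and> y \<in> Ln n \<and> x - y \<in> In_ideal n"
  by (simp add: un_rel_def)

lemma un_rel_refl: "x \<in> Ln n \<Longrightarrow> (x, x) \<in> un_rel n"
  by (simp add: un_rel_iff In_0)
lemma un_rel_sym: "(x, y) \<in> un_rel n \<Longrightarrow> (y, x) \<in> un_rel n"
  using In_minus[of "x - y" n] by (simp add: un_rel_iff)
lemma un_rel_trans: "(x, y) \<in> un_rel n \<Longrightarrow> (y, z) \<in> un_rel n \<Longrightarrow> (x, z) \<in> un_rel n"
  using In_add[of "x - y" n "y - z"] by (simp add: un_rel_iff)

lemma un_class_eq_iff: "x \<in> Ln n \<Longrightarrow> un_class n x = un_class n y \<longleftrightarrow> (x, y) \<in> un_rel n"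
  unfolding un_class_def using un_rel_refl un_rel_sym un_rel_trans
  by (smt (verit, ccfv_threshold) Collect_cong Image_singleton mem_Collect_eq)

lemma mem_un_class: "y \<in> un_class n x \<longleftrightarrow> (x, y) \<in> un_rel n"
  by (simp add: un_class_def)

lemma un_class_in_un: "x \<in> Ln n \<Longrightarrow> un_class n x \<in> un n"
  by (simp add: un_def un_class_def quotientI)

lemma unE: assumes "X \<in> un n" obtains x where "x \<in> Ln n" "X = un_class n x"
  using assms by (auto simp: un_def un_class_def elim: quotientE)

lemma un_rel_add: "(x, x') \<in> un_rel n \<Longrightarrow> (y, y') \<in> un_rel n \<Longrightarrow> (x + y, x' + y') \<in> un_rel n"
  using In_add[of "x - x'" n "y - y'"] by (simp add: un_rel_iff Ln_add algebra_simps)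
lemma un_rel_scale: "(x, x') \<in> un_rel n \<Longrightarrow> (lscale c x, lscale c x') \<in> un_rel n"
  using In_scale[of "x - x'" n c] by (simp add: un_rel_iff Ln_scale free_lie.scale_right_diff_distrib)
lemma un_rel_br: "(x, x') \<in> un_rel n \<Longrightarrow> (y, y') \<in> un_rel n \<Longrightarrow> (lbr x y, lbr x' y') \<in> un_rel n"
  using In_add[OF In_br'[of y n "x - x'"] In_br[of x' n "y - y'"]]
  by (simp add: un_rel_iff Ln_br lbr_diff_left lbr_diff_right)
lemma un_rel_sum: "(\<And>i. i \<in> I \<Longrightarrow> (f i, g i) \<in> un_rel n) \<Longrightarrow> (sum f I, sum g I) \<in> un_rel n"
  by (induct I rule: infinite_finite_induct) (auto intro: un_rel_add simp: un_rel_refl Ln_0)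

lemma un_rel_nested_blocks:
  assumes "(x, x') \<in> un_rel n" "(y, y') \<in> un_rel n"
  shows "(nested_br (blocks x y rs), nested_br (blocks x' y' rs)) \<in> un_rel n"
proof -
  have rep: "list_all2 (\<lambda>a b. (a, b) \<in> un_rel n) (replicate k a) (replicate k b)"
    if "(a, b) \<in> un_rel n" for a b k
    using that by (simp add: list_all2_conv_all_nth)
  have "list_all2 (\<lambda>a b. (a, b) \<in> un_rel n) (blocks x y rs) (blocks x' y' rs)"
    using assms by (induct rs) (auto intro!: list_all2_appendI rep)
  then show ?thesis
  proof (induct rule: list_all2_induct)
    case (Cons a as b bs)
    moreover have "as = [] \<longleftrightarrow> bs = []" using Cons(2) by auto
    ultimately show ?case by (auto intro: un_rel_br)
  qed (simp add: un_rel_refl Ln_0)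
qed

lemma un_rel_bch:
  "(x, x') \<in> un_rel n \<Longrightarrow> (y, y') \<in> un_rel n \<Longrightarrow> (bch m x y, bch m x' y') \<in> un_rel n"
  unfolding bch_eq bch_term_def by (intro un_rel_sum un_rel_scale un_rel_nested_blocks)

lemma UN_un_class:
  assumes "x \<in> Ln n" "\<And>y. (x, y) \<in> un_rel n \<Longrightarrow> g y = g x"
  shows "(\<Union>y\<in>un_class n x. g y) = g x"
proof -
  have x: "x \<in> un_class n x" using un_rel_refl[OF assms(1)] by (simp add: mem_un_class)
  have "g y = g x" if "y \<in> un_class n x" for y
    using that by (intro assms(2)) (simp add: mem_un_class)
  then have "g ` un_class n x = {g x}" using x by blast
  then show ?thesis by simp
qed

lemma Ugp_mult:
  assumes "x \<in> Ln n" "y \<in> Ln n"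
  shows "un_class n x \<otimes>\<^bsub>Ugp n\<^esub> un_class n y = un_class n (bch n x y)"
proof -
  have eq: "un_class n (bch n x' y') = un_class n (bch n x y)"
    if "(x, x') \<in> un_rel n" "(y, y') \<in> un_rel n" for x' y'
    using un_rel_bch[OF that, of n] un_class_eq_iff[OF Ln_bch[OF assms, of n], of "bch n x' y'"] by simp
  have inner: "(\<Union>y'\<in>un_class n y. un_class n (bch n x' y')) = un_class n (bch n x' y)"
    if "(x, x') \<in> un_rel n" for x'
    by (rule UN_un_class[OF assms(2)]) (metis eq that un_rel_refl assms(2))
  have "(\<Union>x'\<in>un_class n x. \<Union>y'\<in>un_class n y. un_class n (bch n x' y'))
    = (\<Union>y'\<in>un_class n y. un_class n (bch n x y'))"
    by (rule UN_un_class[OF assms(1)]) (metis eq inner un_rel_refl assms)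
  also have "\<dots> = un_class n (bch n x y)"
    by (rule inner[OF un_rel_refl[OF assms(1)]])
  finally show ?thesis by (simp add: Ugp_def)
qed

text \<open>The part of degree at least \<open>d\<close>. It is introduced because nested brackets of elements of
  \<open>L\<^sub>n\<close> are sums of homogeneous elements of various degrees, and what counts is that each of these
  degrees is at least the length.\<close>

inductive_set Ln_ge :: "nat \<Rightarrow> nat \<Rightarrow> hlie set" for n d where
  homog: "Ln_homog n e x \<Longrightarrow> d \<le> e \<Longrightarrow> x \<in> Ln_ge n d"
| add: "x \<in> Ln_ge n d \<Longrightarrow> y \<in> Ln_ge n d \<Longrightarrow> x + y \<in> Ln_ge n d"

lemma Ln_ge_scale: "x \<in> Ln_ge n d \<Longrightarrow> lscale c x \<in> Ln_ge n d"
  by (induct rule: Ln_ge.induct)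
    (auto simp: free_lie.scale_right_distrib intro: Ln_ge.intros Ln_homog.scale)

lemma Ln_ge_br: "x \<in> Ln_ge n d \<Longrightarrow> y \<in> Ln_ge n e \<Longrightarrow> lbr x y \<in> Ln_ge n (d + e)"
proof (induct rule: Ln_ge.induct)
  case x: (homog d' x)
  from x(3) show ?case
    by (induct rule: Ln_ge.induct)
      (auto simp: lbr_add_right intro: Ln_ge.add Ln_ge.homog[OF Ln_homog.br[OF x(1)]] x(2) add_mono)
qed (auto simp: lbr_add_left intro: Ln_ge.intros)

lemma Ln_ge_mono: "x \<in> Ln_ge n d \<Longrightarrow> e \<le> d \<Longrightarrow> x \<in> Ln_ge n e"
  by (induct rule: Ln_ge.induct) (auto intro: Ln_ge.intros)

lemma Ln_ge_1: "x \<in> Ln n \<Longrightarrow> x \<in> Ln_ge n 1"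
  unfolding Ln_def
proof (induct rule: lie_subalgebra.induct)
  case (base x)
  then obtain i j where ij: "(i, j) \<in> Ln_gens n" "x = gen (i, j)" by auto
  then show ?case using Ln_ge.homog[OF Ln_homog.gen[OF ij(1)], of 1] by (simp add: Ln_gens_def)
next
  case zero show ?case by (rule Ln_ge.homog[OF Ln_homog.zero[of n 1]]) simp
next
  case (br x y)
  then show ?case using Ln_ge_mono[OF Ln_ge_br[of x n 1 y 1]] by simp
qed (auto intro: Ln_ge.add Ln_ge_scale)

lemma Ln_ge_In: "x \<in> Ln_ge n (Suc n) \<Longrightarrow> x \<in> In_ideal n"
  by (induct rule: Ln_ge.induct) (auto intro: In_homog In_add)

lemma nested_br_Ln_ge: "set ws \<subseteq> Ln n \<Longrightarrow> ws \<noteq> [] \<Longrightarrow> nested_br ws \<in> Ln_ge n (length ws)"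
proof (induct ws)
  case (Cons w ws)
  show ?case
  proof (cases "ws = []")
    case False
    then show ?thesis using Cons Ln_ge_br[OF Ln_ge_1[of w n], of "nested_br ws" "length ws"] by auto
  qed (use Cons Ln_ge_1 in auto)
qed simp

text \<open>The truncated laws are compatible with the projections \<open>u\<^sub>n\<^sub>+\<^sub>1 \<rightarrow> u\<^sub>n\<close>: the additional
  term is a combination of brackets of length \<open>n + 1\<close>.\<close>

lemma bch_Suc: "x \<in> Ln n \<Longrightarrow> y \<in> Ln n \<Longrightarrow> (bch (Suc n) x y, bch n x y) \<in> un_rel n"
proof -
  assume x: "x \<in> Ln n" and y: "y \<in> Ln n"
  have "bch_term (Suc n) x y \<in> In_ideal n"
    unfolding bch_term_def
  proof (intro In_sum In_scale Ln_ge_In)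
    fix k rs assume "rs \<in> dynkin_index k (Suc n)"
    then show "nested_br (blocks x y rs) \<in> Ln_ge n (Suc n)"
      using nested_br_Ln_ge[of "blocks x y rs" n] dynkin_index_length[of rs k "Suc n" x y]
        in_set_blocks[of x y rs] x y by force
  qed
  moreover have "bch (Suc n) x y - bch n x y = bch_term (Suc n) x y" by (simp add: bch_eq)
  ultimately show ?thesis using x y by (simp add: un_rel_iff Ln_bch)
qed

lemma Ln_proj_in: "Ln_proj n x \<in> Ln n"
  unfolding Ln_proj_def
  by (induct x rule: free_lie_induct) (auto intro: Ln_0 Ln_gen Ln_add Ln_scale Ln_br)

lemma Ln_proj_id: "x \<in> Ln n \<Longrightarrow> Ln_proj n x = x"
  unfolding Ln_def by (induct rule: lie_subalgebra.induct) (auto simp: Ln_proj_def)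

lemma Ln_gens_mono: "n \<le> m \<Longrightarrow> Ln_gens n \<subseteq> Ln_gens m"
  by (auto simp: Ln_gens_def)

lemma Ln_proj_proj: "n \<le> m \<Longrightarrow> Ln_proj n (Ln_proj m x) = Ln_proj n x"
  using Ln_gens_mono[of n m] unfolding Ln_proj_def lie_hom_comp
  by (intro arg_cong[of _ _ "\<lambda>f. lie_hom f x"] ext) auto

lemma Ln_proj_add: "Ln_proj n (x + y) = Ln_proj n x + Ln_proj n y" by (simp add: Ln_proj_def)
lemma Ln_proj_scale: "Ln_proj n (lscale c x) = lscale c (Ln_proj n x)" by (simp add: Ln_proj_def)
lemma Ln_proj_br: "Ln_proj n (lbr x y) = lbr (Ln_proj n x) (Ln_proj n y)" by (simp add: Ln_proj_def)
lemma Ln_proj_diff: "Ln_proj n (x - y) = Ln_proj n x - Ln_proj n y" by (simp add: Ln_proj_def lie_hom_diff)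
lemma Ln_proj_0 [simp]: "Ln_proj n 0 = 0" by (simp add: Ln_proj_def)
lemma Ln_proj_gen: "Ln_proj n (gen ij) = (if ij \<in> Ln_gens n then gen ij else 0)" by (simp add: Ln_proj_def)
lemma Ln_proj_bch: "Ln_proj n (bch m x y) = bch m (Ln_proj n x) (Ln_proj n y)"
  by (simp add: Ln_proj_def lie_hom_bch)

lemma Ln_proj_homog: "Ln_homog m d x \<Longrightarrow> Ln_homog n d (Ln_proj n x)"
  by (induct rule: Ln_homog.induct)
    (auto simp: Ln_proj_gen Ln_proj_add Ln_proj_scale Ln_proj_br intro: Ln_homog.intros)

lemma Ln_proj_In: "x \<in> In_ideal m \<Longrightarrow> n \<le> m \<Longrightarrow> Ln_proj n x \<in> In_ideal n"
  unfolding In_ideal_def[of m]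
proof (induct rule: lie_ideal.induct)
  case (base x)
  then obtain d where "d > m" "Ln_homog m d x" by (auto simp: Ln_deg_def)
  then show ?case using base(2) by (intro In_homog[OF Ln_proj_homog]) auto
qed (auto simp: Ln_proj_add Ln_proj_scale Ln_proj_br intro: In_0 In_add In_scale In_br Ln_proj_in)

lemma un_proj_class:
  assumes "x \<in> Ln m" "n \<le> m"
  shows "un_proj n (un_class m x) = un_class n (Ln_proj n x)"
  unfolding un_proj_def
proof (rule UN_un_class[OF assms(1)])
  fix y assume "(x, y) \<in> un_rel m"
  then show "un_class n (Ln_proj n y) = un_class n (Ln_proj n x)"
    using Ln_proj_In[of "x - y" m n] assms
    by (metis un_class_eq_iff Ln_proj_in un_rel_iff Ln_proj_diff)
qed

text \<open>A section of \<open>U \<rightarrow> U\<^sub>n\<close>: every element of the free Lie algebra has compatible images in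
  all \<open>u\<^sub>m\<close>. It allows elements of \<open>U\<^sub>n\<close> to be evaluated in a representation of \<open>U\<close>.\<close>

definition lie_lift :: "hlie \<Rightarrow> nat \<Rightarrow> hlie set" where
  "lie_lift x = (\<lambda>m. un_class m (Ln_proj m x))"

lemma lie_lift_at: "x \<in> Ln n \<Longrightarrow> lie_lift x n = un_class n x"
  by (simp add: lie_lift_def Ln_proj_id)

lemma Ulim_iff: "u \<in> carrier Ulim \<longleftrightarrow> (\<forall>n. u n \<in> un n \<and> un_proj n (u (Suc n)) = u n)"
  by (simp only: Ulim_def partial_object.select_convs mem_Collect_eq)

lemma Ulim_un: "u \<in> carrier Ulim \<Longrightarrow> u n \<in> un n"
  unfolding Ulim_iff by (erule allE[of _ n]) (erule conjunct1)

lemma Ulim_step: "u \<in> carrier Ulim \<Longrightarrow> un_proj n (u (Suc n)) = u n"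
  unfolding Ulim_iff by (erule allE[of _ n]) (erule conjunct2)

lemma lie_lift_Ulim: "lie_lift x \<in> carrier Ulim"
proof -
  have "lie_lift x n \<in> un n" for n
    unfolding lie_lift_def by (rule un_class_in_un[OF Ln_proj_in])
  moreover have "un_proj n (lie_lift x (Suc n)) = lie_lift x n" for n
    unfolding lie_lift_def by (simp add: un_proj_class[OF Ln_proj_in] Ln_proj_proj)
  ultimately show ?thesis unfolding Ulim_iff by blast
qed

lemma Ulim_one: "\<one>\<^bsub>Ulim\<^esub> = lie_lift 0"
  by (simp add: Ulim_def Ugp_def lie_lift_def)

lemma Ulim_at: "u \<in> carrier Ulim \<Longrightarrow> \<exists>x\<in>Ln n. u n = un_class n x"
proof -
  assume "u \<in> carrier Ulim"
  then have "u n \<in> un n" by (rule Ulim_un)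
  then show ?thesis by (rule unE) (rule bexI)
qed

lemma Ulim_proj: "u \<in> carrier Ulim \<Longrightarrow> un_proj n (u (n + k)) = u n"
proof (induct k)
  case 0
  then obtain x where "x \<in> Ln n" "u n = un_class n x" using Ulim_at[OF 0, of n] by blast
  then show ?case by (simp add: un_proj_class Ln_proj_id)
next
  case (Suc k)
  then obtain x where x: "x \<in> Ln (n + Suc k)" "u (n + Suc k) = un_class (n + Suc k) x"
    using Ulim_at[OF Suc(2), of "n + Suc k"] by blast
  have "u (n + k) = un_proj (n + k) (u (Suc (n + k)))" using Ulim_step[OF Suc(2)] by simp
  also have "\<dots> = un_class (n + k) (Ln_proj (n + k) x)" using x by (simp add: un_proj_class)
  finally have "un_proj n (u (n + k)) = un_class n (Ln_proj n x)"
    by (simp add: un_proj_class Ln_proj_in Ln_proj_proj)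
  then show ?case using Suc x by (simp add: un_proj_class)
qed

lemma Ulim_mult_at: "(u \<otimes>\<^bsub>Ulim\<^esub> v) n = u n \<otimes>\<^bsub>Ugp n\<^esub> v n"
  by (simp add: Ulim_def)

lemma Ulim_mult_closed:
  assumes "u \<in> carrier Ulim" "v \<in> carrier Ulim"
  shows "u \<otimes>\<^bsub>Ulim\<^esub> v \<in> carrier Ulim"
  unfolding Ulim_iff
proof
  fix n
  obtain x y where xy: "x \<in> Ln (Suc n)" "u (Suc n) = un_class (Suc n) x"
      "y \<in> Ln (Suc n)" "v (Suc n) = un_class (Suc n) y"
    using Ulim_at[OF assms(1), of "Suc n"] Ulim_at[OF assms(2), of "Suc n"] by blast
  have un: "u n = un_class n (Ln_proj n x)" "v n = un_class n (Ln_proj n y)"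
    using Ulim_proj[OF assms(1), of n 1] Ulim_proj[OF assms(2), of n 1] xy
    by (simp_all add: un_proj_class)
  have 1: "(u \<otimes>\<^bsub>Ulim\<^esub> v) n = un_class n (bch n (Ln_proj n x) (Ln_proj n y))"
    by (simp add: Ulim_mult_at un Ugp_mult Ln_proj_in)
  have "un_proj n ((u \<otimes>\<^bsub>Ulim\<^esub> v) (Suc n)) = un_class n (bch (Suc n) (Ln_proj n x) (Ln_proj n y))"
    by (simp add: Ulim_mult_at xy Ugp_mult un_proj_class Ln_bch Ln_proj_bch)
  also have "\<dots> = un_class n (bch n (Ln_proj n x) (Ln_proj n y))"
    by (simp add: un_class_eq_iff bch_Suc Ln_proj_in Ln_bch)
  finally show "(u \<otimes>\<^bsub>Ulim\<^esub> v) n \<in> un n \<and> un_proj n ((u \<otimes>\<^bsub>Ulim\<^esub> v) (Suc n)) = (u \<otimes>\<^bsub>Ulim\<^esub> v) n"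
    by (simp add: 1 un_class_in_un Ln_bch Ln_proj_in)
qed

lemma bch_0: "x \<in> Ln n \<Longrightarrow> bch n x 0 = x" "x \<in> Ln n \<Longrightarrow> bch n 0 x = x"
proof -
  assume x: "x \<in> Ln n"
  have "bch n x 0 = x \<and> bch n 0 x = x"
  proof (cases "n = 0")
    case True
    have "y = 0" if "y \<in> Ln 0" for y
      using that unfolding Ln_def by (induct rule: lie_subalgebra.induct) (auto simp: Ln_gens_def)
    then show ?thesis using x True by (auto simp: bch_eq)
  next
    case False
    then show ?thesis
      using bch_line[of n 1 x 0] bch_line[of n 0 x 1] by auto
  qed
  then show "bch n x 0 = x" "bch n 0 x = x" by auto
qed

lemma Ulim_r_one: "u \<in> carrier Ulim \<Longrightarrow> u \<otimes>\<^bsub>Ulim\<^esub> \<one>\<^bsub>Ulim\<^esub> = u"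
  and Ulim_l_one: "u \<in> carrier Ulim \<Longrightarrow> \<one>\<^bsub>Ulim\<^esub> \<otimes>\<^bsub>Ulim\<^esub> u = u"
proof -
  assume u: "u \<in> carrier Ulim"
  have "(u \<otimes>\<^bsub>Ulim\<^esub> \<one>\<^bsub>Ulim\<^esub>) n = u n \<and> (\<one>\<^bsub>Ulim\<^esub> \<otimes>\<^bsub>Ulim\<^esub> u) n = u n" for n
  proof -
    obtain x where "x \<in> Ln n" "u n = un_class n x" using Ulim_at[OF u, of n] by blast
    then show ?thesis
      by (simp add: Ulim_mult_at Ulim_one lie_lift_at Ln_0 Ugp_mult bch_0)
  qed
  then show "u \<otimes>\<^bsub>Ulim\<^esub> \<one>\<^bsub>Ulim\<^esub> = u" "\<one>\<^bsub>Ulim\<^esub> \<otimes>\<^bsub>Ulim\<^esub> u = u" by auto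
qed

lemma lie_act_gen:
  "lie_act z (gen (i, j)) = lscale (fst z powi (- int i) * snd z powi (- int j)) (gen (i, j))"
  by (simp add: lie_act_def split_beta)

lemma lie_act_simps:
  "lie_act z 0 = 0" "lie_act z (x + y) = lie_act z x + lie_act z y"
  "lie_act z (lscale c x) = lscale c (lie_act z x)" "lie_act z (lbr x y) = lbr (lie_act z x) (lie_act z y)"
  "lie_act z (x - y) = lie_act z x - lie_act z y"
  by (simp_all add: lie_act_def split_beta lie_hom_diff)

lemma lie_act_one: "lie_act (1, 1) x = x"
  by (induct x rule: free_lie_induct) (auto simp: lie_act_gen lie_act_simps)

lemma lie_act_Ln: "x \<in> Ln n \<Longrightarrow> lie_act z x \<in> Ln n"
  unfolding Ln_def[of n]
  by (induct rule: lie_subalgebra.induct, unfold Ln_def[symmetric])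
    (auto simp: lie_act_gen lie_act_simps Ln_gen Ln_0 Ln_add Ln_scale Ln_br)

lemma lie_act_homog: "Ln_homog n d x \<Longrightarrow> Ln_homog n d (lie_act z x)"
  by (induct rule: Ln_homog.induct) (auto simp: lie_act_gen lie_act_simps intro: Ln_homog.intros)

lemma lie_act_In: "x \<in> In_ideal n \<Longrightarrow> lie_act z x \<in> In_ideal n"
  unfolding In_ideal_def[of n]
  by (induct rule: lie_ideal.induct, unfold In_ideal_def[symmetric])
    (auto simp: lie_act_simps Ln_deg_def
      intro: In_0 In_add In_scale In_br lie_act_Ln In_homog[OF lie_act_homog])

lemma lie_act_proj: "lie_act z (Ln_proj n x) = Ln_proj n (lie_act z x)"
  by (induct x rule: free_lie_induct)
    (auto simp: lie_act_gen lie_act_simps Ln_proj_gen Ln_proj_add Ln_proj_scale Ln_proj_br)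

lemma Ulim_act_at:
  assumes "x \<in> Ln n" "u n = un_class n x"
  shows "Ulim_act z u n = un_class n (lie_act z x)"
  unfolding Ulim_act_def assms(2)
proof (rule UN_un_class[OF assms(1)])
  fix y assume "(x, y) \<in> un_rel n"
  then show "un_class n (lie_act z y) = un_class n (lie_act z x)"
    using lie_act_In[of "x - y" n z] by (metis un_class_eq_iff lie_act_Ln un_rel_iff lie_act_simps(5))
qed

lemma Ulim_act_lift: "Ulim_act z (lie_lift x) = lie_lift (lie_act z x)"
proof
  fix n
  show "Ulim_act z (lie_lift x) n = lie_lift (lie_act z x) n"
    using Ulim_act_at[OF Ln_proj_in, of "lie_lift x" n x z]
    by (simp add: lie_lift_def lie_act_proj)
qed

lemma Ulim_act_closed: assumes "u \<in> carrier Ulim" shows "Ulim_act z u \<in> carrier Ulim"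
  unfolding Ulim_iff
proof
  fix n
  obtain x where x: "x \<in> Ln (Suc n)" "u (Suc n) = un_class (Suc n) x" using Ulim_at[OF assms, of "Suc n"] by blast
  then have "u n = un_class n (Ln_proj n x)"
    using Ulim_proj[OF assms, of n 1] by (simp add: un_proj_class)
  then show "Ulim_act z u n \<in> un n \<and> un_proj n (Ulim_act z u (Suc n)) = Ulim_act z u n"
    using Ulim_act_at[OF Ln_proj_in, of u n x z] Ulim_act_at[of x "Suc n" u z] x
    by (simp add: Ln_proj_in lie_act_Ln un_class_in_un un_proj_class lie_act_proj)
qed

lemma Ulim_act_one: assumes "u \<in> carrier Ulim" shows "Ulim_act (1, 1) u = u"
proof
  fix n
  obtain x where "x \<in> Ln n" "u n = un_class n x" using Ulim_at[OF assms, of n] by blast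
  then show "Ulim_act (1, 1) u n = u n" by (simp add: Ulim_act_at lie_act_one)
qed

section \<open>Linear endomorphisms of a complex vector space\<close>

locale complex_fd_space = finite_dimensional_vector_space scale Basis
  for scale :: "complex \<Rightarrow> 'v::ab_group_add \<Rightarrow> 'v" and Basis :: "'v set"
begin

definition S :: "complex \<Rightarrow> 'v endo" where "S c = Endo (scale c)"

lemma app_S [simp]: "app (S c) v = scale c v"
  by (simp add: S_def app_Endo scale_right_distrib)

lemma S_simps: "S 0 = 0" "S 1 = 1" "S (a + b) = S a + S b" "S (a - b) = S a - S b" "S (a * b) = S a * S b"
  "S (- a) = - S a"
  by (auto intro!: endo_eqI simp: scale_left_distrib scale_left_diff_distrib)

lemma S_comm: "S a * S b = S b * S a"
  by (simp add: S_simps(5)[symmetric] mult.commute)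

lemma S_power: "S a ^ k = S (a ^ k)"
  by (induct k) (simp_all add: S_simps)

lemma S_cancel: "c \<noteq> 0 \<Longrightarrow> S c * a = S c * b \<Longrightarrow> a = b"
proof -
  assume c: "c \<noteq> 0" and "S c * a = S c * b"
  then have "S (inverse c) * S c * a = S (inverse c) * S c * b" by (simp add: mult.assoc)
  then show "a = b" using c by (simp add: S_simps(5)[symmetric] S_simps(2))
qed

sublocale rational_ring "\<lambda>r. S (of_rat r)"
  by standard (simp_all add: S_simps of_rat_add of_rat_mult)

definition Lin :: "'v endo \<Rightarrow> bool" where "Lin a \<longleftrightarrow> (\<forall>c. a * S c = S c * a)"

lemma Lin_scale: "Lin a \<Longrightarrow> app a (scale c v) = scale c (app a v)"
  unfolding Lin_def by (metis app_S app_times)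

lemma LinI: "(\<And>c v. app a (scale c v) = scale c (app a v)) \<Longrightarrow> Lin a"
  unfolding Lin_def by (auto intro!: endo_eqI)

lemma Lin_S_commute: "Lin a \<Longrightarrow> a * S c = S c * a" by (simp add: Lin_def)

lemma Lin_S_left: "Lin a \<Longrightarrow> a * (S c * b) = S c * (a * b)"
  by (simp add: Lin_def flip: mult.assoc)

lemma linear_iff_Lin: "Vector_Spaces.linear scale scale (app a) \<longleftrightarrow> Lin a"
proof
  assume "Lin a"
  then show "Vector_Spaces.linear scale scale (app a)"
    by unfold_locales (simp_all add: Lin_scale)
next
  assume "Vector_Spaces.linear scale scale (app a)"
  then interpret Vector_Spaces.linear scale scale "app a" .
  show "Lin a" by (rule LinI) (rule scale)
qed

lemma linear_Endo:
  assumes "Vector_Spaces.linear scale scale f"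
  shows "app (Endo f) = f" and "Lin (Endo f)"
proof -
  interpret Vector_Spaces.linear scale scale f by fact
  show *: "app (Endo f) = f" by (rule app_Endo) (rule add)
  show "Lin (Endo f)" using assms linear_iff_Lin[of "Endo f"] * by simp
qed

lemma Lin_simps [simp]: "Lin 0" "Lin 1" "Lin (S c)"
  "Lin a \<Longrightarrow> Lin b \<Longrightarrow> Lin (a + b)" "Lin a \<Longrightarrow> Lin b \<Longrightarrow> Lin (a - b)" "Lin a \<Longrightarrow> Lin (- a)"
  "Lin a \<Longrightarrow> Lin b \<Longrightarrow> Lin (a * b)"
  by (auto intro!: LinI simp: Lin_scale scale_right_distrib scale_right_diff_distrib mult.commute)

lemma Lin_sum: "(\<And>i. i \<in> I \<Longrightarrow> Lin (f i)) \<Longrightarrow> Lin (sum f I)"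
  by (induct I rule: infinite_finite_induct) auto

lemma Lin_power: "Lin a \<Longrightarrow> Lin (a ^ k)"
  by (induct k) auto

lemma Lin_ser: "Lin a \<Longrightarrow> Lin (ser c a)"
  unfolding ser_def by (intro Lin_sum Lin_simps Lin_power)

lemma Lin_ex: "Lin a \<Longrightarrow> Lin (ex a)" by (simp add: ex_def Lin_ser)
lemma Lin_lg: "Lin a \<Longrightarrow> Lin (lg a)" by (simp add: lg_def Lin_ser)

lemma nilpotent_map_app: "nilpotent_map (app a) \<longleftrightarrow> nil a"
proof -
  have "app a ^^ k = (\<lambda>_. 0) \<longleftrightarrow> a ^ k = 0" for k
    by (metis app_power app_zero endo_eqI ext)
  then show ?thesis by (simp add: nilpotent_map_def nil_def)
qed

lemma nil_exp_app: assumes "nil a" shows "nil_exp scale (app a) = app (ex a)"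
proof
  fix v
  obtain K where K: "a ^ K = 0" using assms by (auto simp: nil_def)
  have "nil_exp scale (app a) v = (\<Sum>k<K. scale (1 / fact k) (app (a ^ k) v))"
    unfolding nil_exp_def app_power[symmetric]
  proof (rule sum.mono_neutral_left)
    show "{k. app (a ^ k) v \<noteq> 0} \<subseteq> {..<K}"
    proof (rule subsetI, rule ccontr)
      fix k assume "k \<in> {k. app (a ^ k) v \<noteq> 0}" "k \<notin> {..<K}"
      then show False using power_eq_0_mono[OF K, of k] by simp
    qed
  qed auto
  also have "\<dots> = app (ex a) v"
  proof -
    have "of_rat (1 / fact k) = (1 / fact k :: complex)" for k
      by (metis of_nat_fact of_rat_1 of_rat_divide of_rat_of_nat_eq)
    then show ?thesis by (simp add: ex_eq[OF K] sum_app)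
  qed
  finally show "nil_exp scale (app a) v = app (ex a) v" .
qed

section \<open>Operators with prescribed types of matrix coefficients\<close>

definition functional :: "('v \<Rightarrow> complex) \<Rightarrow> bool" where
  "functional \<xi> \<longleftrightarrow> Vector_Spaces.linear scale (*) \<xi>"

lemma functional_simps:
  assumes "functional \<xi>"
  shows "\<xi> (v + w) = \<xi> v + \<xi> w" "\<xi> (scale c v) = c * \<xi> v" "\<xi> 0 = 0" "\<xi> (\<Sum>i\<in>I. f i) = (\<Sum>i\<in>I. \<xi> (f i))"
proof -
  interpret lin: Vector_Spaces.linear scale "(*)" \<xi> using assms by (simp add: functional_def)
  show "\<xi> (v + w) = \<xi> v + \<xi> w" "\<xi> (scale c v) = c * \<xi> v" "\<xi> 0 = 0" "\<xi> (\<Sum>i\<in>I. f i) = (\<Sum>i\<in>I. \<xi> (f i))"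
    by (rule lin.add lin.scale lin.zero lin.sum)+
qed

definition coord :: "'v \<Rightarrow> 'v \<Rightarrow> complex" where "coord b v = representation Basis v b"

lemma functional_coord: "functional (coord b)"
  unfolding functional_def coord_def
  by unfold_locales
    (simp_all add: algebra_simps representation_add independent_Basis span_Basis representation_scale)

lemma coord_expansion: "(\<Sum>b\<in>Basis. scale (coord b v) b) = v"
  unfolding coord_def
  using sum_representation_eq[of Basis v Basis] independent_Basis span_Basis finite_Basis by simp

lemma functional_separates: "(\<And>\<xi>. functional \<xi> \<Longrightarrow> \<xi> v = \<xi> w) \<Longrightarrow> v = w"
proof -
  assume "\<And>\<xi>. functional \<xi> \<Longrightarrow> \<xi> v = \<xi> w"
  then have "coord b v = coord b w" for b using functional_coord by blast
  then have "(\<Sum>b\<in>Basis. scale (coord b v) b) = (\<Sum>b\<in>Basis. scale (coord b w) b)" by simp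
  then show "v = w" unfolding coord_expansion .
qed

lemma Lin_eqI: assumes "Lin a" "Lin a'" "\<And>b. b \<in> Basis \<Longrightarrow> app a b = app a' b" shows "a = a'"
proof (rule endo_eqI)
  fix v
  have "app a (\<Sum>b\<in>Basis. scale (coord b v) b) = app a' (\<Sum>b\<in>Basis. scale (coord b v) b)"
    using assms by (simp add: app_sum Lin_scale)
  then show "app a v = app a' v" by (simp add: coord_expansion)
qed

definition independent_on :: "'s set \<Rightarrow> ('i \<Rightarrow> 's \<Rightarrow> complex) \<Rightarrow> 'i set \<Rightarrow> bool" where
  "independent_on D e J \<longleftrightarrow>
    (\<forall>c. (\<forall>s\<in>D. (\<Sum>i\<in>J. c i * e i s) = 0) \<longrightarrow> (\<forall>i\<in>J. c i = 0))"

text \<open>If every matrix coefficient of a family of operators is a combination of the functions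
  \<open>e i\<close>, finitely many indices suffice for all coefficients at once, because the coefficients in a
  basis determine the operator. The combination then has operators as coefficients.\<close>

lemma operator_family:
  assumes F: "\<And>s. s \<in> D \<Longrightarrow> Lin (F s)"
    and coeffs: "\<And>\<xi> v. functional \<xi> \<Longrightarrow>
      \<exists>J c. finite J \<and> J \<subseteq> I \<and> (\<forall>s\<in>D. \<xi> (app (F s) v) = (\<Sum>i\<in>J. c i * e i s))"
  obtains J A where "finite J" "J \<subseteq> I" "\<And>i. Lin (A i)" "\<And>s. s \<in> D \<Longrightarrow> F s = (\<Sum>i\<in>J. S (e i s) * A i)"
proof -
  have "\<forall>b b'. \<exists>J c. finite J \<and> J \<subseteq> I \<and> (\<forall>s\<in>D. coord b' (app (F s) b) = (\<Sum>i\<in>J. c i * e i s))"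
    using coeffs functional_coord by blast
  then obtain J c where Jc: "\<And>b b'. finite (J b b')" "\<And>b b'. J b b' \<subseteq> I"
      "\<And>b b' s. s \<in> D \<Longrightarrow> coord b' (app (F s) b) = (\<Sum>i\<in>J b b'. c b b' i * e i s)"
    by metis
  define J0 where "J0 = (\<Union>b\<in>Basis. \<Union>b'\<in>Basis. J b b')"
  define c0 where "c0 = (\<lambda>b b' i. if i \<in> J b b' then c b b' i else 0)"
  have c0: "coord b' (app (F s) b) = (\<Sum>i\<in>J0. c0 b b' i * e i s)"
    if "s \<in> D" "b \<in> Basis" "b' \<in> Basis" for s b b'
    unfolding Jc(3)[OF that(1)] c0_def
    by (rule sum.mono_neutral_cong_left) (use that Jc(1) finite_Basis in \<open>auto simp: J0_def\<close>)
  define f where "f = (\<lambda>i v. \<Sum>b\<in>Basis. \<Sum>b'\<in>Basis. scale (coord b v * c0 b b' i) b')"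
  have f: "app (Endo (f i)) = f i" for i
    by (rule app_Endo)
      (simp add: f_def functional_simps[OF functional_coord] distrib_right scale_left_distrib sum.distrib)
  show ?thesis
  proof
    show "finite J0" using Jc(1) finite_Basis by (simp add: J0_def)
    show "J0 \<subseteq> I" unfolding J0_def using Jc(2) by (intro UN_least)
    show "Lin (Endo (f i))" for i
      by (rule LinI) (simp add: f, simp add: f_def functional_simps[OF functional_coord] scale_sum_right mult.assoc)
    fix s assume s: "s \<in> D"
    show "F s = (\<Sum>i\<in>J0. S (e i s) * Endo (f i))"
    proof (rule Lin_eqI[OF F[OF s]])
      show "Lin (\<Sum>i\<in>J0. S (e i s) * Endo (f i))"
        by (intro Lin_sum Lin_simps \<open>\<And>i. Lin (Endo (f i))\<close>)
      fix b assume b: "b \<in> Basis"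
      have "coord b1 b = (if b1 = b then 1 else 0)" for b1
        unfolding coord_def using representation_basis[OF independent_Basis b] by auto
      then have fb: "f i b = (\<Sum>b'\<in>Basis. scale (c0 b b' i) b')" for i
        unfolding f_def using b finite_Basis
        by (subst sum.remove[OF _ b]) (auto intro!: sum.neutral)
      have "app (F s) b = (\<Sum>b'\<in>Basis. scale (\<Sum>i\<in>J0. c0 b b' i * e i s) b')"
        using coord_expansion[of "app (F s) b"] by (simp add: c0[OF s b] cong: sum.cong)
      also have "\<dots> = (\<Sum>b'\<in>Basis. \<Sum>i\<in>J0. scale (e i s * c0 b b' i) b')"
        by (simp add: scale_sum_left mult.commute)
      also have "\<dots> = (\<Sum>i\<in>J0. \<Sum>b'\<in>Basis. scale (e i s * c0 b b' i) b')"
        by (rule sum.swap)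
      also have "\<dots> = app (\<Sum>i\<in>J0. S (e i s) * Endo (f i)) b"
        by (simp add: sum_app f fb scale_sum_right)
      finally show "app (F s) b = app (\<Sum>i\<in>J0. S (e i s) * Endo (f i)) b" .
    qed
  qed
qed

text \<open>Applying all linear functionals reduces the independence over operators to the
  independence over the complex numbers.\<close>

lemma operator_family_unique:
  assumes "independent_on D e J" and 0: "\<And>s. s \<in> D \<Longrightarrow> (\<Sum>i\<in>J. S (e i s) * A i) = 0" and i: "i \<in> J"
  shows "A i = 0"
proof (rule endo_eqI, unfold app_zero, rule functional_separates)
  fix v \<xi> assume \<xi>: "functional \<xi>"
  have "(\<Sum>i\<in>J. \<xi> (app (A i) v) * e i s) = 0" if "s \<in> D" for s
  proof -
    have "\<xi> (app (\<Sum>i\<in>J. S (e i s) * A i) v) = \<xi> 0" using 0[OF that] by simp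
    then show ?thesis by (simp add: sum_app functional_simps[OF \<xi>] mult.commute)
  qed
  then have "\<xi> (app (A i) v) = 0"
    using assms(1) i unfolding independent_on_def by (elim allE[of _ "\<lambda>i. \<xi> (app (A i) v)"]) blast
  then show "\<xi> (app (A i) v) = \<xi> 0" by (simp add: functional_simps[OF \<xi>])
qed

lemma operator_family_unique2:
  assumes "independent_on D e J"
    and "\<And>s. s \<in> D \<Longrightarrow> (\<Sum>i\<in>J. S (e i s) * A i) = (\<Sum>i\<in>J. S (e i s) * A' i)" and "i \<in> J"
  shows "A i = A' i"
  using operator_family_unique[OF assms(1), of "\<lambda>i. A i - A' i" i] assms
  by (simp add: right_diff_distrib sum_subtractf)

lemma independent_monomials: "independent_on UNIV (\<lambda>k t. t ^ k) {..N}"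
  unfolding independent_on_def using polyfun_eq_0[of _ N, where 'a = complex] by simp

text \<open>Dedekind's argument: a relation translated by \<open>t\<close>, minus \<open>e j t\<close> times the relation,
  is a relation without \<open>e j\<close> in which the coefficient of \<open>e i\<close> is multiplied by
  \<open>e i t - e j t\<close>.\<close>

lemma independent_characters:
  assumes "finite J"
    and closed: "\<And>s t. s \<in> D \<Longrightarrow> t \<in> D \<Longrightarrow> m s t \<in> D"
    and mult: "\<And>i s t. i \<in> J \<Longrightarrow> s \<in> D \<Longrightarrow> t \<in> D \<Longrightarrow> e i (m s t) = e i s * e i t"
    and nonzero: "\<And>i. i \<in> J \<Longrightarrow> \<exists>s\<in>D. e i s \<noteq> 0"
    and distinct: "\<And>i j. i \<in> J \<Longrightarrow> j \<in> J \<Longrightarrow> i \<noteq> j \<Longrightarrow> \<exists>s\<in>D. e i s \<noteq> e j s"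
  shows "independent_on D e J"
  using assms(1) mult nonzero distinct
proof (induct J rule: finite_induct)
  case empty
  show ?case by (simp add: independent_on_def)
next
  case (insert j J)
  have IH: "independent_on D e J" using insert by auto
  show ?case
    unfolding independent_on_def
  proof (intro allI impI)
    fix c assume c: "\<forall>s\<in>D. (\<Sum>i\<in>insert j J. c i * e i s) = 0"
    have ci: "c i = 0" if i: "i \<in> J" for i
    proof -
      obtain t where t: "t \<in> D" "e i t \<noteq> e j t" using insert(2,6) i by (metis insert_iff)
      have "(\<Sum>i\<in>J. (c i * (e i t - e j t)) * e i s) = 0" if s: "s \<in> D" for s
      proof -
        have "(\<Sum>i\<in>insert j J. c i * e i (m t s)) - e j t * (\<Sum>i\<in>insert j J. c i * e i s) = 0"
          using c closed[OF t(1) s] s by simp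
        moreover have "(\<Sum>i\<in>insert j J. c i * e i (m t s)) = (\<Sum>i\<in>insert j J. c i * (e i t * e i s))"
          using insert(4) t(1) s by simp
        ultimately have "(\<Sum>i\<in>insert j J. c i * (e i t * e i s) - e j t * (c i * e i s)) = 0"
          by (simp add: sum_distrib_left sum_subtractf)
        then show ?thesis using insert(1,2) by (simp add: algebra_simps)
      qed
      then have "\<forall>i\<in>J. c i * (e i t - e j t) = 0"
        using IH unfolding independent_on_def by (elim allE[of _ "\<lambda>i. c i * (e i t - e j t)"]) blast
      then have "c i * (e i t - e j t) = 0" using i by blast
      then show ?thesis using t by simp
    qed
    then have "\<forall>s\<in>D. c j * e j s = 0" using c insert(1,2) by simp
    then have "c j = 0" using insert(5)[of j] by auto
    then show "\<forall>i\<in>insert j J. c i = 0" using ci by simp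
  qed
qed

section \<open>Gradings as systems of idempotents\<close>

text \<open>The projections to the pieces of a grading. For operators they are easier to handle than
  subspaces: an operator is determined by its blocks \<open>\<pi> w' a (\<pi> w)\<close>. Only finitely many projections
  are nonzero because the dimension is finite.\<close>

definition idem_system :: "'i set \<Rightarrow> ('i \<Rightarrow> 'v endo) \<Rightarrow> bool" where
  "idem_system I \<pi> \<longleftrightarrow> (\<forall>i. Lin (\<pi> i)) \<and> finite {i. \<pi> i \<noteq> 0} \<and> {i. \<pi> i \<noteq> 0} \<subseteq> I \<and>
     (\<forall>i j. \<pi> i * \<pi> j = (if i = j then \<pi> i else 0)) \<and> (\<Sum>i | \<pi> i \<noteq> 0. \<pi> i) = 1"

lemma idem_systemD:
  assumes "idem_system I \<pi>"
  shows "Lin (\<pi> i)" "finite {i. \<pi> i \<noteq> 0}" "\<pi> i \<noteq> 0 \<Longrightarrow> i \<in> I" "\<pi> i * \<pi> i = \<pi> i"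
    "i \<noteq> j \<Longrightarrow> \<pi> i * \<pi> j = 0" "(\<Sum>i | \<pi> i \<noteq> 0. \<pi> i) = 1"
  using assms unfolding idem_system_def by auto

lemma idem_expand: assumes "idem_system I \<pi>" shows "(\<Sum>i | \<pi> i \<noteq> 0. app (\<pi> i) v) = v"
  using arg_cong[OF idem_systemD(6)[OF assms], of "\<lambda>a. app a v"] by (simp add: sum_app)

lemma is_grading_idem:
  assumes \<pi>: "idem_system I \<pi>" and U: "\<And>i. i \<in> I \<Longrightarrow> U i = {v. app (\<pi> i) v = v}"
  shows "is_grading scale I U"
  unfolding is_grading_def
proof (intro conjI ballI allI)
  fix i assume "i \<in> I"
  then show "subspace (U i)"
    using idem_systemD(1)[OF \<pi>] by (intro subspaceI) (auto simp: U Lin_scale)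
next
  fix v
  show "\<exists>!f. (\<forall>i\<in>I. f i \<in> U i) \<and> (\<forall>i. i \<notin> I \<longrightarrow> f i = 0) \<and> finite {i. f i \<noteq> 0} \<and> v = (\<Sum>i | f i \<noteq> 0. f i)"
  proof (rule ex1I[of _ "\<lambda>i. app (\<pi> i) v"], intro conjI ballI allI impI)
    fix i assume "i \<in> I"
    then show "app (\<pi> i) v \<in> U i"
      using idem_systemD(4)[OF \<pi>, of i] by (simp add: U flip: app_times)
  next
    fix i assume "i \<notin> I"
    then show "app (\<pi> i) v = 0" using idem_systemD(3)[OF \<pi>, of i] by fastforce
  next
    have sub: "{i. app (\<pi> i) v \<noteq> 0} \<subseteq> {i. \<pi> i \<noteq> 0}" by auto
    then show "finite {i. app (\<pi> i) v \<noteq> 0}"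
      using idem_systemD(2)[OF \<pi>] by (rule finite_subset)
    show "v = (\<Sum>i | app (\<pi> i) v \<noteq> 0. app (\<pi> i) v)"
      using sum.mono_neutral_left[OF idem_systemD(2)[OF \<pi>] sub, of "\<lambda>i. app (\<pi> i) v"] idem_expand[OF \<pi>, of v]
      by simp
  next
    fix f assume f: "(\<forall>i\<in>I. f i \<in> U i) \<and> (\<forall>i. i \<notin> I \<longrightarrow> f i = 0) \<and> finite {i. f i \<noteq> 0} \<and> v = (\<Sum>i | f i \<noteq> 0. f i)"
    then have fin: "finite {i. f i \<noteq> 0}" by blast
    show "f = (\<lambda>i. app (\<pi> i) v)"
    proof
      fix j
      have fi: "app (\<pi> i) (f i) = f i" for i using f by (cases "i \<in> I") (auto simp: U)
      have "app (\<pi> j) (f i) = (if i = j then f j else 0)" for i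
        using fi[of i] idem_systemD(5)[OF \<pi>, of j i] by (metis app_times app_zero)
      then have "app (\<pi> j) (\<Sum>i | f i \<noteq> 0. f i) = (\<Sum>i | f i \<noteq> 0. if i = j then f j else 0)"
        by (simp add: app_sum)
      also have "\<dots> = f j" using fin by simp
      finally show "f j = app (\<pi> j) v" using f by simp
    qed
  qed
qed

text \<open>The components of a vector are unique, hence additive and homogeneous in it. Each of the
  finitely many basis vectors has finitely many components, which bounds the indices that occur.\<close>

lemma idem_of_grading:
  assumes gr: "is_grading scale I U"
  obtains \<pi> where "idem_system I \<pi>" "\<And>i. i \<in> I \<Longrightarrow> U i = {v. app (\<pi> i) v = v}"
proof -
  define dec where "dec = (\<lambda>v f. (\<forall>i\<in>I. f i \<in> U i) \<and> (\<forall>i. i \<notin> I \<longrightarrow> f i = 0) \<and>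
    finite {i. f i \<noteq> 0} \<and> v = (\<Sum>i | f i \<noteq> 0. f i))"
  have sub: "subspace (U i)" if "i \<in> I" for i using gr that by (simp add: is_grading_def)
  have "\<forall>v. \<exists>!f. dec v f" using gr by (simp add: is_grading_def dec_def)
  then obtain d where d: "\<And>v. dec v (d v)" and du: "\<And>v f. dec v f \<Longrightarrow> d v = f" by metis
  have dsum: "v = (\<Sum>i\<in>A. d v i)" if "finite A" "{i. d v i \<noteq> 0} \<subseteq> A" for v A
  proof -
    have "v = (\<Sum>i | d v i \<noteq> 0. d v i)" using d[of v] unfolding dec_def by blast
    also have "\<dots> = (\<Sum>i\<in>A. d v i)" by (rule sum.mono_neutral_left[OF that]) simp
    finally show ?thesis .
  qed
  have dadd: "d (v + w) = (\<lambda>i. d v i + d w i)" for v w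
  proof (rule du)
    let ?A = "{i. d v i \<noteq> 0} \<union> {i. d w i \<noteq> 0}"
    have fin: "finite ?A" using d[of v] d[of w] unfolding dec_def by blast
    have s: "v = (\<Sum>i\<in>?A. d v i)" "w = (\<Sum>i\<in>?A. d w i)"
      by (rule dsum[OF fin Un_upper1], rule dsum[OF fin Un_upper2])
    have "finite {i. d v i + d w i \<noteq> 0}" by (rule finite_subset[OF _ fin]) auto
    moreover have "v + w = (\<Sum>i | d v i + d w i \<noteq> 0. d v i + d w i)"
    proof -
      have "v + w = (\<Sum>i\<in>?A. d v i + d w i)" using s by (simp only: sum.distrib)
      also have "\<dots> = (\<Sum>i | d v i + d w i \<noteq> 0. d v i + d w i)"
        by (rule sum.mono_neutral_right[OF fin]) auto
      finally show ?thesis .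
    qed
    ultimately show "dec (v + w) (\<lambda>i. d v i + d w i)"
      using d[of v] d[of w] sub unfolding dec_def by (simp add: subspace_add)
  qed
  have dscale: "d (scale c v) = (\<lambda>i. scale c (d v i))" for c v
  proof (rule du)
    have fin: "finite {i. d v i \<noteq> 0}" and v: "v = (\<Sum>i | d v i \<noteq> 0. d v i)"
      using d[of v] unfolding dec_def by auto
    have "finite {i. scale c (d v i) \<noteq> 0}" by (rule finite_subset[OF _ fin]) auto
    moreover have "scale c v = (\<Sum>i | scale c (d v i) \<noteq> 0. scale c (d v i))"
    proof -
      have "scale c v = (\<Sum>i | d v i \<noteq> 0. scale c (d v i))" by (subst v) (rule scale_sum_right)
      also have "\<dots> = (\<Sum>i | scale c (d v i) \<noteq> 0. scale c (d v i))"
        by (rule sum.mono_neutral_right[OF fin]) auto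
      finally show ?thesis .
    qed
    ultimately show "dec (scale c v) (\<lambda>i. scale c (d v i))"
      using d[of v] sub unfolding dec_def by (simp add: subspace_scale)
  qed
  have dU: "d u = (\<lambda>j. if j = i then u else 0)" if "i \<in> I" "u \<in> U i" for i u
  proof (rule du)
    have "{j. (if j = i then u else 0) \<noteq> 0} = (if u = 0 then {} else {i})" by auto
    then show "dec u (\<lambda>j. if j = i then u else 0)"
      using that sub subspace_0 by (auto simp: dec_def)
  qed
  have d0: "d v i = 0" if "i \<notin> I" for v i using d[of v] that by (simp add: dec_def)
  define \<pi> where "\<pi> = (\<lambda>i. Endo (\<lambda>v. d v i))"
  have app_\<pi>: "app (\<pi> i) v = d v i" for i v
    unfolding \<pi>_def by (subst app_Endo) (simp_all add: dadd)
  have lin: "Lin (\<pi> i)" for i by (rule LinI) (simp add: app_\<pi> dscale)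
  have supp: "{i. \<pi> i \<noteq> 0} \<subseteq> (\<Union>b\<in>Basis. {i. d b i \<noteq> 0})"
  proof
    fix i assume "i \<in> {i. \<pi> i \<noteq> 0}"
    then have "\<not> (\<forall>b\<in>Basis. app (\<pi> i) b = app 0 b)" using Lin_eqI[OF lin, of 0 i] by auto
    then show "i \<in> (\<Union>b\<in>Basis. {i. d b i \<noteq> 0})" by (auto simp: app_\<pi>)
  qed
  have fin: "finite {i. \<pi> i \<noteq> 0}"
  proof (rule finite_subset[OF supp], rule finite_UN_I[OF finite_Basis])
    show "finite {i. d b i \<noteq> 0}" for b using d[of b] unfolding dec_def by blast
  qed
  have "idem_system I \<pi>"
    unfolding idem_system_def
  proof (intro conjI allI)
    show "Lin (\<pi> i)" for i by (rule lin)
    show "finite {i. \<pi> i \<noteq> 0}" by (rule fin)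
    show "{i. \<pi> i \<noteq> 0} \<subseteq> I"
    proof
      fix i assume "i \<in> {i. \<pi> i \<noteq> 0}"
      then obtain v where "app (\<pi> i) v \<noteq> 0" by (metis app_zero endo_eqI mem_Collect_eq)
      then show "i \<in> I" using d0 by (auto simp: app_\<pi>)
    qed
    show "\<pi> i * \<pi> j = (if i = j then \<pi> i else 0)" for i j
    proof (rule endo_eqI)
      fix v
      show "app (\<pi> i * \<pi> j) v = app (if i = j then \<pi> i else 0) v"
      proof (cases "j \<in> I")
        case True
        then have "d v j \<in> U j" using d[of v] by (simp add: dec_def)
        then show ?thesis using dU[OF True] by (simp add: app_\<pi>)
      next
        case False
        then have "\<pi> j = 0" by (intro endo_eqI) (simp add: app_\<pi> d0)
        then show ?thesis by simp
      qed
    qed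
    show "(\<Sum>i | \<pi> i \<noteq> 0. \<pi> i) = 1"
    proof (rule endo_eqI)
      fix v
      have "(\<Sum>i | \<pi> i \<noteq> 0. d v i) = (\<Sum>i | d v i \<noteq> 0. d v i)"
      proof (rule sum.mono_neutral_right[OF fin])
        show "{i. d v i \<noteq> 0} \<subseteq> {i. \<pi> i \<noteq> 0}"
          using app_\<pi> by (metis (mono_tags, lifting) app_zero mem_Collect_eq subsetI)
      qed auto
      also have "\<dots> = v" using d[of v] by (simp add: dec_def)
      finally show "app (\<Sum>i | \<pi> i \<noteq> 0. \<pi> i) v = app 1 v" by (simp add: sum_app app_\<pi>)
    qed
  qed
  moreover have "U i = {v. app (\<pi> i) v = v}" if "i \<in> I" for i
    using dU[OF that] d that by (auto simp: app_\<pi> dec_def fun_eq_iff) metis+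
  ultimately show ?thesis by (rule that)
qed

end

section \<open>Characters of the torus\<close>

type_synonym bidegree = "(nat \<Rightarrow> int) \<times> (nat \<Rightarrow> int)"
type_synonym torus_point = "nat \<Rightarrow> complex \<times> complex"

text \<open>Bidegrees are restricted to extensional functions, so that distinct bidegrees give
  distinct characters.\<close>

definition bidegrees :: "nat \<Rightarrow> bidegree set" where "bidegrees g = Zg g \<times> Zg g"

definition torus :: "nat \<Rightarrow> torus_point set" where
  "torus g = {z. \<forall>\<mu><g. fst (z \<mu>) \<noteq> 0 \<and> snd (z \<mu>) \<noteq> 0}"

definition character :: "nat \<Rightarrow> bidegree \<Rightarrow> torus_point \<Rightarrow> complex" where
  "character g w z = (\<Prod>\<mu><g. fst (z \<mu>) powi fst w \<mu> * snd (z \<mu>) powi snd w \<mu>)"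

definition torus_mult :: "torus_point \<Rightarrow> torus_point \<Rightarrow> torus_point" where
  "torus_mult z z' = (\<lambda>\<mu>. (fst (z \<mu>) * fst (z' \<mu>), snd (z \<mu>) * snd (z' \<mu>)))"

definition torus_at :: "nat \<Rightarrow> complex \<Rightarrow> complex \<Rightarrow> torus_point" where
  "torus_at \<mu> x y = (\<lambda>\<nu>. if \<nu> = \<mu> then (x, y) else (1, 1))"

definition bidegree_add :: "nat \<Rightarrow> bidegree \<Rightarrow> bidegree \<Rightarrow> bidegree" where
  "bidegree_add g w w' = (\<lambda>\<mu>\<in>{..<g}. fst w \<mu> + fst w' \<mu>, \<lambda>\<mu>\<in>{..<g}. snd w \<mu> + snd w' \<mu>)"

lemma torus_mult_closed: "z \<in> torus g \<Longrightarrow> z' \<in> torus g \<Longrightarrow> torus_mult z z' \<in> torus g"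
  by (simp add: torus_def torus_mult_def)

lemma torus_at_closed: "x \<noteq> 0 \<Longrightarrow> y \<noteq> 0 \<Longrightarrow> torus_at \<mu> x y \<in> torus g"
  by (simp add: torus_def torus_at_def)

lemma torus_one: "(\<lambda>_. (1, 1)) \<in> torus g"
  by (simp add: torus_def)

lemma character_mult: "character g w (torus_mult z z') = character g w z * character g w z'"
  by (simp add: character_def torus_mult_def power_int_mult_distrib prod.distrib[symmetric] mult_ac)

lemma character_one [simp]: "character g w (\<lambda>_. (1, 1)) = 1"
  by (simp add: character_def)

lemma character_torus_at: "\<mu> < g \<Longrightarrow> character g w (torus_at \<mu> x y) = x powi fst w \<mu> * y powi snd w \<mu>"
proof -
  assume \<mu>: "\<mu> < g"
  have "character g w (torus_at \<mu> x y)
    = (\<Prod>\<nu><g. if \<nu> = \<mu> then x powi fst w \<mu> * y powi snd w \<mu> else 1)"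
    unfolding character_def torus_at_def by (rule prod.cong) auto
  then show ?thesis using \<mu> by simp
qed

lemma character_add: "z \<in> torus g \<Longrightarrow> character g (bidegree_add g w w') z = character g w z * character g w' z"
  unfolding character_def prod.distrib[symmetric]
  by (rule prod.cong) (auto simp: bidegree_add_def torus_def power_int_add mult_ac)

lemma bidegree_add_closed: "bidegree_add g w w' \<in> bidegrees g"
  by (auto simp: bidegree_add_def bidegrees_def Zg_def)

lemma bidegree_eqI:
  assumes "w \<in> bidegrees g" "w' \<in> bidegrees g"
    and "\<And>\<mu>. \<mu> < g \<Longrightarrow> fst w \<mu> = fst w' \<mu>" "\<And>\<mu>. \<mu> < g \<Longrightarrow> snd w \<mu> = snd w' \<mu>"
  shows "w = w'"
proof -
  have "fst w = fst w'" "snd w = snd w'"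
    using assms unfolding bidegrees_def Zg_def
    by (auto intro!: PiE_ext[of _ "{..<g}" "\<lambda>_. UNIV"])
  then show ?thesis by (rule prod_eqI)
qed

text \<open>The points with coordinates \<open>1\<close> and \<open>2\<close> suffice to separate characters of a torus.\<close>

lemma two_powi_inject: "(2::complex) powi a = 2 powi b \<longleftrightarrow> a = b"
proof
  assume "(2::complex) powi a = 2 powi b"
  then have "norm ((2::complex) powi a) = norm ((2::complex) powi b)" by simp
  then have "(2::real) powi a = 2 powi b" by (simp add: norm_power_int)
  then show "a = b"
    using power_int_strict_increasing[of a b "2::real"] power_int_strict_increasing[of b a "2::real"]
    by (cases a b rule: linorder_cases) auto
qed simp

lemma character_eq_iff:
  assumes "w \<in> bidegrees g" "w' \<in> bidegrees g"
    and eq: "\<And>z. z \<in> torus g \<Longrightarrow> character g w z = character g w' z"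
  shows "w = w'"
proof (rule bidegree_eqI[OF assms(1,2)])
  fix \<mu> assume \<mu>: "\<mu> < g"
  show "fst w \<mu> = fst w' \<mu>"
    using eq[OF torus_at_closed, of 2 1 \<mu>] \<mu> by (simp add: character_torus_at two_powi_inject)
  show "snd w \<mu> = snd w' \<mu>"
    using eq[OF torus_at_closed, of 1 2 \<mu>] \<mu> by (simp add: character_torus_at two_powi_inject)
qed

context complex_fd_space
begin

lemma independent_torus_characters:
  assumes "finite J" "J \<subseteq> bidegrees g"
  shows "independent_on (torus g) (character g) J"
proof (rule independent_characters[OF assms(1), where m = torus_mult])
  show "\<exists>s\<in>torus g. character g i s \<noteq> 0" for i
    using torus_one by (intro bexI[of _ "\<lambda>_. (1, 1)"]) auto
  show "\<exists>s\<in>torus g. character g i s \<noteq> character g j s" if "i \<in> J" "j \<in> J" "i \<noteq> j" for i j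
    using character_eq_iff[of i g j] that assms(2) by blast
qed (simp_all add: torus_mult_closed character_mult)

end

section \<open>Generators of the product group\<close>

definition torus_elt :: "nat \<Rightarrow> torus_point \<Rightarrow> nat \<Rightarrow> hodge_point" where
  "torus_elt g z = (\<lambda>\<mu>\<in>{..<g}. (z \<mu>, \<one>\<^bsub>Ulim\<^esub>))"

definition unip_elt :: "nat \<Rightarrow> nat \<Rightarrow> (nat \<Rightarrow> hlie set) \<Rightarrow> nat \<Rightarrow> hodge_point" where
  "unip_elt g \<mu> u = factor g \<mu> ((1, 1), u)"

lemma GC_carrier: "(z, u) \<in> carrier GC \<longleftrightarrow> fst z \<noteq> 0 \<and> snd z \<noteq> 0 \<and> u \<in> carrier Ulim"
  by (cases z) (simp add: GC_def)

lemma GC_mult: "(z, u) \<otimes>\<^bsub>GC\<^esub> (z', v) = ((fst z * fst z', snd z * snd z'), u \<otimes>\<^bsub>Ulim\<^esub> Ulim_act z v)"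
  by (cases z; cases z') (simp add: GC_def)

lemma GC_one: "\<one>\<^bsub>GC\<^esub> = ((1, 1), \<one>\<^bsub>Ulim\<^esub>)"
  by (simp add: GC_def)

lemma Ulim_one_closed: "\<one>\<^bsub>Ulim\<^esub> \<in> carrier Ulim"
  by (simp add: Ulim_one lie_lift_Ulim)

lemma Ulim_act_Ulim_one: "Ulim_act z \<one>\<^bsub>Ulim\<^esub> = \<one>\<^bsub>Ulim\<^esub>"
  by (simp add: Ulim_one Ulim_act_lift lie_act_simps)

lemma GCg_carrier: "a \<in> carrier (GCg g) \<longleftrightarrow> a \<in> extensional {..<g} \<and> (\<forall>\<mu><g. a \<mu> \<in> carrier GC)"
  by (auto simp: GCg_def PiE_iff)

lemma GCg_mult: "a \<otimes>\<^bsub>GCg g\<^esub> b = (\<lambda>\<mu>\<in>{..<g}. a \<mu> \<otimes>\<^bsub>GC\<^esub> b \<mu>)"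
  by (simp add: GCg_def)

lemma GC_closed: "a \<in> carrier GC \<Longrightarrow> b \<in> carrier GC \<Longrightarrow> a \<otimes>\<^bsub>GC\<^esub> b \<in> carrier GC"
  by (cases a; cases b) (simp add: GC_mult GC_carrier Ulim_mult_closed Ulim_act_closed)

lemma GCg_closed: "a \<in> carrier (GCg g) \<Longrightarrow> b \<in> carrier (GCg g) \<Longrightarrow> a \<otimes>\<^bsub>GCg g\<^esub> b \<in> carrier (GCg g)"
  by (simp add: GCg_carrier GCg_mult GC_closed)

lemma torus_elt_closed: "z \<in> torus g \<Longrightarrow> torus_elt g z \<in> carrier (GCg g)"
  by (simp add: GCg_carrier torus_elt_def GC_carrier torus_def Ulim_one_closed)

lemma unip_elt_at: "\<nu> < g \<Longrightarrow> unip_elt g \<mu> u \<nu> = ((1, 1), if \<nu> = \<mu> then u else \<one>\<^bsub>Ulim\<^esub>)"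
  by (simp add: unip_elt_def factor_def GC_one)

lemma unip_elt_closed: "u \<in> carrier Ulim \<Longrightarrow> unip_elt g \<mu> u \<in> carrier (GCg g)"
  by (simp add: GCg_carrier unip_elt_at GC_carrier Ulim_one_closed)
    (simp add: unip_elt_def factor_def)

lemma GCg_eqI: "(\<And>\<nu>. \<nu> < g \<Longrightarrow> a \<nu> = b \<nu>) \<Longrightarrow> a \<in> extensional {..<g} \<Longrightarrow> b \<in> extensional {..<g} \<Longrightarrow> a = b"
  by (rule extensionalityI) auto

lemma ext_simps: "torus_elt g z \<in> extensional {..<g}" "unip_elt g \<mu> u \<in> extensional {..<g}"
  "a \<otimes>\<^bsub>GCg g\<^esub> b \<in> extensional {..<g}"
  by (simp_all add: torus_elt_def unip_elt_def factor_def GCg_mult)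

lemma torus_elt_at: "\<nu> < g \<Longrightarrow> torus_elt g z \<nu> = (z \<nu>, \<one>\<^bsub>Ulim\<^esub>)"
  by (simp add: torus_elt_def)

lemma factor_torus: "factor g \<mu> ((x, y), \<one>\<^bsub>Ulim\<^esub>) = torus_elt g (torus_at \<mu> x y)"
  by (auto simp: factor_def torus_elt_def torus_at_def GC_one fun_eq_iff)

lemma torus_elt_mult: "torus_elt g z \<otimes>\<^bsub>GCg g\<^esub> torus_elt g z' = torus_elt g (torus_mult z z')"
  by (rule GCg_eqI[where g = g]) (simp_all add: ext_simps GCg_mult torus_elt_at GC_mult torus_mult_def
      Ulim_act_Ulim_one Ulim_r_one Ulim_one_closed)

lemma unip_elt_mult:
  "u \<in> carrier Ulim \<Longrightarrow> v \<in> carrier Ulim \<Longrightarrow>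
    unip_elt g \<mu> u \<otimes>\<^bsub>GCg g\<^esub> unip_elt g \<mu> v = unip_elt g \<mu> (u \<otimes>\<^bsub>Ulim\<^esub> v)"
  by (rule GCg_eqI[where g = g]) (simp_all add: ext_simps GCg_mult unip_elt_at GC_mult
      Ulim_act_one Ulim_r_one Ulim_one_closed)

lemma unip_elt_comm:
  "u \<in> carrier Ulim \<Longrightarrow> v \<in> carrier Ulim \<Longrightarrow> \<mu> \<noteq> \<nu> \<Longrightarrow>
    unip_elt g \<mu> u \<otimes>\<^bsub>GCg g\<^esub> unip_elt g \<nu> v = unip_elt g \<nu> v \<otimes>\<^bsub>GCg g\<^esub> unip_elt g \<mu> u"
  by (rule GCg_eqI[where g = g]) (auto simp: ext_simps GCg_mult unip_elt_at GC_mult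
      Ulim_act_one Ulim_r_one Ulim_l_one Ulim_one_closed)

lemma torus_unip:
  "u \<in> carrier Ulim \<Longrightarrow> z \<in> torus g \<Longrightarrow>
    torus_elt g z \<otimes>\<^bsub>GCg g\<^esub> unip_elt g \<mu> u = unip_elt g \<mu> (Ulim_act (z \<mu>) u) \<otimes>\<^bsub>GCg g\<^esub> torus_elt g z"
  by (rule GCg_eqI[where g = g]) (auto simp: ext_simps GCg_mult unip_elt_at torus_elt_at GC_mult Ulim_act_Ulim_one
      Ulim_act_one Ulim_r_one Ulim_l_one Ulim_one_closed Ulim_act_closed)

text \<open>The product of the first \<open>k\<close> unipotent components.\<close>

definition unip_prefix :: "nat \<Rightarrow> (nat \<Rightarrow> nat \<Rightarrow> hlie set) \<Rightarrow> nat \<Rightarrow> nat \<Rightarrow> hodge_point" where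
  "unip_prefix g u k = (\<lambda>\<mu>\<in>{..<g}. ((1, 1), if \<mu> < k then u \<mu> else \<one>\<^bsub>Ulim\<^esub>))"

lemma unip_prefix_0: "unip_prefix g u 0 = torus_elt g (\<lambda>_. (1, 1))"
  by (simp add: unip_prefix_def torus_elt_def)

lemma unip_prefix_closed: "(\<And>\<mu>. \<mu> < g \<Longrightarrow> u \<mu> \<in> carrier Ulim) \<Longrightarrow> unip_prefix g u k \<in> carrier (GCg g)"
  by (simp add: GCg_carrier unip_prefix_def GC_carrier Ulim_one_closed)

lemma unip_prefix_Suc:
  assumes "\<And>\<mu>. \<mu> < g \<Longrightarrow> u \<mu> \<in> carrier Ulim" "k < g"
  shows "unip_prefix g u (Suc k) = unip_prefix g u k \<otimes>\<^bsub>GCg g\<^esub> unip_elt g k (u k)"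
proof (rule GCg_eqI[where g = g])
  fix \<nu> assume "\<nu> < g"
  then show "unip_prefix g u (Suc k) \<nu> = (unip_prefix g u k \<otimes>\<^bsub>GCg g\<^esub> unip_elt g k (u k)) \<nu>"
    using assms by (cases \<nu> k rule: linorder_cases)
      (simp_all add: unip_prefix_def GCg_mult unip_elt_at GC_mult Ulim_act_one Ulim_one_closed
        Ulim_r_one Ulim_l_one)
qed (simp_all add: ext_simps unip_prefix_def)

lemma GCg_decompose:
  assumes "a \<in> carrier (GCg g)"
  shows "a = unip_prefix g (snd \<circ> a) g \<otimes>\<^bsub>GCg g\<^esub> torus_elt g (fst \<circ> a)"
proof (rule GCg_eqI[where g = g])
  fix \<nu> assume \<nu>: "\<nu> < g"
  then have "a \<nu> \<in> carrier GC" using assms by (simp add: GCg_carrier)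
  then have "snd (a \<nu>) \<in> carrier Ulim" by (cases "a \<nu>") (simp add: GC_carrier)
  then show "a \<nu> = (unip_prefix g (snd \<circ> a) g \<otimes>\<^bsub>GCg g\<^esub> torus_elt g (fst \<circ> a)) \<nu>"
    using \<nu> by (simp add: unip_prefix_def GCg_mult torus_elt_at GC_mult Ulim_act_Ulim_one Ulim_r_one)
qed (use assms in \<open>simp_all add: ext_simps GCg_carrier\<close>)

lemma GCg_parts:
  assumes "a \<in> carrier (GCg g)"
  shows "\<mu> < g \<Longrightarrow> snd (a \<mu>) \<in> carrier Ulim" and "fst \<circ> a \<in> torus g"
  using assms by (auto simp: GCg_carrier torus_def) (metis GC_carrier prod.collapse)+

text \<open>The torus and the unipotent factors generate the group.\<close>

lemma GCg_hom_eqI: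
  fixes f f' :: "(nat \<Rightarrow> hodge_point) \<Rightarrow> 'r::unital_ring"
  assumes f: "\<And>a b. a \<in> carrier (GCg g) \<Longrightarrow> b \<in> carrier (GCg g) \<Longrightarrow> f (a \<otimes>\<^bsub>GCg g\<^esub> b) = f a * f b"
    and f': "\<And>a b. a \<in> carrier (GCg g) \<Longrightarrow> b \<in> carrier (GCg g) \<Longrightarrow> f' (a \<otimes>\<^bsub>GCg g\<^esub> b) = f' a * f' b"
    and tor: "\<And>z. z \<in> torus g \<Longrightarrow> f (torus_elt g z) = f' (torus_elt g z)"
    and unip: "\<And>\<mu> u. \<mu> < g \<Longrightarrow> u \<in> carrier Ulim \<Longrightarrow> f (unip_elt g \<mu> u) = f' (unip_elt g \<mu> u)"
    and a: "a \<in> carrier (GCg g)"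
  shows "f a = f' a"
proof -
  note u = GCg_parts(1)[OF a]
  let ?u = "snd \<circ> a"
  have pc: "unip_prefix g ?u k \<in> carrier (GCg g)" for k
    using u by (intro unip_prefix_closed) simp
  have "k \<le> g \<Longrightarrow> f (unip_prefix g ?u k) = f' (unip_prefix g ?u k)" for k
  proof (induct k)
    case 0
    show ?case by (simp add: unip_prefix_0 tor torus_one)
  next
    case (Suc k)
    then show ?case
      using u by (simp add: unip_prefix_Suc f f' pc[unfolded o_def] unip_elt_closed unip)
  qed
  then have "f (unip_prefix g ?u g) = f' (unip_prefix g ?u g)" by simp
  then have "f (unip_prefix g ?u g \<otimes>\<^bsub>GCg g\<^esub> torus_elt g (fst \<circ> a))
      = f' (unip_prefix g ?u g \<otimes>\<^bsub>GCg g\<^esub> torus_elt g (fst \<circ> a))"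
    by (simp only: f f' pc torus_elt_closed[OF GCg_parts(2)[OF a]] tor[OF GCg_parts(2)[OF a]])
  then show ?thesis by (simp only: GCg_decompose[OF a, symmetric])
qed

section \<open>Regular functions on the torus and on the unipotent factors\<close>

lemma character_combination_mult:
  assumes "finite J" "J \<subseteq> bidegrees g" "finite J'" "J' \<subseteq> bidegrees g"
  shows "\<exists>K d. finite K \<and> K \<subseteq> bidegrees g \<and> (\<forall>z\<in>torus g.
    (\<Sum>w\<in>J. c w * character g w z) * (\<Sum>w\<in>J'. c' w * character g w z) = (\<Sum>w\<in>K. d w * character g w z))"
proof -
  define h where "h = (\<lambda>(w, w'). bidegree_add g w w')"
  define d where "d = (\<lambda>v. \<Sum>(w, w') | (w, w') \<in> J \<times> J' \<and> h (w, w') = v. c w * c' w')"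
  have "(\<Sum>w\<in>J. c w * character g w z) * (\<Sum>w\<in>J'. c' w * character g w z)
      = (\<Sum>w\<in>h ` (J \<times> J'). d w * character g w z)" if z: "z \<in> torus g" for z
  proof -
    have "(\<Sum>w\<in>J. c w * character g w z) * (\<Sum>w\<in>J'. c' w * character g w z)
      = (\<Sum>p\<in>J \<times> J'. c (fst p) * c' (snd p) * character g (h p) z)"
      unfolding sum_product sum.cartesian_product
      by (rule sum.cong) (auto simp: h_def character_add[OF z] mult_ac)
    also have "\<dots> = (\<Sum>v\<in>h ` (J \<times> J'). \<Sum>p | p \<in> J \<times> J' \<and> h p = v. c (fst p) * c' (snd p) * character g (h p) z)"
      by (rule sum.image_gen) (use assms in auto)
    also have "\<dots> = (\<Sum>w\<in>h ` (J \<times> J'). d w * character g w z)"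
      unfolding d_def sum_distrib_right by (intro sum.cong) (auto simp: split_beta)
    finally show ?thesis .
  qed
  moreover have "finite (h ` (J \<times> J'))" "h ` (J \<times> J') \<subseteq> bidegrees g"
    using assms by (auto simp: h_def bidegree_add_closed)
  ultimately show ?thesis by blast
qed

lemma character_combination_add:
  assumes "finite J" "J \<subseteq> bidegrees g" "finite J'" "J' \<subseteq> bidegrees g"
  shows "\<exists>K d. finite K \<and> K \<subseteq> bidegrees g \<and> (\<forall>z\<in>torus g.
    (\<Sum>w\<in>J. c w * character g w z) + (\<Sum>w\<in>J'. c' w * character g w z) = (\<Sum>w\<in>K. d w * character g w z))"
proof -
  define d where "d = (\<lambda>w. (if w \<in> J then c w else 0) + (if w \<in> J' then c' w else 0))"
  have "(\<Sum>w\<in>J. c w * character g w z) = (\<Sum>w\<in>J \<union> J'. (if w \<in> J then c w else 0) * character g w z)"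
    "(\<Sum>w\<in>J'. c' w * character g w z) = (\<Sum>w\<in>J \<union> J'. (if w \<in> J' then c' w else 0) * character g w z)" for z
    using assms by (auto intro!: sum.mono_neutral_cong_left)
  then have "(\<Sum>w\<in>J. c w * character g w z) + (\<Sum>w\<in>J'. c' w * character g w z)
      = (\<Sum>w\<in>J \<union> J'. d w * character g w z)" for z
    by (simp add: d_def distrib_right sum.distrib)
  then show ?thesis using assms by (intro exI[of _ "J \<union> J'"] exI[of _ d]) auto
qed

text \<open>Restricted to the torus, the generators of the coordinate ring are characters or
  constant, and characters are closed under products.\<close>

lemma regular_on_torus:
  assumes "f \<in> regular_functions g"
  shows "\<exists>J c. finite J \<and> J \<subseteq> bidegrees g \<and>
    (\<forall>z\<in>torus g. f (torus_elt g z) = (\<Sum>w\<in>J. c w * character g w z))"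
proof -
  define comb where "comb = (\<lambda>h. \<exists>J c. finite J \<and> J \<subseteq> bidegrees g \<and>
    (\<forall>z\<in>torus g. h z = (\<Sum>w\<in>J. c w * character g w z)))"
  define w0 :: bidegree where "w0 = (\<lambda>\<mu>\<in>{..<g}. 0, \<lambda>\<mu>\<in>{..<g}. 0)"
  have monomial: "comb h" if "w \<in> bidegrees g" "\<And>z. z \<in> torus g \<Longrightarrow> h z = c * character g w z" for h w c
    unfolding comb_def using that by (intro exI[of _ "{w}"] exI[of _ "\<lambda>_. c"]) auto
  have const: "comb (\<lambda>_. c)" for c
    by (rule monomial[of w0 _ c]) (auto simp: w0_def bidegrees_def Zg_def character_def)
  have delta: "(\<Prod>\<nu><g. if \<nu> = \<mu> then F \<nu> else 1) = F \<mu>" if "\<mu> < g" for F :: "nat \<Rightarrow> complex" and \<mu>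
    using that by simp
  have coord1: "comb (\<lambda>z. fst (z \<mu>) powi k)" if "\<mu> < g" for \<mu> k
  proof (rule monomial[of "(\<lambda>\<nu>\<in>{..<g}. if \<nu> = \<mu> then k else 0, \<lambda>\<nu>\<in>{..<g}. 0)" _ 1])
    fix z
    have "character g (\<lambda>\<nu>\<in>{..<g}. if \<nu> = \<mu> then k else 0, \<lambda>\<nu>\<in>{..<g}. 0) z
      = (\<Prod>\<nu><g. if \<nu> = \<mu> then fst (z \<nu>) powi k else 1)"
      unfolding character_def by (rule prod.cong) auto
    then show "fst (z \<mu>) powi k = 1 * character g (\<lambda>\<nu>\<in>{..<g}. if \<nu> = \<mu> then k else 0, \<lambda>\<nu>\<in>{..<g}. 0) z"
      using delta[OF that, of "\<lambda>\<nu>. fst (z \<nu>) powi k"] by simp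
  qed (auto simp: bidegrees_def Zg_def)
  have coord2: "comb (\<lambda>z. snd (z \<mu>) powi k)" if "\<mu> < g" for \<mu> k
  proof (rule monomial[of "(\<lambda>\<nu>\<in>{..<g}. 0, \<lambda>\<nu>\<in>{..<g}. if \<nu> = \<mu> then k else 0)" _ 1])
    fix z
    have "character g (\<lambda>\<nu>\<in>{..<g}. 0, \<lambda>\<nu>\<in>{..<g}. if \<nu> = \<mu> then k else 0) z
      = (\<Prod>\<nu><g. if \<nu> = \<mu> then snd (z \<nu>) powi k else 1)"
      unfolding character_def by (rule prod.cong) auto
    then show "snd (z \<mu>) powi k = 1 * character g (\<lambda>\<nu>\<in>{..<g}. 0, \<lambda>\<nu>\<in>{..<g}. if \<nu> = \<mu> then k else 0) z"
      using delta[OF that, of "\<lambda>\<nu>. snd (z \<nu>) powi k"] by simp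
  qed (auto simp: bidegrees_def Zg_def)
  have comb_add: "comb (\<lambda>z. h z + h' z)" if h: "comb h" and h': "comb h'" for h h'
  proof -
    obtain J c where J: "finite J" "J \<subseteq> bidegrees g" "\<forall>z\<in>torus g. h z = (\<Sum>w\<in>J. c w * character g w z)"
      using h unfolding comb_def by meson
    obtain J' c' where J': "finite J'" "J' \<subseteq> bidegrees g" "\<forall>z\<in>torus g. h' z = (\<Sum>w\<in>J'. c' w * character g w z)"
      using h' unfolding comb_def by meson
    show ?thesis
      using character_combination_add[OF J(1,2) J'(1,2), of c c'] J(3) J'(3) unfolding comb_def by simp
  qed
  have comb_mult: "comb (\<lambda>z. h z * h' z)" if h: "comb h" and h': "comb h'" for h h'
  proof -
    obtain J c where J: "finite J" "J \<subseteq> bidegrees g" "\<forall>z\<in>torus g. h z = (\<Sum>w\<in>J. c w * character g w z)"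
      using h unfolding comb_def by meson
    obtain J' c' where J': "finite J'" "J' \<subseteq> bidegrees g" "\<forall>z\<in>torus g. h' z = (\<Sum>w\<in>J'. c' w * character g w z)"
      using h' unfolding comb_def by meson
    show ?thesis
      using character_combination_mult[OF J(1,2) J'(1,2), of c c'] J(3) J'(3) unfolding comb_def by simp
  qed
  have "comb (\<lambda>z. f (torus_elt g z))"
    using assms
  proof induct
    case (add f h)
    then show ?case by (intro comb_add)
  next
    case (mult f h)
    then show ?case by (intro comb_mult)
  qed (use coord1[of _ 1] coord1[of _ "-1"] coord2[of _ 1] coord2[of _ "-1"] const
       in \<open>simp_all add: torus_elt_at power_int_minus\<close>)
  then show ?thesis by (simp add: comb_def)
qed

inductive_set polynomial_functions :: "nat \<Rightarrow> (hlie set \<Rightarrow> complex) set" for n where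
  const: "(\<lambda>_. c) \<in> polynomial_functions n"
| linear: "un_linear_form n l \<Longrightarrow> l \<in> polynomial_functions n"
| add: "p \<in> polynomial_functions n \<Longrightarrow> p' \<in> polynomial_functions n \<Longrightarrow> (\<lambda>X. p X + p' X) \<in> polynomial_functions n"
| mult: "p \<in> polynomial_functions n \<Longrightarrow> p' \<in> polynomial_functions n \<Longrightarrow> (\<lambda>X. p X * p' X) \<in> polynomial_functions n"

lemma un_linear_form_proj:
  assumes "un_linear_form m l" "m \<le> n" shows "un_linear_form n (\<lambda>X. l (un_proj m X))"
  using assms by (simp add: un_linear_form_def un_proj_class Ln_add Ln_scale Ln_proj_add Ln_proj_scale Ln_proj_in)

text \<open>A regular function involves linear forms on only finitely many \<open>u\<^sub>m\<close>, and each of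
  them factors through \<open>u\<^sub>n\<close> for all larger \<open>n\<close>.\<close>

lemma regular_on_unip:
  assumes "f \<in> regular_functions g"
  shows "\<exists>n0. \<forall>n\<ge>n0. \<exists>p\<in>polynomial_functions n. \<forall>u\<in>carrier Ulim. f (unip_elt g \<mu> u) = p (u n)"
proof -
  have cst: "\<exists>n0. \<forall>n\<ge>n0. \<exists>p\<in>polynomial_functions n. \<forall>u\<in>carrier Ulim. F u = p (u n)"
    if "\<forall>u\<in>carrier Ulim. F u = c" for F c
    using that by (intro exI[of _ 0] allI impI bexI[OF _ polynomial_functions.const[of c]])
  show ?thesis
  using assms
proof induct
  case (unip \<nu> m l)
  show ?case
  proof (intro exI[of _ m] allI impI)
    fix n assume n: "m \<le> n"
    show "\<exists>p\<in>polynomial_functions n. \<forall>u\<in>carrier Ulim. l (snd (unip_elt g \<mu> u \<nu>) m) = p (u n)"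
    proof (cases "\<nu> = \<mu>")
      case True
      have "l (snd (unip_elt g \<mu> u \<nu>) m) = l (un_proj m (u n))" if "u \<in> carrier Ulim" for u
        using unip(1) True Ulim_proj[OF that, of m "n - m"] n by (simp add: unip_elt_at)
      then show ?thesis
        by (intro bexI[OF _ polynomial_functions.linear[OF un_linear_form_proj[OF unip(2) n]]]) simp
    next
      case False
      then show ?thesis
        using unip(1) by (intro bexI[OF _ polynomial_functions.const[of "l (\<one>\<^bsub>Ulim\<^esub> m)"]]) (simp add: unip_elt_at)
    qed
  qed
next
  case (add f h)
  from add(2) obtain n0 where
    n0: "\<forall>n\<ge>n0. \<exists>p\<in>polynomial_functions n. \<forall>u\<in>carrier Ulim. f (unip_elt g \<mu> u) = p (u n)" ..
  from add(4) obtain n1 where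
    n1: "\<forall>n\<ge>n1. \<exists>p\<in>polynomial_functions n. \<forall>u\<in>carrier Ulim. h (unip_elt g \<mu> u) = p (u n)" ..
  show ?case
  proof (intro exI[of _ "max n0 n1"] allI impI)
    fix n assume "max n0 n1 \<le> n"
    then have "n0 \<le> n" "n1 \<le> n" by auto
    obtain p where p: "p \<in> polynomial_functions n" "\<forall>u\<in>carrier Ulim. f (unip_elt g \<mu> u) = p (u n)"
      using n0[rule_format, OF \<open>n0 \<le> n\<close>] by (rule bexE)
    obtain p' where p': "p' \<in> polynomial_functions n" "\<forall>u\<in>carrier Ulim. h (unip_elt g \<mu> u) = p' (u n)"
      using n1[rule_format, OF \<open>n1 \<le> n\<close>] by (rule bexE)
    show "\<exists>p\<in>polynomial_functions n. \<forall>u\<in>carrier Ulim. f (unip_elt g \<mu> u) + h (unip_elt g \<mu> u) = p (u n)"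
      using p(2) p'(2) by (intro bexI[OF _ polynomial_functions.add[OF p(1) p'(1)]]) simp
  qed
next
  case (mult f h)
  from mult(2) obtain n0 where
    n0: "\<forall>n\<ge>n0. \<exists>p\<in>polynomial_functions n. \<forall>u\<in>carrier Ulim. f (unip_elt g \<mu> u) = p (u n)" ..
  from mult(4) obtain n1 where
    n1: "\<forall>n\<ge>n1. \<exists>p\<in>polynomial_functions n. \<forall>u\<in>carrier Ulim. h (unip_elt g \<mu> u) = p (u n)" ..
  show ?case
  proof (intro exI[of _ "max n0 n1"] allI impI)
    fix n assume "max n0 n1 \<le> n"
    then have "n0 \<le> n" "n1 \<le> n" by auto
    obtain p where p: "p \<in> polynomial_functions n" "\<forall>u\<in>carrier Ulim. f (unip_elt g \<mu> u) = p (u n)"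
      using n0[rule_format, OF \<open>n0 \<le> n\<close>] by (rule bexE)
    obtain p' where p': "p' \<in> polynomial_functions n" "\<forall>u\<in>carrier Ulim. h (unip_elt g \<mu> u) = p' (u n)"
      using n1[rule_format, OF \<open>n1 \<le> n\<close>] by (rule bexE)
    show "\<exists>p\<in>polynomial_functions n. \<forall>u\<in>carrier Ulim. f (unip_elt g \<mu> u) * h (unip_elt g \<mu> u) = p (u n)"
      using p(2) p'(2) by (intro bexI[OF _ polynomial_functions.mult[OF p(1) p'(1)]]) simp
  qed
next
  case (const c)
  show ?case by (rule cst[of _ c]) simp
qed (rule cst[of _ 1], simp add: unip_elt_at)+
qed

definition curve :: "nat \<Rightarrow> (nat \<Rightarrow> hlie) \<Rightarrow> complex \<Rightarrow> hlie" where
  "curve n W t = (\<Sum>i = 1..n. lscale (t ^ i) (W i))"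

lemma Ln_curve: "(\<And>i. W i \<in> Ln n) \<Longrightarrow> curve n W t \<in> Ln n"
  unfolding curve_def by (intro Ln_sum Ln_scale)

text \<open>The expansion of a polynomial function on \<open>u\<^sub>n\<close> to second order: along a curve
  \<open>t W\<^sub>1 + t\<^sup>2 W\<^sub>2 + \<dots>\<close> it is \<open>c0 + t l(W\<^sub>1) + t\<^sup>2 (l(W\<^sub>2) + b(W\<^sub>1)) + \<dots>\<close> with \<open>l\<close> linear;
  \<open>b\<close> takes the same value for all curves with the same tangent vector \<open>W\<^sub>1\<close>.\<close>

definition jet :: "nat \<Rightarrow> (hlie set \<Rightarrow> complex) \<Rightarrow> complex \<Rightarrow> (hlie \<Rightarrow> complex) \<Rightarrow> (hlie \<Rightarrow> complex) \<Rightarrow> bool" where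
  "jet n p c0 l b \<longleftrightarrow> (\<forall>x\<in>Ln n. \<forall>y\<in>Ln n. l (x + y) = l x + l y) \<and>
     (\<forall>c. \<forall>x\<in>Ln n. l (lscale c x) = c * l x) \<and>
     (\<forall>W. (\<forall>i. W i \<in> Ln n) \<longrightarrow> (\<exists>r. (\<forall>t. p (un_class n (curve n W t)) = poly r t) \<and>
        coeff r 0 = c0 \<and> coeff r 1 = l (W 1) \<and> coeff r 2 = l (W 2) + b (W 1)))"

lemma jet_curve:
  assumes "jet n p c l b" "\<forall>i. W i \<in> Ln n"
  obtains r where "\<And>t. p (un_class n (curve n W t)) = poly r t" "coeff r 0 = c"
    "coeff r 1 = l (W 1)" "coeff r 2 = l (W 2) + b (W 1)"
proof -
  have "\<exists>r. (\<forall>t. p (un_class n (curve n W t)) = poly r t) \<and>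
        coeff r 0 = c \<and> coeff r 1 = l (W 1) \<and> coeff r 2 = l (W 2) + b (W 1)"
    using assms unfolding jet_def by (elim conjE) (drule spec[of _ W], erule mp, assumption)
  then obtain r where r: "(\<forall>t. p (un_class n (curve n W t)) = poly r t) \<and>
        coeff r 0 = c \<and> coeff r 1 = l (W 1) \<and> coeff r 2 = l (W 2) + b (W 1)" ..
  show ?thesis by (rule that[of r]) (simp_all add: r[simplified])
qed

lemma polynomial_function_jet:
  assumes "p \<in> polynomial_functions n" "n \<ge> 2"
  shows "\<exists>c0 l b. jet n p c0 l b"
  using assms(1)
proof induct
  case (const c)
  have "jet n (\<lambda>_. c) c (\<lambda>_. 0) (\<lambda>_. 0)"
    unfolding jet_def by (auto intro!: exI[of _ "[:c:]"] simp: numeral_2_eq_2)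
  then show ?case by blast
next
  case (linear l)
  have l: "l (un_class n (x + y)) = l (un_class n x) + l (un_class n y)"
    "l (un_class n (lscale c x)) = c * l (un_class n x)" if "x \<in> Ln n" "y \<in> Ln n" for x y c
    using linear that by (auto simp: un_linear_form_def)
  have l0: "l (un_class n 0) = 0" using l(2)[of 0 0 0] by (simp add: Ln_0)
  have lsum: "l (un_class n (\<Sum>i\<in>I. f i)) = (\<Sum>i\<in>I. l (un_class n (f i)))"
    if "\<And>i. f i \<in> Ln n" for f and I :: "nat set"
    by (induct I rule: infinite_finite_induct) (auto simp: l0 l that Ln_sum)
  have "jet n l 0 (\<lambda>x. l (un_class n x)) (\<lambda>_. 0)"
    unfolding jet_def
  proof (intro conjI ballI allI impI)
    fix W :: "nat \<Rightarrow> hlie" assume W: "\<forall>i. W i \<in> Ln n"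
    define r where "r = (\<Sum>i = 1..n. monom (l (un_class n (W i))) i)"
    have r: "coeff r i = (if 1 \<le> i \<and> i \<le> n then l (un_class n (W i)) else 0)" for i
      by (simp add: r_def coeff_sum coeff_monom)
    have "l (un_class n (curve n W t)) = poly r t" for t
      using W by (simp add: curve_def lsum Ln_scale l[OF _ Ln_0] r_def poly_sum poly_monom mult.commute)
    then show "\<exists>r. (\<forall>t. l (un_class n (curve n W t)) = poly r t) \<and> coeff r 0 = 0 \<and>
        coeff r 1 = l (un_class n (W 1)) \<and> coeff r 2 = l (un_class n (W 2)) + 0"
      using assms(2) by (intro exI[of _ r]) (simp add: r)
  qed (simp_all add: l l[OF _ Ln_0])
  then show ?case by blast
next
  case (add p p')
  then obtain c l b c' l' b' where j: "jet n p c l b" "jet n p' c' l' b'" by blast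
  have "jet n (\<lambda>X. p X + p' X) (c + c') (\<lambda>x. l x + l' x) (\<lambda>x. b x + b' x)"
    unfolding jet_def
  proof (intro conjI ballI allI impI)
    fix W :: "nat \<Rightarrow> hlie" assume W: "\<forall>i. W i \<in> Ln n"
    obtain r where r: "\<And>t. p (un_class n (curve n W t)) = poly r t" "coeff r 0 = c"
      "coeff r 1 = l (W 1)" "coeff r 2 = l (W 2) + b (W 1)" using j(1) W by (rule jet_curve) (rule that)
    obtain r' where r': "\<And>t. p' (un_class n (curve n W t)) = poly r' t" "coeff r' 0 = c'"
      "coeff r' 1 = l' (W 1)" "coeff r' 2 = l' (W 2) + b' (W 1)" using j(2) W by (rule jet_curve) (rule that)
    show "\<exists>r. (\<forall>t. p (un_class n (curve n W t)) + p' (un_class n (curve n W t)) = poly r t) \<and>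
        coeff r 0 = c + c' \<and> coeff r 1 = l (W 1) + l' (W 1) \<and>
        coeff r 2 = l (W 2) + l' (W 2) + (b (W 1) + b' (W 1))"
      by (intro exI[of _ "r + r'"]) (use r r' in simp)
  qed (use j in \<open>auto simp: jet_def algebra_simps\<close>)
  then show ?case by blast
next
  case (mult p p')
  then obtain c l b c' l' b' where j: "jet n p c l b" "jet n p' c' l' b'" by blast
  have "jet n (\<lambda>X. p X * p' X) (c * c') (\<lambda>x. c * l' x + c' * l x)
      (\<lambda>x. c * b' x + c' * b x + l x * l' x)"
    unfolding jet_def
  proof (intro conjI ballI allI impI)
    fix W :: "nat \<Rightarrow> hlie" assume W: "\<forall>i. W i \<in> Ln n"
    obtain r where r: "\<And>t. p (un_class n (curve n W t)) = poly r t" "coeff r 0 = c"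
      "coeff r 1 = l (W 1)" "coeff r 2 = l (W 2) + b (W 1)" using j(1) W by (rule jet_curve) (rule that)
    obtain r' where r': "\<And>t. p' (un_class n (curve n W t)) = poly r' t" "coeff r' 0 = c'"
      "coeff r' 1 = l' (W 1)" "coeff r' 2 = l' (W 2) + b' (W 1)" using j(2) W by (rule jet_curve) (rule that)
    show "\<exists>r. (\<forall>t. p (un_class n (curve n W t)) * p' (un_class n (curve n W t)) = poly r t) \<and>
        coeff r 0 = c * c' \<and> coeff r 1 = c * l' (W 1) + c' * l (W 1) \<and>
        coeff r 2 = c * l' (W 2) + c' * l (W 2) +
          (c * b' (W 1) + c' * b (W 1) + l (W 1) * l' (W 1))"
      by (intro exI[of _ "r * r'"])
        (use r r' in \<open>simp add: coeff_mult numeral_2_eq_2 algebra_simps\<close>)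
  qed (use j in \<open>auto simp: jet_def algebra_simps\<close>)
  then show ?case by blast
qed

context complex_fd_space
begin

section \<open>One-parameter groups of operators\<close>

definition operator_poly :: "(complex \<Rightarrow> 'v endo) \<Rightarrow> (nat \<Rightarrow> 'v endo) \<Rightarrow> bool" where
  "operator_poly F A \<longleftrightarrow> (\<exists>M. (\<forall>k>M. A k = 0) \<and> (\<forall>t. F t = (\<Sum>k\<le>M. S (t ^ k) * A k)))"

lemma operator_poly_bound:
  assumes "operator_poly F A"
  obtains M where "\<And>k. k > M \<Longrightarrow> A k = 0" "\<And>t N. N \<ge> M \<Longrightarrow> F t = (\<Sum>k\<le>N. S (t ^ k) * A k)"
proof -
  obtain M where M: "\<forall>k>M. A k = 0" "\<forall>t. F t = (\<Sum>k\<le>M. S (t ^ k) * A k)"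
    using assms unfolding operator_poly_def by (elim exE conjE)
  have "F t = (\<Sum>k\<le>N. S (t ^ k) * A k)" if "N \<ge> M" for t N
    unfolding M(2)[rule_format, of t] by (rule sum.mono_neutral_left) (use that M(1) in auto)
  then show ?thesis using M(1) by (intro that[of M]) simp_all
qed

lemma operator_poly_unique:
  assumes "operator_poly F A" "operator_poly F B"
  shows "A = B"
proof
  fix k
  obtain M where M: "\<And>k. k > M \<Longrightarrow> A k = 0" "\<And>t N. N \<ge> M \<Longrightarrow> F t = (\<Sum>k\<le>N. S (t ^ k) * A k)"
    using operator_poly_bound[OF assms(1)] by metis
  obtain M' where M': "\<And>k. k > M' \<Longrightarrow> B k = 0" "\<And>t N. N \<ge> M' \<Longrightarrow> F t = (\<Sum>k\<le>N. S (t ^ k) * B k)"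
    using operator_poly_bound[OF assms(2)] by metis
  define N where "N = max (max M M') k"
  have N: "M \<le> N" "M' \<le> N" "k \<le> N" by (auto simp: N_def)
  have "(\<Sum>k\<le>N. S (t ^ k) * A k) = (\<Sum>k\<le>N. S (t ^ k) * B k)" for t
    using M(2)[OF N(1), of t] M'(2)[OF N(2), of t] by simp
  then show "A k = B k"
    using operator_family_unique2[OF independent_monomials[of N], where A = A and A' = B and i = k] N(3) by simp
qed

lemma operator_poly_mult:
  assumes "operator_poly F A" "operator_poly G B" and lin: "\<And>i. Lin (A i)"
  shows "operator_poly (\<lambda>t. F t * G t) (\<lambda>k. \<Sum>i\<le>k. A i * B (k - i))"
proof -
  obtain M where M: "\<And>k. k > M \<Longrightarrow> A k = 0" "\<And>t N. N \<ge> M \<Longrightarrow> F t = (\<Sum>k\<le>N. S (t ^ k) * A k)"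
    using operator_poly_bound[OF assms(1)] by metis
  obtain M' where M': "\<And>k. k > M' \<Longrightarrow> B k = 0" "\<And>t N. N \<ge> M' \<Longrightarrow> G t = (\<Sum>k\<le>N. S (t ^ k) * B k)"
    using operator_poly_bound[OF assms(2)] by metis
  define h where "h = (\<lambda>t i j. S (t ^ (i + j)) * (A i * B j))"
  have AB: "A i * B j = 0" if "i + j > M + M'" for i j
    using that M(1)[of i] M'(1)[of j] by (cases "i > M") auto
  show ?thesis
    unfolding operator_poly_def
  proof (intro exI[of _ "M + M'"] conjI allI impI)
    fix k assume "M + M' < k"
    then show "(\<Sum>i\<le>k. A i * B (k - i)) = 0" by (intro sum.neutral ballI AB) simp
  next
    fix t
    have hh: "(S (t ^ i) * A i) * (S (t ^ j) * B j) = h t i j" for i j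
      unfolding h_def power_add S_simps(5) by (simp add: mult.assoc Lin_S_left[OF lin])
    have "F t * G t = (\<Sum>i\<le>M + M'. \<Sum>j\<le>M + M'. h t i j)"
      using M(2)[of "M + M'" t] M'(2)[of "M + M'" t] by (simp add: sum_product hh)
    also have "\<dots> = (\<Sum>(i, j)\<in>{..M + M'} \<times> {..M + M'}. h t i j)"
      by (rule sum.cartesian_product)
    also have "\<dots> = (\<Sum>(i, j) | i + j \<le> M + M'. h t i j)"
    proof (rule sum.mono_neutral_right)
      show "\<forall>p\<in>{..M + M'} \<times> {..M + M'} - {(i, j). i + j \<le> M + M'}. (case p of (i, j) \<Rightarrow> h t i j) = 0"
        using AB by (simp add: split_beta not_le h_def)
    qed auto
    also have "\<dots> = (\<Sum>k\<le>M + M'. \<Sum>i\<le>k. h t i (k - i))"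
      by (rule sum.triangle_reindex_eq)
    also have "\<dots> = (\<Sum>k\<le>M + M'. S (t ^ k) * (\<Sum>i\<le>k. A i * B (k - i)))"
      by (simp add: sum_distrib_left h_def)
    finally show "F t * G t = (\<Sum>k\<le>M + M'. S (t ^ k) * (\<Sum>i\<le>k. A i * B (k - i)))" .
  qed
qed

lemma operator_poly_exists:
  assumes lin: "\<And>t. Lin (F t)"
    and coeffs: "\<And>\<xi> v. functional \<xi> \<Longrightarrow> \<exists>r. \<forall>t. \<xi> (app (F t) v) = poly r t"
  obtains A where "operator_poly F A" "\<And>k. Lin (A k)"
proof -
  have "\<exists>J c. finite J \<and> J \<subseteq> UNIV \<and> (\<forall>t\<in>UNIV. \<xi> (app (F t) v) = (\<Sum>i\<in>J. c i * t ^ i))"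
    if \<xi>: "functional \<xi>" for \<xi> v
  proof -
    obtain r where "\<forall>t. \<xi> (app (F t) v) = poly r t" using coeffs[OF \<xi>] ..
    then show ?thesis
      by (intro exI[of _ "{..degree r}"] exI[of _ "coeff r"]) (simp add: poly_altdef)
  qed
  from operator_family[of UNIV F UNIV "\<lambda>k t. t ^ k", OF lin this]
  obtain J A where J: "finite J" "\<And>i. Lin (A i)" "\<And>t. F t = (\<Sum>i\<in>J. S (t ^ i) * A i)"
    by (metis UNIV_I)
  define A' where "A' = (\<lambda>k. if k \<in> J then A k else 0)"
  obtain M where M: "J \<subseteq> {..M}" using J(1) finite_nat_iff_bounded_le by blast
  have "F t = (\<Sum>k\<le>M. S (t ^ k) * A' k)" for t
    unfolding J(3) A'_def by (rule sum.mono_neutral_cong_left) (use M in auto)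
  then have "operator_poly F A'"
    unfolding operator_poly_def A'_def using M by (intro exI[of _ M]) auto
  then show ?thesis by (rule that) (simp add: A'_def J)
qed

lemma operator_poly_coeff:
  assumes "operator_poly F A" "functional \<xi>" "\<And>t. \<xi> (app (F t) v) = poly r t"
  shows "\<xi> (app (A k) v) = coeff r k"
proof -
  obtain M where M: "\<And>k. k > M \<Longrightarrow> A k = 0" "\<And>t N. N \<ge> M \<Longrightarrow> F t = (\<Sum>k\<le>N. S (t ^ k) * A k)"
    using operator_poly_bound[OF assms(1)] by metis
  define r' where "r' = (\<Sum>k\<le>M. monom (\<xi> (app (A k) v)) k)"
  have "poly r t = poly r' t" for t
    using assms(3)[of t] M(2)[of M t]
    by (simp add: r'_def poly_sum poly_monom sum_app functional_simps[OF assms(2)] mult.commute)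
  then have "r = r'" by (simp add: poly_eq_poly_eq_iff[symmetric] fun_eq_iff)
  then show ?thesis
    using M(1)[of k] functional_simps(3)[OF assms(2)]
    by (cases "k \<le> M") (simp_all add: r'_def coeff_sum coeff_monom)
qed

text \<open>Comparing the coefficients of \<open>t\<close> in \<open>F (s + t) = F s F t\<close> gives
  \<open>(k + 1) A\<^sub>k\<^sub>+\<^sub>1 = A\<^sub>k A\<^sub>1\<close>, hence \<open>k! A\<^sub>k = A\<^sub>1\<^sup>k\<close>. As \<open>F\<close> is polynomial, \<open>A\<^sub>1\<close> is nilpotent.\<close>

lemma one_parameter_group:
  assumes F: "operator_poly F A" and lin: "\<And>k. Lin (A k)"
    and F0: "F 0 = 1" and add: "\<And>s t. F (s + t) = F s * F t"
  shows "nil (A 1)" "F t = ex (S t * A 1)" "A 0 = 1" "S 2 * A 2 = A 1 * A 1"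
proof -
  obtain M where M: "\<And>k. k > M \<Longrightarrow> A k = 0" "\<And>t N. N \<ge> M \<Longrightarrow> F t = (\<Sum>k\<le>N. S (t ^ k) * A k)"
    using operator_poly_bound[OF F] by metis
  show A0: "A 0 = 1"
    using F0 M(2)[of M 0] by (simp add: sum.atMost_shift S_simps)
  have step: "A k * A 1 = S (of_nat (Suc k)) * A (Suc k)" for k
  proof -
    have "F s * A 1 = (\<Sum>k\<le>M. S (s ^ k) * (S (of_nat (Suc k)) * A (Suc k)))" for s
    proof -
      define B where "B = (\<lambda>j. \<Sum>k | k \<le> M \<and> j \<le> k. S (of_nat (k choose j) * s ^ (k - j)) * A k)"
      have "operator_poly (\<lambda>t. F s * F t) (\<lambda>j. F s * A j)"
        unfolding operator_poly_def
      proof (intro exI[of _ M] conjI allI impI)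
        fix t
        have "Lin (F s)" using M(2)[of M s] by (auto intro!: Lin_sum Lin_simps lin)
        then show "F s * F t = (\<Sum>k\<le>M. S (t ^ k) * (F s * A k))"
          using M(2)[of M t] by (simp add: sum_distrib_left Lin_S_left)
      qed (simp add: M)
      moreover have "operator_poly (\<lambda>t. F s * F t) B"
        unfolding operator_poly_def
      proof (intro exI[of _ M] conjI allI impI)
        fix j assume "j > M"
        then have "{k. k \<le> M \<and> j \<le> k} = {}" by auto
        then show "B j = 0" unfolding B_def by (simp only: sum.empty)
      next
        fix t
        have "F s * F t = (\<Sum>k\<le>M. S ((t + s) ^ k) * A k)"
          using M(2)[of M "t + s"] add[of s t] by (simp add: add.commute)
        also have "\<dots> = (\<Sum>k\<le>M. \<Sum>j\<le>k. S (t ^ j) * (S (of_nat (k choose j) * s ^ (k - j)) * A k))"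
        proof (rule sum.cong[OF HOL.refl])
          fix k
          have "S (c * x * y) * a = S x * (S (c * y) * a)" for c x y a
          proof -
            have "c * x * y = x * (c * y)" by (simp only: mult_ac)
            then show ?thesis by (simp only: S_simps(5) mult.assoc)
          qed
          moreover have "S (\<Sum>j\<in>I. f j) = (\<Sum>j\<in>I. S (f j))" for f and I :: "nat set"
            by (induct I rule: infinite_finite_induct) (auto simp: S_simps)
          ultimately show "S ((t + s) ^ k) * A k = (\<Sum>j\<le>k. S (t ^ j) * (S (of_nat (k choose j) * s ^ (k - j)) * A k))"
            unfolding binomial_ring[of t s k] by (simp only: sum_distrib_right)
        qed
        also have "\<dots> = (\<Sum>k\<le>M. \<Sum>j | j \<in> {..M} \<and> j \<le> k.
            S (t ^ j) * (S (of_nat (k choose j) * s ^ (k - j)) * A k))"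
          by (intro sum.cong HOL.refl) auto
        also have "\<dots> = (\<Sum>j\<le>M. \<Sum>k | k \<in> {..M} \<and> j \<le> k.
            S (t ^ j) * (S (of_nat (k choose j) * s ^ (k - j)) * A k))"
          by (rule sum.swap_restrict) simp_all
        also have "\<dots> = (\<Sum>j\<le>M. S (t ^ j) * B j)"
          by (simp add: B_def sum_distrib_left)
        finally show "F s * F t = (\<Sum>j\<le>M. S (t ^ j) * B j)" .
      qed
      ultimately have "(\<lambda>j. F s * A j) = B" by (rule operator_poly_unique)
      then have "F s * A 1 = B 1" by (rule fun_cong)
      also have "\<dots> = (\<Sum>k | k \<le> Suc M \<and> 1 \<le> k. S (of_nat (k choose 1) * s ^ (k - 1)) * A k)"
        unfolding B_def
      proof (rule sum.mono_neutral_left)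
        show "\<forall>k\<in>{k. k \<le> Suc M \<and> 1 \<le> k} - {k. k \<le> M \<and> 1 \<le> k}.
            S (of_nat (k choose 1) * s ^ (k - 1)) * A k = 0"
        proof
          fix k assume "k \<in> {k. k \<le> Suc M \<and> 1 \<le> k} - {k. k \<le> M \<and> 1 \<le> k}"
          then have "k > M" by auto
          then show "S (of_nat (k choose 1) * s ^ (k - 1)) * A k = 0" by (simp add: M(1))
        qed
      qed auto
      also have "\<dots> = (\<Sum>k\<le>M. S (of_nat (Suc k choose 1) * s ^ k) * A (Suc k))"
        by (rule sum.reindex_bij_witness[of _ Suc "\<lambda>k. k - 1"]) auto
      also have "\<dots> = (\<Sum>k\<le>M. S (s ^ k) * (S (of_nat (Suc k)) * A (Suc k)))"
        by (simp add: S_simps(5)[symmetric] mult.commute del: of_nat_Suc flip: mult.assoc)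
      finally show ?thesis .
    qed
    then have "operator_poly (\<lambda>s. F s * A 1) (\<lambda>k. S (of_nat (Suc k)) * A (Suc k))"
      unfolding operator_poly_def using M(1) by (intro exI[of _ M]) simp
    moreover have "operator_poly (\<lambda>s. F s * A 1) (\<lambda>k. A k * A 1)"
      unfolding operator_poly_def using M(1) M(2)[of M]
      by (intro exI[of _ M]) (simp add: sum_distrib_right mult.assoc)
    ultimately have "(\<lambda>k. S (of_nat (Suc k)) * A (Suc k)) = (\<lambda>k. A k * A 1)"
      by (rule operator_poly_unique)
    from fun_cong[OF this, of k] show ?thesis by (simp only:)
  qed
  have Ak: "S (fact k) * A k = A 1 ^ k" for k
  proof (induct k)
    case 0 show ?case by (simp add: A0 S_simps)
  next
    case (Suc k)
    have "A 1 ^ Suc k = A 1 ^ k * A 1" by (rule power_Suc2)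
    also have "\<dots> = S (fact k) * (A k * A 1)" unfolding Suc[symmetric] by (rule mult.assoc)
    also have "\<dots> = S (fact (Suc k)) * A (Suc k)"
    proof -
      have "fact (Suc k) = (fact k * of_nat (Suc k) :: complex)" by simp
      then show ?thesis unfolding step by (simp only: S_simps(5) mult.assoc)
    qed
    finally show ?case ..
  qed
  have nil: "A 1 ^ Suc M = 0" using Ak[of "Suc M"] M(1) by simp
  then show "nil (A 1)" unfolding nil_def by blast
  show "S 2 * A 2 = A 1 * A 1" using Ak[of 2] by (simp add: fact_2 power2_eq_square)
  have tA: "(S t * A 1) ^ k = S (t ^ k * fact k) * A k" for k
  proof -
    have "(S t * A 1) ^ k = S t ^ k * A 1 ^ k"
      by (rule power_mult_commuting) (rule Lin_S_commute[OF lin, symmetric])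
    then show ?thesis by (simp only: S_power Ak[symmetric] S_simps(5) mult.assoc)
  qed
  have 0: "(S t * A 1) ^ Suc M = 0"
    unfolding tA using M(1)[of "Suc M"] by simp
  have "ex (S t * A 1) = (\<Sum>k<Suc M. S (of_rat (1 / fact k)) * (S (t ^ k * fact k) * A k))"
    unfolding ex_eq[OF 0] tA ..
  also have "\<dots> = (\<Sum>k\<le>M. S (t ^ k) * A k)"
  proof (rule sum.cong)
    fix k
    have "of_rat (1 / fact k) = (1 / fact k :: complex)"
      by (metis of_nat_fact of_rat_1 of_rat_divide of_rat_of_nat_eq)
    then have "S (of_rat (1 / fact k)) * S (t ^ k * fact k) = S (t ^ k)"
      by (simp add: S_simps(5)[symmetric])
    then show "S (of_rat (1 / fact k)) * (S (t ^ k * fact k) * A k) = S (t ^ k) * A k"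
      by (metis mult.assoc)
  qed auto
  also have "\<dots> = F t" using M(2)[of M t] by simp
  finally show "F t = ex (S t * A 1)" ..
qed

section \<open>The action of the torus on a graded space\<close>

definition grading_action :: "nat \<Rightarrow> (bidegree \<Rightarrow> 'v endo) \<Rightarrow> torus_point \<Rightarrow> 'v endo" where
  "grading_action g \<pi> z = (\<Sum>w | \<pi> w \<noteq> 0. S (character g w z) * \<pi> w)"

lemma grading_action_idem:
  assumes "idem_system I \<pi>"
  shows "grading_action g \<pi> z * \<pi> w = S (character g w z) * \<pi> w"
    and "\<pi> w * grading_action g \<pi> z = S (character g w z) * \<pi> w"
proof -
  have *: "(\<Sum>w' | \<pi> w' \<noteq> 0. if w' = w then S (character g w z) * \<pi> w else 0) = S (character g w z) * \<pi> w"
    using idem_systemD(2)[OF assms] by simp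
  have "grading_action g \<pi> z * \<pi> w = (\<Sum>w' | \<pi> w' \<noteq> 0. if w' = w then S (character g w z) * \<pi> w else 0)"
    unfolding grading_action_def sum_distrib_right
    by (rule sum.cong) (auto simp: mult.assoc idem_systemD[OF assms])
  then show "grading_action g \<pi> z * \<pi> w = S (character g w z) * \<pi> w" using * by simp
  have "\<pi> w * grading_action g \<pi> z = (\<Sum>w' | \<pi> w' \<noteq> 0. if w' = w then S (character g w z) * \<pi> w else 0)"
    unfolding grading_action_def sum_distrib_left
    by (rule sum.cong) (auto simp: Lin_S_left[OF idem_systemD(1)[OF assms]] idem_systemD(4,5)[OF assms])
  then show "\<pi> w * grading_action g \<pi> z = S (character g w z) * \<pi> w" using * by simp
qed

lemma Lin_grading_action: "idem_system I \<pi> \<Longrightarrow> Lin (grading_action g \<pi> z)"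
  unfolding grading_action_def by (intro Lin_sum Lin_simps idem_systemD)

lemma idem_eqI:
  assumes "idem_system I \<pi>" "\<And>w. a * \<pi> w = b * \<pi> w"
  shows "a = b"
proof -
  have "a * (\<Sum>w | \<pi> w \<noteq> 0. \<pi> w) = b * (\<Sum>w | \<pi> w \<noteq> 0. \<pi> w)"
    unfolding sum_distrib_left by (simp add: assms(2))
  then show ?thesis by (simp add: idem_systemD(6)[OF assms(1)])
qed

lemma grading_action_mult:
  assumes "idem_system I \<pi>"
  shows "grading_action g \<pi> (torus_mult z z') = grading_action g \<pi> z * grading_action g \<pi> z'"
  by (rule idem_eqI[OF assms])
    (simp add: grading_action_idem[OF assms] mult.assoc character_mult S_simps(5)
      Lin_S_left[OF Lin_grading_action[OF assms]] S_comm[of "character g _ z'"] flip: mult.assoc,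
     simp add: mult.assoc Lin_S_left[OF Lin_grading_action[OF assms]] grading_action_idem[OF assms],
     simp add: S_comm flip: mult.assoc)

lemma grading_action_one:
  assumes "idem_system I \<pi>" shows "grading_action g \<pi> (\<lambda>_. (1, 1)) = 1"
  by (rule idem_eqI[OF assms]) (simp add: grading_action_idem[OF assms] S_simps)

end

section \<open>The bigrading of a representation\<close>

locale hodge_rep = complex_fd_space scale Basis
  for scale :: "complex \<Rightarrow> 'v::ab_group_add \<Rightarrow> 'v" and Basis :: "'v set" +
  fixes g :: nat and \<rho> :: "(nat \<Rightarrow> hodge_point) \<Rightarrow> 'v \<Rightarrow> 'v"
  assumes rep: "\<rho> \<in> reps scale g"
begin

definition R :: "(nat \<Rightarrow> hodge_point) \<Rightarrow> 'v endo" where "R a = Endo (\<rho> a)"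

lemma rho_GL: "a \<in> carrier (GCg g) \<Longrightarrow> Vector_Spaces.linear scale scale (\<rho> a) \<and> bij (\<rho> a)"
  using rep by (auto simp: reps_def hom_def GLV_def)

lemma app_R: "a \<in> carrier (GCg g) \<Longrightarrow> app (R a) = \<rho> a"
  and Lin_R: "a \<in> carrier (GCg g) \<Longrightarrow> Lin (R a)"
  using rho_GL linear_Endo by (auto simp: R_def)

lemma R_mult: "a \<in> carrier (GCg g) \<Longrightarrow> b \<in> carrier (GCg g) \<Longrightarrow> R (a \<otimes>\<^bsub>GCg g\<^esub> b) = R a * R b"
proof (rule endo_eqI)
  fix v assume ab: "a \<in> carrier (GCg g)" "b \<in> carrier (GCg g)"
  then have "\<rho> (a \<otimes>\<^bsub>GCg g\<^esub> b) = \<rho> a \<circ> \<rho> b"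
    using rep by (simp add: reps_def hom_def GLV_def)
  then show "app (R (a \<otimes>\<^bsub>GCg g\<^esub> b)) v = app (R a * R b) v"
    using ab by (simp add: app_R GCg_closed)
qed

lemma R_one: "R (torus_elt g (\<lambda>_. (1, 1))) = 1"
proof (rule endo_eqI)
  fix v
  let ?e = "torus_elt g (\<lambda>_. (1, 1))"
  have e: "?e \<in> carrier (GCg g)" by (simp add: torus_elt_closed torus_one)
  have "torus_mult (\<lambda>_. (1, 1)) (\<lambda>_. (1, 1)) = (\<lambda>_. (1, 1))" by (simp add: torus_mult_def)
  then have "R ?e = R ?e * R ?e" using R_mult[OF e e] by (simp add: torus_elt_mult)
  then have "app (R ?e) (app (R ?e) v) = app (R ?e) v" by (metis app_times)
  then have "\<rho> ?e (\<rho> ?e v) = \<rho> ?e v" by (simp add: app_R[OF e])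
  then show "app (R ?e) v = app 1 v"
    using rho_GL[OF e] by (simp add: app_R[OF e] bij_def inj_eq)
qed

lemma unip_elt_one: "unip_elt g \<mu> (lie_lift 0) = torus_elt g (\<lambda>_. (1, 1))"
  by (rule GCg_eqI[where g = g]) (simp_all add: unip_elt_at torus_elt_at ext_simps Ulim_one)

lemma R_regular:
  assumes "functional \<xi>"
  obtains f where "f \<in> regular_functions g" "\<And>a. a \<in> carrier (GCg g) \<Longrightarrow> \<xi> (app (R a) v) = f a"
proof -
  have "\<exists>f\<in>regular_functions g. \<forall>a\<in>carrier (GCg g). \<xi> (\<rho> a v) = f a"
    using rep assms by (simp add: reps_def functional_def)
  then show ?thesis using that by (auto simp: app_R)
qed

text \<open>The operator coefficients of the characters are orthogonal idempotents: compare the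
  coefficients of \<open>\<chi>\<^sub>w(z) \<chi>\<^sub>w\<^sub>'(z')\<close> in \<open>R (z z') = R z R z'\<close>, first in \<open>z\<close>, then in \<open>z'\<close>.\<close>

lemma torus_idem:
  obtains \<pi> where "idem_system (bidegrees g) \<pi>"
    "\<And>z. z \<in> torus g \<Longrightarrow> R (torus_elt g z) = grading_action g \<pi> z"
proof -
  have lin: "Lin (R (torus_elt g z))" if "z \<in> torus g" for z
    using that by (intro Lin_R torus_elt_closed)
  have coeffs: "\<exists>J c. finite J \<and> J \<subseteq> bidegrees g \<and>
      (\<forall>z\<in>torus g. \<xi> (app (R (torus_elt g z)) v) = (\<Sum>w\<in>J. c w * character g w z))" if \<xi>: "functional \<xi>" for \<xi> v
  proof -
    obtain f where f: "f \<in> regular_functions g" "\<And>a. a \<in> carrier (GCg g) \<Longrightarrow> \<xi> (app (R a) v) = f a"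
      using R_regular[OF \<xi>] by metis
    then show ?thesis using regular_on_torus[OF f(1)] by (simp add: torus_elt_closed)
  qed
  obtain J P where J: "finite J" "J \<subseteq> bidegrees g" "\<And>w. Lin (P w)"
      "\<And>z. z \<in> torus g \<Longrightarrow> R (torus_elt g z) = (\<Sum>w\<in>J. S (character g w z) * P w)"
    by (rule operator_family[of "torus g" "\<lambda>z. R (torus_elt g z)" "bidegrees g" "character g", OF lin coeffs])
      (assumption | rule that)+
  note uniq = operator_family_unique2[OF independent_torus_characters[OF J(1,2)]]
  have PP: "P w * P w' = (if w' = w then P w else 0)" if w: "w \<in> J" "w' \<in> J" for w w'
  proof -
    have "S (character g w z') * P w = (\<Sum>w'\<in>J. S (character g w' z') * (P w * P w'))" if z': "z' \<in> torus g" for z'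
    proof (rule uniq[OF _ w(1)])
      fix z assume z: "z \<in> torus g"
      have "(\<Sum>w\<in>J. S (character g w z) * (S (character g w z') * P w)) = R (torus_elt g (torus_mult z z'))"
        using z z' by (simp add: J(4) torus_mult_closed character_mult S_simps(5) mult.assoc)
      also have "\<dots> = R (torus_elt g z) * R (torus_elt g z')"
        using z z' by (simp add: torus_elt_mult[symmetric] R_mult torus_elt_closed)
      also have "\<dots> = (\<Sum>w\<in>J. S (character g w z) * (\<Sum>w'\<in>J. S (character g w' z') * (P w * P w')))"
        unfolding J(4)[OF z] J(4)[OF z'] sum_product
        by (simp only: sum_distrib_left mult.assoc Lin_S_left[OF J(3)])
      finally show "(\<Sum>w\<in>J. S (character g w z) * (S (character g w z') * P w)) = \<dots>" .
    qed
    moreover have "(\<Sum>w'\<in>J. S (character g w' z') * (if w' = w then P w else 0)) = S (character g w z') * P w" for z'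
      using w(1) J(1) by (simp add: if_distrib[of "\<lambda>a. _ * a"] cong: if_cong)
    ultimately show ?thesis
      by (intro uniq[OF _ w(2), of "\<lambda>w'. P w * P w'"]) simp
  qed
  define \<pi> where "\<pi> = (\<lambda>w. if w \<in> J then P w else 0)"
  have sub: "{w. \<pi> w \<noteq> 0} \<subseteq> J" by (auto simp: \<pi>_def split: if_splits)
  have act: "R (torus_elt g z) = grading_action g \<pi> z" if "z \<in> torus g" for z
    unfolding grading_action_def J(4)[OF that]
    by (rule sum.mono_neutral_cong_right) (use J(1) sub in \<open>auto simp: \<pi>_def\<close>)
  have "idem_system (bidegrees g) \<pi>"
    unfolding idem_system_def
  proof (intro conjI allI)
    show "Lin (\<pi> w)" for w by (simp add: \<pi>_def J)
    show "finite {w. \<pi> w \<noteq> 0}" using sub J(1) by (rule finite_subset)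
    show "{w. \<pi> w \<noteq> 0} \<subseteq> bidegrees g" using sub J(2) by (rule subset_trans)
    show "\<pi> w * \<pi> w' = (if w = w' then \<pi> w else 0)" for w w' using PP[of w w'] by (auto simp: \<pi>_def)
    have "grading_action g \<pi> (\<lambda>_. (1, 1)) = 1" using act[OF torus_one] R_one by simp
    then show "(\<Sum>w | \<pi> w \<noteq> 0. \<pi> w) = 1" by (simp add: grading_action_def S_simps)
  qed
  then show ?thesis using act by (rule that)
qed

end

lemma polynomial_functions_sum:
  "(\<And>i. i \<in> I \<Longrightarrow> f i \<in> polynomial_functions n) \<Longrightarrow> (\<lambda>X. \<Sum>i\<in>I. f i X) \<in> polynomial_functions n"
  by (induct I rule: infinite_finite_induct)
    (simp_all add: polynomial_functions.const polynomial_functions.add)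

text \<open>The coefficients of the curve \<open>t x\<close>.\<close>

definition line :: "hlie \<Rightarrow> nat \<Rightarrow> hlie" where "line x = (\<lambda>i. if i = 1 then x else 0)"

lemma line_Ln: "x \<in> Ln n \<Longrightarrow> \<forall>i. line x i \<in> Ln n"
  by (simp add: line_def Ln_0)

lemma curve_line: "n \<ge> 1 \<Longrightarrow> curve n (line x) t = lscale t x"
proof -
  assume "n \<ge> 1"
  then have "curve n (line x) t = (\<Sum>i\<in>{1}. lscale (t ^ i) (line x i))"
    unfolding curve_def by (intro sum.mono_neutral_right) (auto simp: line_def)
  then show ?thesis by (simp add: line_def)
qed

context hodge_rep
begin

lemma weight_spaces:
  assumes \<pi>: "idem_system (bidegrees g) \<pi>"
    and act: "\<And>z. z \<in> torus g \<Longrightarrow> R (torus_elt g z) = grading_action g \<pi> z"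
    and w: "w \<in> bidegrees g"
  shows "(\<Inter>\<mu><g. weight_space scale g \<rho> \<mu> (fst w \<mu>) (snd w \<mu>)) = {v. app (\<pi> w) v = v}"
proof -
  have rho: "\<rho> (factor g \<mu> ((x, y), \<one>\<^bsub>Ulim\<^esub>)) v = app (grading_action g \<pi> (torus_at \<mu> x y)) v"
    if "x \<noteq> 0" "y \<noteq> 0" for \<mu> x y v
    using torus_at_closed[OF that, of \<mu> g]
    by (simp add: factor_torus act[symmetric] app_R torus_elt_closed)
  show ?thesis
  proof (intro Set.set_eqI iffI)
    fix v assume "v \<in> {v. app (\<pi> w) v = v}"
    then have v: "app (\<pi> w) v = v" by simp
    have "app (grading_action g \<pi> z) v = scale (character g w z) v" for z
      using arg_cong[OF grading_action_idem(1)[OF \<pi>, of g z w], of "\<lambda>a. app a v"] by (simp add: v)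
    then show "v \<in> (\<Inter>\<mu><g. weight_space scale g \<rho> \<mu> (fst w \<mu>) (snd w \<mu>))"
      by (auto simp: weight_space_def rho character_torus_at)
  next
    fix v assume v: "v \<in> (\<Inter>\<mu><g. weight_space scale g \<rho> \<mu> (fst w \<mu>) (snd w \<mu>))"
    have other: "app (\<pi> w') v = 0" if w': "w' \<noteq> w" for w'
    proof (rule ccontr)
      assume nz: "app (\<pi> w') v \<noteq> 0"
      have eq: "x powi fst w' \<mu> * y powi snd w' \<mu> = x powi fst w \<mu> * y powi snd w \<mu>"
        if "\<mu> < g" "x \<noteq> 0" "y \<noteq> 0" for \<mu> and x y :: complex
      proof -
        have "app (grading_action g \<pi> (torus_at \<mu> x y)) v = scale (x powi fst w \<mu> * y powi snd w \<mu>) v"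
          using v that by (simp add: weight_space_def rho)
        then have "app (\<pi> w' * grading_action g \<pi> (torus_at \<mu> x y)) v
            = scale (x powi fst w \<mu> * y powi snd w \<mu>) (app (\<pi> w') v)"
          by (simp add: Lin_scale idem_systemD(1)[OF \<pi>])
        then show ?thesis
          using nz by (simp add: grading_action_idem(2)[OF \<pi>] character_torus_at[OF that(1)])
      qed
      have "\<pi> w' \<noteq> 0" using nz by auto
      then have "w' \<in> bidegrees g" using idem_systemD(3)[OF \<pi>] by blast
      then have "w' = w"
      proof (rule bidegree_eqI[OF _ w])
        fix \<mu> assume "\<mu> < g"
        then show "fst w' \<mu> = fst w \<mu>" "snd w' \<mu> = snd w \<mu>"
          using eq[of \<mu> 2 1] eq[of \<mu> 1 2] by (simp_all add: two_powi_inject)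
      qed
      then show False using w' by simp
    qed
    have "v = (\<Sum>w' | \<pi> w' \<noteq> 0. app (\<pi> w') v)" by (simp add: idem_expand[OF \<pi>])
    also have "\<dots> = (\<Sum>w' | \<pi> w' \<noteq> 0. if w' = w then app (\<pi> w) v else 0)"
      by (rule sum.cong) (auto simp: other)
    also have "\<dots> = app (\<pi> w) v" using idem_systemD(2)[OF \<pi>] by simp
    finally show "v \<in> {v. app (\<pi> w) v = v}" by simp
  qed
qed

section \<open>The Lie algebra action of a representation\<close>

text \<open>One \<open>n\<close> serves all matrix coefficients, because they are combinations of the finitely
  many coefficients in a basis.\<close>

lemma unipotent_coefficients:
  obtains n0 where "n0 \<ge> 2" "\<And>n \<xi> v. n \<ge> n0 \<Longrightarrow> functional \<xi> \<Longrightarrow>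
    \<exists>p\<in>polynomial_functions n. \<forall>u\<in>carrier Ulim. \<xi> (app (R (unip_elt g \<mu> u)) v) = p (u n)"
proof -
  define Q where "Q = (\<lambda>b b' n p. p \<in> polynomial_functions n \<and>
    (\<forall>u\<in>carrier Ulim. coord b' (app (R (unip_elt g \<mu> u)) b) = p (u n)))"
  have "\<exists>m. \<forall>n\<ge>m. \<exists>p. Q b b' n p" for b b'
  proof -
    obtain f where f: "f \<in> regular_functions g"
      "\<And>a. a \<in> carrier (GCg g) \<Longrightarrow> coord b' (app (R a) b) = f a"
      by (rule R_regular[OF functional_coord]) (rule that)
    show ?thesis
      using regular_on_unip[OF f(1), of \<mu>] unfolding Q_def f(2)[OF unip_elt_closed] Bex_def
      by (simp add: f(2)[OF unip_elt_closed])
  qed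
  then obtain m where m: "\<And>b b' n. n \<ge> m b b' \<Longrightarrow> \<exists>p. Q b b' n p"
    by metis
  define n0 where "n0 = 2 + (\<Sum>b\<in>Basis. \<Sum>b'\<in>Basis. m b b')"
  have n0: "m b b' \<le> n0" if "b \<in> Basis" "b' \<in> Basis" for b b'
  proof -
    have "m b b' \<le> (\<Sum>b'\<in>Basis. m b b')"
      by (rule member_le_sum[OF that(2)]) (simp_all add: finite_Basis)
    also have "\<dots> \<le> (\<Sum>b\<in>Basis. \<Sum>b'\<in>Basis. m b b')"
      by (rule member_le_sum[OF that(1)]) (simp_all add: finite_Basis)
    finally show ?thesis by (simp add: n0_def)
  qed
  show ?thesis
  proof (rule that[of n0])
    show "n0 \<ge> 2" by (simp add: n0_def)
    fix n \<xi> v assume n: "n \<ge> n0" and \<xi>: "functional \<xi>"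
    have "\<exists>p. Q b b' n p" if "b \<in> Basis" "b' \<in> Basis" for b b'
      using m[of b b' n] n0[OF that] n by (simp only: order_trans)
    then obtain p where Q: "\<And>b b'. b \<in> Basis \<Longrightarrow> b' \<in> Basis \<Longrightarrow> Q b b' n (p b b')"
      by metis
    then have p: "\<And>b b'. b \<in> Basis \<Longrightarrow> b' \<in> Basis \<Longrightarrow> p b b' \<in> polynomial_functions n"
      "\<And>b b' u. b \<in> Basis \<Longrightarrow> b' \<in> Basis \<Longrightarrow> u \<in> carrier Ulim \<Longrightarrow>
        coord b' (app (R (unip_elt g \<mu> u)) b) = p b b' (u n)"
      unfolding Q_def by simp_all
    define P where "P = (\<lambda>X. \<Sum>b\<in>Basis. \<Sum>b'\<in>Basis. (coord b v * \<xi> b') * p b b' X)"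
    have "P \<in> polynomial_functions n"
      unfolding P_def
      by (intro polynomial_functions_sum polynomial_functions.mult polynomial_functions.const p(1))
    moreover have "\<xi> (app (R (unip_elt g \<mu> u)) v) = P (u n)" if u: "u \<in> carrier Ulim" for u
    proof -
      let ?a = "R (unip_elt g \<mu> u)"
      have lin: "Lin ?a" using u by (intro Lin_R unip_elt_closed)
      have "\<xi> (app ?a v) = (\<Sum>b\<in>Basis. coord b v * \<xi> (app ?a b))"
        using arg_cong[OF coord_expansion[of v], of "\<lambda>v. \<xi> (app ?a v)"]
        by (simp add: app_sum Lin_scale[OF lin] functional_simps[OF \<xi>])
      also have "\<dots> = (\<Sum>b\<in>Basis. coord b v * (\<Sum>b'\<in>Basis. coord b' (app ?a b) * \<xi> b'))"
      proof (intro sum.cong HOL.refl arg_cong2[of _ _ _ _ "(*)"])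
        fix b
        show "\<xi> (app ?a b) = (\<Sum>b'\<in>Basis. coord b' (app ?a b) * \<xi> b')"
          using arg_cong[OF coord_expansion[of "app ?a b"], of \<xi>]
          by (simp add: functional_simps[OF \<xi>])
      qed
      also have "\<dots> = P (u n)"
        unfolding P_def sum_distrib_left
        by (intro sum.cong HOL.refl) (simp add: p(2)[OF _ _ u])
      finally show ?thesis .
    qed
    ultimately show "\<exists>p\<in>polynomial_functions n. \<forall>u\<in>carrier Ulim. \<xi> (app (R (unip_elt g \<mu> u)) v) = p (u n)"
      by (intro bexI[of _ P]) simp_all
  qed
qed

text \<open>The derivative \<open>\<Phi>\<close> of the action at the origin is the required representation of
  \<open>u\<^sub>n\<close>. It is linear because the first-order term of a polynomial function is. To compare brackets,
  the second-order terms of \<open>F (t x) F (t y) = F (t (x + y) + t\<^sup>2 [x, y] / 2 + \<dots>)\<close> are equated: the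
  left side gives \<open>\<Phi>(x)\<^sup>2/2 + \<Phi>(x) \<Phi>(y) + \<Phi>(y)\<^sup>2/2\<close>, the right side
  \<open>\<Phi>(x + y)\<^sup>2/2 + \<Phi>([x, y])/2\<close>.\<close>

lemma acts_through_level:
  assumes n: "n \<ge> 2"
    and H: "\<And>\<xi> v. functional \<xi> \<Longrightarrow>
      \<exists>p\<in>polynomial_functions n. \<forall>u\<in>carrier Ulim. \<xi> (app (R (unip_elt g \<mu> u)) v) = p (u n)"
  shows "\<exists>\<phi>. acts_through scale g \<rho> \<mu> n \<phi>"
proof -
  define F where "F = (\<lambda>x. R (unip_elt g \<mu> (lie_lift x)))"
  have LinF: "Lin (F x)" for x
    unfolding F_def by (intro Lin_R unip_elt_closed lie_lift_Ulim)
  have F_at: "R (unip_elt g \<mu> u) = F x" if u: "u \<in> carrier Ulim" "x \<in> Ln n" "u n = un_class n x" for u x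
  proof (rule endo_eqI, rule functional_separates)
    fix v \<xi> assume "functional \<xi>"
    from H[OF this, of v] obtain p where
      p: "\<forall>u\<in>carrier Ulim. \<xi> (app (R (unip_elt g \<mu> u)) v) = p (u n)" by (rule bexE)
    show "\<xi> (app (R (unip_elt g \<mu> u)) v) = \<xi> (app (F x) v)"
      unfolding F_def p[rule_format, OF u(1)] p[rule_format, OF lie_lift_Ulim]
      by (simp add: u(3) lie_lift_at[OF u(2)])
  qed
  have F_bch: "F (bch n x y) = F x * F y" if xy: "x \<in> Ln n" "y \<in> Ln n" for x y
  proof -
    let ?u = "lie_lift x \<otimes>\<^bsub>Ulim\<^esub> lie_lift y"
    have "?u n = un_class n (bch n x y)"
      using xy by (simp add: Ulim_mult_at lie_lift_at Ugp_mult)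
    then have "F (bch n x y) = R (unip_elt g \<mu> ?u)"
      using xy by (intro F_at[symmetric]) (simp_all add: Ulim_mult_closed lie_lift_Ulim Ln_bch)
    then show ?thesis
      by (simp add: F_def unip_elt_mult[symmetric] R_mult unip_elt_closed lie_lift_Ulim)
  qed
  have jets: "\<exists>p c l b. jet n p c l b \<and> (\<forall>x\<in>Ln n. \<xi> (app (F x) v) = p (un_class n x))"
    if \<xi>: "functional \<xi>" for \<xi> v
  proof -
    from H[OF \<xi>, of v] obtain p where p: "p \<in> polynomial_functions n"
      "\<forall>u\<in>carrier Ulim. \<xi> (app (R (unip_elt g \<mu> u)) v) = p (u n)" by (rule bexE)
    have "\<xi> (app (F x) v) = p (un_class n x)" if "x \<in> Ln n" for x
      unfolding F_def p(2)[rule_format, OF lie_lift_Ulim] by (simp add: lie_lift_at[OF that])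
    moreover obtain c l b where "jet n p c l b"
      using polynomial_function_jet[OF p(1) n] by (elim exE) (rule that)
    ultimately show ?thesis by (intro exI[of _ p] exI[of _ c] exI[of _ l] exI[of _ b]) simp
  qed
  define Q where "Q = (\<lambda>W A. operator_poly (\<lambda>t. F (curve n W t)) A \<and> (\<forall>k. Lin (A k)))"
  have "\<exists>A. Q W A" if W: "\<forall>i. W i \<in> Ln n" for W
  proof -
    have "\<exists>r. \<forall>t. \<xi> (app (F (curve n W t)) v) = poly r t" if \<xi>: "functional \<xi>" for \<xi> v
    proof -
      obtain p c l b where j: "jet n p c l b" and p: "\<forall>x\<in>Ln n. \<xi> (app (F x) v) = p (un_class n x)"
        using jets[OF \<xi>, of v] by (elim exE conjE) (rule that)
      obtain r where "\<And>t. p (un_class n (curve n W t)) = poly r t" using j W by (rule jet_curve) (rule that)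
      then show ?thesis using p W by (intro exI[of _ r]) (simp add: Ln_curve)
    qed
    then obtain A where "operator_poly (\<lambda>t. F (curve n W t)) A" "\<And>k. Lin (A k)"
      by (rule operator_poly_exists[OF LinF]) (assumption | rule that)+
    then show ?thesis unfolding Q_def by (intro exI[of _ A]) simp
  qed
  then obtain C where "\<And>W. \<forall>i. W i \<in> Ln n \<Longrightarrow> Q W (C W)" by metis
  then have C: "\<And>W. \<forall>i. W i \<in> Ln n \<Longrightarrow> operator_poly (\<lambda>t. F (curve n W t)) (C W)"
    "\<And>W k. \<forall>i. W i \<in> Ln n \<Longrightarrow> Lin (C W k)"
    unfolding Q_def by simp_all
  have coeffs: "\<exists>l b. (\<forall>x\<in>Ln n. \<forall>y\<in>Ln n. l (x + y) = l x + l y) \<and>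
      (\<forall>c. \<forall>x\<in>Ln n. l (lscale c x) = c * l x) \<and>
      (\<forall>W. (\<forall>i. W i \<in> Ln n) \<longrightarrow> \<xi> (app (C W 1) v) = l (W 1) \<and> \<xi> (app (C W 2) v) = l (W 2) + b (W 1))"
    if \<xi>: "functional \<xi>" for \<xi> v
  proof -
    obtain p c l b where j: "jet n p c l b" and p: "\<forall>x\<in>Ln n. \<xi> (app (F x) v) = p (un_class n x)"
      using jets[OF \<xi>, of v] by (elim exE conjE) (rule that)
    have "\<xi> (app (C W 1) v) = l (W 1) \<and> \<xi> (app (C W 2) v) = l (W 2) + b (W 1)"
      if W: "\<forall>i. W i \<in> Ln n" for W
    proof -
      obtain r where r: "\<And>t. p (un_class n (curve n W t)) = poly r t" "coeff r 0 = c"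
        "coeff r 1 = l (W 1)" "coeff r 2 = l (W 2) + b (W 1)" using j W by (rule jet_curve) (rule that)
      have "\<xi> (app (F (curve n W t)) v) = poly r t" for t
        using p W r(1) by (simp add: Ln_curve)
      then have "\<xi> (app (C W k) v) = coeff r k" for k
        by (rule operator_poly_coeff[OF C(1)[OF W] \<xi>])
      then show ?thesis using r(3,4) by simp
    qed
    then show ?thesis
      using j unfolding jet_def by (intro exI[of _ l] exI[of _ b]) simp
  qed
  \<comment> \<open>\<open>C W k\<close> is the coefficient of \<open>t\<^sup>k\<close> of the action along the curve with coefficients \<open>W\<close>\<close>
  define \<Phi> where "\<Phi> = (\<lambda>x. C (line x) 1)"
  have Lin\<Phi>: "Lin (\<Phi> x)" if "x \<in> Ln n" for x
    unfolding \<Phi>_def by (rule C(2)[OF line_Ln[OF that]])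
  have opl: "operator_poly (\<lambda>t. F (lscale t x)) (C (line x))" if "x \<in> Ln n" for x
    using C(1)[OF line_Ln[OF that]] n by (simp add: curve_line)
  have opg: "nil (\<Phi> x)" "F (lscale t x) = ex (S t * \<Phi> x)" "C (line x) 0 = 1" "S 2 * C (line x) 2 = \<Phi> x * \<Phi> x"
    if x: "x \<in> Ln n" for x t
  proof -
    have F0: "F (lscale 0 x) = 1" by (simp add: F_def unip_elt_one R_one)
    have Fadd: "F (lscale (s + t) x) = F (lscale s x) * F (lscale t x)" for s t
      using F_bch[of "lscale s x" "lscale t x"] bch_line[of n s x t] x n by (simp add: Ln_scale)
    note * = one_parameter_group[OF opl[OF x] C(2)[OF line_Ln[OF x]] F0 Fadd]
    show "nil (\<Phi> x)" "F (lscale t x) = ex (S t * \<Phi> x)" "C (line x) 0 = 1" "S 2 * C (line x) 2 = \<Phi> x * \<Phi> x"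
      using * by (simp_all add: \<Phi>_def)
  qed
  have F_ex: "F x = ex (\<Phi> x)" if "x \<in> Ln n" for x
    using opg(2)[OF that, of 1] by (simp add: S_simps)
  have \<Phi>_add: "\<Phi> (x + y) = \<Phi> x + \<Phi> y" if xy: "x \<in> Ln n" "y \<in> Ln n" for x y
  proof (rule endo_eqI, rule functional_separates)
    fix v \<xi> assume \<xi>: "functional \<xi>"
    obtain l b where l: "\<forall>x\<in>Ln n. \<forall>y\<in>Ln n. l (x + y) = l x + l y"
      "\<forall>W. (\<forall>i. W i \<in> Ln n) \<longrightarrow> \<xi> (app (C W 1) v) = l (W 1) \<and> \<xi> (app (C W 2) v) = l (W 2) + b (W 1)"
      using coeffs[OF \<xi>, of v] by (elim exE conjE) (rule that)
    have "\<xi> (app (\<Phi> z) v) = l z" if "z \<in> Ln n" for z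
      using l(2) line_Ln[OF that] by (simp add: \<Phi>_def line_def)
    then show "\<xi> (app (\<Phi> (x + y)) v) = \<xi> (app (\<Phi> x + \<Phi> y) v)"
      using l(1) xy by (simp add: Ln_add functional_simps[OF \<xi>])
  qed
  have \<Phi>_scale: "\<Phi> (lscale c x) = S c * \<Phi> x" if x: "x \<in> Ln n" for c x
  proof (rule endo_eqI, rule functional_separates)
    fix v \<xi> assume \<xi>: "functional \<xi>"
    obtain l b where l: "\<forall>c. \<forall>x\<in>Ln n. l (lscale c x) = c * l x"
      "\<forall>W. (\<forall>i. W i \<in> Ln n) \<longrightarrow> \<xi> (app (C W 1) v) = l (W 1) \<and> \<xi> (app (C W 2) v) = l (W 2) + b (W 1)"
      using coeffs[OF \<xi>, of v] by (elim exE conjE) (rule that)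
    have "\<xi> (app (\<Phi> z) v) = l z" if "z \<in> Ln n" for z
      using l(2) line_Ln[OF that] by (simp add: \<Phi>_def line_def)
    then show "\<xi> (app (\<Phi> (lscale c x)) v) = \<xi> (app (S c * \<Phi> x) v)"
      using l(1) x by (simp add: Ln_scale functional_simps[OF \<xi>])
  qed
  have \<Phi>_br: "\<Phi> (lbr x y) = \<Phi> x * \<Phi> y - \<Phi> y * \<Phi> x" if xy: "x \<in> Ln n" "y \<in> Ln n" for x y
  proof -
    \<comment> \<open>by homogeneity the product of \<open>t x\<close> and \<open>t y\<close> is the curve with these coefficients\<close>
    define W where "W = (\<lambda>i. bch_term i x y)"
    have W: "\<forall>i. W i \<in> Ln n" using xy by (simp add: W_def Ln_bch_term)
    have "curve n W t = bch n (lscale t x) (lscale t y)" for t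
      by (simp add: curve_def W_def bch_eq bch_term_scale)
    then have "operator_poly (\<lambda>t. F (lscale t x) * F (lscale t y)) (C W)"
      using C(1)[OF W] xy by (simp add: F_bch Ln_scale)
    moreover have "operator_poly (\<lambda>t. F (lscale t x) * F (lscale t y))
        (\<lambda>k. \<Sum>i\<le>k. C (line x) i * C (line y) (k - i))"
      using opl[OF xy(1)] opl[OF xy(2)] C(2)[OF line_Ln[OF xy(1)]] by (rule operator_poly_mult)
    ultimately have "C W = (\<lambda>k. \<Sum>i\<le>k. C (line x) i * C (line y) (k - i))"
      by (rule operator_poly_unique)
    from fun_cong[OF this, of 2]
    have CW: "C W 2 = C (line x) 2 + \<Phi> x * \<Phi> y + C (line y) 2"
      by (simp add: numeral_2_eq_2 opg(3) xy \<Phi>_def)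
    have "C W 2 = \<Phi> (W 2) + C (line (W 1)) 2"
    proof (rule endo_eqI, rule functional_separates)
      fix v \<xi> assume \<xi>: "functional \<xi>"
      obtain l b where l: "\<forall>x\<in>Ln n. \<forall>y\<in>Ln n. l (x + y) = l x + l y"
        "\<forall>W. (\<forall>i. W i \<in> Ln n) \<longrightarrow> \<xi> (app (C W 1) v) = l (W 1) \<and> \<xi> (app (C W 2) v) = l (W 2) + b (W 1)"
        using coeffs[OF \<xi>, of v] by (elim exE conjE) (rule that)
      have l0: "l 0 = 0" using l(1)[rule_format, OF Ln_0 Ln_0] by simp
      have "\<xi> (app (\<Phi> (W 2)) v) = l (W 2)"
        using l(2)[rule_format, of "line (W 2)"] line_Ln[of "W 2" n] W by (simp add: \<Phi>_def line_def)
      moreover have "\<xi> (app (C (line (W 1)) 2) v) = b (W 1)"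
        using l(2)[rule_format, of "line (W 1)"] line_Ln[of "W 1" n] W by (simp add: line_def l0)
      moreover have "\<xi> (app (C W 2) v) = l (W 2) + b (W 1)" using l(2) W by simp
      ultimately show "\<xi> (app (C W 2) v) = \<xi> (app (\<Phi> (W 2) + C (line (W 1)) 2) v)"
        by (simp add: functional_simps[OF \<xi>])
    qed
    moreover have W1: "W 1 = x + y" unfolding W_def by (rule bch_term_1)
    moreover have "W 2 = lscale (1 / 2) (lbr x y)" unfolding W_def by (rule bch_term_2)
    then have "S 2 * \<Phi> (W 2) = \<Phi> (lbr x y)"
      using xy by (simp add: \<Phi>_scale Ln_br S_simps(2) flip: mult.assoc S_simps(5))
    moreover have "S 2 * C (line (x + y)) 2 = (\<Phi> x + \<Phi> y) * (\<Phi> x + \<Phi> y)"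
      using opg(4)[of "x + y"] xy by (simp add: Ln_add \<Phi>_add)
    ultimately have "\<Phi> (lbr x y) + (\<Phi> x + \<Phi> y) * (\<Phi> x + \<Phi> y) = S 2 * C W 2"
      by (simp add: distrib_left)
    also have "\<dots> = \<Phi> x * \<Phi> x + S 2 * (\<Phi> x * \<Phi> y) + \<Phi> y * \<Phi> y"
      by (simp add: CW distrib_left opg(4) xy)
    also have "S 2 * (\<Phi> x * \<Phi> y) = \<Phi> x * \<Phi> y + \<Phi> x * \<Phi> y"
      using S_simps(3)[of 1 1] by (simp add: S_simps distrib_right)
    finally show ?thesis by (simp add: algebra_simps)
  qed
  have \<Phi>_cong: "\<Phi> x = \<Phi> y" if xy: "x \<in> Ln n" "y \<in> Ln n" "un_class n x = un_class n y" for x y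
  proof -
    have "F (lscale t x) = F (lscale t y)" for t
    proof -
      have "(lscale t x, lscale t y) \<in> un_rel n"
        using xy by (intro un_rel_scale) (simp add: un_class_eq_iff)
      then have "un_class n (lscale t x) = un_class n (lscale t y)"
        using xy by (simp add: un_class_eq_iff Ln_scale)
      then show ?thesis
        unfolding F_def[of] using xy
        by (intro F_at[OF lie_lift_Ulim, unfolded F_def]) (simp_all add: Ln_scale lie_lift_at)
    qed
    then have "operator_poly (\<lambda>t. F (lscale t x)) (C (line y))" using opl[OF xy(2)] by simp
    then have "C (line x) = C (line y)" using opl[OF xy(1)] operator_poly_unique by simp
    then show ?thesis by (simp add: \<Phi>_def)
  qed
  define \<phi> where "\<phi> = (\<lambda>X. app (\<Phi> (SOME x. x \<in> Ln n \<and> X = un_class n x)))"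
  have \<phi>: "\<phi> (un_class n x) = app (\<Phi> x)" if x: "x \<in> Ln n" for x
  proof -
    let ?y = "SOME y. y \<in> Ln n \<and> un_class n x = un_class n y"
    have "?y \<in> Ln n \<and> un_class n x = un_class n ?y"
      by (rule someI[of "\<lambda>y. y \<in> Ln n \<and> un_class n x = un_class n y" x]) (simp add: x)
    then show ?thesis unfolding \<phi>_def using \<Phi>_cong[OF x] by metis
  qed
  have "acts_through scale g \<rho> \<mu> n \<phi>"
    unfolding acts_through_def nil_lie_rep_def
  proof (intro conjI ballI allI)
    fix X assume "X \<in> un n"
    then obtain x where x: "x \<in> Ln n" "X = un_class n x" by (rule unE)
    show "Vector_Spaces.linear scale scale (\<phi> X)" unfolding x(2) \<phi>[OF x(1)] linear_iff_Lin by (rule Lin\<Phi>[OF x(1)])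
    show "nilpotent_map (\<phi> X)" unfolding x(2) \<phi>[OF x(1)] nilpotent_map_app by (rule opg(1)[OF x(1)])
  next
    fix u assume u: "u \<in> carrier Ulim"
    obtain x where x: "x \<in> Ln n" "u n = un_class n x" using Ulim_at[OF u, of n] by (rule bexE)
    have "\<rho> (factor g \<mu> ((1, 1), u)) = app (R (unip_elt g \<mu> u))"
      by (simp add: app_R unip_elt_closed[OF u]) (simp add: unip_elt_def)
    also have "\<dots> = app (ex (\<Phi> x))" using F_at[OF u x] F_ex[OF x(1)] by simp
    also have "\<dots> = nil_exp scale (\<phi> (u n))" by (simp add: x \<phi> nil_exp_app opg(1))
    finally show "\<rho> (factor g \<mu> ((1, 1), u)) = nil_exp scale (\<phi> (u n))" .
  qed (simp_all add: \<phi> Ln_add Ln_scale Ln_br \<Phi>_add \<Phi>_scale \<Phi>_br)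
  then show ?thesis by (intro exI[of _ \<phi>])
qed

lemma acts_through_eventually: "\<exists>n0. \<forall>n\<ge>n0. \<exists>\<phi>. acts_through scale g \<rho> \<mu> n \<phi>"
proof -
  obtain n0 where n0: "n0 \<ge> 2" "\<And>n \<xi> v. n \<ge> n0 \<Longrightarrow> functional \<xi> \<Longrightarrow>
    \<exists>p\<in>polynomial_functions n. \<forall>u\<in>carrier Ulim. \<xi> (app (R (unip_elt g \<mu> u)) v) = p (u n)"
    by (rule unipotent_coefficients) (rule that)
  show ?thesis
  proof (intro exI[of _ n0] allI impI)
    fix n assume "n0 \<le> n"
    then show "\<exists>\<phi>. acts_through scale g \<rho> \<mu> n \<phi>"
      using n0(1) by (intro acts_through_level n0(2)) simp_all
  qed
qed

end

section \<open>Operators that lower the bidegree\<close>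

definition shifts :: "nat \<Rightarrow> nat \<Rightarrow> nat \<Rightarrow> nat \<Rightarrow> bidegree \<Rightarrow> bidegree \<Rightarrow> bool" where
  "shifts g \<mu> i j w' w \<longleftrightarrow> (\<forall>\<nu><g. \<nu> \<noteq> \<mu> \<longrightarrow> fst w' \<nu> = fst w \<nu> \<and> snd w' \<nu> = snd w \<nu>) \<and>
     fst w' \<mu> = fst w \<mu> - int i \<and> snd w' \<mu> = snd w \<mu> - int j"

definition lower :: "nat \<Rightarrow> nat \<Rightarrow> bidegree \<Rightarrow> bidegree \<Rightarrow> bool" where
  "lower g \<mu> w' w \<longleftrightarrow> (\<forall>\<nu><g. \<nu> \<noteq> \<mu> \<longrightarrow> fst w' \<nu> = fst w \<nu> \<and> snd w' \<nu> = snd w \<nu>) \<and>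
     fst w' \<mu> < fst w \<mu> \<and> snd w' \<mu> < snd w \<mu>"

lemma lower_trans: "lower g \<mu> w'' w' \<Longrightarrow> lower g \<mu> w' w \<Longrightarrow> lower g \<mu> w'' w"
  unfolding lower_def by simp

lemma shifts_lower: "shifts g \<mu> i j w' w \<Longrightarrow> 0 < i \<Longrightarrow> 0 < j \<Longrightarrow> lower g \<mu> w' w"
  by (simp add: shifts_def lower_def)

text \<open>The total degree at \<open>\<mu>\<close>, which drops by \<open>i + j\<close> under the generator \<open>T\<^sup>i\<^sup>,\<^sup>j\<close>.\<close>

definition height :: "nat \<Rightarrow> bidegree \<Rightarrow> int" where "height \<mu> w = fst w \<mu> + snd w \<mu>"

lemma finite_Ln_gens: "finite (Ln_gens n)"
  by (rule finite_subset[of _ "{..n} \<times> {..n}"]) (auto simp: Ln_gens_def)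

definition generator_sum :: "nat \<Rightarrow> hlie" where "generator_sum n = (\<Sum>ij\<in>Ln_gens n. gen ij)"

lemma generator_sum_Ln: "generator_sum n \<in> Ln n"
  unfolding generator_sum_def by (intro Ln_sum Ln_gen)

context complex_fd_space
begin

lemma idem_sandwich:
  assumes "idem_system I \<pi>" shows "\<pi> w' * (a * b) * \<pi> w = (\<Sum>v | \<pi> v \<noteq> 0. (\<pi> w' * a * \<pi> v) * (\<pi> v * b * \<pi> w))"
proof -
  have "\<pi> w' * (a * b) * \<pi> w = \<pi> w' * a * (\<Sum>v | \<pi> v \<noteq> 0. \<pi> v) * b * \<pi> w"
    by (simp add: idem_systemD(6)[OF assms] mult.assoc)
  also have "\<dots> = (\<Sum>v | \<pi> v \<noteq> 0. \<pi> w' * a * \<pi> v * b * \<pi> w)"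
    by (simp only: sum_distrib_left sum_distrib_right)
  also have "\<dots> = (\<Sum>v | \<pi> v \<noteq> 0. (\<pi> w' * a * \<pi> v) * (\<pi> v * b * \<pi> w))"
  proof (rule sum.cong[OF HOL.refl])
    fix v
    have "\<pi> w' * a * \<pi> v * b * \<pi> w = \<pi> w' * a * (\<pi> v * \<pi> v) * b * \<pi> w"
      by (simp only: idem_systemD(4)[OF assms])
    then show "\<pi> w' * a * \<pi> v * b * \<pi> w = (\<pi> w' * a * \<pi> v) * (\<pi> v * b * \<pi> w)"
      by (simp only: mult.assoc)
  qed
  finally show ?thesis .
qed

lemma idem_zero: "idem_system I \<pi> \<Longrightarrow> i \<notin> I \<Longrightarrow> \<pi> i = 0"
  using idem_systemD(3)[of I \<pi> i] by (cases "\<pi> i = 0") simp_all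

lemma idem_eqI2:
  assumes \<pi>: "idem_system I \<pi>" and eq: "\<And>w w'. \<pi> w' * a * \<pi> w = \<pi> w' * b * \<pi> w"
  shows "a = b"
proof (rule idem_eqI[OF \<pi>])
  fix w
  have expand: "c * \<pi> w = (\<Sum>w' | \<pi> w' \<noteq> 0. \<pi> w' * c * \<pi> w)" for c
  proof -
    have "c * \<pi> w = (\<Sum>w' | \<pi> w' \<noteq> 0. \<pi> w') * c * \<pi> w" by (simp add: idem_systemD(6)[OF \<pi>])
    then show ?thesis by (simp only: sum_distrib_right)
  qed
  have "a * \<pi> w = (\<Sum>w' | \<pi> w' \<noteq> 0. \<pi> w' * b * \<pi> w)"
    unfolding eq[symmetric] by (rule expand)
  also have "\<dots> = b * \<pi> w" by (rule expand[symmetric])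
  finally show "a * \<pi> w = b * \<pi> w" .
qed

lemma idem_unique:
  assumes \<pi>: "idem_system I \<pi>" and \<pi>': "idem_system I \<pi>'"
    and eq: "\<And>i. i \<in> I \<Longrightarrow> {v. app (\<pi> i) v = v} = {v. app (\<pi>' i) v = v}"
  shows "\<pi> = \<pi>'"
proof
  fix i
  show "\<pi> i = \<pi>' i"
  proof (cases "i \<in> I")
    case False
    then show ?thesis by (simp add: idem_zero[OF \<pi>] idem_zero[OF \<pi>'])
  next
    case True
    have same: "\<pi> j * \<pi>' j = \<pi>' j" for j
    proof (cases "j \<in> I")
      case True
      show ?thesis
      proof (rule endo_eqI)
        fix v
        have "app (\<pi>' j) (app (\<pi>' j) v) = app (\<pi>' j) v"
          using arg_cong[OF idem_systemD(4)[OF \<pi>', of j], of "\<lambda>a. app a v"] by simp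
        then have "app (\<pi>' j) v \<in> {v. app (\<pi> j) v = v}" unfolding eq[OF True] by simp
        then show "app (\<pi> j * \<pi>' j) v = app (\<pi>' j) v" by simp
      qed
    next
      case False
      then show ?thesis by (simp add: idem_zero[OF \<pi>'])
    qed
    have "\<pi> i = (\<Sum>j | \<pi>' j \<noteq> 0. \<pi> i * \<pi>' j)"
      using idem_systemD(6)[OF \<pi>'] by (simp add: sum_distrib_left[symmetric])
    also have "\<dots> = (\<Sum>j | \<pi>' j \<noteq> 0. if j = i then \<pi>' i else 0)"
    proof (rule sum.cong[OF HOL.refl])
      fix j
      have "\<pi> i * \<pi>' j = \<pi> i * \<pi> j * \<pi>' j" by (simp add: same mult.assoc)
      then show "\<pi> i * \<pi>' j = (if j = i then \<pi>' i else 0)"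
        using idem_systemD(4,5)[OF \<pi>, of i] same by (cases "i = j") simp_all
    qed
    also have "\<dots> = \<pi>' i" using idem_systemD(2)[OF \<pi>'] by simp
    finally show ?thesis .
  qed
qed

lemma grading_action_inverse:
  assumes \<pi>: "idem_system I \<pi>" and z: "z \<in> torus g"
  obtains D' where "grading_action g \<pi> z * D' = 1" "D' * grading_action g \<pi> z = 1"
proof -
  define z' where "z' = (\<lambda>\<mu>. (inverse (fst (z \<mu>)), inverse (snd (z \<mu>))))"
  have "character g w z * character g w z' = 1" for w
    unfolding character_def prod.distrib[symmetric]
    using z by (intro prod.neutral ballI) (simp add: z'_def torus_def power_int_inverse field_simps)
  then have 1: "S (character g w z) * S (character g w z') = 1" for w
    by (simp add: S_simps(5)[symmetric] S_simps(2))
  have c: "S (character g w z) * (S (character g w z') * a) = a"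
    "S (character g w z') * (S (character g w z) * a) = a" for w a
    using 1[of w] S_comm[of "character g w z"] by (simp_all flip: mult.assoc)
  have "grading_action g \<pi> z * grading_action g \<pi> z' = 1"
    "grading_action g \<pi> z' * grading_action g \<pi> z = 1"
    by (rule idem_eqI[OF \<pi>], simp add: mult.assoc grading_action_idem(1)[OF \<pi>]
        Lin_S_left[OF Lin_grading_action[OF \<pi>]] c)+
  then show ?thesis by (rule that)
qed

definition lowering :: "nat \<Rightarrow> nat \<Rightarrow> (bidegree \<Rightarrow> 'v endo) \<Rightarrow> 'v endo \<Rightarrow> bool" where
  "lowering g \<mu> \<pi> a \<longleftrightarrow> (\<forall>w w'. \<pi> w' * a * \<pi> w \<noteq> 0 \<longrightarrow> lower g \<mu> w' w)"

lemma lowering_0: "lowering g \<mu> \<pi> 0" by (simp add: lowering_def)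

lemma lowering_add: "lowering g \<mu> \<pi> a \<Longrightarrow> lowering g \<mu> \<pi> b \<Longrightarrow> lowering g \<mu> \<pi> (a + b)"
proof -
  assume a: "lowering g \<mu> \<pi> a" and b: "lowering g \<mu> \<pi> b"
  have "\<pi> w' * a * \<pi> w \<noteq> 0 \<or> \<pi> w' * b * \<pi> w \<noteq> 0" if "\<pi> w' * (a + b) * \<pi> w \<noteq> 0" for w w'
    using that by (auto simp: distrib_left distrib_right)
  then show ?thesis using a b unfolding lowering_def by (metis (no_types))
qed

lemma lowering_sum: "(\<And>i. i \<in> I \<Longrightarrow> lowering g \<mu> \<pi> (f i)) \<Longrightarrow> lowering g \<mu> \<pi> (sum f I)"
  by (induct I rule: infinite_finite_induct) (auto simp: lowering_0 lowering_add)

lemma lowering_S: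
  assumes "idem_system I \<pi>" "lowering g \<mu> \<pi> a" shows "lowering g \<mu> \<pi> (S c * a)"
proof -
  have "\<pi> w' * (S c * a) * \<pi> w = S c * (\<pi> w' * a * \<pi> w)" for w w'
    by (simp add: Lin_S_left[OF idem_systemD(1)[OF assms(1)]] mult.assoc)
  moreover have "\<pi> w' * a * \<pi> w \<noteq> 0" if "S c * (\<pi> w' * a * \<pi> w) \<noteq> 0" for w w' using that by auto
  ultimately show ?thesis using assms(2) by (simp add: lowering_def)
qed

lemma lowering_mult:
  assumes "idem_system I \<pi>" "lowering g \<mu> \<pi> a" "lowering g \<mu> \<pi> b" shows "lowering g \<mu> \<pi> (a * b)"
  unfolding lowering_def
proof (intro allI impI)
  fix w w' assume "\<pi> w' * (a * b) * \<pi> w \<noteq> 0"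
  then obtain v where "(\<pi> w' * a * \<pi> v) * (\<pi> v * b * \<pi> w) \<noteq> 0"
    unfolding idem_sandwich[OF assms(1)] by (metis (mono_tags, lifting) sum.neutral)
  then have "\<pi> w' * a * \<pi> v \<noteq> 0" "\<pi> v * b * \<pi> w \<noteq> 0" by auto
  then show "lower g \<mu> w' w" using assms(2,3) lower_trans unfolding lowering_def by meson
qed

lemma lowering_ser:
  assumes \<pi>: "idem_system I \<pi>" "lowering g \<mu> \<pi> a" and c: "c $ 0 = 0"
  shows "lowering g \<mu> \<pi> (ser c a)"
  unfolding ser_def
proof (rule lowering_sum)
  have pow: "lowering g \<mu> \<pi> (a ^ Suc k)" for k
    by (induct k) (use \<pi> in \<open>auto intro: lowering_mult\<close>)
  fix k show "lowering g \<mu> \<pi> (S (of_rat (c $ k)) * a ^ k)"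
  proof (cases k)
    case 0
    then show ?thesis using c by (simp add: S_simps lowering_0)
  next
    case (Suc m)
    then show ?thesis using lowering_S[OF \<pi>(1) pow[of m]] by simp
  qed
qed

definition height_bound :: "nat \<Rightarrow> (bidegree \<Rightarrow> 'v endo) \<Rightarrow> nat" where
  "height_bound \<mu> \<pi> = nat (\<Sum>w | \<pi> w \<noteq> 0. \<bar>height \<mu> w\<bar>)"

text \<open>Heights lie between \<open>-B\<close> and \<open>B\<close> for \<open>B = height_bound \<mu> \<pi>\<close>; the members of the
  filtration are cut out by \<open>height \<le> B - d\<close>, so they are zero from \<open>d = 2 B + 1\<close> on.\<close>

definition height_filtration :: "nat \<Rightarrow> (bidegree \<Rightarrow> 'v endo) \<Rightarrow> nat \<Rightarrow> 'v set" where
  "height_filtration \<mu> \<pi> d = {v. \<forall>w. app (\<pi> w) v \<noteq> 0 \<longrightarrow> height \<mu> w + int d \<le> int (height_bound \<mu> \<pi>)}"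

lemma height_bound:
  assumes "idem_system I \<pi>" "\<pi> w \<noteq> 0"
  shows "\<bar>height \<mu> w\<bar> \<le> int (height_bound \<mu> \<pi>)"
proof -
  have "\<bar>height \<mu> w\<bar> \<le> (\<Sum>w | \<pi> w \<noteq> 0. \<bar>height \<mu> w\<bar>)"
    using assms(2) idem_systemD(2)[OF assms(1)] by (intro member_le_sum[of w]) auto
  then show ?thesis by (simp add: height_bound_def)
qed

lemma filtered_module_height:
  assumes \<pi>: "idem_system I \<pi>" and n: "n \<ge> 2 * height_bound \<mu> \<pi>"
  shows "filtered_module (\<lambda>r. S (of_rat r)) (height_filtration \<mu> \<pi>) n"
proof unfold_locales
  fix v w d r
  have "height \<mu> u \<le> int (height_bound \<mu> \<pi>)" if "app (\<pi> u) v \<noteq> 0" for u v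
    using height_bound[OF \<pi>, of u \<mu>] that by (cases "\<pi> u = 0") auto
  then show "height_filtration \<mu> \<pi> 0 = UNIV" by (auto simp: height_filtration_def)
  show "v + w \<in> height_filtration \<mu> \<pi> d"
    if "v \<in> height_filtration \<mu> \<pi> d" "w \<in> height_filtration \<mu> \<pi> d"
    using that unfolding height_filtration_def by (simp, metis add.right_neutral)
  show "0 \<in> height_filtration \<mu> \<pi> d" by (simp add: height_filtration_def)
  show "app (S (of_rat r)) v \<in> height_filtration \<mu> \<pi> d" if "v \<in> height_filtration \<mu> \<pi> d"
    using that by (auto simp: height_filtration_def Lin_scale idem_systemD(1)[OF \<pi>])
  show "height_filtration \<mu> \<pi> (Suc d) \<subseteq> height_filtration \<mu> \<pi> d"
    by (force simp: height_filtration_def)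
  show "height_filtration \<mu> \<pi> (Suc n) \<subseteq> {0}"
  proof
    fix v assume v: "v \<in> height_filtration \<mu> \<pi> (Suc n)"
    have "app (\<pi> w) v = 0" for w
    proof (rule ccontr)
      assume nz: "app (\<pi> w) v \<noteq> 0"
      then have "\<pi> w \<noteq> 0" by auto
      then have "\<bar>height \<mu> w\<bar> \<le> int (height_bound \<mu> \<pi>)" by (rule height_bound[OF \<pi>])
      moreover have "height \<mu> w + int (Suc n) \<le> int (height_bound \<mu> \<pi>)"
        by (rule v[unfolded height_filtration_def mem_Collect_eq, rule_format, OF nz])
      ultimately show False using n by linarith
    qed
    then show "v \<in> {0}" using idem_expand[OF \<pi>, of v] by simp
  qed
qed

lemma height_drop:
  assumes \<pi>: "idem_system I \<pi>"
    and a: "\<And>w w'. \<pi> w' * a * \<pi> w \<noteq> 0 \<Longrightarrow> height \<mu> w' + int k \<le> height \<mu> w"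
    and v: "v \<in> height_filtration \<mu> \<pi> d"
  shows "app a v \<in> height_filtration \<mu> \<pi> (d + k)"
  unfolding height_filtration_def
proof (intro CollectI allI impI)
  fix w' assume nz: "app (\<pi> w') (app a v) \<noteq> 0"
  have "app (\<pi> w') (app a v) = (\<Sum>w | \<pi> w \<noteq> 0. app (\<pi> w' * a) (app (\<pi> w) v))"
    using arg_cong[OF idem_expand[OF \<pi>, of v], of "app (\<pi> w' * a)"] by (simp add: app_sum)
  then obtain w where w: "app (\<pi> w' * a) (app (\<pi> w) v) \<noteq> 0"
    using nz by (metis (mono_tags, lifting) sum.neutral)
  then have "\<pi> w' * a * \<pi> w \<noteq> 0" by (metis app_times app_zero)
  then have "height \<mu> w' + int k \<le> height \<mu> w" by (rule a)
  moreover have "app (\<pi> w) v \<noteq> 0" using w by auto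
  then have "height \<mu> w + int d \<le> int (height_bound \<mu> \<pi>)"
    by (rule v[unfolded height_filtration_def mem_Collect_eq, rule_format])
  ultimately show "height \<mu> w' + int (d + k) \<le> int (height_bound \<mu> \<pi>)" by simp
qed

lemma lowering_height:
  assumes \<pi>: "idem_system I \<pi>" and a: "lowering g \<mu> \<pi> a" and v: "v \<in> height_filtration \<mu> \<pi> d"
  shows "app a v \<in> height_filtration \<mu> \<pi> (Suc d)"
proof -
  have "height \<mu> w' + int 1 \<le> height \<mu> w" if "\<pi> w' * a * \<pi> w \<noteq> 0" for w w'
  proof -
    have "lower g \<mu> w' w" using that by (rule a[unfolded lowering_def, rule_format])
    then show ?thesis by (simp add: lower_def height_def)
  qed
  from height_drop[OF \<pi> this v] show ?thesis by simp
qed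

lemma lowering_power:
  assumes \<pi>: "idem_system I \<pi>" and a: "lowering g \<mu> \<pi> a"
  shows "a ^ Suc (2 * height_bound \<mu> \<pi>) = 0"
proof -
  interpret F: filtered_module "\<lambda>r. S (of_rat r)" "height_filtration \<mu> \<pi>" "2 * height_bound \<mu> \<pi>"
    by (rule filtered_module_height[OF \<pi>]) simp
  have "app (a ^ k) v \<in> height_filtration \<mu> \<pi> k" for k v
    by (induct k) (simp_all add: F.F_UNIV lowering_height[OF \<pi> a])
  then have "app (a ^ Suc (2 * height_bound \<mu> \<pi>)) v = 0" for v using F.F_last by blast
  then show ?thesis by (intro endo_eqI) (simp del: power_Suc)
qed

lemma lowering_nil: "idem_system I \<pi> \<Longrightarrow> lowering g \<mu> \<pi> a \<Longrightarrow> nil a"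
  unfolding nil_def by (intro exI) (rule lowering_power)

definition lower_span :: "nat \<Rightarrow> (bidegree \<Rightarrow> 'v set) \<Rightarrow> nat \<Rightarrow> bidegree \<Rightarrow> 'v set" where
  "lower_span g U \<mu> w = span (\<Union>{U w' | w'. w' \<in> bidegrees g \<and> lower g \<mu> w' w})"

text \<open>The condition on the automorphisms of a triple, expressed by the blocks of an
  operator.\<close>

lemma lowering_iff:
  assumes \<pi>: "idem_system (bidegrees g) \<pi>" and U: "\<And>w. w \<in> bidegrees g \<Longrightarrow> U w = {v. app (\<pi> w) v = v}"
  shows "lowering g \<mu> \<pi> a \<longleftrightarrow> (\<forall>w\<in>bidegrees g. \<forall>u\<in>U w. app a u \<in> lower_span g U \<mu> w)"
proof
  assume a: "lowering g \<mu> \<pi> a"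
  show "\<forall>w\<in>bidegrees g. \<forall>u\<in>U w. app a u \<in> lower_span g U \<mu> w"
  proof (intro ballI)
    fix w u assume w: "w \<in> bidegrees g" and "u \<in> U w"
    then have u: "app (\<pi> w) u = u" using U by simp
    have "app (\<pi> w') (app a u) \<in> lower_span g U \<mu> w" for w'
    proof (cases "app (\<pi> w') (app a u) = 0")
      case True then show ?thesis unfolding True lower_span_def by (intro span_zero)
    next
      case False
      then have nz: "app (\<pi> w' * a * \<pi> w) u \<noteq> 0" by (simp add: u)
      have "\<pi> w' * a * \<pi> w \<noteq> 0"
      proof
        assume "\<pi> w' * a * \<pi> w = 0"
        then have "app (\<pi> w' * a * \<pi> w) u = app 0 u" by (rule arg_cong)
        then show False using nz by simp
      qed
      moreover from this have "\<pi> w' \<noteq> 0" by auto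
      ultimately have w': "lower g \<mu> w' w" "w' \<in> bidegrees g"
        using a[unfolded lowering_def, rule_format] idem_systemD(3)[OF \<pi>] by simp_all
      have "app (\<pi> w') (app a u) \<in> U w'"
        unfolding U[OF w'(2)]
        using arg_cong[OF idem_systemD(4)[OF \<pi>, of w'], of "\<lambda>b. app b (app a u)"] by simp
      then show ?thesis
        unfolding lower_span_def using w'
        by (intro span_base UnionI[of "U w'"] CollectI exI[of _ w'] conjI HOL.refl)
    qed
    then have "(\<Sum>w' | \<pi> w' \<noteq> 0. app (\<pi> w') (app a u)) \<in> lower_span g U \<mu> w"
      unfolding lower_span_def by (intro span_sum)
    then show "app a u \<in> lower_span g U \<mu> w" by (simp only: idem_expand[OF \<pi>])
  qed
next
  assume a: "\<forall>w\<in>bidegrees g. \<forall>u\<in>U w. app a u \<in> lower_span g U \<mu> w"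
  show "lowering g \<mu> \<pi> a"
    unfolding lowering_def
  proof (intro allI impI, rule ccontr)
    fix w w' assume nz: "\<pi> w' * a * \<pi> w \<noteq> 0" and low: "\<not> lower g \<mu> w' w"
    have "\<pi> w \<noteq> 0" using nz by auto
    then have w: "w \<in> bidegrees g" by (rule idem_systemD(3)[OF \<pi>])
    have "app (\<pi> w' * a * \<pi> w) v = 0" for v
    proof -
      have "app (\<pi> w) v \<in> U w"
        unfolding U[OF w] using idem_systemD(4)[OF \<pi>, of w] by (simp flip: app_times)
      then have "app a (app (\<pi> w) v) \<in> lower_span g U \<mu> w" using a w by blast
      moreover have "lower_span g U \<mu> w \<subseteq> {v. app (\<pi> w') v = 0}"
        unfolding lower_span_def
      proof (rule span_minimal)
        show "subspace {v. app (\<pi> w') v = 0}"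
          by (rule subspaceI) (simp_all add: Lin_scale idem_systemD(1)[OF \<pi>])
        show "\<Union>{U w' | w'. w' \<in> bidegrees g \<and> lower g \<mu> w' w} \<subseteq> {v. app (\<pi> w') v = 0}"
        proof
          fix v assume "v \<in> \<Union>{U w' | w'. w' \<in> bidegrees g \<and> lower g \<mu> w' w}"
          then obtain w2 where w2: "v \<in> U w2" "w2 \<in> bidegrees g" "lower g \<mu> w2 w" by auto
          have "w' \<noteq> w2"
          proof
            assume "w' = w2"
            then show False using low w2(3) by simp
          qed
          then have "app (\<pi> w' * \<pi> w2) v = app 0 v" using idem_systemD(5)[OF \<pi>] by simp
          moreover have "app (\<pi> w2) v = v" using w2(1) unfolding U[OF w2(2)] by (rule CollectD)
          ultimately show "v \<in> {v. app (\<pi> w') v = 0}" by simp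
        qed
      qed
      ultimately have "app a (app (\<pi> w) v) \<in> {v. app (\<pi> w') v = 0}" by (rule rev_subsetD)
      then show ?thesis by simp
    qed
    then have "\<pi> w' * a * \<pi> w = 0" by (intro endo_eqI) simp
    then show False using nz by contradiction
  qed
qed

text \<open>Different pairs \<open>(i, j)\<close> shift by different amounts, so each block of the sum comes from
  exactly one summand. This recovers the summands from the sum.\<close>

lemma component:
  fixes \<pi> :: "bidegree \<Rightarrow> 'v endo" and T :: "nat \<times> nat \<Rightarrow> 'v endo"
  assumes G: "finite G" and T: "\<And>i j w w'. (i, j) \<in> G \<Longrightarrow> \<pi> w' * T (i, j) * \<pi> w \<noteq> 0 \<Longrightarrow> shifts g \<mu> i j w' w"
    and ij: "(i, j) \<in> G"
  shows "\<pi> w' * T (i, j) * \<pi> w = (if shifts g \<mu> i j w' w then \<pi> w' * (\<Sum>kl\<in>G. T kl) * \<pi> w else 0)"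
proof (cases "shifts g \<mu> i j w' w")
  case True
  have "\<pi> w' * (\<Sum>kl\<in>G. T kl) * \<pi> w = (\<Sum>kl\<in>G. \<pi> w' * T kl * \<pi> w)"
    by (simp only: sum_distrib_left sum_distrib_right)
  also have "\<dots> = (\<Sum>kl\<in>{(i, j)}. \<pi> w' * T kl * \<pi> w)"
  proof (rule sum.mono_neutral_right[OF G])
    show "\<forall>kl\<in>G - {(i, j)}. \<pi> w' * T kl * \<pi> w = 0"
    proof
      fix kl assume kl: "kl \<in> G - {(i, j)}"
      obtain k l where [simp]: "kl = (k, l)" by (cases kl)
      show "\<pi> w' * T kl * \<pi> w = 0"
        using T[of k l w' w] kl True by (auto simp: shifts_def)
    qed
  qed (use ij in auto)
  finally show ?thesis using True by simp
qed (use T[OF ij, of w' w] in auto)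

end

section \<open>From representations to triples\<close>

definition lie_op :: "nat \<Rightarrow> (hlie set \<Rightarrow> 'v \<Rightarrow> 'v) \<Rightarrow> hlie \<Rightarrow> 'v::ab_group_add endo" where
  "lie_op n \<phi> x = Endo (\<phi> (un_class n x))"

context hodge_rep
begin

context
  fixes \<mu> n \<phi> assumes at: "acts_through scale g \<rho> \<mu> n \<phi>"
begin

lemma lie_op_app: "x \<in> Ln n \<Longrightarrow> app (lie_op n \<phi> x) = \<phi> (un_class n x)"
  and lie_op_Lin: "x \<in> Ln n \<Longrightarrow> Lin (lie_op n \<phi> x)"
  and lie_op_nil: "x \<in> Ln n \<Longrightarrow> nil (lie_op n \<phi> x)"
proof -
  assume x: "x \<in> Ln n"
  have *: "Vector_Spaces.linear scale scale (\<phi> (un_class n x))" "nilpotent_map (\<phi> (un_class n x))"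
    using at un_class_in_un[OF x] unfolding acts_through_def nil_lie_rep_def by blast+
  show app: "app (lie_op n \<phi> x) = \<phi> (un_class n x)" and "Lin (lie_op n \<phi> x)"
    unfolding lie_op_def using linear_Endo[OF *(1)] by simp_all
  show "nil (lie_op n \<phi> x)" using *(2) by (simp add: nilpotent_map_app[symmetric] app)
qed

lemma lie_op_simps:
  assumes "x \<in> Ln n" "y \<in> Ln n"
  shows "lie_op n \<phi> (x + y) = lie_op n \<phi> x + lie_op n \<phi> y"
    "lie_op n \<phi> (lscale c x) = S c * lie_op n \<phi> x"
    "lie_op n \<phi> (lbr x y) = lie_op n \<phi> x * lie_op n \<phi> y - lie_op n \<phi> y * lie_op n \<phi> x"
  using at assms unfolding acts_through_def nil_lie_rep_def
  by (auto intro!: endo_eqI simp: lie_op_app Ln_add Ln_scale Ln_br)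

lemma lie_op_0: "lie_op n \<phi> 0 = 0"
  using lie_op_simps(2)[OF Ln_0 Ln_0, of 0] by (simp add: S_simps)

lemma lie_op_sum: "(\<And>i. i \<in> I \<Longrightarrow> f i \<in> Ln n) \<Longrightarrow> lie_op n \<phi> (\<Sum>i\<in>I. f i) = (\<Sum>i\<in>I. lie_op n \<phi> (f i))"
  by (induct I rule: infinite_finite_induct) (auto simp: lie_op_0 lie_op_simps Ln_sum)

lemma R_unip:
  assumes "u \<in> carrier Ulim" "x \<in> Ln n" "u n = un_class n x"
  shows "R (unip_elt g \<mu> u) = ex (lie_op n \<phi> x)"
proof (rule endo_eqI)
  fix v
  have "\<rho> (factor g \<mu> ((1, 1), u)) = nil_exp scale (\<phi> (u n))"
    using at assms(1) by (simp add: acts_through_def)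
  then show "app (R (unip_elt g \<mu> u)) v = app (ex (lie_op n \<phi> x)) v"
    using nil_exp_app[OF lie_op_nil[OF assms(2)]]
    by (simp add: app_R unip_elt_closed assms lie_op_app) (simp add: unip_elt_def)
qed

lemma R_lift: "R (unip_elt g \<mu> (lie_lift x)) = ex (lie_op n \<phi> (Ln_proj n x))"
  by (rule R_unip[OF lie_lift_Ulim Ln_proj_in]) (simp add: lie_lift_def)

end

text \<open>The operator of \<open>T\<^sup>i\<^sup>,\<^sup>j\<close> does not depend on the level: at every level its exponential is
  the action of the same element of \<open>U\<close>, and the exponential is injective on nilpotent
  operators.\<close>

lemma rep_T_eq:
  assumes at: "acts_through scale g \<rho> \<mu> n \<phi>"
  shows "rep_T scale g \<rho> \<mu> i j = app (lie_op n \<phi> (Ln_proj n (gen (i, j))))"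
proof -
  have T: "\<phi>' (un_T m i j) = app (lie_op m \<phi>' (Ln_proj m (gen (i, j))))"
    if "acts_through scale g \<rho> \<mu> m \<phi>'" for m \<phi>'
    unfolding lie_op_app[OF that Ln_proj_in] un_T_def ..
  show ?thesis
    unfolding rep_T_def
  proof (rule the_equality)
    show "\<exists>m \<phi>'. acts_through scale g \<rho> \<mu> m \<phi>' \<and> app (lie_op n \<phi> (Ln_proj n (gen (i, j)))) = \<phi>' (un_T m i j)"
      using at T[OF at] by (intro exI[of _ n] exI[of _ \<phi>]) simp
  next
    fix N assume "\<exists>m \<phi>'. acts_through scale g \<rho> \<mu> m \<phi>' \<and> N = \<phi>' (un_T m i j)"
    then obtain m \<phi>' where m: "acts_through scale g \<rho> \<mu> m \<phi>'" "N = \<phi>' (un_T m i j)"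
      by (elim exE conjE)
    have "lie_op m \<phi>' (Ln_proj m (gen (i, j))) = lie_op n \<phi> (Ln_proj n (gen (i, j)))"
      using R_lift[OF at, of "gen (i, j)"] R_lift[OF m(1), of "gen (i, j)"]
      by (intro ex_inject[OF lie_op_nil[OF m(1) Ln_proj_in] lie_op_nil[OF at Ln_proj_in]]) simp
    then show "N = app (lie_op n \<phi> (Ln_proj n (gen (i, j))))" by (simp add: m(2) T[OF m(1)])
  qed
qed

lemma rep_t_eq:
  assumes at: "acts_through scale g \<rho> \<mu> n \<phi>"
  shows "rep_t scale g \<rho> \<mu> = app (ex (lie_op n \<phi> (generator_sum n)))"
proof -
  let ?A = "{(i, j). 0 < i \<and> 0 < j \<and> rep_T scale g \<rho> \<mu> i j \<noteq> (\<lambda>_. 0)}"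
  have sub: "?A \<subseteq> Ln_gens n"
  proof
    fix ij assume "ij \<in> ?A"
    then obtain i j where ij: "ij = (i, j)" "0 < i" "0 < j" "rep_T scale g \<rho> \<mu> i j \<noteq> (\<lambda>_. 0)" by auto
    show "ij \<in> Ln_gens n"
    proof (rule ccontr)
      assume "ij \<notin> Ln_gens n"
      then have "rep_T scale g \<rho> \<mu> i j = app 0"
        unfolding rep_T_eq[OF at] by (simp add: ij(1) Ln_proj_gen lie_op_0[OF at])
      then show False using ij(4) by (simp add: fun_eq_iff)
    qed
  qed
  have "(\<Sum>(i, j)\<in>?A. rep_T scale g \<rho> \<mu> i j v) = app (lie_op n \<phi> (generator_sum n)) v" for v
  proof -
    have "(\<Sum>(i, j)\<in>?A. rep_T scale g \<rho> \<mu> i j v) = (\<Sum>(i, j)\<in>Ln_gens n. rep_T scale g \<rho> \<mu> i j v)"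
    proof (rule sum.mono_neutral_left[OF finite_Ln_gens sub])
      show "\<forall>ij\<in>Ln_gens n - ?A. (case ij of (i, j) \<Rightarrow> rep_T scale g \<rho> \<mu> i j v) = 0"
        by (auto simp: Ln_gens_def)
    qed
    also have "\<dots> = (\<Sum>ij\<in>Ln_gens n. app (lie_op n \<phi> (gen ij)) v)"
      by (rule sum.cong) (auto simp: rep_T_eq[OF at] Ln_proj_gen)
    also have "\<dots> = app (lie_op n \<phi> (generator_sum n)) v"
      unfolding generator_sum_def by (simp add: lie_op_sum[OF at] Ln_gen sum_app)
    finally show ?thesis .
  qed
  then show ?thesis
    unfolding rep_t_def by (simp add: nil_exp_app[OF lie_op_nil[OF at generator_sum_Ln], symmetric])
qed

lemma rep_t_R:
  assumes at: "acts_through scale g \<rho> \<mu> n \<phi>"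
  shows "rep_t scale g \<rho> \<mu> = app (R (unip_elt g \<mu> (lie_lift (generator_sum n))))"
  unfolding rep_t_eq[OF at] R_lift[OF at] by (simp add: Ln_proj_id generator_sum_Ln)

text \<open>Conjugation by \<open>z\<close> in the group multiplies the generator by \<open>x\<^sup>-\<^sup>i y\<^sup>-\<^sup>j\<close>; injectivity of
  the exponential carries this over to operators. Hence a nonzero block from \<open>w\<close> to \<open>w'\<close> forces
  \<open>\<chi>\<^sub>w\<^sub>'(z) = x\<^sup>-\<^sup>i y\<^sup>-\<^sup>j \<chi>\<^sub>w(z)\<close> for all \<open>z\<close>.\<close>

lemma generator_shifts:
  assumes at: "acts_through scale g \<rho> \<mu> n \<phi>"
    and \<pi>: "idem_system (bidegrees g) \<pi>"
    and act: "\<And>z. z \<in> torus g \<Longrightarrow> R (torus_elt g z) = grading_action g \<pi> z"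
    and \<mu>: "\<mu> < g" and ij: "(i, j) \<in> Ln_gens n"
    and nz: "\<pi> w' * lie_op n \<phi> (gen (i, j)) * \<pi> w \<noteq> 0"
  shows "shifts g \<mu> i j w' w"
proof -
  let ?T = "lie_op n \<phi> (gen (i, j))"
  let ?c = "\<lambda>z. fst (z \<mu>) powi (- int i) * snd (z \<mu>) powi (- int j)"
  have T: "nil ?T" "Lin ?T" using lie_op_nil[OF at] lie_op_Lin[OF at] Ln_gen[OF ij] by auto
  have conj: "grading_action g \<pi> z * ?T = S (?c z) * ?T * grading_action g \<pi> z" if z: "z \<in> torus g" for z
  proof -
    let ?D = "grading_action g \<pi> z"
    obtain D' where D: "?D * D' = 1" "D' * ?D = 1" by (rule grading_action_inverse[OF \<pi> z]) (rule that)
    let ?u = "lie_lift (gen (i, j))"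
    have "Ulim_act (z \<mu>) ?u = lie_lift (lscale (?c z) (gen (i, j)))"
      by (simp add: Ulim_act_lift lie_act_gen)
    then have "R (torus_elt g z \<otimes>\<^bsub>GCg g\<^esub> unip_elt g \<mu> ?u)
        = R (unip_elt g \<mu> (lie_lift (lscale (?c z) (gen (i, j)))) \<otimes>\<^bsub>GCg g\<^esub> torus_elt g z)"
      by (simp add: torus_unip lie_lift_Ulim z)
    then have "?D * ex ?T = ex (S (?c z) * ?T) * ?D"
      using z Ln_gen[OF ij]
      by (simp add: R_mult torus_elt_closed unip_elt_closed lie_lift_Ulim act R_lift[OF at]
          Ln_proj_id Ln_scale lie_op_simps(2)[OF at])
    then have "?D * ex ?T * D' = ex (S (?c z) * ?T) * (?D * D')" by (simp add: mult.assoc)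
    then have eq: "?D * ex ?T * D' = ex (S (?c z) * ?T)" by (simp add: D)
    have pow: "(?D * ?T * D') ^ k = ?D * ?T ^ k * D'" for k
    proof (induct k)
      case (Suc k)
      have "(?D * ?T * D') ^ Suc k = ?D * ?T * D' * (?D * ?T ^ k * D')"
        by (simp only: power_Suc Suc)
      also have "\<dots> = ?D * ?T * (D' * ?D) * ?T ^ k * D'" by (simp only: mult.assoc)
      finally show ?case by (simp add: D mult.assoc)
    qed (simp add: D)
    have nilD: "nil (?D * ?T * D')"
      using T(1) unfolding nil_def pow by (elim exE) (metis mult_zero_left mult_zero_right)
    have rr: "rational_ring (\<lambda>r. S (of_rat r))" by unfold_locales
    have "?D * ex ?T * D' = ex (?D * ?T * D')"
      unfolding ex_def
    proof (rule ser_hom[where h = "\<lambda>x. ?D * x * D'", OF rr rr T(1) nilD])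
      fix r k
      show "?D * (S (of_rat r) * ?T ^ k) * D' = S (of_rat r) * (?D * ?T * D') ^ k"
        unfolding pow by (simp add: mult.assoc Lin_S_left[OF Lin_grading_action[OF \<pi>]])
    qed (simp add: distrib_left distrib_right)
    then have "ex (?D * ?T * D') = ex (S (?c z) * ?T)" using eq by simp
    moreover have "nil (S (?c z) * ?T)"
      using nil_mult_commuting[OF T(1), of "S (?c z)"] Lin_S_commute[OF T(2), of "?c z"] by simp
    ultimately have "?D * ?T * D' = S (?c z) * ?T" by (intro ex_inject[OF nilD])
    then have "?D * ?T * (D' * ?D) = S (?c z) * ?T * ?D" by (simp flip: mult.assoc)
    then show ?thesis by (simp add: D)
  qed
  have eq: "character g w' z = ?c z * character g w z" if z: "z \<in> torus g" for z
  proof -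
    have "\<pi> w' * (grading_action g \<pi> z * ?T) * \<pi> w = \<pi> w' * (S (?c z) * ?T * grading_action g \<pi> z) * \<pi> w"
      unfolding conj[OF z] ..
    moreover have "\<pi> w' * (grading_action g \<pi> z * ?T) * \<pi> w = S (character g w' z) * (\<pi> w' * ?T * \<pi> w)"
      using grading_action_idem(2)[OF \<pi>, of w' g z] by (simp flip: mult.assoc)
    moreover have "\<pi> w' * (S (?c z) * ?T * grading_action g \<pi> z) * \<pi> w
        = S (?c z * character g w z) * (\<pi> w' * ?T * \<pi> w)"
      by (simp add: mult.assoc grading_action_idem(1)[OF \<pi>] Lin_S_left[OF T(2)]
          Lin_S_left[OF idem_systemD(1)[OF \<pi>]] S_simps(5))
    ultimately have "S (character g w' z - ?c z * character g w z) * (\<pi> w' * ?T * \<pi> w) = 0"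
      by (simp add: S_simps(4) left_diff_distrib)
    then show ?thesis
      using nz S_cancel[of "character g w' z - ?c z * character g w z" "\<pi> w' * ?T * \<pi> w" 0]
      by (cases "character g w' z - ?c z * character g w z = 0") simp_all
  qed
  have other: "fst w' \<nu> = fst w \<nu> \<and> snd w' \<nu> = snd w \<nu>" if "\<nu> < g" "\<nu> \<noteq> \<mu>" for \<nu>
    using eq[OF torus_at_closed, of 2 1 \<nu>] eq[OF torus_at_closed, of 1 2 \<nu>] that
    by (simp add: character_torus_at two_powi_inject) (simp add: torus_at_def two_powi_inject)
  have "(2::complex) powi fst w' \<mu> = 2 powi (fst w \<mu> - int i)" "(2::complex) powi snd w' \<mu> = 2 powi (snd w \<mu> - int j)"
    using eq[OF torus_at_closed, of 2 1 \<mu>] eq[OF torus_at_closed, of 1 2 \<mu>] \<mu>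
    by (simp_all add: character_torus_at) (simp_all add: torus_at_def power_int_diff power_int_minus divide_inverse mult.commute)
  then show ?thesis using other by (simp add: shifts_def two_powi_inject)
qed

end

lemma fst_correspondence:
  assumes "w \<in> bidegrees g"
  shows "fst (correspondence scale g \<rho>) w = (\<Inter>\<mu><g. weight_space scale g \<rho> \<mu> (fst w \<mu>) (snd w \<mu>))"
  using assms by (cases w) (simp add: correspondence_def bidegrees_def)

lemma snd_correspondence: "\<mu> < g \<Longrightarrow> snd (correspondence scale g \<rho>) \<mu> = rep_t scale g \<rho> \<mu>"
  by (simp add: correspondence_def)

context complex_fd_space
begin

lemma lower_span_pair:
  "span (\<Union>{U (r, s) | r s. r \<in> Zg g \<and> s \<in> Zg g \<and>
      (\<forall>\<nu><g. \<nu> \<noteq> \<mu> \<longrightarrow> r \<nu> = p \<nu> \<and> s \<nu> = q \<nu>) \<and> r \<mu> < p \<mu> \<and> s \<mu> < q \<mu>})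
    = lower_span g U \<mu> (p, q)"
  unfolding lower_span_def
  by (intro arg_cong[of _ _ span] arg_cong[of _ _ Union] Set.set_eqI)
    (simp add: bidegrees_def lower_def)

lemma triples_iff:
  "(U, t) \<in> triples scale g \<longleftrightarrow> U \<in> extensional (bidegrees g) \<and> t \<in> extensional {..<g} \<and>
     is_grading scale (bidegrees g) U \<and>
     (\<forall>\<mu><g. Vector_Spaces.linear scale scale (t \<mu>) \<and> bij (t \<mu>)) \<and>
     (\<forall>\<mu><g. \<forall>\<nu><g. t \<mu> \<circ> t \<nu> = t \<nu> \<circ> t \<mu>) \<and>
     (\<forall>\<mu><g. \<forall>w\<in>bidegrees g. \<forall>u\<in>U w. t \<mu> u - u \<in> lower_span g U \<mu> w)"
proof -
  have "(\<forall>p\<in>Zg g. \<forall>q\<in>Zg g. \<forall>u\<in>U (p, q). t \<mu> u - u \<in> lower_span g U \<mu> (p, q))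
      \<longleftrightarrow> (\<forall>w\<in>bidegrees g. \<forall>u\<in>U w. t \<mu> u - u \<in> lower_span g U \<mu> w)" for \<mu>
    by (simp add: bidegrees_def)
  then show ?thesis
    unfolding triples_def mem_Collect_eq case_prod_conv lower_span_pair
    by (simp only: bidegrees_def[symmetric])
qed

end

context hodge_rep
begin

lemma generator_sum_lowering:
  assumes at: "acts_through scale g \<rho> \<mu> n \<phi>"
    and \<pi>: "idem_system (bidegrees g) \<pi>"
    and act: "\<And>z. z \<in> torus g \<Longrightarrow> R (torus_elt g z) = grading_action g \<pi> z"
    and \<mu>: "\<mu> < g"
  shows "lowering g \<mu> \<pi> (lie_op n \<phi> (generator_sum n))"
proof -
  have "lie_op n \<phi> (generator_sum n) = (\<Sum>ij\<in>Ln_gens n. lie_op n \<phi> (gen ij))"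
    unfolding generator_sum_def by (rule lie_op_sum[OF at Ln_gen])
  moreover have "lowering g \<mu> \<pi> (lie_op n \<phi> (gen ij))" if ij: "ij \<in> Ln_gens n" for ij
  proof (cases ij)
    case (Pair i j)
    show ?thesis
      unfolding lowering_def
    proof (intro allI impI)
      fix w w' assume "\<pi> w' * lie_op n \<phi> (gen ij) * \<pi> w \<noteq> 0"
      then have "shifts g \<mu> i j w' w"
        using ij unfolding Pair by (intro generator_shifts[OF at \<pi> act \<mu>])
      then show "lower g \<mu> w' w" by (rule shifts_lower) (use ij in \<open>simp_all add: Pair Ln_gens_def\<close>)
    qed
  qed
  ultimately show ?thesis by (simp add: lowering_sum)
qed

text \<open>The automorphism \<open>t\<^sub>\<mu>\<close> is the action of an element of the \<open>\<mu>\<close>-th unipotent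
  factor; hence it is invertible, and automorphisms of different factors commute.\<close>

theorem correspondence_in_triples: "correspondence scale g \<rho> \<in> triples scale g"
proof -
  define U where "U = fst (correspondence scale g \<rho>)"
  define t where "t = snd (correspondence scale g \<rho>)"
  obtain \<pi> where \<pi>: "idem_system (bidegrees g) \<pi>"
    and act: "\<And>z. z \<in> torus g \<Longrightarrow> R (torus_elt g z) = grading_action g \<pi> z"
    by (rule torus_idem) (rule that)
  have U: "U w = {v. app (\<pi> w) v = v}" if "w \<in> bidegrees g" for w
    unfolding U_def fst_correspondence[OF that] by (rule weight_spaces[OF \<pi> act that])
  have t: "\<exists>n \<phi>. acts_through scale g \<rho> \<mu> n \<phi> \<and>
      t \<mu> = app (R (unip_elt g \<mu> (lie_lift (generator_sum n))))" if "\<mu> < g" for \<mu>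
  proof -
    obtain n0 where "\<forall>n\<ge>n0. \<exists>\<phi>. acts_through scale g \<rho> \<mu> n \<phi>" using acts_through_eventually[of \<mu>] ..
    then obtain \<phi> where at: "acts_through scale g \<rho> \<mu> n0 \<phi>" by auto
    show ?thesis
      unfolding t_def snd_correspondence[OF that] using at rep_t_R[OF at] by (intro exI conjI)
  qed
  have closed: "unip_elt g \<mu> (lie_lift x) \<in> carrier (GCg g)" for \<mu> x
    by (simp add: unip_elt_closed lie_lift_Ulim)
  have "(U, t) \<in> triples scale g"
    unfolding triples_iff
  proof (intro conjI allI impI ballI)
    show "U \<in> extensional (bidegrees g)"
      by (simp add: U_def correspondence_def bidegrees_def)
    show "t \<in> extensional {..<g}" by (simp add: t_def correspondence_def)
    show "is_grading scale (bidegrees g) U" by (rule is_grading_idem[OF \<pi> U])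
  next
    fix \<mu> assume "\<mu> < g"
    then obtain n where t\<mu>: "t \<mu> = app (R (unip_elt g \<mu> (lie_lift (generator_sum n))))"
      using t by meson
    show "Vector_Spaces.linear scale scale (t \<mu>)" "bij (t \<mu>)"
      unfolding t\<mu> app_R[OF closed] using rho_GL[OF closed] by simp_all
  next
    fix \<mu> \<nu> assume \<mu>: "\<mu> < g" and \<nu>: "\<nu> < g"
    show "t \<mu> \<circ> t \<nu> = t \<nu> \<circ> t \<mu>"
    proof (cases "\<mu> = \<nu>")
      case False
      obtain n where t\<mu>: "t \<mu> = app (R (unip_elt g \<mu> (lie_lift (generator_sum n))))"
        using t[OF \<mu>] by meson
      obtain m where t\<nu>: "t \<nu> = app (R (unip_elt g \<nu> (lie_lift (generator_sum m))))"
        using t[OF \<nu>] by meson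
      have "R (unip_elt g \<mu> (lie_lift (generator_sum n))) * R (unip_elt g \<nu> (lie_lift (generator_sum m)))
        = R (unip_elt g \<nu> (lie_lift (generator_sum m))) * R (unip_elt g \<mu> (lie_lift (generator_sum n)))"
        using unip_elt_comm[OF lie_lift_Ulim lie_lift_Ulim False, of g]
        by (simp add: R_mult[OF closed closed, symmetric])
      then show ?thesis
        unfolding t\<mu> t\<nu> by (intro ext) (metis app_times comp_apply)
    qed simp
  next
    fix \<mu> w u assume \<mu>: "\<mu> < g" and w: "w \<in> bidegrees g" "u \<in> U w"
    obtain n \<phi> where at: "acts_through scale g \<rho> \<mu> n \<phi>"
      using t[OF \<mu>] by meson
    let ?N = "lie_op n \<phi> (generator_sum n)"
    have "lowering g \<mu> \<pi> (ex ?N - 1)"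
      unfolding ex_minus_1[OF lie_op_nil[OF at generator_sum_Ln]]
      by (rule lowering_ser[OF \<pi> generator_sum_lowering[OF at \<pi> act \<mu>]]) simp_all
    then have "app (ex ?N - 1) u \<in> lower_span g U \<mu> w"
      using w lowering_iff[OF \<pi> U] by simp
    then show "t \<mu> u - u \<in> lower_span g U \<mu> w"
      unfolding t_def snd_correspondence[OF \<mu>] rep_t_eq[OF at] by simp
  qed
  then show ?thesis by (simp add: U_def t_def)
qed

end

section \<open>A representation is determined by its triple\<close>

context complex_fd_space
begin

text \<open>Equal weight spaces give equal torus actions. Equal \<open>t\<^sub>\<mu>\<close> have equal logarithms, whose
  parts of bidegree \<open>(-i, -j)\<close> are the generators; these determine the representation of \<open>u\<^sub>n\<close> at
  a level through which both representations act.\<close>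

theorem correspondence_inject:
  assumes rep: "\<rho> \<in> reps scale g" and rep': "\<rho>' \<in> reps scale g"
    and eq: "correspondence scale g \<rho> = correspondence scale g \<rho>'"
  shows "\<rho> = \<rho>'"
proof -
  interpret r: hodge_rep scale Basis g \<rho> by unfold_locales (rule rep)
  interpret r': hodge_rep scale Basis g \<rho>' by unfold_locales (rule rep')
  obtain \<pi> where \<pi>: "idem_system (bidegrees g) \<pi>"
    and act: "\<And>z. z \<in> torus g \<Longrightarrow> r.R (torus_elt g z) = grading_action g \<pi> z"
    by (rule r.torus_idem) (rule that)
  obtain \<pi>' where \<pi>': "idem_system (bidegrees g) \<pi>'"
    and act': "\<And>z. z \<in> torus g \<Longrightarrow> r'.R (torus_elt g z) = grading_action g \<pi>' z"
    by (rule r'.torus_idem) (rule that)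
  have "{v. app (\<pi> w) v = v} = {v. app (\<pi>' w) v = v}" if w: "w \<in> bidegrees g" for w
    using r.weight_spaces[OF \<pi> act w] r'.weight_spaces[OF \<pi>' act' w] eq
      fst_correspondence[OF w, of scale \<rho>] fst_correspondence[OF w, of scale \<rho>'] by simp
  then have same: "\<pi> = \<pi>'" by (rule idem_unique[OF \<pi> \<pi>'])
  have unip: "r.R (unip_elt g \<mu> u) = r'.R (unip_elt g \<mu> u)" if \<mu>: "\<mu> < g" and u: "u \<in> carrier Ulim" for \<mu> u
  proof -
    obtain n0 where n0: "\<forall>n\<ge>n0. \<exists>\<phi>. acts_through scale g \<rho> \<mu> n \<phi>" using r.acts_through_eventually[of \<mu>] ..
    obtain n1 where n1: "\<forall>n\<ge>n1. \<exists>\<phi>. acts_through scale g \<rho>' \<mu> n \<phi>" using r'.acts_through_eventually[of \<mu>] ..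
    define n where "n = max n0 n1"
    obtain \<phi> where at: "acts_through scale g \<rho> \<mu> n \<phi>" using n0[rule_format, of n] by (auto simp: n_def)
    obtain \<phi>' where at': "acts_through scale g \<rho>' \<mu> n \<phi>'" using n1[rule_format, of n] by (auto simp: n_def)
    let ?T = "\<lambda>ij. lie_op n \<phi> (gen ij)" and ?T' = "\<lambda>ij. lie_op n \<phi>' (gen ij)"
    have "rep_t scale g \<rho> \<mu> = rep_t scale g \<rho>' \<mu>"
      using snd_correspondence[OF \<mu>, of scale \<rho>] snd_correspondence[OF \<mu>, of scale \<rho>'] eq by simp
    then have "ex (lie_op n \<phi> (generator_sum n)) = ex (lie_op n \<phi>' (generator_sum n))"
      unfolding r.rep_t_eq[OF at] r'.rep_t_eq[OF at'] app_inject .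
    then have "lie_op n \<phi> (generator_sum n) = lie_op n \<phi>' (generator_sum n)"
      by (rule ex_inject[OF r.lie_op_nil[OF at generator_sum_Ln] r'.lie_op_nil[OF at' generator_sum_Ln]])
    moreover have "lie_op n \<phi> (generator_sum n) = (\<Sum>ij\<in>Ln_gens n. ?T ij)"
      unfolding generator_sum_def by (rule r.lie_op_sum[OF at Ln_gen])
    moreover have "lie_op n \<phi>' (generator_sum n) = (\<Sum>ij\<in>Ln_gens n. ?T' ij)"
      unfolding generator_sum_def by (rule r'.lie_op_sum[OF at' Ln_gen])
    ultimately have N: "(\<Sum>ij\<in>Ln_gens n. ?T ij) = (\<Sum>ij\<in>Ln_gens n. ?T' ij)" by simp
    have gens: "?T ij = ?T' ij" if ij: "ij \<in> Ln_gens n" for ij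
    proof (cases ij)
      case (Pair i j)
      note ij' = ij[unfolded Pair]
      show ?thesis
        unfolding Pair
      proof (rule idem_eqI2[OF \<pi>])
        fix w w'
        show "\<pi> w' * ?T (i, j) * \<pi> w = \<pi> w' * ?T' (i, j) * \<pi> w"
          using component[of "Ln_gens n" \<pi> ?T g \<mu> i j w' w, OF finite_Ln_gens
              r.generator_shifts[OF at \<pi> act \<mu>] ij']
            component[of "Ln_gens n" \<pi> ?T' g \<mu> i j w' w, OF finite_Ln_gens
              r'.generator_shifts[OF at' \<pi>'[folded same] act'[folded same] \<mu>] ij']
          by (simp add: N)
      qed
    qed
    have lie: "lie_op n \<phi> x = lie_op n \<phi>' x" if "x \<in> Ln n" for x
      using that unfolding Ln_def
    proof (induct rule: lie_subalgebra.induct)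
      case (base x)
      then show ?case using gens by auto
    next
      case zero
      show ?case by (simp add: r.lie_op_0[OF at] r'.lie_op_0[OF at'])
    qed (simp_all add: Ln_def[symmetric] r.lie_op_simps[OF at] r'.lie_op_simps[OF at'])
    obtain x where x: "x \<in> Ln n" "u n = un_class n x" using Ulim_at[OF u, of n] by (rule bexE)
    show ?thesis
      unfolding r.R_unip[OF at u x] r'.R_unip[OF at' u x] lie[OF x(1)] ..
  qed
  have R: "r.R a = r'.R a" if a: "a \<in> carrier (GCg g)" for a
    by (rule GCg_hom_eqI[OF r.R_mult r'.R_mult _ unip a]) (simp_all add: act act' same)
  show ?thesis
  proof (rule extensionalityI)
    show "\<rho> \<in> extensional (carrier (GCg g))" "\<rho>' \<in> extensional (carrier (GCg g))"
      using rep rep' by (simp_all add: reps_def)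
    fix a assume a: "a \<in> carrier (GCg g)"
    show "\<rho> a = \<rho>' a"
      unfolding r.app_R[OF a, symmetric] r'.app_R[OF a, symmetric] R[OF a] ..
  qed
qed

end

section \<open>Ordered products and regular families of operators\<close>

lemma prod_list_commute:
  fixes f :: "'i \<Rightarrow> 'r::monoid_mult"
  shows "(\<And>i. i \<in> set xs \<Longrightarrow> a * f i = f i * a) \<Longrightarrow> a * prod_list (map f xs) = prod_list (map f xs) * a"
proof (induct xs)
  case (Cons x xs)
  have "a * (f x * prod_list (map f xs)) = f x * (a * prod_list (map f xs))"
    using Cons(2)[of x] by (simp flip: mult.assoc)
  then show ?case using Cons by (simp add: mult.assoc)
qed simp

lemma prod_list_mult:
  fixes f h :: "'i \<Rightarrow> 'r::monoid_mult"
  assumes "distinct xs" "\<And>i j. i \<in> set xs \<Longrightarrow> j \<in> set xs \<Longrightarrow> i \<noteq> j \<Longrightarrow> h i * f j = f j * h i"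
  shows "prod_list (map (\<lambda>i. f i * h i) xs) = prod_list (map f xs) * prod_list (map h xs)"
  using assms
proof (induct xs)
  case (Cons x xs)
  have "h x * prod_list (map f xs) = prod_list (map f xs) * h x"
    using Cons(2,3) by (intro prod_list_commute) auto
  moreover have "prod_list (map (\<lambda>i. f i * h i) xs) = prod_list (map f xs) * prod_list (map h xs)"
    using Cons by simp
  ultimately show ?case by (simp add: mult.assoc) (simp flip: mult.assoc)
qed simp

lemma prod_list_intertwine:
  fixes f f' :: "'i \<Rightarrow> 'r::monoid_mult"
  assumes "\<And>i. i \<in> set xs \<Longrightarrow> a * f i = f' i * a"
  shows "a * prod_list (map f xs) = prod_list (map f' xs) * a"
  using assms
proof (induct xs)
  case (Cons x xs)
  have "a * (f x * prod_list (map f xs)) = f' x * (a * prod_list (map f xs))"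
    using Cons(2)[of x] by (simp flip: mult.assoc)
  then show ?case using Cons by (simp add: mult.assoc)
qed simp

lemma prod_list_single:
  fixes e :: "'r::monoid_mult"
  shows "distinct xs \<Longrightarrow> prod_list (map (\<lambda>i. if i = k then e else 1) xs) = (if k \<in> set xs then e else 1)"
  by (induct xs) auto

context rational_ring
begin

text \<open>A generalization of conjugation to elements that need not be invertible.\<close>

lemma ser_intertwine:
  assumes "d * a = b * d" "nil a" "nil b"
  shows "d * ser c a = ser c b * d"
proof -
  obtain i where "a ^ i = 0" using assms(2) by (auto simp: nil_def)
  then have a: "a ^ k = 0" if "k \<ge> i" for k using that by (rule power_eq_0_mono)
  obtain j where "b ^ j = 0" using assms(3) by (auto simp: nil_def)
  then have b: "b ^ k = 0" if "k \<ge> j" for k using that by (rule power_eq_0_mono)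
  have pow: "d * a ^ k = b ^ k * d" for k
  proof (induct k)
    case (Suc k)
    have "d * a ^ Suc k = d * a * a ^ k" by (simp add: mult.assoc)
    also have "\<dots> = b * (d * a ^ k)" by (simp add: assms(1) mult.assoc)
    finally show ?case by (simp add: Suc mult.assoc)
  qed simp
  have "d * (q r * a ^ k) = q r * b ^ k * d" for r k
    by (simp add: q_left[of d] pow mult.assoc)
  then show ?thesis
    unfolding ser_eq[OF a[of "i + j", simplified]] ser_eq[OF b[of "i + j", simplified]]
    by (simp add: sum_distrib_left sum_distrib_right)
qed

end

lemma regular_powi1: "\<mu> < g \<Longrightarrow> (\<lambda>a. fst (fst (a \<mu>)) powi k) \<in> regular_functions g"
proof -
  assume \<mu>: "\<mu> < g"
  have "(\<lambda>a. fst (fst (a \<mu>)) ^ m) \<in> regular_functions g" "(\<lambda>a. inverse (fst (fst (a \<mu>))) ^ m) \<in> regular_functions g" for m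
    by (induct m) (simp_all add: regular_functions.const regular_functions.mult regular_functions.torus1
        regular_functions.torus1_inv \<mu>)
  then show ?thesis by (cases "0 \<le> k") (simp_all add: power_int_def)
qed

lemma regular_powi2: "\<mu> < g \<Longrightarrow> (\<lambda>a. snd (fst (a \<mu>)) powi k) \<in> regular_functions g"
proof -
  assume \<mu>: "\<mu> < g"
  have "(\<lambda>a. snd (fst (a \<mu>)) ^ m) \<in> regular_functions g" "(\<lambda>a. inverse (snd (fst (a \<mu>))) ^ m) \<in> regular_functions g" for m
    by (induct m) (simp_all add: regular_functions.const regular_functions.mult regular_functions.torus2
        regular_functions.torus2_inv \<mu>)
  then show ?thesis by (cases "0 \<le> k") (simp_all add: power_int_def)
qed

lemma regular_prod:
  "(\<And>i. i \<in> I \<Longrightarrow> f i \<in> regular_functions g) \<Longrightarrow> (\<lambda>a. \<Prod>i\<in>I. f i a) \<in> regular_functions g"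
  by (induct I rule: infinite_finite_induct) (simp_all add: regular_functions.const regular_functions.mult)

lemma regular_sum:
  "(\<And>i. i \<in> I \<Longrightarrow> f i \<in> regular_functions g) \<Longrightarrow> (\<lambda>a. \<Sum>i\<in>I. f i a) \<in> regular_functions g"
  by (induct I rule: infinite_finite_induct) (simp_all add: regular_functions.const regular_functions.add)

lemma regular_character: "(\<lambda>a. character g w (\<lambda>\<mu>. fst (a \<mu>))) \<in> regular_functions g"
  unfolding character_def
  by (intro regular_prod regular_functions.mult regular_powi1 regular_powi2) simp_all

lemma character_shifts:
  assumes "shifts g \<mu> i j w' w" "\<mu> < g" "z \<in> torus g"
  shows "character g w' z = fst (z \<mu>) powi (- int i) * snd (z \<mu>) powi (- int j) * character g w z"
proof -
  let ?f = "\<lambda>w \<nu>. fst (z \<nu>) powi fst w \<nu> * snd (z \<nu>) powi snd w \<nu>"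
  have split: "character g w z = ?f w \<mu> * (\<Prod>\<nu>\<in>{..<g} - {\<mu>}. ?f w \<nu>)" for w :: bidegree
    unfolding character_def using assms(2) by (intro prod.remove) auto
  have "(\<Prod>\<nu>\<in>{..<g} - {\<mu>}. ?f w' \<nu>) = (\<Prod>\<nu>\<in>{..<g} - {\<mu>}. ?f w \<nu>)"
    using assms(1) by (intro prod.cong) (auto simp: shifts_def)
  moreover have "?f w' \<mu> = fst (z \<mu>) powi (- int i) * snd (z \<mu>) powi (- int j) * ?f w \<mu>"
  proof -
    have "fst w' \<mu> = fst w \<mu> + - int i" "snd w' \<mu> = snd w \<mu> + - int j"
      using assms(1) by (simp_all add: shifts_def)
    moreover have "fst (z \<mu>) \<noteq> 0" "snd (z \<mu>) \<noteq> 0" using assms(2,3) by (simp_all add: torus_def)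
    ultimately show ?thesis by (simp only: power_int_add mult_ac simp_thms)
  qed
  ultimately show ?thesis unfolding split[of w'] split[of w] by (simp add: mult.assoc)
qed

lemma of_rat_block_fact: "of_rat (block_fact rs) = (block_fact rs :: complex)"
proof (induct rs)
  case Nil show ?case by (simp add: block_fact_def)
next
  case (Cons p rs)
  have "of_rat (fact k) = (fact k :: complex)" for k by (metis of_nat_fact of_rat_of_nat_eq)
  then show ?case by (cases p) (simp add: block_fact_Cons of_rat_mult Cons)
qed

context complex_fd_space
begin

lemma grading_action_cong: "(\<And>\<nu>. \<nu> < g \<Longrightarrow> z \<nu> = z' \<nu>) \<Longrightarrow> grading_action g \<pi> z = grading_action g \<pi> z'"
  unfolding grading_action_def character_def by (intro sum.cong HOL.refl arg_cong2[of _ _ _ _ "(*)"] arg_cong[of _ _ S] prod.cong) simp_all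

text \<open>The homomorphism from the free Lie algebra to endomorphisms with prescribed values on
  the generators, defined on terms since the free Lie algebra is a quotient of them.\<close>

primrec term_eval :: "(nat \<times> nat \<Rightarrow> 'v endo) \<Rightarrow> (nat \<times> nat) lie_term \<Rightarrow> 'v endo" where
  "term_eval T (TGen a) = T a"
| "term_eval T TZero = 0"
| "term_eval T (TAdd s t) = term_eval T s + term_eval T t"
| "term_eval T (TScale c s) = S c * term_eval T s"
| "term_eval T (TBr s t) = term_eval T s * term_eval T t - term_eval T t * term_eval T s"

definition lie_eval :: "(nat \<times> nat \<Rightarrow> 'v endo) \<Rightarrow> hlie \<Rightarrow> 'v endo" where
  "lie_eval T x = term_eval T (rep_free_lie x)"

context
  fixes T :: "nat \<times> nat \<Rightarrow> 'v endo" assumes T: "\<And>ij. Lin (T ij)"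
begin

lemma Lin_term_eval: "Lin (term_eval T s)"
  by (induct s) (simp_all add: T)

text \<open>Bilinearity of the bracket over the complex numbers holds among linear endomorphisms
  only, which is why the values on the generators must be linear.\<close>

lemma term_eval_cong: "lie_eq s t \<Longrightarrow> term_eval T s = term_eval T t"
proof (induct rule: lie_eq.induct)
  case (jacobi s t u)
  show ?case by (simp add: algebra_simps)
next
  case (br_scale_right s a t)
  show ?case
    by (simp add: Lin_S_left[OF Lin_term_eval] right_diff_distrib mult.assoc)
next
  case (br_scale_left a s t)
  show ?case
    by (simp add: Lin_S_left[OF Lin_term_eval] right_diff_distrib mult.assoc)
qed (simp_all add: S_simps algebra_simps)

lemma lie_eval_abs: "lie_eval T (abs_free_lie s) = term_eval T s"
proof -
  have "abs_free_lie (rep_free_lie (abs_free_lie s)) = abs_free_lie s"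
    by (rule Quotient3_abs_rep[OF Quotient3_free_lie])
  then have "lie_eq (rep_free_lie (abs_free_lie s)) s" by (simp only: free_lie.abs_eq_iff)
  then show ?thesis unfolding lie_eval_def by (rule term_eval_cong)
qed

lemma lie_eval_simps:
  "lie_eval T (gen a) = T a" "lie_eval T 0 = 0" "lie_eval T (x + y) = lie_eval T x + lie_eval T y"
  "lie_eval T (lscale c x) = S c * lie_eval T x"
  "lie_eval T (lbr x y) = lie_eval T x * lie_eval T y - lie_eval T y * lie_eval T x"
proof -
  show "lie_eval T (gen a) = T a" by (simp add: gen.abs_eq lie_eval_abs)
  show "lie_eval T 0 = 0" by (simp add: zero_free_lie_def lie_eval_abs)
  obtain s t where s: "x = abs_free_lie s" and t: "y = abs_free_lie t"
    using Quotient3_abs_rep[OF Quotient3_free_lie] by metis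
  show "lie_eval T (x + y) = lie_eval T x + lie_eval T y"
    unfolding s t plus_free_lie.abs_eq lie_eval_abs by simp
  show "lie_eval T (lscale c x) = S c * lie_eval T x"
    unfolding s lscale.abs_eq lie_eval_abs by simp
  show "lie_eval T (lbr x y) = lie_eval T x * lie_eval T y - lie_eval T y * lie_eval T x"
    unfolding s t lbr.abs_eq lie_eval_abs by simp
qed

lemma Lin_lie_eval: "Lin (lie_eval T x)"
  unfolding lie_eval_def by (rule Lin_term_eval)

lemma lie_eval_diff: "lie_eval T (x - y) = lie_eval T x - lie_eval T y"
  using lie_eval_simps(3)[of "x - y" y] by (simp add: algebra_simps)

lemma lie_eval_sum: "lie_eval T (\<Sum>i\<in>I. f i) = (\<Sum>i\<in>I. lie_eval T (f i))"
  by (induct I rule: infinite_finite_induct) (simp_all add: lie_eval_simps)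

lemma lie_eval_nested: "lie_eval T (nested_br ws) = nested_commutator (map (lie_eval T) ws)"
  by (induct ws) (simp_all add: lie_eval_simps)

lemma lie_eval_bch: "lie_eval T (bch n x y) = dynkin n (lie_eval T x) (lie_eval T y)"
proof -
  have "of_rat ((- 1) ^ (k - 1) / (of_nat k * of_nat m * block_fact rs))
      = ((- 1) ^ (k - 1) / (of_nat k * of_nat m * block_fact rs) :: complex)" for k m rs
    by (simp add: of_rat_divide of_rat_mult of_rat_power of_rat_minus of_rat_block_fact)
  then show ?thesis
    by (simp only: bch_eq bch_term_def dynkin_def lie_eval_sum lie_eval_simps(4) lie_eval_nested map_blocks)
qed

end

definition unit_endo :: "'v endo \<Rightarrow> bool" where "unit_endo a \<longleftrightarrow> (\<exists>b. a * b = 1 \<and> b * a = 1)"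

lemma unit_endo_mult: assumes "unit_endo a" "unit_endo b" shows "unit_endo (a * b)"
proof -
  obtain a' where a: "a * a' = 1" "a' * a = 1" using assms(1) unfolding unit_endo_def by (elim exE conjE)
  obtain b' where b: "b * b' = 1" "b' * b = 1" using assms(2) unfolding unit_endo_def by (elim exE conjE)
  have "a * b * (b' * a') = a * (b * b') * a'" "b' * a' * (a * b) = b' * (a' * a) * b"
    by (simp_all only: mult.assoc)
  then show ?thesis unfolding unit_endo_def by (intro exI[of _ "b' * a'"]) (simp add: a b)
qed

lemma unit_endo_prod: "(\<And>i. i \<in> set xs \<Longrightarrow> unit_endo (f i)) \<Longrightarrow> unit_endo (prod_list (map f xs))"
proof (induct xs)
  case Nil show ?case unfolding unit_endo_def by (intro exI[of _ 1]) simp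
qed (simp add: unit_endo_mult)

lemma unit_endo_ex: "nil a \<Longrightarrow> unit_endo (ex a)"
  unfolding unit_endo_def using ex_minus[of a] by (intro exI[of _ "ex (- a)"]) simp

lemma unit_endo_bij: assumes "unit_endo a" shows "bij (app a)"
proof -
  obtain b where b: "a * b = 1" "b * a = 1" using assms unfolding unit_endo_def by (elim exE conjE)
  have "app a (app b v) = v" "app b (app a v) = v" for v
    using arg_cong[OF b(1), of "\<lambda>c. app c v"] arg_cong[OF b(2), of "\<lambda>c. app c v"] by simp_all
  then show ?thesis by (intro o_bij[of "app b"]) (simp_all add: fun_eq_iff)
qed

definition regular_op :: "nat \<Rightarrow> ((nat \<Rightarrow> hodge_point) \<Rightarrow> 'v endo) \<Rightarrow> bool" where
  "regular_op g e \<longleftrightarrow> (\<forall>\<xi> v. functional \<xi> \<longrightarrow>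
     (\<exists>f\<in>regular_functions g. \<forall>a\<in>carrier (GCg g). \<xi> (app (e a) v) = f a))"

lemma regular_opI:
  assumes "\<And>\<xi> v. functional \<xi> \<Longrightarrow> f \<xi> v \<in> regular_functions g"
    "\<And>\<xi> v a. functional \<xi> \<Longrightarrow> a \<in> carrier (GCg g) \<Longrightarrow> \<xi> (app (e a) v) = f \<xi> v a"
  shows "regular_op g e"
  unfolding regular_op_def
proof (intro allI impI)
  fix \<xi> v assume "functional \<xi>"
  then show "\<exists>f\<in>regular_functions g. \<forall>a\<in>carrier (GCg g). \<xi> (app (e a) v) = f a"
    using assms by (intro bexI[of _ "f \<xi> v"]) simp_all
qed

lemma regular_opE:
  assumes "regular_op g e"
  obtains f where "\<And>\<xi> v. functional \<xi> \<Longrightarrow> f \<xi> v \<in> regular_functions g"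
    "\<And>\<xi> v a. functional \<xi> \<Longrightarrow> a \<in> carrier (GCg g) \<Longrightarrow> \<xi> (app (e a) v) = f \<xi> v a"
proof -
  define Q where "Q = (\<lambda>\<xi> v f. f \<in> regular_functions g \<and> (\<forall>a\<in>carrier (GCg g). \<xi> (app (e a) v) = f a))"
  have "\<exists>f. functional \<xi> \<longrightarrow> Q \<xi> v f" for \<xi> v
    using assms unfolding regular_op_def Q_def Bex_def by simp
  then obtain f where "\<And>\<xi> v. functional \<xi> \<Longrightarrow> Q \<xi> v (f \<xi> v)" by metis
  then show ?thesis unfolding Q_def by (intro that[of f]) simp_all
qed

lemma regular_op_const: "regular_op g (\<lambda>_. e)"
  by (rule regular_opI[where f = "\<lambda>\<xi> v a. \<xi> (app e v)"]) (simp_all add: regular_functions.const)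

lemma regular_op_add: assumes "regular_op g e" "regular_op g e'" shows "regular_op g (\<lambda>a. e a + e' a)"
proof -
  obtain f where f: "\<And>\<xi> v. functional \<xi> \<Longrightarrow> f \<xi> v \<in> regular_functions g"
    "\<And>\<xi> v a. functional \<xi> \<Longrightarrow> a \<in> carrier (GCg g) \<Longrightarrow> \<xi> (app (e a) v) = f \<xi> v a"
    by (rule regular_opE[OF assms(1)]) (rule that)
  obtain f' where f': "\<And>\<xi> v. functional \<xi> \<Longrightarrow> f' \<xi> v \<in> regular_functions g"
    "\<And>\<xi> v a. functional \<xi> \<Longrightarrow> a \<in> carrier (GCg g) \<Longrightarrow> \<xi> (app (e' a) v) = f' \<xi> v a"
    by (rule regular_opE[OF assms(2)]) (rule that)
  show ?thesis
    by (rule regular_opI[where f = "\<lambda>\<xi> v a. f \<xi> v a + f' \<xi> v a"])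
      (simp_all add: f f' functional_simps regular_functions.add)
qed

lemma regular_op_sum: "(\<And>i. i \<in> I \<Longrightarrow> regular_op g (e i)) \<Longrightarrow> regular_op g (\<lambda>a. \<Sum>i\<in>I. e i a)"
  by (induct I rule: infinite_finite_induct) (simp_all add: regular_op_const regular_op_add)

lemma regular_op_scale:
  assumes "f \<in> regular_functions g" shows "regular_op g (\<lambda>a. S (f a) * e)"
  by (rule regular_opI[where f = "\<lambda>\<xi> v a. f a * \<xi> (app e v)"])
    (simp_all add: functional_simps regular_functions.const regular_functions.mult assms)

lemma regular_op_mult:
  assumes "regular_op g e" "regular_op g e'" and lin: "\<And>a. a \<in> carrier (GCg g) \<Longrightarrow> Lin (e a)"
  shows "regular_op g (\<lambda>a. e a * e' a)"
proof -
  obtain f where f: "\<And>\<xi> v. functional \<xi> \<Longrightarrow> f \<xi> v \<in> regular_functions g"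
    "\<And>\<xi> v a. functional \<xi> \<Longrightarrow> a \<in> carrier (GCg g) \<Longrightarrow> \<xi> (app (e a) v) = f \<xi> v a"
    by (rule regular_opE[OF assms(1)]) (rule that)
  obtain f' where f': "\<And>\<xi> v. functional \<xi> \<Longrightarrow> f' \<xi> v \<in> regular_functions g"
    "\<And>\<xi> v a. functional \<xi> \<Longrightarrow> a \<in> carrier (GCg g) \<Longrightarrow> \<xi> (app (e' a) v) = f' \<xi> v a"
    by (rule regular_opE[OF assms(2)]) (rule that)
  show ?thesis
  proof (rule regular_opI[where f = "\<lambda>\<xi> v a. \<Sum>b\<in>Basis. f' (coord b) v a * f \<xi> b a"])
    fix \<xi> v assume \<xi>: "functional \<xi>"
    show "(\<lambda>a. \<Sum>b\<in>Basis. f' (coord b) v a * f \<xi> b a) \<in> regular_functions g"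
      by (intro regular_sum regular_functions.mult f f' \<xi> functional_coord)
    fix a assume a: "a \<in> carrier (GCg g)"
    have "\<xi> (app (e a) (app (e' a) v)) = \<xi> (app (e a) (\<Sum>b\<in>Basis. scale (coord b (app (e' a) v)) b))"
      by (simp only: coord_expansion)
    also have "\<dots> = (\<Sum>b\<in>Basis. coord b (app (e' a) v) * \<xi> (app (e a) b))"
      by (simp add: app_sum Lin_scale[OF lin[OF a]] functional_simps[OF \<xi>])
    also have "\<dots> = (\<Sum>b\<in>Basis. f' (coord b) v a * f \<xi> b a)"
      by (simp only: f(2)[OF \<xi> a] f'(2)[OF functional_coord a])
    finally show "\<xi> (app (e a * e' a) v) = (\<Sum>b\<in>Basis. f' (coord b) v a * f \<xi> b a)" by simp
  qed
qed

lemma regular_op_power: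
  assumes "regular_op g e" "\<And>a. a \<in> carrier (GCg g) \<Longrightarrow> Lin (e a)" shows "regular_op g (\<lambda>a. e a ^ k)"
  by (induct k) (simp_all add: regular_op_const regular_op_mult assms)

lemma regular_op_prod:
  assumes "\<And>i. i \<in> set xs \<Longrightarrow> regular_op g (e i)" "\<And>i a. i \<in> set xs \<Longrightarrow> a \<in> carrier (GCg g) \<Longrightarrow> Lin (e i a)"
  shows "regular_op g (\<lambda>a. prod_list (map (\<lambda>i. e i a) xs))"
  using assms by (induct xs) (simp_all add: regular_op_const regular_op_mult)

end

section \<open>The representation attached to a triple\<close>

text \<open>The data of a triple in the form used for the construction: projections \<open>\<pi>\<close> of the
  grading, the nilpotent logarithms \<open>N \<mu>\<close> of the automorphisms, and a level \<open>n\<close> at least as large as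
  the spread of the heights in every direction.\<close>

locale hodge_triple = complex_fd_space scale Basis
  for scale :: "complex \<Rightarrow> 'v::ab_group_add \<Rightarrow> 'v" and Basis :: "'v set" +
  fixes g :: nat and \<pi> :: "bidegree \<Rightarrow> 'v endo" and N :: "nat \<Rightarrow> 'v endo" and n :: nat
  assumes \<pi>: "idem_system (bidegrees g) \<pi>"
    and N_Lin: "\<mu> < g \<Longrightarrow> Lin (N \<mu>)"
    and N_lowering: "\<mu> < g \<Longrightarrow> lowering g \<mu> \<pi> (N \<mu>)"
    and N_comm: "\<mu> < g \<Longrightarrow> \<nu> < g \<Longrightarrow> N \<mu> * N \<nu> = N \<nu> * N \<mu>"
    and n: "\<mu> < g \<Longrightarrow> 2 * height_bound \<mu> \<pi> \<le> n"
begin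

text \<open>The part of \<open>N \<mu>\<close> that shifts the bidegree by \<open>(-i, -j)\<close>.\<close>

definition T :: "nat \<Rightarrow> nat \<times> nat \<Rightarrow> 'v endo" where
  "T \<mu> ij = (\<Sum>w | \<pi> w \<noteq> 0. \<Sum>w' | \<pi> w' \<noteq> 0.
     if shifts g \<mu> (fst ij) (snd ij) w' w then \<pi> w' * N \<mu> * \<pi> w else 0)"

lemma T_sandwich:
  "\<pi> w' * T \<mu> ij * \<pi> w = (if shifts g \<mu> (fst ij) (snd ij) w' w then \<pi> w' * N \<mu> * \<pi> w else 0)"
proof -
  define h where "h = (\<lambda>u' u. if shifts g \<mu> (fst ij) (snd ij) u' u then \<pi> u' * N \<mu> * \<pi> u else 0)"
  have entry: "\<pi> w' * h u' u * \<pi> w = (if u' = w' then if u = w then h w' w else 0 else 0)" for u u'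
  proof -
    have "\<pi> w' * (\<pi> u' * N \<mu> * \<pi> u) * \<pi> w = (\<pi> w' * \<pi> u') * N \<mu> * (\<pi> u * \<pi> w)"
      by (simp only: mult.assoc)
    then show ?thesis
      using idem_systemD(4,5)[OF \<pi>] by (cases "u' = w'"; cases "u = w") (simp_all add: h_def)
  qed
  have "\<pi> w' * T \<mu> ij * \<pi> w = (\<Sum>u | \<pi> u \<noteq> 0. \<Sum>u' | \<pi> u' \<noteq> 0. \<pi> w' * h u' u * \<pi> w)"
    unfolding T_def h_def by (simp only: sum_distrib_left sum_distrib_right)
  also have "\<dots> = (\<Sum>u | \<pi> u \<noteq> 0. \<Sum>u' | \<pi> u' \<noteq> 0. if u' = w' then if u = w then h w' w else 0 else 0)"
    by (simp only: entry)
  also have "\<dots> = (\<Sum>u | \<pi> u \<noteq> 0. if u = w then if \<pi> w' \<noteq> 0 then h w' w else 0 else 0)"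
    using idem_systemD(2)[OF \<pi>] by (intro sum.cong HOL.refl) simp
  also have "\<dots> = h w' w"
    using idem_systemD(2)[OF \<pi>] by (simp add: h_def)
  finally show ?thesis by (simp add: h_def)
qed

lemma T_shifts: "\<pi> w' * T \<mu> (i, j) * \<pi> w \<noteq> 0 \<Longrightarrow> shifts g \<mu> i j w' w"
  unfolding T_sandwich by (simp split: if_splits)

lemma T_Lin: "\<mu> < g \<Longrightarrow> Lin (T \<mu> ij)"
  unfolding T_def by (intro Lin_sum) (simp add: N_Lin idem_systemD(1)[OF \<pi>])

text \<open>Every block of \<open>N \<mu>\<close> shifts by some \<open>(-i, -j)\<close> with \<open>i, j > 0\<close>, and \<open>i + j \<le> n\<close> because
  heights vary by at most \<open>n\<close>.\<close>

lemma T_sum: assumes \<mu>: "\<mu> < g" shows "(\<Sum>ij\<in>Ln_gens n. T \<mu> ij) = N \<mu>"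
proof (rule idem_eqI2[OF \<pi>])
  fix w w'
  let ?X = "\<pi> w' * N \<mu> * \<pi> w"
  have "\<pi> w' * (\<Sum>ij\<in>Ln_gens n. T \<mu> ij) * \<pi> w = (\<Sum>ij\<in>Ln_gens n. \<pi> w' * T \<mu> ij * \<pi> w)"
    by (simp only: sum_distrib_left sum_distrib_right)
  also have "\<dots> = (\<Sum>ij\<in>Ln_gens n. if shifts g \<mu> (fst ij) (snd ij) w' w then ?X else 0)"
    by (simp only: T_sandwich)
  also have "\<dots> = ?X"
  proof (cases "?X = 0")
    case True
    then show ?thesis by (simp only: if_cancel sum.neutral_const)
  next
    case False
    then have low: "lower g \<mu> w' w" by (rule N_lowering[OF \<mu>, unfolded lowering_def, rule_format])
    define i where "i = nat (fst w \<mu> - fst w' \<mu>)"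
    define j where "j = nat (snd w \<mu> - snd w' \<mu>)"
    have sh: "shifts g \<mu> (fst ij) (snd ij) w' w \<longleftrightarrow> ij = (i, j)" for ij
      using low by (cases ij) (auto simp: shifts_def lower_def i_def j_def)
    have "\<pi> w \<noteq> 0" "\<pi> w' \<noteq> 0" using False by auto
    then have "\<bar>height \<mu> w\<bar> \<le> int (height_bound \<mu> \<pi>)" "\<bar>height \<mu> w'\<bar> \<le> int (height_bound \<mu> \<pi>)"
      by (auto intro: height_bound[OF \<pi>])
    moreover have ij: "int i = fst w \<mu> - fst w' \<mu>" "int j = snd w \<mu> - snd w' \<mu>" "0 < i" "0 < j"
      using low by (simp_all add: i_def j_def lower_def)
    ultimately have "int i + int j \<le> int n" using n[OF \<mu>] unfolding height_def by linarith
    then have "(i, j) \<in> Ln_gens n" using ij(3,4) by (simp add: Ln_gens_def)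
    then show ?thesis unfolding sh by (simp add: finite_Ln_gens)
  qed
  finally show "\<pi> w' * (\<Sum>ij\<in>Ln_gens n. T \<mu> ij) * \<pi> w = ?X" .
qed

text \<open>The shift by two generators of different factors, in a form that is visibly symmetric
  in them.\<close>

definition double_shift :: "nat \<Rightarrow> nat \<times> nat \<Rightarrow> nat \<Rightarrow> nat \<times> nat \<Rightarrow> bidegree \<Rightarrow> bidegree \<Rightarrow> bool" where
  "double_shift \<mu> ij \<nu> kl w' w \<longleftrightarrow>
     (\<forall>\<kappa><g. \<kappa> \<noteq> \<mu> \<longrightarrow> \<kappa> \<noteq> \<nu> \<longrightarrow> fst w' \<kappa> = fst w \<kappa> \<and> snd w' \<kappa> = snd w \<kappa>) \<and>
     (fst w' \<mu> = fst w \<mu> - int (fst ij) \<and> snd w' \<mu> = snd w \<mu> - int (snd ij)) \<and>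
     (fst w' \<nu> = fst w \<nu> - int (fst kl) \<and> snd w' \<nu> = snd w \<nu> - int (snd kl))"

lemma T_mult_sandwich:
  assumes \<mu>: "\<mu> < g" and \<nu>: "\<nu> < g" and ne: "\<mu> \<noteq> \<nu>"
  shows "\<pi> w' * (T \<mu> ij * T \<nu> kl) * \<pi> w
    = (if double_shift \<mu> ij \<nu> kl w' w then \<pi> w' * (N \<mu> * N \<nu>) * \<pi> w else 0)"
proof -
  have "(\<pi> w' * T \<mu> ij * \<pi> v) * (\<pi> v * T \<nu> kl * \<pi> w)
    = (if double_shift \<mu> ij \<nu> kl w' w then (\<pi> w' * N \<mu> * \<pi> v) * (\<pi> v * N \<nu> * \<pi> w) else 0)" for v
  proof (cases "\<pi> w' * N \<mu> * \<pi> v = 0 \<or> \<pi> v * N \<nu> * \<pi> w = 0")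
    case True
    then show ?thesis unfolding T_sandwich by (elim disjE) simp_all
  next
    case False
    have "lower g \<mu> w' v"
      by (rule N_lowering[OF \<mu>, unfolded lowering_def, rule_format]) (use False in simp)
    moreover have "lower g \<nu> v w"
      by (rule N_lowering[OF \<nu>, unfolded lowering_def, rule_format]) (use False in simp)
    ultimately have "shifts g \<mu> (fst ij) (snd ij) w' v \<and> shifts g \<nu> (fst kl) (snd kl) v w
        \<longleftrightarrow> double_shift \<mu> ij \<nu> kl w' w"
      using \<mu> \<nu> ne unfolding lower_def shifts_def double_shift_def by (smt (verit))
    then show ?thesis unfolding T_sandwich by auto
  qed
  then show ?thesis
    unfolding idem_sandwich[OF \<pi>, of w' "T \<mu> ij"] idem_sandwich[OF \<pi>, of w' "N \<mu>"] by simp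
qed

text \<open>The blocks of \<open>N \<mu> N \<nu>\<close> determine those of \<open>T \<mu> ij T \<nu> kl\<close>: for \<open>\<mu> \<noteq> \<nu>\<close> the two shifts can
  be read off from source and target. So commutation of \<open>N \<mu>\<close> and \<open>N \<nu>\<close> passes to their parts.\<close>

lemma T_comm: assumes "\<mu> < g" "\<nu> < g" "\<mu> \<noteq> \<nu>" shows "T \<mu> ij * T \<nu> kl = T \<nu> kl * T \<mu> ij"
proof (rule idem_eqI2[OF \<pi>])
  fix w w'
  have "double_shift \<mu> ij \<nu> kl w' w = double_shift \<nu> kl \<mu> ij w' w"
    unfolding double_shift_def by (simp only: conj_ac imp_conjR) (simp only: imp_conjL[symmetric] conj_ac)
  then show "\<pi> w' * (T \<mu> ij * T \<nu> kl) * \<pi> w = \<pi> w' * (T \<nu> kl * T \<mu> ij) * \<pi> w"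
    unfolding T_mult_sandwich[OF assms] T_mult_sandwich[OF assms(2,1) assms(3)[symmetric]] N_comm[OF assms(1,2)]
    by simp
qed

abbreviation "ev \<mu> \<equiv> lie_eval (T \<mu>)"

lemma ev_simps:
  assumes "\<mu> < g"
  shows "ev \<mu> (gen a) = T \<mu> a" "ev \<mu> 0 = 0" "ev \<mu> (x + y) = ev \<mu> x + ev \<mu> y"
    "ev \<mu> (lscale c x) = S c * ev \<mu> x" "ev \<mu> (lbr x y) = ev \<mu> x * ev \<mu> y - ev \<mu> y * ev \<mu> x"
    "ev \<mu> (x - y) = ev \<mu> x - ev \<mu> y" "Lin (ev \<mu> x)"
  by (rule lie_eval_simps lie_eval_diff Lin_lie_eval, rule T_Lin[OF assms])+

lemma lowering_diff: "lowering g \<mu> \<pi> a \<Longrightarrow> lowering g \<mu> \<pi> b \<Longrightarrow> lowering g \<mu> \<pi> (a - b)"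
  using lowering_add[of g \<mu> \<pi> a "S (- 1) * b"] lowering_S[OF \<pi>, of g \<mu> b "- 1"] by (simp add: S_simps)

lemma ev_lowering: assumes \<mu>: "\<mu> < g" shows "x \<in> Ln n \<Longrightarrow> lowering g \<mu> \<pi> (ev \<mu> x)"
  unfolding Ln_def
proof (induct rule: lie_subalgebra.induct)
  case (base x)
  then obtain i j where ij: "(i, j) \<in> Ln_gens n" "x = gen (i, j)" by auto
  show ?case
    unfolding ij(2) ev_simps(1)[OF \<mu>] lowering_def
  proof (intro allI impI)
    fix w w' assume "\<pi> w' * T \<mu> (i, j) * \<pi> w \<noteq> 0"
    then have "shifts g \<mu> i j w' w" by (rule T_shifts)
    then show "lower g \<mu> w' w" by (rule shifts_lower) (use ij in \<open>simp_all add: Ln_gens_def\<close>)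
  qed
qed (simp_all add: ev_simps[OF \<mu>] lowering_0 lowering_add lowering_S[OF \<pi>] lowering_mult[OF \<pi>] lowering_diff)

lemma ev_nil: "\<mu> < g \<Longrightarrow> x \<in> Ln n \<Longrightarrow> nil (ev \<mu> x)"
  by (rule lowering_nil[OF \<pi> ev_lowering])

lemma filtered: "\<mu> < g \<Longrightarrow> filtered_module (\<lambda>r. S (of_rat r)) (height_filtration \<mu> \<pi>) n"
  by (rule filtered_module_height[OF \<pi> n])

lemma ev_homog_drop:
  assumes \<mu>: "\<mu> < g" and x: "Ln_homog n d x"
  shows "v \<in> height_filtration \<mu> \<pi> k \<Longrightarrow> app (ev \<mu> x) v \<in> height_filtration \<mu> \<pi> (k + d)"
proof -
  interpret F: filtered_module "\<lambda>r. S (of_rat r)" "height_filtration \<mu> \<pi>" n by (rule filtered[OF \<mu>])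
  have F_S: "scale c v \<in> height_filtration \<mu> \<pi> k" if "v \<in> height_filtration \<mu> \<pi> k" for c v k
    using that by (auto simp: height_filtration_def Lin_scale idem_systemD(1)[OF \<pi>])
  have F_diff: "v - w \<in> height_filtration \<mu> \<pi> k"
    if "v \<in> height_filtration \<mu> \<pi> k" "w \<in> height_filtration \<mu> \<pi> k" for v w k
    using F.F_add[OF that(1) F_S[OF that(2), of "- 1"]] by simp
  show "v \<in> height_filtration \<mu> \<pi> k \<Longrightarrow> app (ev \<mu> x) v \<in> height_filtration \<mu> \<pi> (k + d)"
    using x
  proof (induct arbitrary: v k rule: Ln_homog.induct)
    case (gen i j)
    have "height \<mu> w' + int (i + j) \<le> height \<mu> w" if "\<pi> w' * T \<mu> (i, j) * \<pi> w \<noteq> 0" for w w'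
      using T_shifts[OF that] by (simp add: shifts_def height_def)
    from height_drop[OF \<pi> this gen(2)] show ?case by (simp add: ev_simps[OF \<mu>])
  next
    case (br d x e y)
    have "app (ev \<mu> x) (app (ev \<mu> y) v) \<in> height_filtration \<mu> \<pi> (k + e + d)"
      by (intro br(2) br(4) br(5))
    moreover have "app (ev \<mu> y) (app (ev \<mu> x) v) \<in> height_filtration \<mu> \<pi> (k + d + e)"
      by (intro br(2) br(4) br(5))
    ultimately show ?case by (simp add: ev_simps[OF \<mu>] F_diff ac_simps)
  qed (simp_all add: ev_simps[OF \<mu>] F.F_zero F.F_add F_S)
qed

text \<open>A homogeneous element of degree \<open>d\<close> lowers the height by \<open>d\<close>, which is impossible on
  nonzero vectors for \<open>d > n\<close>.\<close>

lemma ev_In: assumes \<mu>: "\<mu> < g" shows "x \<in> In_ideal n \<Longrightarrow> ev \<mu> x = 0"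
  unfolding In_ideal_def
proof (induct rule: lie_ideal.induct)
  case (base x)
  then obtain d where d: "d > n" "Ln_homog n d x" by (auto simp: Ln_deg_def)
  interpret F: filtered_module "\<lambda>r. S (of_rat r)" "height_filtration \<mu> \<pi>" n by (rule filtered[OF \<mu>])
  show ?case
  proof (rule endo_eqI)
    fix v
    have "app (ev \<mu> x) v \<in> height_filtration \<mu> \<pi> (0 + d)"
      by (rule ev_homog_drop[OF \<mu> d(2)]) (simp add: F.F_UNIV)
    then have "app (ev \<mu> x) v \<in> height_filtration \<mu> \<pi> (Suc n)"
      using F.F_anti[of "Suc n" d] d(1) by (auto dest: subsetD)
    then show "app (ev \<mu> x) v = app 0 v" using F.F_last by (auto dest: subsetD)
  qed
qed (simp_all add: ev_simps[OF \<mu>])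

lemma ev_comm: assumes "\<mu> < g" "\<nu> < g" "\<mu> \<noteq> \<nu>" shows "ev \<mu> x * ev \<nu> y = ev \<nu> y * ev \<mu> x"
proof -
  have comb: "b * (c * a - a * c) = (c * a - a * c) * b" if "b * c = c * b" "b * a = a * b" for a b c :: "'v endo"
  proof -
    have "b * (c * a) = c * a * b" "b * (a * c) = a * c * b"
      using that by (metis mult.assoc)+
    then show ?thesis by (simp add: right_diff_distrib left_diff_distrib)
  qed
  have 1: "T \<mu> a * ev \<nu> y = ev \<nu> y * T \<mu> a" for a
    by (induct y rule: free_lie_induct)
      (simp_all add: ev_simps[OF assms(2)] T_comm[OF assms] distrib_left distrib_right comb
        Lin_S_left[OF T_Lin[OF assms(1)]] mult.assoc)
  have "ev \<nu> y * ev \<mu> x = ev \<mu> x * ev \<nu> y"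
    by (induct x rule: free_lie_induct)
      (simp_all add: ev_simps[OF assms(1)] 1 distrib_left distrib_right comb
        Lin_S_left[OF ev_simps(7)[OF assms(2)]] mult.assoc)
  then show ?thesis ..
qed

abbreviation "D \<equiv> grading_action g \<pi>"

lemma D_Lin: "Lin (D z)" by (rule Lin_grading_action[OF \<pi>])

text \<open>It suffices to check generators, where the weights of the blocks on the two sides agree
  by the choice of the shifts.\<close>

lemma D_ev: assumes \<mu>: "\<mu> < g" and z: "z \<in> torus g" shows "D z * ev \<mu> x = ev \<mu> (lie_act (z \<mu>) x) * D z"
proof (induct x rule: free_lie_induct)
  case (gen ij)
  obtain i j where ij: "ij = (i, j)" by (cases ij)
  let ?c = "fst (z \<mu>) powi (- int i) * snd (z \<mu>) powi (- int j)"
  have "D z * T \<mu> ij = S ?c * T \<mu> ij * D z"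
  proof (rule idem_eqI2[OF \<pi>])
    fix w w'
    have "\<pi> w' * (D z * T \<mu> ij) * \<pi> w = S (character g w' z) * (\<pi> w' * T \<mu> ij * \<pi> w)"
      using grading_action_idem(2)[OF \<pi>, of w' g z] by (simp flip: mult.assoc)
    moreover have "\<pi> w' * (S ?c * T \<mu> ij * D z) * \<pi> w = S (?c * character g w z) * (\<pi> w' * T \<mu> ij * \<pi> w)"
      by (simp only: mult.assoc grading_action_idem(1)[OF \<pi>] Lin_S_left[OF T_Lin[OF \<mu>]]
          Lin_S_left[OF idem_systemD(1)[OF \<pi>]] S_simps(5))
    moreover have "character g w' z = ?c * character g w z" if "\<pi> w' * T \<mu> ij * \<pi> w \<noteq> 0"
      using that unfolding ij by (intro character_shifts[OF T_shifts \<mu> z])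
    ultimately show "\<pi> w' * (D z * T \<mu> ij) * \<pi> w = \<pi> w' * (S ?c * T \<mu> ij * D z) * \<pi> w"
      by (cases "\<pi> w' * T \<mu> ij * \<pi> w = 0") simp_all
  qed
  then show ?case by (simp add: ij ev_simps[OF \<mu>] lie_act_gen)
next
  case (br x y)
  have prod: "D z * (ev \<mu> a * ev \<mu> b) = ev \<mu> a' * ev \<mu> b' * D z"
    if h: "D z * ev \<mu> a = ev \<mu> a' * D z" "D z * ev \<mu> b = ev \<mu> b' * D z" for a b a' b'
  proof -
    have "D z * (ev \<mu> a * ev \<mu> b) = (D z * ev \<mu> a) * ev \<mu> b" by (simp only: mult.assoc)
    also have "\<dots> = ev \<mu> a' * (D z * ev \<mu> b)" unfolding h(1) by (rule mult.assoc)
    also have "\<dots> = ev \<mu> a' * ev \<mu> b' * D z" unfolding h(2) by (simp only: mult.assoc)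
    finally show ?thesis .
  qed
  show ?case
    unfolding ev_simps(5)[OF \<mu>] lie_act_simps right_diff_distrib left_diff_distrib
      prod[OF br] prod[OF br(2,1)] ..
next
  case (scale c x)
  have "D z * (S c * ev \<mu> x) = S c * (D z * ev \<mu> x)" by (rule Lin_S_left[OF D_Lin])
  then show ?case
    unfolding ev_simps(4)[OF \<mu>] lie_act_simps scale mult.assoc .
next
  case (add x y)
  then show ?case
    unfolding ev_simps(3)[OF \<mu>] lie_act_simps distrib_left distrib_right by (simp only:)
qed (simp_all add: ev_simps[OF \<mu>] lie_act_simps)

text \<open>The induced map on \<open>u\<^sub>n\<close>; elements of \<open>u\<^sub>n\<close> are cosets, and the choice of a
  representative is immaterial because \<open>I\<^sub>n\<close> acts as zero.\<close>

definition op :: "nat \<Rightarrow> hlie set \<Rightarrow> 'v endo" where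
  "op \<mu> X = ev \<mu> (SOME x. x \<in> Ln n \<and> X = un_class n x)"

lemma op_class: assumes \<mu>: "\<mu> < g" and x: "x \<in> Ln n" shows "op \<mu> (un_class n x) = ev \<mu> x"
proof -
  define y where "y = (SOME y. y \<in> Ln n \<and> un_class n x = un_class n y)"
  have "y \<in> Ln n \<and> un_class n x = un_class n y"
    unfolding y_def by (rule someI[of "\<lambda>y. y \<in> Ln n \<and> un_class n x = un_class n y" x]) (simp add: x)
  then have "x - y \<in> In_ideal n" using un_class_eq_iff[OF x, of y] by (simp add: un_rel_iff)
  then have "ev \<mu> x = ev \<mu> y" using ev_In[OF \<mu>] ev_simps(6)[OF \<mu>, of x y] by simp
  then show ?thesis by (simp add: op_def y_def)
qed

lemma ex_bch: assumes \<mu>: "\<mu> < g" and xy: "x \<in> Ln n" "y \<in> Ln n"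
  shows "ex (ev \<mu> (bch n x y)) = ex (ev \<mu> x) * ex (ev \<mu> y)"
proof -
  interpret F: filtered_module "\<lambda>r. S (of_rat r)" "height_filtration \<mu> \<pi>" n by (rule filtered[OF \<mu>])
  show ?thesis
    unfolding lie_eval_bch[OF T_Lin[OF \<mu>]]
    by (rule F.ex_mult_ex[symmetric]; rule lowering_height[OF \<pi> ev_lowering[OF \<mu>]]) (use xy in simp_all)
qed

text \<open>The operator of the \<open>\<mu>\<close>-th unipotent component of \<open>a\<close>.\<close>

definition M :: "(nat \<Rightarrow> hodge_point) \<Rightarrow> nat \<Rightarrow> 'v endo" where "M a \<mu> = ex (op \<mu> (snd (a \<mu>) n))"

text \<open>The order of the factors follows the convention that a pair \<open>(z, u)\<close> stands for
  the product \<open>u z\<close>.\<close>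

definition E :: "(nat \<Rightarrow> hodge_point) \<Rightarrow> 'v endo" where
  "E a = prod_list (map (M a) [0..<g]) * D (\<lambda>\<mu>. fst (a \<mu>))"

lemma rep_at: assumes "a \<in> carrier (GCg g)" "\<mu> < g" obtains x where "x \<in> Ln n" "snd (a \<mu>) n = un_class n x"
  using Ulim_at[OF GCg_parts(1)[OF assms], of n] by (rule bexE) (rule that)

lemma torus_part: "a \<in> carrier (GCg g) \<Longrightarrow> (\<lambda>\<mu>. fst (a \<mu>)) \<in> torus g"
  using GCg_parts(2) by (simp add: comp_def)

lemma M_eq: "\<mu> < g \<Longrightarrow> x \<in> Ln n \<Longrightarrow> snd (a \<mu>) n = un_class n x \<Longrightarrow> M a \<mu> = ex (ev \<mu> x)"
  by (simp add: M_def op_class)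

lemma op_Lin: assumes a: "a \<in> carrier (GCg g)" and \<mu>: "\<mu> < g" shows "Lin (op \<mu> (snd (a \<mu>) n))"
proof -
  obtain x where x: "x \<in> Ln n" "snd (a \<mu>) n = un_class n x" by (rule rep_at[OF a \<mu>])
  show ?thesis unfolding x(2) op_class[OF \<mu> x(1)] by (rule ev_simps(7)[OF \<mu>])
qed

lemma M_Lin: "a \<in> carrier (GCg g) \<Longrightarrow> \<mu> < g \<Longrightarrow> Lin (M a \<mu>)"
  unfolding M_def by (rule Lin_ex[OF op_Lin])

lemma M_prod_Lin: "a \<in> carrier (GCg g) \<Longrightarrow> set xs \<subseteq> {..<g} \<Longrightarrow> Lin (prod_list (map (M a) xs))"
  by (induct xs) (simp_all add: M_Lin)

lemma E_Lin: "a \<in> carrier (GCg g) \<Longrightarrow> Lin (E a)"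
  by (simp add: E_def D_Lin M_prod_Lin atLeast0LessThan)

text \<open>The torus part of \<open>a\<close> has to be moved past the unipotent part of \<open>b\<close>, which turns each
  component \<open>v\<close> into \<open>z v z\<^sup>-\<^sup>1 = z \<cdot> v\<close>, as in the semidirect product. Components of different
  factors commute, and within one factor the product is that of \<open>U\<^sub>n\<close> by Dynkin's formula.\<close>

lemma E_mult:
  assumes a: "a \<in> carrier (GCg g)" and b: "b \<in> carrier (GCg g)"
  shows "E (a \<otimes>\<^bsub>GCg g\<^esub> b) = E a * E b"
proof -
  let ?z = "\<lambda>\<mu>. fst (a \<mu>)" and ?z' = "\<lambda>\<mu>. fst (b \<mu>)"
  have z: "?z \<in> torus g" by (rule torus_part[OF a])
  obtain x where x: "\<And>\<mu>. \<mu> < g \<Longrightarrow> x \<mu> \<in> Ln n" "\<And>\<mu>. \<mu> < g \<Longrightarrow> snd (a \<mu>) n = un_class n (x \<mu>)"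
    using Ulim_at[OF GCg_parts(1)[OF a], of _ n] by metis
  obtain y where y: "\<And>\<mu>. \<mu> < g \<Longrightarrow> y \<mu> \<in> Ln n" "\<And>\<mu>. \<mu> < g \<Longrightarrow> snd (b \<mu>) n = un_class n (y \<mu>)"
    using Ulim_at[OF GCg_parts(1)[OF b], of _ n] by metis
  define M' where "M' = (\<lambda>\<mu>. ex (ev \<mu> (lie_act (fst (a \<mu>)) (y \<mu>))))"
  have Mab: "M (a \<otimes>\<^bsub>GCg g\<^esub> b) \<mu> = M a \<mu> * M' \<mu>" if \<mu>: "\<mu> < g" for \<mu>
  proof -
    have "(a \<otimes>\<^bsub>GCg g\<^esub> b) \<mu> = (fst (a \<mu>), snd (a \<mu>)) \<otimes>\<^bsub>GC\<^esub> (fst (b \<mu>), snd (b \<mu>))"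
      using \<mu> by (simp add: GCg_mult)
    then have "snd ((a \<otimes>\<^bsub>GCg g\<^esub> b) \<mu>) n = un_class n (bch n (x \<mu>) (lie_act (fst (a \<mu>)) (y \<mu>)))"
      unfolding GC_mult using x[OF \<mu>] Ulim_act_at[OF y(1)[OF \<mu>], where u = "snd (b \<mu>)"] y[OF \<mu>]
      by (simp add: Ulim_mult_at Ugp_mult lie_act_Ln)
    then have "M (a \<otimes>\<^bsub>GCg g\<^esub> b) \<mu> = ex (ev \<mu> (bch n (x \<mu>) (lie_act (fst (a \<mu>)) (y \<mu>))))"
      using x[OF \<mu>] y[OF \<mu>] \<mu> by (intro M_eq Ln_bch lie_act_Ln)
    also have "\<dots> = M a \<mu> * M' \<mu>"
      unfolding M'_def M_eq[where a = a and x = "x \<mu>", OF \<mu> x(1)[OF \<mu>] x(2)[OF \<mu>]] using x[OF \<mu>] y[OF \<mu>] by (intro ex_bch \<mu> lie_act_Ln)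
    finally show ?thesis .
  qed
  have DM: "D ?z * M b \<mu> = M' \<mu> * D ?z" if \<mu>: "\<mu> < g" for \<mu>
    unfolding M_eq[where a = b and x = "y \<mu>", OF \<mu> y(1)[OF \<mu>] y(2)[OF \<mu>]] M'_def ex_def
    by (rule ser_intertwine[OF D_ev[OF \<mu> z]]; intro ev_nil \<mu> lie_act_Ln y)
  have comm: "M' i * M a j = M a j * M' i" if "i < g" "j < g" "i \<noteq> j" for i j
    unfolding M_eq[where a = a and x = "x j", OF that(2) x(1)[OF that(2)] x(2)[OF that(2)]] M'_def ex_def
    by (rule ser_commute2[OF ev_comm[OF that]])
  have "prod_list (map (M (a \<otimes>\<^bsub>GCg g\<^esub> b)) [0..<g]) = prod_list (map (\<lambda>\<mu>. M a \<mu> * M' \<mu>) [0..<g])"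
    by (intro arg_cong[of _ _ prod_list] map_cong HOL.refl) (simp add: Mab)
  also have "\<dots> = prod_list (map (M a) [0..<g]) * prod_list (map M' [0..<g])"
    by (rule prod_list_mult) (simp_all add: comm)
  finally have P: "prod_list (map (M (a \<otimes>\<^bsub>GCg g\<^esub> b)) [0..<g]) = \<dots>" .
  have DP: "D ?z * prod_list (map (M b) [0..<g]) = prod_list (map M' [0..<g]) * D ?z"
    by (rule prod_list_intertwine) (simp add: DM)
  have "D (\<lambda>\<mu>. fst ((a \<otimes>\<^bsub>GCg g\<^esub> b) \<mu>)) = D (torus_mult ?z ?z')"
  proof (rule grading_action_cong)
    fix \<nu> assume "\<nu> < g"
    then have "(a \<otimes>\<^bsub>GCg g\<^esub> b) \<nu> = (fst (a \<nu>), snd (a \<nu>)) \<otimes>\<^bsub>GC\<^esub> (fst (b \<nu>), snd (b \<nu>))"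
      by (simp add: GCg_mult)
    then show "fst ((a \<otimes>\<^bsub>GCg g\<^esub> b) \<nu>) = torus_mult ?z ?z' \<nu>"
      unfolding GC_mult by (simp add: torus_mult_def)
  qed
  then have "E (a \<otimes>\<^bsub>GCg g\<^esub> b)
      = prod_list (map (M a) [0..<g]) * (prod_list (map M' [0..<g]) * D ?z) * D ?z'"
    unfolding E_def P by (simp only: grading_action_mult[OF \<pi>] mult.assoc)
  also have "\<dots> = E a * E b" unfolding DP[symmetric] E_def by (simp only: mult.assoc)
  finally show ?thesis .
qed

lemma E_unit: assumes a: "a \<in> carrier (GCg g)" shows "unit_endo (E a)"
  unfolding E_def
proof (intro unit_endo_mult unit_endo_prod)
  fix \<mu> assume "\<mu> \<in> set [0..<g]"
  then have \<mu>: "\<mu> < g" by simp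
  obtain x where "x \<in> Ln n" "snd (a \<mu>) n = un_class n x" by (rule rep_at[OF a \<mu>])
  then show "unit_endo (M a \<mu>)" using \<mu> by (simp add: M_eq unit_endo_ex ev_nil)
next
  obtain D' where "D (\<lambda>\<mu>. fst (a \<mu>)) * D' = 1" "D' * D (\<lambda>\<mu>. fst (a \<mu>)) = 1"
    by (rule grading_action_inverse[OF \<pi> torus_part[OF a]]) (rule that)
  then show "unit_endo (D (\<lambda>\<mu>. fst (a \<mu>)))" unfolding unit_endo_def by (intro exI[of _ D'] conjI)
qed

lemma regular_op_op: assumes \<mu>: "\<mu> < g" shows "regular_op g (\<lambda>a. op \<mu> (snd (a \<mu>) n))"
proof (rule regular_opI[where f = "\<lambda>\<xi> v a. \<xi> (app (op \<mu> (snd (a \<mu>) n)) v)"])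
  fix \<xi> v assume \<xi>: "functional \<xi>"
  have "un_linear_form n (\<lambda>X. \<xi> (app (op \<mu> X) v))"
    unfolding un_linear_form_def
    by (simp add: op_class[OF \<mu>] Ln_add Ln_scale ev_simps[OF \<mu>] functional_simps[OF \<xi>])
  from regular_functions.unip[OF \<mu> this]
  show "(\<lambda>a. \<xi> (app (op \<mu> (snd (a \<mu>) n)) v)) \<in> regular_functions g" .
qed simp

text \<open>The exponentials are polynomials in operators that depend linearly on \<open>u\<^sub>n\<close>, and the
  action of the torus is a combination of characters.\<close>

lemma regular_op_E: "regular_op g E"
proof -
  have M: "regular_op g (\<lambda>a. M a \<mu>)" if \<mu>: "\<mu> < g" for \<mu>
  proof -
    let ?K = "Suc (2 * height_bound \<mu> \<pi>)"
    have "regular_op g (\<lambda>a. \<Sum>k<?K. S (of_rat (1 / fact k)) * op \<mu> (snd (a \<mu>) n) ^ k)"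
      by (intro regular_op_sum regular_op_mult regular_op_const regular_op_power regular_op_op \<mu> Lin_simps op_Lin)
    moreover have "M a \<mu> = (\<Sum>k<?K. S (of_rat (1 / fact k)) * op \<mu> (snd (a \<mu>) n) ^ k)"
      if a: "a \<in> carrier (GCg g)" for a
    proof -
      obtain x where x: "x \<in> Ln n" "snd (a \<mu>) n = un_class n x" by (rule rep_at[OF a \<mu>])
      show ?thesis
        unfolding M_def x(2) op_class[OF \<mu> x(1)]
        by (rule ex_eq[OF lowering_power[OF \<pi> ev_lowering[OF \<mu> x(1)]]])
    qed
    ultimately show ?thesis unfolding regular_op_def by simp
  qed
  have D: "regular_op g (\<lambda>a. D (\<lambda>\<mu>. fst (a \<mu>)))"
    unfolding grading_action_def by (intro regular_op_sum regular_op_scale regular_character)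
  have "regular_op g (\<lambda>a. prod_list (map (\<lambda>\<mu>. M a \<mu>) [0..<g]))"
    by (rule regular_op_prod) (simp_all add: M M_Lin)
  moreover have "Lin (prod_list (map (\<lambda>\<mu>. M a \<mu>) [0..<g]))" if "a \<in> carrier (GCg g)" for a
    by (rule M_prod_Lin[OF that]) auto
  ultimately have "regular_op g (\<lambda>a. prod_list (map (\<lambda>\<mu>. M a \<mu>) [0..<g]) * D (\<lambda>\<mu>. fst (a \<mu>)))"
    by (intro regular_op_mult D)
  moreover have "E = (\<lambda>a. prod_list (map (\<lambda>\<mu>. M a \<mu>) [0..<g]) * D (\<lambda>\<mu>. fst (a \<mu>)))"
    by (rule ext) (rule E_def)
  ultimately show ?thesis by simp
qed

definition \<rho> :: "(nat \<Rightarrow> hodge_point) \<Rightarrow> 'v \<Rightarrow> 'v" where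
  "\<rho> = (\<lambda>a\<in>carrier (GCg g). app (E a))"

lemma rho_reps: "\<rho> \<in> reps scale g"
proof -
  have GL: "app (E a) \<in> carrier (GLV scale)" if "a \<in> carrier (GCg g)" for a
    using that by (simp add: GLV_def linear_iff_Lin E_Lin unit_endo_bij E_unit)
  have "\<rho> \<in> hom (GCg g) (GLV scale)"
    unfolding hom_def
  proof (intro CollectI conjI ballI)
    show "\<rho> \<in> carrier (GCg g) \<rightarrow> carrier (GLV scale)" by (simp add: \<rho>_def GL)
    fix a b assume "a \<in> carrier (GCg g)" "b \<in> carrier (GCg g)"
    then show "\<rho> (a \<otimes>\<^bsub>GCg g\<^esub> b) = \<rho> a \<otimes>\<^bsub>GLV scale\<^esub> \<rho> b"
      by (simp add: \<rho>_def GCg_closed E_mult GLV_def fun_eq_iff)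
  qed
  moreover have "\<exists>f\<in>regular_functions g. \<forall>a\<in>carrier (GCg g). \<xi> (\<rho> a v) = f a"
    if "Vector_Spaces.linear scale (*) \<xi>" for v \<xi>
    using regular_op_E that unfolding regular_op_def functional_def by (simp add: \<rho>_def)
  ultimately show ?thesis by (simp add: reps_def \<rho>_def)
qed

theorem correspondence_rho:
  "w \<in> bidegrees g \<Longrightarrow> fst (correspondence scale g \<rho>) w = {v. app (\<pi> w) v = v}"
  "\<mu> < g \<Longrightarrow> snd (correspondence scale g \<rho>) \<mu> = app (ex (N \<mu>))"
proof -
  interpret r: hodge_rep scale Basis g \<rho> by unfold_locales (rule rho_reps)
  have RE: "r.R a = E a" if "a \<in> carrier (GCg g)" for a
    by (rule endo_eqI) (simp only: r.app_R[OF that], simp add: \<rho>_def that)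
  have ex0: "op \<mu> (\<one>\<^bsub>Ulim\<^esub> n) = 0" if "\<mu> < g" for \<mu>
    using op_class[OF that Ln_0] by (simp add: Ulim_one lie_lift_at[OF Ln_0] ev_simps[OF that])
  have act: "r.R (torus_elt g z) = D z" if z: "z \<in> torus g" for z
  proof -
    have "M (torus_elt g z) \<mu> = 1" if "\<mu> < g" for \<mu> using that by (simp add: M_def torus_elt_at ex0)
    then have eq: "map (M (torus_elt g z)) [0..<g] = map (\<lambda>_. 1) [0..<g]"
      by (intro map_cong HOL.refl) simp
    have "prod_list (map (\<lambda>_. 1 :: 'v endo) xs) = 1" for xs :: "nat list"
      by (induct xs) simp_all
    then have "prod_list (map (M (torus_elt g z)) [0..<g]) = 1" unfolding eq .
    moreover have "D (\<lambda>\<mu>. fst (torus_elt g z \<mu>)) = D z"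
      by (rule grading_action_cong) (simp add: torus_elt_at)
    ultimately show ?thesis by (simp add: RE torus_elt_closed z E_def)
  qed
  have unip: "r.R (unip_elt g \<mu> u) = ex (op \<mu> (u n))" if \<mu>: "\<mu> < g" and u: "u \<in> carrier Ulim" for \<mu> u
  proof -
    have eq: "map (M (unip_elt g \<mu> u)) [0..<g] = map (\<lambda>\<nu>. if \<nu> = \<mu> then ex (op \<mu> (u n)) else 1) [0..<g]"
      by (intro map_cong HOL.refl) (simp add: M_def unip_elt_at ex0)
    have "prod_list (map (M (unip_elt g \<mu> u)) [0..<g]) = ex (op \<mu> (u n))"
      unfolding eq using prod_list_single[of "[0..<g]" \<mu> "ex (op \<mu> (u n))"] \<mu> by simp
    moreover have "D (\<lambda>\<nu>. fst (unip_elt g \<mu> u \<nu>)) = D (\<lambda>_. (1, 1))"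
      by (rule grading_action_cong) (simp add: unip_elt_at)
    ultimately show ?thesis
      by (simp add: RE unip_elt_closed u E_def grading_action_one[OF \<pi>])
  qed
  show "fst (correspondence scale g \<rho>) w = {v. app (\<pi> w) v = v}" if w: "w \<in> bidegrees g"
    unfolding fst_correspondence[OF w] by (rule r.weight_spaces[OF \<pi> act w])
  assume \<mu>: "\<mu> < g"
  let ?\<phi> = "\<lambda>X. app (op \<mu> X)"
  have at: "acts_through scale g \<rho> \<mu> n ?\<phi>"
    unfolding acts_through_def nil_lie_rep_def
  proof (intro conjI ballI allI)
    fix X assume "X \<in> un n"
    then obtain x where x: "x \<in> Ln n" "X = un_class n x" by (rule unE)
    show "Vector_Spaces.linear scale scale (app (op \<mu> X))"
      unfolding x(2) op_class[OF \<mu> x(1)] linear_iff_Lin by (rule ev_simps(7)[OF \<mu>])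
    show "nilpotent_map (app (op \<mu> X))"
      unfolding x(2) op_class[OF \<mu> x(1)] nilpotent_map_app by (rule ev_nil[OF \<mu> x(1)])
  next
    fix u assume u: "u \<in> carrier Ulim"
    obtain x where x: "x \<in> Ln n" "u n = un_class n x" using Ulim_at[OF u, of n] by (rule bexE)
    have "\<rho> (factor g \<mu> ((1, 1), u)) = app (r.R (unip_elt g \<mu> u))"
      by (simp add: r.app_R unip_elt_closed[OF u]) (simp add: unip_elt_def)
    also have "\<dots> = nil_exp scale (app (op \<mu> (u n)))"
      unfolding unip[OF \<mu> u] x(2) op_class[OF \<mu> x(1)] nil_exp_app[OF ev_nil[OF \<mu> x(1)]] ..
    finally show "\<rho> (factor g \<mu> ((1, 1), u)) = nil_exp scale (app (op \<mu> (u n)))" .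
  qed (simp_all add: op_class[OF \<mu>] Ln_add Ln_scale Ln_br ev_simps[OF \<mu>])
  have "lie_op n ?\<phi> (generator_sum n) = ev \<mu> (generator_sum n)"
    by (rule endo_eqI) (simp add: r.lie_op_app[OF at generator_sum_Ln] op_class[OF \<mu> generator_sum_Ln])
  also have "\<dots> = N \<mu>"
    unfolding generator_sum_def lie_eval_sum[OF T_Lin[OF \<mu>]] ev_simps(1)[OF \<mu>] by (rule T_sum[OF \<mu>])
  finally show "snd (correspondence scale g \<rho>) \<mu> = app (ex (N \<mu>))"
    unfolding snd_correspondence[OF \<mu>] r.rep_t_eq[OF at] by simp
qed

end

section \<open>The bijection\<close>

context complex_fd_space
begin

text \<open>The construction is applied to \<open>log t\<^sub>\<mu>\<close>. As \<open>t\<^sub>\<mu> - 1\<close> lowers the bidegree, it is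
  nilpotent, and its power series without constant term lower the bidegree as well.\<close>

theorem correspondence_surj:
  assumes "(U, t) \<in> triples scale g"
  shows "\<exists>\<rho>\<in>reps scale g. correspondence scale g \<rho> = (U, t)"
proof -
  have U: "U \<in> extensional (bidegrees g)" and t: "t \<in> extensional {..<g}"
    and gr: "is_grading scale (bidegrees g) U"
    and lin: "\<And>\<mu>. \<mu> < g \<Longrightarrow> Vector_Spaces.linear scale scale (t \<mu>)"
    and comm: "\<And>\<mu> \<nu>. \<mu> < g \<Longrightarrow> \<nu> < g \<Longrightarrow> t \<mu> \<circ> t \<nu> = t \<nu> \<circ> t \<mu>"
    and low: "\<And>\<mu> w u. \<mu> < g \<Longrightarrow> w \<in> bidegrees g \<Longrightarrow> u \<in> U w \<Longrightarrow> t \<mu> u - u \<in> lower_span g U \<mu> w"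
    using assms unfolding triples_iff by simp_all
  obtain \<pi> where \<pi>: "idem_system (bidegrees g) \<pi>"
    and U\<pi>: "\<And>w. w \<in> bidegrees g \<Longrightarrow> U w = {v. app (\<pi> w) v = v}"
    by (rule idem_of_grading[OF gr]) (rule that)
  define \<tau> where "\<tau> = (\<lambda>\<mu>. Endo (t \<mu>))"
  have \<tau>: "app (\<tau> \<mu>) = t \<mu>" "Lin (\<tau> \<mu>)" if "\<mu> < g" for \<mu>
    unfolding \<tau>_def using linear_Endo[OF lin[OF that]] by simp_all
  have low1: "lowering g \<mu> \<pi> (\<tau> \<mu> - 1)" if "\<mu> < g" for \<mu>
    by (rule iffD2[OF lowering_iff[OF \<pi> U\<pi>]], assumption, intro ballI)
      (simp add: \<tau>(1)[OF that] low[OF that])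
  have comm1: "(\<tau> \<mu> - 1) * (\<tau> \<nu> - 1) = (\<tau> \<nu> - 1) * (\<tau> \<mu> - 1)" if "\<mu> < g" "\<nu> < g" for \<mu> \<nu>
  proof -
    have "\<tau> \<mu> * \<tau> \<nu> = \<tau> \<nu> * \<tau> \<mu>"
      using fun_cong[OF comm[OF that]] by (intro endo_eqI) (simp add: \<tau> that)
    then show ?thesis by (simp add: algebra_simps)
  qed
  \<comment> \<open>a sum instead of a maximum also covers \<open>g = 0\<close>\<close>
  define n where "n = (\<Sum>\<mu><g. 2 * height_bound \<mu> \<pi>)"
  have "hodge_triple scale Basis g \<pi> (\<lambda>\<mu>. lg (\<tau> \<mu>)) n"
  proof unfold_locales
    fix \<mu> \<nu> assume \<mu>: "\<mu> < g"
    show "Lin (lg (\<tau> \<mu>))" by (rule Lin_lg[OF \<tau>(2)[OF \<mu>]])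
    show "lowering g \<mu> \<pi> (lg (\<tau> \<mu>))"
      unfolding lg_def by (rule lowering_ser[OF \<pi> low1[OF \<mu>]]) simp
    show "2 * height_bound \<mu> \<pi> \<le> n"
      unfolding n_def using \<mu> by (intro member_le_sum) simp_all
    assume \<nu>: "\<nu> < g"
    show "lg (\<tau> \<mu>) * lg (\<tau> \<nu>) = lg (\<tau> \<nu>) * lg (\<tau> \<mu>)"
      unfolding lg_def by (rule ser_commute2[OF comm1[OF \<mu> \<nu>]])
  qed (rule \<pi>)
  then interpret H: hodge_triple scale Basis g \<pi> "\<lambda>\<mu>. lg (\<tau> \<mu>)" n .
  have "fst (correspondence scale g H.\<rho>) = U"
  proof (rule extensionalityI[OF _ U])
    show "fst (correspondence scale g H.\<rho>) \<in> extensional (bidegrees g)"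
      by (simp add: correspondence_def bidegrees_def)
    show "fst (correspondence scale g H.\<rho>) w = U w" if w: "w \<in> bidegrees g" for w
      unfolding H.correspondence_rho(1)[OF w] U\<pi>[OF w] ..
  qed
  moreover have "snd (correspondence scale g H.\<rho>) = t"
  proof (rule extensionalityI[OF _ t])
    show "snd (correspondence scale g H.\<rho>) \<in> extensional {..<g}" by (simp add: correspondence_def)
    fix \<mu> assume "\<mu> \<in> {..<g}"
    then have \<mu>: "\<mu> < g" by simp
    show "snd (correspondence scale g H.\<rho>) \<mu> = t \<mu>"
      unfolding H.correspondence_rho(2)[OF \<mu>] ex_lg[OF lowering_nil[OF \<pi> low1[OF \<mu>]]] \<tau>(1)[OF \<mu>] ..
  qed
  ultimately have "correspondence scale g H.\<rho> = (U, t)" by (intro prod_eqI) simp_all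
  then show ?thesis using H.rho_reps by (intro bexI[of _ H.\<rho>])
qed

end

theorem proposition1p1:
  fixes scale :: "complex \<Rightarrow> 'v \<Rightarrow> 'v :: ab_group_add" and B :: "'v set" and g :: nat
  assumes "finite_dimensional_vector_space scale B"
  shows "bij_betw (correspondence scale g) (reps scale g) (triples scale g)"
proof -
  interpret complex_fd_space scale B using assms by (simp add: complex_fd_space_def)
  show ?thesis
    unfolding bij_betw_def
  proof (intro conjI inj_onI Set.set_eqI iffI)
    fix \<rho> \<rho>' assume "\<rho> \<in> reps scale g" "\<rho>' \<in> reps scale g"
      "correspondence scale g \<rho> = correspondence scale g \<rho>'"
    then show "\<rho> = \<rho>'" by (rule correspondence_inject)
  next
    fix Ut assume "Ut \<in> correspondence scale g ` reps scale g"
    then obtain \<rho> where \<rho>: "\<rho> \<in> reps scale g" "Ut = correspondence scale g \<rho>" by (elim imageE)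
    interpret hodge_rep scale B g \<rho> by unfold_locales (rule \<rho>(1))
    show "Ut \<in> triples scale g" unfolding \<rho>(2) by (rule correspondence_in_triples)
  next
    fix Ut assume "Ut \<in> triples scale g"
    moreover obtain U t where "Ut = (U, t)" by (cases Ut)
    ultimately obtain \<rho> where "\<rho> \<in> reps scale g" "correspondence scale g \<rho> = Ut"
      using correspondence_surj by blast
    then show "Ut \<in> correspondence scale g ` reps scale g" by (intro image_eqI[of _ _ \<rho>]) simp_all
  qed
qed

end
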